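(* Let $\mathbb T=\mathbb R^2/\Lambda$ with $\Lambda=\{m\boldsymbol\xi+n\boldsymbol\eta\mid m,n\in\mathbb Z\}$, $\boldsymbol\xi=2\pi(1,0)$, $\boldsymbol\eta=2\pi\left(\frac12,\frac{\sqrt3}2\right)$, and let $1<p<\infty$. Let $$\bar\omega=A\cos\left(x_1-\frac{x_2}{\sqrt3}+\alpha\right)+B\cos\left(\frac{2x_2}{\sqrt3}+\beta\right)+C\cos\left(x_1+\frac{x_2}{\sqrt3}+\gamma\right),$$ where $A,B,C\ge0$ and $\alpha,\beta,\gamma\in\mathbb R$ (this is the general form of an element of the first eigenspace $\mathbb E_1$ of $-\Delta$ on mean-zero functions on $\mathbb T$). Then for any $\varepsilon>0$ there exists $\delta>0$ such that for any $L^p$-admissible map $\zeta$, if $$\|\zeta(0)-\bar\omega\|_{L^p(\mathbb T)}<\delta,$$ then for any $t\in\mathbb R$ there exists $\tilde\omega\in\mathbb E_1$ of the form $$\tilde\omega=A\cos\left(x_1-\frac{x_2}{\sqrt3}+\tilde\alpha\right)+B\cos\left(\frac{2x_2}{\sqrt3}+\tilde\beta\right)+C\cos\left(x_1+\frac{x_2}{\sqrt3}+\tilde\gamma\right),$$ where $\tilde\alpha,\tilde\beta,\tilde\gamma\in\mathbb R$ satisfy $$ABC\,e^{\mathrm i(\alpha+\beta-\gamma)}=ABC\,e^{\mathrm i(\tilde\alpha+\tilde\beta-\tilde\gamma)},$$ such that $$\|\zeta(t)-\tilde\omega\|_{L^p(\mathbb T)}<\varepsilon.$$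
   Context: $\mathbb T$ carries the Euclidean metric and Lebesgue measure $|\cdot|$; functions on $\mathbb T$ are real-valued $\Lambda$-periodic functions on $\mathbb R^2$, identified when equal a.e. $\mathring L^p(\mathbb T)$ and $\mathring W^{2,p}(\mathbb T)$ denote the subspaces of functions with zero integral in $L^p(\mathbb T)$ and $W^{2,p}(\mathbb T)$. On this torus the smallest eigenvalue of $-\Delta$ on mean-zero functions is $\lambda_1=4/3$, and $\mathbb E_1$ is the corresponding eigenspace, the real span of $\cos$ and $\sin$ of $x_1-\frac{x_2}{\sqrt3}$, $\frac{2x_2}{\sqrt3}$, $x_1+\frac{x_2}{\sqrt3}$ (six functions). Energy: for $f\in\mathring L^p(\mathbb T)$, $\mathsf Gf\in\mathring W^{2,p}(\mathbb T)$ is the unique mean-zero solution $u$ of $-\Delta u=f$ on $\mathbb T$, and $E(f)=\frac12\int_{\mathbb T}f\,\mathsf Gf\,d\boldsymbol x$. Rearrangement class: for measurable $f:\mathbb T\to\mathbb R$, $\mathcal R_f$ is the set of measurable $g:\mathbb T\to\mathbb R$ with $|\{g>s\}|=|\{f>s\}|$ for all $s\in\mathbb R$. $L^p$-admissible map: $\zeta\in C(\mathbb R;\mathring L^p(\mathbb T))$ such that $E(\zeta(t))=E(\zeta(0))$ and $\zeta(t)\in\mathcal R_{\zeta(0)}$ for all $t\in\mathbb R$. *)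

theory Defs
  imports "HOL-Analysis.Analysis"
begin

section \<open>The hexagonal torus\<close>

definition xi :: "real^2" where
  "xi = (2 * pi) *\<^sub>R vector [1, 0]"

definition eta :: "real^2" where
  "eta = (2 * pi) *\<^sub>R vector [1/2, sqrt 3 / 2]"

definition lattice :: "(real^2) set" where
  "lattice = {of_int m *\<^sub>R xi + of_int n *\<^sub>R eta | m n :: int. True}"

text \<open>A function on the torus is a lattice-periodic function on the plane. Integrals over the
  torus are integrals over the half-open fundamental cell. Functions that agree almost everywhere
  are not identified as objects; every notion below except periodicity and smoothness of test
  functions depends on the equivalence class only.\<close>

definition periodic :: "(real^2 \<Rightarrow> real) \<Rightarrow> bool" where
  "periodic f \<longleftrightarrow> (\<forall>x. \<forall>v\<in>lattice. f (x + v) = f x)"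

definition cell :: "(real^2) set" where
  "cell = {s *\<^sub>R xi + t *\<^sub>R eta | s t :: real. 0 \<le> s \<and> s < 1 \<and> 0 \<le> t \<and> t < 1}"

definition torus :: "(real^2) measure" where
  "torus = lebesgue_on cell"

definition torus_measurable :: "(real^2 \<Rightarrow> real) \<Rightarrow> bool" where
  "torus_measurable f \<longleftrightarrow> periodic f \<and> f \<in> borel_measurable torus"

section \<open>Lebesgue and Sobolev spaces on the torus\<close>

definition Lp :: "real \<Rightarrow> (real^2 \<Rightarrow> real) set" where
  "Lp p = {f. torus_measurable f \<and> integrable torus (\<lambda>x. \<bar>f x\<bar> powr p)}"

definition Lp_norm :: "real \<Rightarrow> (real^2 \<Rightarrow> real) \<Rightarrow> real" where
  "Lp_norm p f = (\<integral>x. \<bar>f x\<bar> powr p \<partial>torus) powr (1 / p)"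

definition mean_zero :: "(real^2 \<Rightarrow> real) \<Rightarrow> bool" where
  "mean_zero f \<longleftrightarrow> (\<integral>x. f x \<partial>torus) = 0"

definition Lp0 :: "real \<Rightarrow> (real^2 \<Rightarrow> real) set" where
  "Lp0 p = {f \<in> Lp p. mean_zero f}"

definition partial_deriv :: "2 \<Rightarrow> (real^2 \<Rightarrow> real) \<Rightarrow> real^2 \<Rightarrow> real" where
  "partial_deriv i f x = frechet_derivative f (at x) (axis i 1)"

fun C_k :: "nat \<Rightarrow> (real^2 \<Rightarrow> real) \<Rightarrow> bool" where
  "C_k 0 f \<longleftrightarrow> continuous_on UNIV f"
| "C_k (Suc k) f \<longleftrightarrow> (\<forall>x. f differentiable (at x)) \<and> (\<forall>i. C_k k (partial_deriv i f))"

definition test_function :: "(real^2 \<Rightarrow> real) \<Rightarrow> bool" where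
  "test_function \<phi> \<longleftrightarrow> periodic \<phi> \<and> (\<forall>k. C_k k \<phi>)"

text \<open>The torus has no boundary, so all smooth periodic functions are admitted for testing.\<close>

definition weak_deriv :: "2 \<Rightarrow> (real^2 \<Rightarrow> real) \<Rightarrow> (real^2 \<Rightarrow> real) \<Rightarrow> bool" where
  "weak_deriv i u v \<longleftrightarrow>
     (\<forall>\<phi>. test_function \<phi> \<longrightarrow>
        (\<integral>x. u x * partial_deriv i \<phi> x \<partial>torus) = - (\<integral>x. v x * \<phi> x \<partial>torus))"

definition W2p :: "real \<Rightarrow> (real^2 \<Rightarrow> real) set" where
  "W2p p = {u \<in> Lp p. \<forall>i. \<exists>v\<in>Lp p. weak_deriv i u v \<and> (\<forall>j. \<exists>w\<in>Lp p. weak_deriv j v w)}"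

definition W2p0 :: "real \<Rightarrow> (real^2 \<Rightarrow> real) set" where
  "W2p0 p = {u \<in> W2p p. mean_zero u}"

section \<open>Poisson equation, energy and the first eigenspace\<close>

definition poisson_solution :: "real \<Rightarrow> (real^2 \<Rightarrow> real) \<Rightarrow> (real^2 \<Rightarrow> real) \<Rightarrow> bool" where
  "poisson_solution p f u \<longleftrightarrow> u \<in> W2p0 p \<and>
     (\<exists>v w. (\<forall>i. v i \<in> Lp p \<and> w i \<in> Lp p \<and> weak_deriv i u (v i) \<and> weak_deriv i (v i) (w i)) \<and>
            (AE x in torus. - (\<Sum>i\<in>UNIV. w i x) = f x))"

text \<open>The solution is unique only up to null sets, so a representative is chosen; the energy does
  not depend on the choice.\<close>

definition G :: "real \<Rightarrow> (real^2 \<Rightarrow> real) \<Rightarrow> real^2 \<Rightarrow> real" where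
  "G p f = (SOME u. poisson_solution p f u)"

definition energy :: "real \<Rightarrow> (real^2 \<Rightarrow> real) \<Rightarrow> real" where
  "energy p f = 1 / 2 * (\<integral>x. f x * G p f x \<partial>torus)"

definition eigenspace :: "real \<Rightarrow> (real^2 \<Rightarrow> real) set" where
  "eigenspace l = {u. poisson_solution 2 (\<lambda>x. l * u x) u}"

definition is_eigenvalue :: "real \<Rightarrow> bool" where
  "is_eigenvalue l \<longleftrightarrow> (\<exists>u\<in>eigenspace l. \<not> (AE x in torus. u x = 0))"

text \<open>The least eigenvalue on mean-zero functions is 4/3. Its eigenspace is spanned (up to null
  sets) by the cosine and sine of the three phases occurring in \<open>wave\<close>.\<close>

definition first_eigenvalue :: real where
  "first_eigenvalue = (LEAST l. is_eigenvalue l)"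

definition E1 :: "(real^2 \<Rightarrow> real) set" where
  "E1 = eigenspace first_eigenvalue"

definition wave :: "real \<Rightarrow> real \<Rightarrow> real \<Rightarrow> real \<Rightarrow> real \<Rightarrow> real \<Rightarrow> real^2 \<Rightarrow> real" where
  "wave A B C \<alpha> \<beta> \<gamma> x =
     A * cos (x $ 1 - x $ 2 / sqrt 3 + \<alpha>) +
     B * cos (2 * x $ 2 / sqrt 3 + \<beta>) +
     C * cos (x $ 1 + x $ 2 / sqrt 3 + \<gamma>)"

section \<open>Rearrangements and admissible maps\<close>

definition rearrangements :: "(real^2 \<Rightarrow> real) \<Rightarrow> (real^2 \<Rightarrow> real) set" where
  "rearrangements f = {g. torus_measurable g \<and>
     (\<forall>s. measure torus {x \<in> space torus. g x > s} = measure torus {x \<in> space torus. f x > s})}"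

definition admissible :: "real \<Rightarrow> (real \<Rightarrow> real^2 \<Rightarrow> real) \<Rightarrow> bool" where
  "admissible p \<zeta> \<longleftrightarrow>
     (\<forall>t. \<zeta> t \<in> Lp0 p) \<and>
     (\<forall>t. ((\<lambda>s. Lp_norm p (\<lambda>x. \<zeta> s x - \<zeta> t x)) \<longlongrightarrow> 0) (at t)) \<and>
     (\<forall>t. energy p (\<zeta> t) = energy p (\<zeta> 0) \<and> \<zeta> t \<in> rearrangements (\<zeta> 0))"

end

theory Submission
  imports Defs "HOL-Analysis.Analysis"
begin

text \<open>The least eigenvalue is \<open>4 / 3\<close> and the next one is at least three times as large, so
  \<open>3 / 4 * \<integral>f\<^sup>2 - 2 * E f\<close> is nonnegative and controls the squared distance of \<open>f\<close> to the first
  eigenspace. The integral of \<open>f\<^sup>2\<close> is invariant under rearrangement and \<open>E\<close> is conserved, hence a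
  solution starting near \<open>wave A B C \<alpha> \<beta> \<gamma>\<close> stays near the eigenspace. For \<open>p \<noteq> 2\<close> this is applied to
  the truncation of \<open>\<zeta> t\<close> at a fixed height, which commutes with rearrangement; the energy is
  continuous in \<open>L\<^sup>p\<close> by the boundedness of the second derivatives of the inverse Laplacian, which
  follows from a Bellman function argument.

  The moments of orders 2, 3, 4 and 6 are invariant under rearrangement as well. On the eigenspace
  they determine the squared amplitudes up to order and, with the amplitudes, the product
  \<open>A * B * C * cis (\<alpha> + \<beta> - \<gamma>)\<close> up to conjugation. These are finitely many possibilities, and
  continuity in time excludes a transition from one to another.\<close>

text \<open>The functional that controls the distance is quadratic, whereas closeness is given in
  \<open>L^p\<close> only: for \<open>p < 2\<close> squares need not be integrable, for
  \<open>p > 2\<close> an \<open>L^2\<close> bound does not control the \<open>L^p\<close> norm.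
  Clipping at a height above the wave settles both. Bounded functions interpolate between all
  exponents, and the discarded tail has the same \<open>p\<close>-norm for a function and for its
  rearrangement. A constant must be subtracted to restore zero mean, and it is again the same for
  both. The combination \<open>\<alpha> + \<beta> - \<gamma>\<close> is singled out by the relation
  \<open>(1, 0) + (0, 1) = (1, 1)\<close> between the three frequencies: translations move the
  phases freely but preserve it, and the third moment is nonzero only through this resonance.
  Moments cannot tell a wave from one with conjugate phase product or permuted amplitudes, so
  conservation laws alone do not suffice and continuity in time is essential. Computations are done
  on trigonometric polynomials, given by finitely supported coefficient functions; general functions
  enter through limits.\<close>

text \<open>Two of the three phases of \<open>wave\<close> serve as coordinates; they turn the lattice into the
  square lattice of mesh \<open>2 * pi\<close>, and the third phase is their sum.\<close>
definition ph1 :: "real^2 \<Rightarrow> real" where "ph1 x = x $ 1 - x $ 2 / sqrt 3"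
definition ph2 :: "real^2 \<Rightarrow> real" where "ph2 x = 2 * x $ 2 / sqrt 3"
definition pt :: "real \<Rightarrow> real \<Rightarrow> real^2" where "pt a b = vector [a + b / 2, sqrt 3 / 2 * b]"

lemma ph_pt [simp]: "ph1 (pt a b) = a" "ph2 (pt a b) = b"
  by (simp_all add: ph1_def ph2_def pt_def vector_2)

lemma pt_ph [simp]: "pt (ph1 x) (ph2 x) = x"
  by (simp add: vec_eq_iff forall_2 pt_def ph1_def ph2_def vector_2)

lemma ph_add [simp]: "ph1 (x + y) = ph1 x + ph1 y" "ph2 (x + y) = ph2 x + ph2 y"
  by (simp_all add: ph1_def ph2_def add_divide_distrib algebra_simps)

lemma ph_diff [simp]: "ph1 (x - y) = ph1 x - ph1 y" "ph2 (x - y) = ph2 x - ph2 y"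
  by (simp_all add: ph1_def ph2_def diff_divide_distrib algebra_simps)

lemma ph_minus [simp]: "ph1 (- x) = - ph1 x" "ph2 (- x) = - ph2 x"
  by (simp_all add: ph1_def ph2_def)

lemma ph_scaleR [simp]: "ph1 (a *\<^sub>R x) = a * ph1 x" "ph2 (a *\<^sub>R x) = a * ph2 x"
  by (simp_all add: ph1_def ph2_def algebra_simps)

lemma ph_zero [simp]: "ph1 0 = 0" "ph2 0 = 0"
  by (simp_all add: ph1_def ph2_def)

lemma continuous_ph [continuous_intros]:
  "continuous_on S f \<Longrightarrow> continuous_on S (\<lambda>x. ph1 (f x))"
  "continuous_on S f \<Longrightarrow> continuous_on S (\<lambda>x. ph2 (f x))"
  unfolding ph1_def ph2_def by (intro continuous_intros; simp)+

lemma ph_eqI: "ph1 x = ph1 y \<Longrightarrow> ph2 x = ph2 y \<Longrightarrow> x = y"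
  by (metis pt_ph)

lemma ph_xi [simp]: "ph1 xi = 2 * pi" "ph2 xi = 0"
  by (simp_all add: ph1_def ph2_def xi_def vector_2)

lemma ph_eta [simp]: "ph1 eta = 0" "ph2 eta = 2 * pi"
  by (simp_all add: ph1_def ph2_def eta_def vector_2)

text \<open>Indexing the lattice by integer pairs turns sums over it into integrals against
  \<open>count_space UNIV\<close>, which Tonelli's theorem exchanges with Lebesgue
  integrals.\<close>

definition lat :: "int \<times> int \<Rightarrow> real^2" where
  "lat v = of_int (fst v) *\<^sub>R xi + of_int (snd v) *\<^sub>R eta"

lemma ph_lat [simp]: "ph1 (lat v) = 2 * pi * of_int (fst v)" "ph2 (lat v) = 2 * pi * of_int (snd v)"
  by (simp_all add: lat_def)

lemma lattice_eq: "lattice = range lat"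
  unfolding lattice_def lat_def by (auto simp: image_iff) metis+

lemma cell_iff: "x \<in> cell \<longleftrightarrow> 0 \<le> ph1 x \<and> ph1 x < 2 * pi \<and> 0 \<le> ph2 x \<and> ph2 x < 2 * pi"
proof
  assume "x \<in> cell"
  then obtain s t where "x = s *\<^sub>R xi + t *\<^sub>R eta" "0 \<le> s" "s < 1" "0 \<le> t" "t < 1"
    unfolding cell_def by blast
  then show "0 \<le> ph1 x \<and> ph1 x < 2 * pi \<and> 0 \<le> ph2 x \<and> ph2 x < 2 * pi"
    by simp
next
  assume a: "0 \<le> ph1 x \<and> ph1 x < 2 * pi \<and> 0 \<le> ph2 x \<and> ph2 x < 2 * pi"
  have "x = (ph1 x / (2 * pi)) *\<^sub>R xi + (ph2 x / (2 * pi)) *\<^sub>R eta"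
    by (rule ph_eqI) simp_all
  moreover have "ph1 x / (2 * pi) < 1" "ph2 x / (2 * pi) < 1"
    using a by (simp_all add: divide_less_eq)
  ultimately show "x \<in> cell"
    unfolding cell_def using a
    by (intro CollectI exI[of _ "ph1 x / (2 * pi)"] exI[of _ "ph2 x / (2 * pi)"]) simp
qed

lemma ph_measurable [measurable]: "ph1 \<in> borel_measurable borel" "ph2 \<in> borel_measurable borel"
  by (intro borel_measurable_continuous_onI continuous_intros)+

lemma cell_borel [measurable]: "cell \<in> sets borel"
proof -
  have "cell = {x \<in> space borel. 0 \<le> ph1 x \<and> ph1 x < 2 * pi \<and> 0 \<le> ph2 x \<and> ph2 x < 2 * pi}"
    by (auto simp: cell_iff)
  also have "\<dots> \<in> sets borel" by measurable
  finally show ?thesis .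
qed

lemma cell_lebesgue [simp]: "cell \<in> sets lebesgue"
  using cell_borel by (simp add: sets_completionI_sets)

text \<open>The half-open \<open>cell\<close> is right for tiling but not compact. Its closure
  serves for bounds and for Stone-Weierstrass, at the price of boundary points that the torus
  identifies.\<close>

definition ccell :: "(real^2) set" where
  "ccell = {x. 0 \<le> ph1 x \<and> ph1 x \<le> 2 * pi \<and> 0 \<le> ph2 x \<and> ph2 x \<le> 2 * pi}"

lemma compact_ccell: "compact ccell"
proof -
  have "ccell = (\<lambda>(a, b). pt a b) ` ({0..2*pi} \<times> {0..2*pi})"
  proof -
    have "x \<in> (\<lambda>(a, b). pt a b) ` ({0..2*pi} \<times> {0..2*pi})" if "x \<in> ccell" for x
      using that by (intro image_eqI[of _ _ "(ph1 x, ph2 x)"]) (auto simp: ccell_def)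
    then show ?thesis by (auto simp: ccell_def)
  qed
  moreover have "(\<lambda>p. pt (fst p) (snd p)) = (\<lambda>p. (fst p) *\<^sub>R pt 1 0 + (snd p) *\<^sub>R pt 0 1)"
    by (rule ext, rule ph_eqI) simp_all
  then have "continuous_on ({0..2*pi} \<times> {0..2*pi}) (\<lambda>(a, b). pt a b)"
    by (simp add: case_prod_unfold) (intro continuous_intros)
  ultimately show ?thesis
    using compact_continuous_image[OF _ compact_Times[OF compact_Icc compact_Icc]] by metis
qed

lemma cell_subset: "cell \<subseteq> ccell"
  by (auto simp: cell_iff ccell_def)

lemma bounded_cell: "bounded cell"
  using compact_ccell cell_subset bounded_subset compact_imp_bounded by blast

lemma space_torus [simp]: "space torus = cell"
  by (simp add: torus_def space_restrict_space)

lemma emeasure_torus: "emeasure torus (space torus) = emeasure lebesgue cell"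
  by (simp add: torus_def space_restrict_space emeasure_restrict_space)

interpretation torus: finite_measure torus
proof
  have "cell \<in> lmeasurable"
    using bounded_cell by (simp add: bounded_set_imp_lmeasurable)
  then show "emeasure torus (space torus) \<noteq> \<infinity>"
    unfolding emeasure_torus by (simp add: fmeasurable_def less_top)
qed

definition vol :: real where "vol = measure torus (space torus)"

lemma measure_torus_cell [simp]: "measure torus cell = vol"
  by (simp add: vol_def)

lemma vol_pos: "0 < vol"
proof -
  let ?U = "{x. 0 < ph1 x \<and> ph1 x < 2 * pi \<and> 0 < ph2 x \<and> ph2 x < 2 * pi}"
  have "open ?U"
    by (intro open_Collect_conj open_Collect_less continuous_intros)
  moreover have "pt 1 1 \<in> ?U"
    using pi_gt3 by simp
  ultimately have "\<not> negligible ?U"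
    using open_not_negligible by blast
  then have "\<not> negligible cell"
    by (rule contrapos_nn) (auto intro: negligible_subset simp: cell_iff)
  then have "emeasure lebesgue cell \<noteq> 0"
    by (auto simp: negligible_iff_null_sets null_sets_def)
  then show ?thesis
    unfolding vol_def using torus.emeasure_eq_measure[of "space torus"] emeasure_torus
    by (metis ennreal_0 measure_nonneg order_le_less)
qed

section \<open>Periodicity, tiling and translation invariance of the torus integral\<close>

lemma periodicD: "periodic f \<Longrightarrow> f (x + lat v) = f x"
  unfolding periodic_def lattice_eq by blast

lemma periodicI: "(\<And>x v. f (x + lat v) = f x) \<Longrightarrow> periodic f"
  unfolding periodic_def lattice_eq by blast

lemma torus_nn_integral: "(\<integral>\<^sup>+x. f x \<partial>torus) = (\<integral>\<^sup>+x. f x * indicator cell x \<partial>lborel)"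
  unfolding torus_def by (simp add: nn_integral_restrict_space nn_integral_completion)

lemma borel_measurable_torus: "f \<in> borel_measurable borel \<Longrightarrow> f \<in> borel_measurable torus"
  unfolding torus_def by (intro measurable_restrict_space1 measurable_completion) simp

text \<open>The index of the one lattice vector that moves \<open>x\<close> into
  \<open>cell\<close>.\<close>

definition red :: "real^2 \<Rightarrow> int \<times> int" where
  "red x = (- \<lfloor>ph1 x / (2 * pi)\<rfloor>, - \<lfloor>ph2 x / (2 * pi)\<rfloor>)"

lemma floor_eq_iff_mult:
  "0 \<le> y + 2 * pi * of_int n \<and> y + 2 * pi * of_int n < 2 * pi \<longleftrightarrow> n = - \<lfloor>y / (2 * pi)\<rfloor>"
proof -
  have "n = - \<lfloor>y / (2 * pi)\<rfloor> \<longleftrightarrow> \<lfloor>y / (2 * pi)\<rfloor> = - n" by linarith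
  also have "\<dots> \<longleftrightarrow> of_int (- n) \<le> y / (2 * pi) \<and> y / (2 * pi) < of_int (- n) + 1"
    by (rule floor_eq_iff)
  also have "\<dots> \<longleftrightarrow> 0 \<le> y + 2 * pi * of_int n \<and> y + 2 * pi * of_int n < 2 * pi"
  proof -
    have "y / (2 * pi) < of_int (- n) + 1 \<longleftrightarrow> y < (of_int (- n) + 1) * (2 * pi)"
      by (simp add: divide_less_eq)
    moreover have "of_int (- n) \<le> y / (2 * pi) \<longleftrightarrow> of_int (- n) * (2 * pi) \<le> y"
      by (simp add: le_divide_eq)
    ultimately show ?thesis by (auto simp: algebra_simps)
  qed
  finally show ?thesis by blast
qed

lemma cell_lat_iff: "x + lat v \<in> cell \<longleftrightarrow> v = red x"
  unfolding cell_iff red_def using floor_eq_iff_mult[of "ph1 x" "fst v"] floor_eq_iff_mult[of "ph2 x" "snd v"]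
  by (auto simp: prod_eq_iff)

text \<open>The translates of \<open>cell\<close> form a partition of unity. Inserting this factor 1
  into an integral is how one fundamental domain is exchanged for another.\<close>

lemma cell_tiling: "(\<integral>\<^sup>+v. indicator cell (x + lat v) \<partial>count_space UNIV) = (1 :: ennreal)"
proof -
  have "(\<integral>\<^sup>+v. indicator cell (x + lat v) \<partial>count_space UNIV) = (\<Sum>v\<in>{red x}. indicator cell (x + lat v) :: ennreal)"
    by (rule nn_integral_count_space') (auto simp: indicator_def cell_lat_iff)
  then show ?thesis by (simp add: indicator_def cell_lat_iff)
qed

lemma nn_integral_lborel_translation:
  fixes f :: "real^2 \<Rightarrow> ennreal"
  assumes [measurable]: "f \<in> borel_measurable borel"
  shows "(\<integral>\<^sup>+x. f (a + x) \<partial>lborel) = (\<integral>\<^sup>+x. f x \<partial>lborel)"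
proof -
  have "(\<integral>\<^sup>+x. f x \<partial>lborel) = (\<integral>\<^sup>+x. f x \<partial>(distr lborel borel ((+) a)))"
    by (simp add: lborel_distr_plus)
  also have "\<dots> = (\<integral>\<^sup>+x. f (a + x) \<partial>lborel)"
    by (subst nn_integral_distr) simp_all
  finally show ?thesis by simp
qed

text \<open>Shifting the argument moves the domain of integration from \<open>cell\<close> to
  \<open>cell + a\<close>. The moved domain is cut along the tiling, each piece is carried by a
  lattice vector into \<open>cell\<close>, which periodicity of \<open>f\<close> allows, and the
  pieces fill \<open>cell\<close> exactly once.\<close>

lemma nn_integral_torus_translation:
  fixes f :: "real^2 \<Rightarrow> ennreal"
  assumes [measurable]: "f \<in> borel_measurable borel" and per: "\<And>x v. f (x + lat v) = f x"
  shows "(\<integral>\<^sup>+x. f (x + a) \<partial>torus) = (\<integral>\<^sup>+x. f x \<partial>torus)"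
proof -
  have "(\<integral>\<^sup>+x. f (x + a) \<partial>torus) = (\<integral>\<^sup>+x. f (a + x) * indicator cell ((a + x) + (- a)) \<partial>lborel)"
    by (simp add: torus_nn_integral add.commute)
  also have "\<dots> = (\<integral>\<^sup>+x. f x * indicator cell (x - a) \<partial>lborel)"
    using nn_integral_lborel_translation[of "\<lambda>x. f x * indicator cell (x - a)" a] by simp
  also have "\<dots> = (\<integral>\<^sup>+x. (\<integral>\<^sup>+v. f x * indicator cell (x - a) * indicator cell (x + lat v) \<partial>count_space UNIV) \<partial>lborel)"
    by (simp add: nn_integral_cmult cell_tiling)
  also have "\<dots> = (\<integral>\<^sup>+v. (\<integral>\<^sup>+x. f x * indicator cell (x - a) * indicator cell (x + lat v) \<partial>lborel) \<partial>count_space UNIV)"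
    by (rule nn_integral_count_space_nn_integral) (auto intro!: measurable_compose[OF _ borel_measurable_indicator[OF cell_borel]] borel_measurable_times)
  also have "\<dots> = (\<integral>\<^sup>+v. (\<integral>\<^sup>+x. f x * indicator cell x * indicator cell (x - a + lat (- v)) \<partial>lborel) \<partial>count_space UNIV)"
  proof (rule nn_integral_cong)
    fix v :: "int \<times> int"
    have m: "lat (- v) = - lat v" by (rule ph_eqI) simp_all
    have "(\<integral>\<^sup>+x. f x * indicator cell (x - a) * indicator cell (x + lat v) \<partial>lborel)
        = (\<integral>\<^sup>+x. f (- lat v + x) * indicator cell ((- lat v + x) - a) * indicator cell ((- lat v + x) + lat v) \<partial>lborel)"
      by (rule nn_integral_lborel_translation[symmetric]) measurable
    also have "\<dots> = (\<integral>\<^sup>+x. f x * indicator cell x * indicator cell (x - a + lat (- v)) \<partial>lborel)"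
    proof (rule nn_integral_cong)
      fix x
      have 1: "f (- lat v + x) = f x" using per[of x "- v"] unfolding m by (simp add: add.commute)
      have 2: "- lat v + x - a = x - a + lat (- v)" "- lat v + x + lat v = x" unfolding m by simp_all
      show "f (- lat v + x) * indicator cell ((- lat v + x) - a) * indicator cell ((- lat v + x) + lat v)
        = f x * indicator cell x * indicator cell (x - a + lat (- v))"
        unfolding 1 2 by (simp add: mult_ac)
    qed
    finally show "(\<integral>\<^sup>+x. f x * indicator cell (x - a) * indicator cell (x + lat v) \<partial>lborel) = \<dots>" .
  qed
  also have "\<dots> = (\<integral>\<^sup>+x. (\<integral>\<^sup>+v. f x * indicator cell x * indicator cell (x - a + lat (- v)) \<partial>count_space UNIV) \<partial>lborel)"
    by (rule nn_integral_count_space_nn_integral[symmetric]) (auto intro!: measurable_compose[OF _ borel_measurable_indicator[OF cell_borel]] borel_measurable_times)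
  also have "\<dots> = (\<integral>\<^sup>+x. f x * indicator cell x \<partial>lborel)"
  proof (rule nn_integral_cong)
    fix x
    have "(\<integral>\<^sup>+v. indicator cell (x - a + lat (- v)) \<partial>count_space UNIV)
        = (\<integral>\<^sup>+v. indicator cell (x - a + lat v) \<partial>count_space UNIV)"
      by (rule nn_integral_bij_count_space) (rule bij_uminus)
    then show "(\<integral>\<^sup>+v. f x * indicator cell x * indicator cell (x - a + lat (- v)) \<partial>count_space UNIV) = f x * indicator cell x"
      by (simp add: nn_integral_cmult cell_tiling)
  qed
  finally show ?thesis by (simp add: torus_nn_integral)
qed

section \<open>Continuous periodic functions\<close>

definition cper :: "(real^2 \<Rightarrow> real) \<Rightarrow> bool" where
  "cper f \<longleftrightarrow> periodic f \<and> continuous_on UNIV f"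

lemma cperI: "(\<And>x v. f (x + lat v) = f x) \<Longrightarrow> continuous_on UNIV f \<Longrightarrow> cper f"
  by (simp add: cper_def periodicI)

lemma cper_lat: "cper f \<Longrightarrow> f (x + lat v) = f x"
  by (simp add: cper_def periodicD)

lemma cper_compose:
  assumes "cper f" "continuous_on UNIV h"
  shows "cper (\<lambda>x. h (f x))"
proof (rule cperI)
  show "continuous_on UNIV (\<lambda>x. h (f x))"
    by (rule continuous_on_compose2[OF assms(2)]) (use assms(1) in \<open>auto simp: cper_def\<close>)
qed (simp add: assms cper_lat)

lemma cper_compose2:
  assumes "cper f" "cper g" "continuous_on UNIV (\<lambda>p. h (fst p) (snd p))"
  shows "cper (\<lambda>x. h (f x) (g x))"
proof (rule cperI)
  have "continuous_on UNIV (\<lambda>x. (f x, g x))"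
    using assms by (intro continuous_intros) (auto simp: cper_def)
  from continuous_on_compose2[OF assms(3) this]
  show "continuous_on UNIV (\<lambda>x. h (f x) (g x))" by simp
qed (simp add: assms cper_lat)

lemma cper_const [simp, intro]: "cper (\<lambda>x. c)"
  by (rule cperI) simp_all

lemma cper_add [intro]: "cper f \<Longrightarrow> cper g \<Longrightarrow> cper (\<lambda>x. f x + g x)"
  by (rule cper_compose2) (auto intro!: continuous_intros)
lemma cper_diff [intro]: "cper f \<Longrightarrow> cper g \<Longrightarrow> cper (\<lambda>x. f x - g x)"
  by (rule cper_compose2) (auto intro!: continuous_intros)
lemma cper_mult [intro]: "cper f \<Longrightarrow> cper g \<Longrightarrow> cper (\<lambda>x. f x * g x)"
  by (rule cper_compose2) (auto intro!: continuous_intros)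
lemma cper_abs [intro]: "cper f \<Longrightarrow> cper (\<lambda>x. \<bar>f x\<bar>)"
  by (rule cper_compose) (auto intro!: continuous_intros)
lemma cper_power [intro]: "cper f \<Longrightarrow> cper (\<lambda>x. f x ^ n)"
  by (rule cper_compose) (auto intro!: continuous_intros)
lemma cper_divide [intro]: "cper f \<Longrightarrow> cper (\<lambda>x. f x / c)"
  using cper_mult[of f "\<lambda>x. inverse c"] by (simp add: divide_inverse)
lemma cper_sum [intro]: "(\<And>i. i \<in> I \<Longrightarrow> cper (f i)) \<Longrightarrow> cper (\<lambda>x. \<Sum>i\<in>I. f i x)"
  by (induction I rule: infinite_finite_induct) auto
lemma cper_abs_powr [intro]: "cper f \<Longrightarrow> 0 < p \<Longrightarrow> cper (\<lambda>x. \<bar>f x\<bar> powr p)"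
  by (rule cper_compose) (auto intro!: continuous_intros continuous_on_powr')
lemma cper_shift [intro]: "cper f \<Longrightarrow> cper (\<lambda>x. f (x + a))"
proof (rule cperI)
  assume f: "cper f"
  show "continuous_on UNIV (\<lambda>x. f (x + a))"
    by (rule continuous_on_compose2[of UNIV f]) (use f in \<open>auto simp: cper_def intro!: continuous_intros\<close>)
  show "f (x + lat v + a) = f (x + a)" for x v
    using cper_lat[OF f, of "x + a" v] by (simp add: ac_simps)
qed

lemma cper_borel: "cper f \<Longrightarrow> f \<in> borel_measurable borel"
  by (simp add: cper_def borel_measurable_continuous_onI)

lemma cper_measurable [measurable_dest]: "cper f \<Longrightarrow> f \<in> borel_measurable torus"
  by (intro borel_measurable_torus cper_borel)

lemma cell_red: "x + lat (red x) \<in> cell"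
  by (simp add: cell_lat_iff)

lemma cper_bounded: assumes "cper f" obtains R where "0 < R" "\<And>x. \<bar>f x\<bar> \<le> R"
proof -
  have "bounded (f ` ccell)"
    using assms by (intro compact_imp_bounded compact_continuous_image compact_ccell)
      (auto simp: cper_def intro: continuous_on_subset)
  then obtain R where R: "\<And>x. x \<in> ccell \<Longrightarrow> \<bar>f x\<bar> \<le> R" "0 < R"
    unfolding bounded_pos by force
  have "\<bar>f x\<bar> \<le> R" for x
    using R(1)[of "x + lat (red x)"] cell_red[of x] cell_subset cper_lat[OF assms, of x "red x"] by auto
  then show thesis using that R(2) by blast
qed

lemma integrable_torus_bounded:
  fixes f :: "real^2 \<Rightarrow> real"
  shows "f \<in> borel_measurable torus \<Longrightarrow> (\<And>x. x \<in> cell \<Longrightarrow> \<bar>f x\<bar> \<le> R) \<Longrightarrow> integrable torus f"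
  by (rule torus.integrable_const_bound[where B = R]) (auto intro!: AE_I2)

lemma cper_integrable [intro, simp]: "cper f \<Longrightarrow> integrable torus f"
  by (metis cper_bounded cper_measurable integrable_torus_bounded)

lemma integral_translation:
  assumes f: "cper f"
  shows "(\<integral>x. f (x + a) \<partial>torus) = (\<integral>x. f x \<partial>torus)"
proof -
  obtain R where R: "0 < R" "\<And>x. \<bar>f x\<bar> \<le> R" using cper_bounded[OF f] by blast
  \<comment> \<open>Adding the bound makes the function nonnegative, so that the statement on
    nonnegative integrals applies.\<close>
  define g where "g x = f x + R" for x
  have g: "cper g" unfolding g_def using f by auto
  have g0: "0 \<le> g x" for x using R(2)[of x] by (auto simp: g_def)
  have "(\<integral>\<^sup>+x. ennreal (g (x + a)) \<partial>torus) = (\<integral>\<^sup>+x. ennreal (g x) \<partial>torus)"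
    by (rule nn_integral_torus_translation) (use cper_borel[OF g] in \<open>simp_all add: cper_lat[OF g]\<close>)
  then have "(\<integral>x. g (x + a) \<partial>torus) = (\<integral>x. g x \<partial>torus)"
    using g0 g cper_shift[OF g, of a] by (simp add: integral_eq_nn_integral cper_measurable)
  then show ?thesis
    unfolding g_def using f cper_shift[OF f, of a] by simp
qed

section \<open>Fourier modes and their orthogonality\<close>

definition ph :: "int \<times> int \<Rightarrow> real^2 \<Rightarrow> real" where
  "ph k x = of_int (fst k) * ph1 x + of_int (snd k) * ph2 x"

text \<open>One complex number carries amplitude and phase of a real wave. The frequencies
  \<open>k\<close> and \<open>- k\<close> give the same functions, with conjugate coefficients; this
  redundancy causes the two cases in every orthogonality statement.\<close>

definition mode :: "int \<times> int \<Rightarrow> complex \<Rightarrow> real^2 \<Rightarrow> real" where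
  "mode k c x = Re (c * cis (ph k x))"

lemma ph_simps [simp]:
  "ph (k + l) x = ph k x + ph l x" "ph (k - l) x = ph k x - ph l x" "ph (- k) x = - ph k x"
  "ph 0 x = 0" "ph k (x + y) = ph k x + ph k y" "ph k (x - y) = ph k x - ph k y"
  "ph k (- x) = - ph k x" "ph k (a *\<^sub>R x) = a * ph k x" "ph k 0 = 0"
  by (simp_all add: ph_def algebra_simps)

lemma ph_pt2 [simp]: "ph k (pt a b) = of_int (fst k) * a + of_int (snd k) * b"
  by (simp add: ph_def)

lemma cis_ph_lat: "cis (ph k (x + lat v)) = cis (ph k x)"
proof -
  have "cis (ph k (lat v)) = 1"
  proof -
    have "ph k (lat v) = 2 * pi * of_int (fst k * fst v + snd k * snd v)"
      by (simp add: ph_def algebra_simps)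
    then show ?thesis by (metis cis_multiple_2pi Ints_of_int)
  qed
  then show ?thesis by (simp add: cis_mult[symmetric])
qed

lemma continuous_ph2 [continuous_intros]:
  "continuous_on S f \<Longrightarrow> continuous_on S (\<lambda>x. ph k (f x))"
  unfolding ph_def by (intro continuous_intros)

lemma cper_mode [simp, intro]: "cper (mode k c)"
  unfolding mode_def
proof (rule cperI)
  show "Re (c * cis (ph k (x + lat v))) = Re (c * cis (ph k x))" for x v
    unfolding cis_ph_lat ..
qed (intro continuous_intros)

lemma mode_zero [simp]: "mode k 0 x = 0"
  by (simp add: mode_def)

lemma mode_0 [simp]: "mode 0 c x = Re c"
  by (simp add: mode_def)

lemma mode_add: "mode k (c + d) x = mode k c x + mode k d x"
  by (simp add: mode_def algebra_simps)

lemma mode_scale: "mode k (of_real r * c) x = r * mode k c x"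
  by (simp add: mode_def algebra_simps)

lemma mode_cnj: "mode (- k) (cnj c) x = mode k c x"
  by (simp add: mode_def)

lemma mode_shift: "mode k c (x + a) = mode k (cis (ph k a) * c) x"
  by (simp add: mode_def cis_mult[symmetric] mult_ac)

lemma mode_bound: "\<bar>mode k c x\<bar> \<le> cmod c"
  unfolding mode_def using abs_Re_le_cmod[of "c * cis (ph k x)"] by (simp add: norm_mult)

lemma mode_mult: "mode k c x * mode l d x = (mode (k + l) (c * d) x + mode (k - l) (c * cnj d) x) / 2"
proof -
  have e: "Re z * Re w = (Re (z * w) + Re (z * cnj w)) / 2" for z w :: complex
    by simp
  have "mode k c x * mode l d x = (Re ((c * cis (ph k x)) * (d * cis (ph l x))) + Re ((c * cis (ph k x)) * cnj (d * cis (ph l x)))) / 2"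
    unfolding mode_def by (rule e)
  moreover have "(c * cis (ph k x)) * (d * cis (ph l x)) = c * d * cis (ph (k + l) x)"
    by (simp add: cis_mult[symmetric])
  moreover have "(c * cis (ph k x)) * cnj (d * cis (ph l x)) = c * cnj d * cis (ph (k - l) x)"
    by (simp add: cis_cnj cis_mult)
  ultimately show ?thesis by (simp only: mode_def)
qed

text \<open>For \<open>k \<noteq> 0\<close> some translation changes the phase by \<open>pi\<close>,
  hence the sign of the mode, while the integral is translation invariant.\<close>

lemma integral_mode: "(\<integral>x. mode k c x \<partial>torus) = (if k = 0 then Re c * vol else 0)"
proof (cases "k = 0")
  case False
  obtain a where a: "ph k a = pi"
  proof (cases "fst k = 0")
    case True
    then have "snd k \<noteq> 0" using False by (simp add: prod_eq_iff)
    then show thesis using that[of "pt 0 (pi / of_int (snd k))"] True by simp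
  next
    case F: False
    then show thesis using that[of "pt (pi / of_int (fst k)) 0"] by simp
  qed
  have "mode k c (x + a) = - mode k c x" for x
    by (simp add: mode_shift a) (simp add: mode_def)
  then have "(\<integral>x. mode k c x \<partial>torus) = - (\<integral>x. mode k c x \<partial>torus)"
    using integral_translation[OF cper_mode, of k c a] by simp
  then show ?thesis using False by simp
qed simp

lemma integral_mode_mult:
  "(\<integral>x. mode k c x * mode l d x \<partial>torus) =
     vol / 2 * ((if l = - k then Re (c * d) else 0) + (if l = k then Re (c * cnj d) else 0))"
proof -
  have "(\<integral>x. mode k c x * mode l d x \<partial>torus)
      = ((\<integral>x. mode (k + l) (c * d) x \<partial>torus) + (\<integral>x. mode (k - l) (c * cnj d) x \<partial>torus)) / 2"
    unfolding mode_mult by (subst Bochner_Integration.integral_add[symmetric]) auto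
  moreover have "k + l = 0 \<longleftrightarrow> l = - k" by (metis add_eq_0_iff)
  ultimately show ?thesis unfolding integral_mode by (auto simp: field_simps)
qed

section \<open>Trigonometric polynomials and their multipliers\<close>

definition fin :: "(int \<times> int \<Rightarrow> complex) \<Rightarrow> bool" where
  "fin c \<longleftrightarrow> finite {k. c k \<noteq> 0}"

text \<open>A sum over an infinite set is 0 by convention, so \<open>T c\<close> is continuous and
  periodic for every \<open>c\<close>; the algebraic rules assume \<open>fin\<close>. Different
  \<open>c\<close> can give the same function, by the pairing of \<open>k\<close> with
  \<open>- k\<close>.\<close>

definition T :: "(int \<times> int \<Rightarrow> complex) \<Rightarrow> real^2 \<Rightarrow> real" where
  "T c x = (\<Sum>k | c k \<noteq> 0. mode k (c k) x)"

lemma T_on: "finite S \<Longrightarrow> (\<And>k. c k \<noteq> 0 \<Longrightarrow> k \<in> S) \<Longrightarrow> T c x = (\<Sum>k\<in>S. mode k (c k) x)"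
  unfolding T_def by (rule sum.mono_neutral_left) auto

lemma cper_T [simp, intro]: "cper (T c)"
  unfolding T_def by (intro cper_sum cper_mode)

lemma fin_subset: "fin c \<Longrightarrow> (\<And>k. d k \<noteq> 0 \<Longrightarrow> c k \<noteq> 0) \<Longrightarrow> fin d"
  unfolding fin_def by (erule rev_finite_subset) auto

lemma fin_mult [intro]: "fin c \<Longrightarrow> fin (\<lambda>k. m k * c k)"
  by (erule fin_subset) auto

lemma fin_add [intro]: "fin c \<Longrightarrow> fin d \<Longrightarrow> fin (\<lambda>k. c k + d k)"
  unfolding fin_def by (rule finite_subset[of _ "{k. c k \<noteq> 0} \<union> {k. d k \<noteq> 0}"]) auto

lemma fin_diff [intro]: "fin c \<Longrightarrow> fin d \<Longrightarrow> fin (\<lambda>k. c k - d k)"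
  unfolding fin_def by (rule finite_subset[of _ "{k. c k \<noteq> 0} \<union> {k. d k \<noteq> 0}"]) auto

lemma T_add: assumes "fin c" "fin d" shows "T (\<lambda>k. c k + d k) x = T c x + T d x"
proof -
  let ?S = "{k. c k \<noteq> 0} \<union> {k. d k \<noteq> 0}"
  have f: "finite ?S" using assms by (simp add: fin_def)
  show ?thesis
    using T_on[OF f, of c] T_on[OF f, of d] T_on[OF f, of "\<lambda>k. c k + d k"]
    by (simp add: mode_add sum.distrib) force
qed

lemma T_scale: assumes "fin c" shows "T (\<lambda>k. of_real r * c k) x = r * T c x"
proof -
  have f: "finite {k. c k \<noteq> 0}" using assms by (simp add: fin_def)
  show ?thesis
    using T_on[OF f, of c] T_on[OF f, of "\<lambda>k. of_real r * c k"]
    by (simp add: mode_scale sum_distrib_left)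
qed

lemma T_diff: assumes "fin c" "fin d" shows "T (\<lambda>k. c k - d k) x = T c x - T d x"
  using T_add[OF assms(1) fin_mult[OF assms(2), of "\<lambda>_. of_real (-1)"], of x] T_scale[OF assms(2), of "-1"]
  by simp

definition trig :: "(real^2 \<Rightarrow> real) \<Rightarrow> bool" where
  "trig f \<longleftrightarrow> (\<exists>c. fin c \<and> f = T c)"

lemma trig_mode [intro]: "trig (mode k c)"
proof -
  let ?d = "\<lambda>l. if l = k then c else 0"
  have "fin ?d" by (simp add: fin_def)
  moreover have "T ?d = mode k c"
    by (rule ext, subst T_on[of "{k}"]) (auto split: if_splits)
  ultimately show ?thesis unfolding trig_def by metis
qed

lemma trig_const [intro]: "trig (\<lambda>x. r)"
proof -
  have "mode 0 (of_real r) = (\<lambda>x. r)" by (rule ext) simp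
  then show ?thesis by (metis trig_mode)
qed

lemma trig_add [intro]: "trig f \<Longrightarrow> trig g \<Longrightarrow> trig (\<lambda>x. f x + g x)"
proof -
  assume "trig f" "trig g"
  then obtain c d where "fin c" "f = T c" "fin d" "g = T d" by (auto simp: trig_def)
  then have "(\<lambda>x. f x + g x) = T (\<lambda>k. c k + d k)" "fin (\<lambda>k. c k + d k)" by (auto simp: T_add)
  then show ?thesis by (auto simp: trig_def)
qed

lemma trig_scale [intro]: "trig f \<Longrightarrow> trig (\<lambda>x. r * f x)"
proof -
  assume "trig f"
  then obtain c where "fin c" "f = T c" by (auto simp: trig_def)
  then have "(\<lambda>x. r * f x) = T (\<lambda>k. of_real r * c k)" "fin (\<lambda>k. of_real r * c k)"
    by (auto simp: T_scale)
  then show ?thesis by (auto simp: trig_def)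
qed

lemma trig_sum: "(\<And>i. i \<in> I \<Longrightarrow> trig (f i)) \<Longrightarrow> trig (\<lambda>x. \<Sum>i\<in>I. f i x)"
  by (induction I rule: infinite_finite_induct) auto

lemma trig_mult [intro]: assumes "trig f" "trig g" shows "trig (\<lambda>x. f x * g x)"
proof -
  obtain c d where *: "fin c" "f = T c" "fin d" "g = T d" using assms by (auto simp: trig_def)
  have eq: "(\<lambda>x. f x * g x) = (\<lambda>x. \<Sum>k | c k \<noteq> 0. \<Sum>l | d l \<noteq> 0. mode k (c k) x * mode l (d l) x)"
    by (auto simp: * T_def sum_product)
  show ?thesis unfolding eq
  proof (intro trig_sum)
    fix k l
    have e: "(\<lambda>x. mode k (c k) x * mode l (d l) x) =
      (\<lambda>x. (1/2) * (mode (k + l) (c k * d l) x + mode (k - l) (c k * cnj (d l)) x))"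
      by (auto simp: mode_mult)
    show "trig (\<lambda>x. mode k (c k) x * mode l (d l) x)"
      unfolding e by (intro trig_scale trig_add trig_mode)
  qed
qed

lemma trig_cper: "trig f \<Longrightarrow> cper f" by (auto simp: trig_def)

lemma integral_T_mult_on:
  assumes "finite S" "\<And>k. c k \<noteq> 0 \<Longrightarrow> k \<in> S" "\<And>k. d k \<noteq> 0 \<Longrightarrow> k \<in> S"
  shows "(\<integral>x. T c x * T d x \<partial>torus) =
    (\<Sum>k\<in>S. \<Sum>l\<in>S. vol / 2 * ((if l = - k then Re (c k * d l) else 0) + (if l = k then Re (c k * cnj (d l)) else 0)))"
proof -
  have "(\<lambda>x. T c x * T d x) = (\<lambda>x. \<Sum>k\<in>S. \<Sum>l\<in>S. mode k (c k) x * mode l (d l) x)"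
    by (rule ext, subst (1 2) T_on[OF assms(1)]) (use assms in \<open>auto simp: sum_product\<close>)
  then have "(\<integral>x. T c x * T d x \<partial>torus) = (\<Sum>k\<in>S. \<Sum>l\<in>S. \<integral>x. mode k (c k) x * mode l (d l) x \<partial>torus)"
    by (simp only:) (subst Bochner_Integration.integral_sum; (intro cper_integrable cper_sum cper_mult cper_mode sum.cong refl)?)+
  then show ?thesis unfolding integral_mode_mult .
qed

text \<open>A real even multiplier is self-adjoint: orthogonality pairs \<open>k\<close> with
  \<open>k\<close> and \<open>- k\<close> only, and there the multiplier takes the same
  value.\<close>

lemma integral_T_even:
  assumes "fin c" "fin d" and ev: "\<And>k. m (- k) = m k"
  shows "(\<integral>x. T (\<lambda>k. of_real (m k) * c k) x * T d x \<partial>torus) = (\<integral>x. T c x * T (\<lambda>k. of_real (m k) * d k) x \<partial>torus)"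
proof -
  let ?S = "{k. c k \<noteq> 0} \<union> {k. d k \<noteq> 0}"
  have f: "finite ?S" using assms by (simp add: fin_def)
  show ?thesis
  proof (subst (1 2) integral_T_mult_on[OF f])
    have 1: "Re (of_real r * a * b) = r * Re (a * b)" "Re (a * (of_real r * b)) = r * Re (a * b)" for r a b
      by (simp_all add: algebra_simps)
    have 2: "cnj (of_real r * a) = of_real r * cnj a" for r a by simp
    show "(\<Sum>k\<in>?S. \<Sum>l\<in>?S. vol / 2 * ((if l = - k then Re (of_real (m k) * c k * d l) else 0) + (if l = k then Re (of_real (m k) * c k * cnj (d l)) else 0)))
      = (\<Sum>k\<in>?S. \<Sum>l\<in>?S. vol / 2 * ((if l = - k then Re (c k * (of_real (m l) * d l)) else 0) + (if l = k then Re (c k * cnj (of_real (m l) * d l)) else 0)))"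
      unfolding 2 1 by (intro sum.cong refl arg_cong2[where f="(*)"] arg_cong2[where f="(+)"]) (simp_all add: ev)
  qed auto
qed

text \<open>Integration by parts on the frequency side. An odd real symbol times \<open>\<i>\<close>
  is a derivative or a central difference; it is antisymmetric, so two of them combine to the
  positive square.\<close>

lemma integral_T_odd:
  assumes "fin c" "fin d" and odd: "\<And>k. m (- k) = - m k"
  shows "(\<integral>x. T (\<lambda>k. \<i> * of_real (m k) * c k) x * T (\<lambda>k. \<i> * of_real (m k) * d k) x \<partial>torus)
     = (\<integral>x. T (\<lambda>k. of_real ((m k)\<^sup>2) * c k) x * T d x \<partial>torus)"
proof -
  let ?S = "{k. c k \<noteq> 0} \<union> {k. d k \<noteq> 0}"
  have f: "finite ?S" using assms by (simp add: fin_def)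
  show ?thesis
  proof (subst (1 2) integral_T_mult_on[OF f])
    have 1: "Re (of_real r * a * b) = r * Re (a * b)" for r a b
      by (simp add: algebra_simps)
    have 2: "Re (\<i> * of_real r * a * (\<i> * of_real r' * b)) = - (r * r') * Re (a * b)"
      "Re (\<i> * of_real r * a * cnj (\<i> * of_real r' * b)) = r * r' * Re (a * cnj b)" for r r' a b
      by (simp_all add: algebra_simps)
    show "(\<Sum>k\<in>?S. \<Sum>l\<in>?S. vol / 2 * ((if l = - k then Re (\<i> * of_real (m k) * c k * (\<i> * of_real (m l) * d l)) else 0) + (if l = k then Re (\<i> * of_real (m k) * c k * cnj (\<i> * of_real (m l) * d l)) else 0)))
      = (\<Sum>k\<in>?S. \<Sum>l\<in>?S. vol / 2 * ((if l = - k then Re (of_real ((m k)\<^sup>2) * c k * d l) else 0) + (if l = k then Re (of_real ((m k)\<^sup>2) * c k * cnj (d l)) else 0)))"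
      unfolding 2 1 by (intro sum.cong refl arg_cong2[where f="(*)"] arg_cong2[where f="(+)"]) (simp_all add: odd power2_eq_square)
  qed auto
qed

text \<open>The usual symmetry of Fourier coefficients of a real function. It removes the ambiguity
  between \<open>k\<close> and \<open>- k\<close> and makes Parseval's formula diagonal.\<close>

definition herm :: "(int \<times> int \<Rightarrow> complex) \<Rightarrow> bool" where
  "herm c \<longleftrightarrow> (\<forall>k. c (- k) = cnj (c k))"

lemma hermD: "herm c \<Longrightarrow> c (- k) = cnj (c k)"
  by (simp only: herm_def)

text \<open>Replacing \<open>c k\<close> by the mean of \<open>c k\<close> and
  \<open>cnj (c (- k))\<close> leaves the function unchanged, because the second coefficient at
  \<open>k\<close> describes the same mode as \<open>c (- k)\<close> at \<open>- k\<close>.\<close>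

lemma herm_exists:
  assumes "fin c"
  obtains d where "fin d" "herm d" "T d = T c" "c 0 = 0 \<Longrightarrow> d 0 = 0"
proof -
  define S where "S = {k. c k \<noteq> 0} \<union> uminus ` {k. c k \<noteq> 0}"
  have S: "finite S" using assms by (simp add: S_def fin_def)
  have mS: "uminus ` S = S" by (auto simp: S_def image_Un image_image)
  define d where "d k = of_real (1/2) * (c k + cnj (c (- k)))" for k
  have dS: "k \<in> S" if "d k \<noteq> 0" for k
  proof (rule ccontr)
    assume "k \<notin> S"
    then have "c k = 0" by (auto simp: S_def)
    moreover have "c (- k) = 0"
    proof (rule ccontr)
      assume "c (- k) \<noteq> 0"
      then have "- (- k) \<in> uminus ` {k. c k \<noteq> 0}" by (intro imageI) simp
      then show False using \<open>k \<notin> S\<close> by (simp add: S_def)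
    qed
    ultimately show False using that by (simp add: d_def)
  qed
  have "T d = T c"
  proof
    fix x
    have "T d x = (1/2) * ((\<Sum>k\<in>S. mode k (c k) x) + (\<Sum>k\<in>S. mode k (cnj (c (- k))) x))"
      by (subst T_on[OF S dS], assumption)
        (simp only: d_def mode_scale mode_add sum.distrib sum_distrib_left[symmetric])
    also have "(\<Sum>k\<in>S. mode k (cnj (c (- k))) x) = (\<Sum>k\<in>S. mode k (c k) x)"
    proof -
      have "(\<Sum>k\<in>S. mode k (c k) x) = (\<Sum>k\<in>uminus ` S. mode k (c k) x)" by (simp add: mS)
      also have "\<dots> = (\<Sum>k\<in>S. mode (- k) (c (- k)) x)"
        by (subst sum.reindex) (auto simp: inj_on_def)
      also have "\<dots> = (\<Sum>k\<in>S. mode k (cnj (c (- k))) x)"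
      proof (rule sum.cong[OF refl])
        fix k
        show "mode (- k) (c (- k)) x = mode k (cnj (c (- k))) x"
          using mode_cnj[of k "cnj (c (- k))" x] by simp
      qed
      finally show ?thesis ..
    qed
    also have "(\<Sum>k\<in>S. mode k (c k) x) = T c x"
      by (rule T_on[symmetric, OF S]) (auto simp: S_def)
    finally show "T d x = T c x" by simp
  qed
  moreover have "fin d" unfolding fin_def by (rule finite_subset[OF _ S]) (auto dest: dS)
  moreover have "herm d" by (simp add: herm_def d_def)
  moreover have "c 0 = 0 \<Longrightarrow> d 0 = 0" by (simp add: d_def)
  ultimately show thesis using that by blast
qed

text \<open>For Hermitian coefficients the contributions of \<open>l = k\<close> and
  \<open>l = - k\<close> coincide, which cancels the factor 1/2.\<close>

lemma parseval:
  assumes "finite S" "\<And>k. c k \<noteq> 0 \<Longrightarrow> k \<in> S" "\<And>k. d k \<noteq> 0 \<Longrightarrow> k \<in> S" "herm c" "herm d"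
  shows "(\<integral>x. T c x * T d x \<partial>torus) = vol * (\<Sum>k\<in>S. Re (c k * cnj (d k)))"
proof -
  have n: "(\<Sum>l\<in>S. if l = - k then Re (c k * d l) else 0) = Re (c k * cnj (d k))" if "k \<in> S" for k
  proof (cases "- k \<in> S")
    case True
    then show ?thesis using assms by (simp add: hermD[OF assms(5)])
  next
    case False
    then have "d (- k) = 0" using assms by blast
    then have "d k = 0" using hermD[OF assms(5), of k] by simp
    then show ?thesis using False assms(1) by simp
  qed
  have "(\<integral>x. T c x * T d x \<partial>torus) =
    (\<Sum>k\<in>S. vol / 2 * ((\<Sum>l\<in>S. if l = - k then Re (c k * d l) else 0) + (\<Sum>l\<in>S. if l = k then Re (c k * cnj (d l)) else 0)))"
  proof -
    have "(\<integral>x. T c x * T d x \<partial>torus) = (\<Sum>k\<in>S. \<Sum>l\<in>S. vol / 2 * ((if l = - k then Re (c k * d l) else 0) + (if l = k then Re (c k * cnj (d l)) else 0)))"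
      by (rule integral_T_mult_on) (use assms in auto)
    then show ?thesis by (simp only: sum_distrib_left[symmetric] sum.distrib)
  qed
  also have "\<dots> = (\<Sum>k\<in>S. vol * Re (c k * cnj (d k)))"
  proof (rule sum.cong[OF refl])
    fix k assume k: "k \<in> S"
    have "(\<Sum>l\<in>S. if l = k then Re (c k * cnj (d l)) else 0) = Re (c k * cnj (d k))"
      using k assms(1) by simp
    then show "vol / 2 * ((\<Sum>l\<in>S. if l = - k then Re (c k * d l) else 0) + (\<Sum>l\<in>S. if l = k then Re (c k * cnj (d l)) else 0)) = vol * Re (c k * cnj (d k))"
      unfolding n[OF k] by simp
  qed
  finally show ?thesis by (simp add: sum_distrib_left)
qed

section \<open>Density\<close>

text \<open>The torus as a compact set of pairs of complex numbers: polynomials in the real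
  coordinates become trigonometric polynomials, so Stone-Weierstrass applies.\<close>

definition Psi :: "real^2 \<Rightarrow> complex \<times> complex" where
  "Psi x = (cis (ph1 x), cis (ph2 x))"

lemma trig_real_polynomial:
  assumes "real_polynomial_function g"
  shows "trig (\<lambda>x. g (Psi x))"
  using assms
proof induction
  case (linear f)
  then interpret bounded_linear f .
  have 1: "Psi x = Re (cis (ph1 x)) *\<^sub>R (1, 0) + Im (cis (ph1 x)) *\<^sub>R (\<i>, 0) + Re (cis (ph2 x)) *\<^sub>R (0, 1) + Im (cis (ph2 x)) *\<^sub>R (0, \<i>)" for x
    by (simp add: Psi_def complex_eq_iff)
  have "f (Psi x) = mode (1, 0) (of_real (f (1, 0))) x + mode (1, 0) (of_real (- f (\<i>, 0)) * \<i>) x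
       + mode (0, 1) (of_real (f (0, 1))) x + mode (0, 1) (of_real (- f (0, \<i>)) * \<i>) x" for x
    unfolding 1 add scaleR by (simp add: mode_def ph_def)
  then show ?case by (simp only:) (intro trig_add trig_mode)
qed auto

text \<open>A continuous map from a compact space to a Hausdorff space is closed, hence a quotient
  map onto its image: the preimage of a closed set under \<open>H\<close> is the image of a compact
  set.\<close>

lemma continuous_on_quotient:
  fixes h :: "'a::t2_space \<Rightarrow> 'b::topological_space" and P :: "'a \<Rightarrow> 'c::t2_space"
  assumes "compact K" "continuous_on K P" "continuous_on K h"
    and "\<And>x y. x \<in> K \<Longrightarrow> y \<in> K \<Longrightarrow> P x = P y \<Longrightarrow> h x = h y"
  obtains H where "continuous_on (P ` K) H" "\<And>x. x \<in> K \<Longrightarrow> H (P x) = h x"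
proof -
  define H where "H z = h (SOME x. x \<in> K \<and> P x = z)" for z
  have H: "H (P x) = h x" if "x \<in> K" for x
  proof -
    have "(SOME y. y \<in> K \<and> P y = P x) \<in> K \<and> P (SOME y. y \<in> K \<and> P y = P x) = P x"
      by (rule someI[of _ x]) (use that in auto)
    then show ?thesis unfolding H_def using assms(4) that by blast
  qed
  have "continuous_on (P ` K) H"
    unfolding continuous_on_closed_invariant
  proof (intro allI impI)
    fix B :: "'b set" assume B: "closed B"
    have "compact (h -` B \<inter> K)"
    proof -
      have "closed (h -` B \<inter> K)"
        using B assms(3) continuous_on_closed_vimage[OF compact_imp_closed[OF assms(1)]] by blast
      from compact_Int_closed[OF assms(1) this] show ?thesis
        by (simp add: Int_absorb2 Int_ac)
    qed
    then have "compact (P ` (h -` B \<inter> K))"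
      by (rule compact_continuous_image[rotated]) (rule continuous_on_subset[OF assms(2)], auto)
    then have "closed (P ` (h -` B \<inter> K))" by (rule compact_imp_closed)
    moreover have "P ` (h -` B \<inter> K) \<inter> P ` K = H -` B \<inter> P ` K"
    proof (intro equalityI subsetI)
      fix z assume "z \<in> P ` (h -` B \<inter> K) \<inter> P ` K"
      then obtain x where "x \<in> K" "h x \<in> B" "z = P x" by blast
      then show "z \<in> H -` B \<inter> P ` K" using H[of x] by simp
    next
      fix z assume "z \<in> H -` B \<inter> P ` K"
      then obtain x where "x \<in> K" "H z \<in> B" "z = P x" by blast
      then show "z \<in> P ` (h -` B \<inter> K) \<inter> P ` K" using H[of x] by auto
    qed
    ultimately show "\<exists>A. closed A \<and> A \<inter> P ` K = H -` B \<inter> P ` K" by blast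
  qed
  then show thesis using that H by blast
qed

lemma continuous_Psi: "continuous_on S Psi"
  unfolding Psi_def by (intro continuous_intros)

text \<open>Only the values on \<open>ccell\<close> and their compatibility with the identification
  of opposite sides enter, so the lemma serves functions that are not periodic on the whole
  plane.\<close>

lemma trig_uniform_approx:
  assumes "continuous_on ccell h" "\<And>x y. x \<in> ccell \<Longrightarrow> y \<in> ccell \<Longrightarrow> Psi x = Psi y \<Longrightarrow> h x = h y" "0 < e"
  obtains t where "trig t" "\<And>x. x \<in> ccell \<Longrightarrow> \<bar>h x - t x\<bar> < e"
proof -
  obtain H where H: "continuous_on (Psi ` ccell) H" "\<And>x. x \<in> ccell \<Longrightarrow> H (Psi x) = h x"
    using continuous_on_quotient[OF compact_ccell continuous_Psi assms(1,2)] by metis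
  obtain g where g: "real_polynomial_function g" "\<And>z. z \<in> Psi ` ccell \<Longrightarrow> \<bar>H z - g z\<bar> < e"
    using Stone_Weierstrass_real_polynomial_function[OF compact_continuous_image[OF continuous_Psi compact_ccell] H(1) assms(3)] by metis
  have "\<bar>h x - g (Psi x)\<bar> < e" if "x \<in> ccell" for x
    using g(2)[of "Psi x"] H(2)[OF that] that by simp
  then show thesis using that[OF trig_real_polynomial[OF g(1)]] by blast
qed

lemma cis_eq_imp: assumes "cis a = cis b" shows "\<exists>n::int. a = b + 2 * pi * of_int n"
proof -
  have "cos a = cos b" using arg_cong[OF assms, of Re] by simp
  moreover have "sin a = sin b" using arg_cong[OF assms, of Im] by simp
  ultimately show ?thesis using sin_cos_eq_iff by blast
qed

lemma trig_approx_cper: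
  assumes f: "cper f" and "0 < e"
  obtains t where "trig t" "\<And>x. \<bar>f x - t x\<bar> < e"
proof -
  have 1: "continuous_on ccell f" using f by (auto simp: cper_def intro: continuous_on_subset)
  have 2: "f x = f y" if Psi: "Psi x = Psi y" for x y
  proof -
    obtain m n :: int where "ph1 x = ph1 y + 2 * pi * of_int m" "ph2 x = ph2 y + 2 * pi * of_int n"
      using Psi cis_eq_imp[of "ph1 x" "ph1 y"] cis_eq_imp[of "ph2 x" "ph2 y"] unfolding Psi_def prod.inject by blast
    then have "x = y + lat (m, n)" by (intro ph_eqI) simp_all
    then show ?thesis using cper_lat[OF f, of y "(m, n)"] by simp
  qed
  obtain t where t: "trig t" "\<And>x. x \<in> ccell \<Longrightarrow> \<bar>f x - t x\<bar> < e"
    using trig_uniform_approx[OF 1 2 assms(2)] by metis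
  have "\<bar>f x - t x\<bar> < e" for x
  proof -
    have "x + lat (red x) \<in> ccell" using cell_red cell_subset by blast
    from t(2)[OF this] show ?thesis
      by (simp add: cper_lat[OF f] cper_lat[OF trig_cper[OF t(1)]])
  qed
  then show thesis using that t(1) by blast
qed

section \<open>A Bellman function\<close>

lemma taylor_lower:
  fixes f f1 f2 :: "real \<Rightarrow> real"
  assumes d1: "\<And>t. (f has_real_derivative f1 t) (at t)" and d2: "\<And>t. (f1 has_real_derivative f2 t) (at t)"
    and m: "\<And>t. 2 * m \<le> f2 t"
  shows "f 0 + f1 0 + m \<le> f 1"
proof -
  have 1: "f1 0 + 2 * m * t \<le> f1 t" if "0 \<le> t" for t
  proof -
    have "(\<lambda>t. f1 t - 2 * m * t) 0 \<le> (\<lambda>t. f1 t - 2 * m * t) t"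
    proof (rule DERIV_nonneg_imp_nondecreasing[of 0 t "\<lambda>t. f1 t - 2 * m * t"])
      fix t :: real assume "0 \<le> t"
      show "\<exists>y. ((\<lambda>t. f1 t - 2 * m * t) has_real_derivative y) (at t) \<and> 0 \<le> y"
        using m[of t] by (intro exI[of _ "f2 t - 2 * m"] conjI) (auto intro!: derivative_eq_intros d2)
    qed (rule that)
    then show ?thesis by simp
  qed
  have "(\<lambda>t. f t - f1 0 * t - m * t\<^sup>2) 0 \<le> (\<lambda>t. f t - f1 0 * t - m * t\<^sup>2) 1"
  proof (rule DERIV_nonneg_imp_nondecreasing[of 0 1 "\<lambda>t. f t - f1 0 * t - m * t\<^sup>2"])
    fix t :: real assume "0 \<le> t" "t \<le> 1"
    then show "\<exists>y. ((\<lambda>t. f t - f1 0 * t - m * t\<^sup>2) has_real_derivative y) (at t) \<and> 0 \<le> y"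
      using 1[of t] by (intro exI[of _ "f1 t - f1 0 - m * (2 * t)"] conjI) (auto intro!: derivative_eq_intros d1)
  qed simp
  then show ?thesis by simp
qed

lemma powr_add_le:
  fixes a b g :: real
  assumes "0 \<le> a" "0 \<le> b" "0 < g"
  shows "(a + b) powr g \<le> 2 powr g * (a powr g + b powr g)"
proof -
  have "(a + b) powr g \<le> (2 * max a b) powr g"
    using assms by (intro powr_mono2) auto
  also have "\<dots> = 2 powr g * max a b powr g"
    using assms by (simp add: powr_mult)
  also have "max a b powr g \<le> a powr g + b powr g"
    by (simp add: max_def)
  finally show ?thesis by simp
qed

text \<open>A smooth Bellman function of Nazarov--Treil type for conjugate exponents: it grows like
  \<open>1 + \<bar>x\<bar> powr p + \<bar>y\<bar> powr q\<close>, while its Hessian form dominates \<open>\<bar>d * e\<bar>\<close>.\<close>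
locale bellman_exponents =
  fixes p q s K :: real
  assumes p2: "2 \<le> p" and q1: "1 < q" and pq: "(p - 1) * (q - 1) = 1"
  defines "s \<equiv> (2 - q) / 2" and "K \<equiv> (2 + 8 * p\<^sup>2) / (q * (q - 1))"
begin

lemma q2: "q \<le> 2"
proof (rule ccontr)
  assume "\<not> q \<le> 2"
  then have "1 * (q - 1) \<le> (p - 1) * (q - 1)" using p2 by (intro mult_right_mono) auto
  then show False using pq \<open>\<not> q \<le> 2\<close> by simp
qed

lemma s_bounds: "0 \<le> s" "s \<le> 1 / 2" "q / 2 - 1 = - s" "q - 1 + s = q / 2"
  using q2 q1 by (auto simp: s_def field_simps)

lemma K_pos: "0 < K" "K * q * (q - 1) = 2 + 8 * p\<^sup>2"
  using q1 by (auto simp: K_def intro!: divide_pos_pos add_pos_nonneg)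

text \<open>A smooth substitute for the larger of \<open>y\<^sup>2\<close> and
  \<open>\<bar>x\<bar> powr (2 * (p - 1))\<close>. By conjugacy the two balance where
  \<open>\<bar>x\<bar> powr p = \<bar>y\<bar> powr q\<close>. The summand 1 keeps the base of every
  power positive.\<close>

definition Z :: "real \<Rightarrow> real \<Rightarrow> real" where
  "Z x y = y\<^sup>2 + (1 + x\<^sup>2) powr (p - 1)"

text \<open>For large arguments the second term behaves like
  \<open>x\<^sup>2 * \<bar>y\<bar> powr (2 - q)\<close> where \<open>y\<close> dominates and like
  \<open>\<bar>x\<bar> powr p\<close> where \<open>x\<close> does. The first term supplies the
  convexity in \<open>y\<close> that the second may lack.\<close>

definition B :: "real \<Rightarrow> real \<Rightarrow> real" where
  "B x y = K * (1 + y\<^sup>2) powr (q / 2) + x\<^sup>2 * Z x y powr s"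

lemma w_ge1: "1 \<le> (1 + x\<^sup>2) powr (p - 1)"
  using p2 by (intro ge_one_powr_ge_zero) auto

lemma Z_ge: "1 + y\<^sup>2 \<le> Z x y" "1 \<le> Z x y" "0 < Z x y" "(1 + x\<^sup>2) powr (p - 1) \<le> Z x y"
  using w_ge1[of x] zero_le_power2[of y] unfolding Z_def by linarith+

lemma x2_le: "x\<^sup>2 \<le> Z x y powr (q - 1)"
proof -
  have "1 + x\<^sup>2 = ((1 + x\<^sup>2) powr (p - 1)) powr (q - 1)"
    by (simp add: powr_powr pq add_nonneg_pos)
  also have "\<dots> \<le> Z x y powr (q - 1)"
    by (intro powr_mono2) (use q1 Z_ge in auto)
  finally show ?thesis by simp
qed

text \<open>By \<open>x2_le\<close> the square is at most \<open>Z\<close> to the power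
  \<open>2 * (s - 1) + q\<close>, and this exponent is 0. The bounded quantity is the coefficient of
  the mixed part of the Hessian form.\<close>

lemma xy_le: "(Z x y powr s * (x * y) / Z x y)\<^sup>2 \<le> 1"
proof -
  have "(Z x y powr s * (x * y) / Z x y)\<^sup>2 = (Z x y powr s / Z x y)\<^sup>2 * (x\<^sup>2 * y\<^sup>2)"
    by (simp add: power_mult_distrib power_divide)
  also have "\<dots> \<le> (Z x y powr s / Z x y)\<^sup>2 * (Z x y powr (q - 1) * Z x y)"
    using x2_le[of x y] Z_ge[where x=x and y=y] by (intro mult_left_mono mult_mono) auto
  also have "\<dots> = 1"
  proof -
    have "Z x y powr s / Z x y = Z x y powr (s - 1)"
      using Z_ge[where x=x and y=y] by (simp add: powr_diff)
    moreover have "(Z x y powr (s - 1))\<^sup>2 = Z x y powr (s - 1 + (s - 1))"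
      unfolding powr_add power2_eq_square ..
    moreover have "Z x y powr (q - 1) * Z x y = Z x y powr (q - 1 + 1)"
      unfolding powr_add using Z_ge[where x=x and y=y] by simp
    moreover have "s - 1 + (s - 1) + (q - 1 + 1) = 0" by (simp add: s_def field_simps)
    ultimately show ?thesis using Z_ge(3)[where x=x and y=y] by (simp add: powr_add[symmetric])
  qed
  finally show ?thesis .
qed

lemma B_nonneg: "0 \<le> B x y"
  unfolding B_def using K_pos by (intro add_nonneg_nonneg mult_nonneg_nonneg) auto

lemma B_upper: "\<exists>C>0. \<forall>x y. B x y \<le> C * (1 + \<bar>x\<bar> powr p + \<bar>y\<bar> powr q)"
proof -
  \<comment> \<open>The label is local and unrelated to the constant of that name; the fact converts
    powers of a square into powers of an absolute value.\<close>
  have amplitude_invariants: "(x\<^sup>2) powr (r / 2) = \<bar>x\<bar> powr r" for x r :: real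
    by (metis abs_ge_zero mult_2_right nonzero_mult_div_cancel_left powr_numeral powr_powr power2_abs times_divide_eq_right zero_neq_numeral)
  define C1 where "C1 = 2 powr (q / 2)"
  define C2 where "C2 = 2 powr (p / 2)"
  have c: "0 < C1" "0 < C2" by (simp_all add: C1_def C2_def)
  have "B x y \<le> (K * C1 + C1 + C1 * C2) * (1 + \<bar>x\<bar> powr p + \<bar>y\<bar> powr q)" for x y
  proof -
    have 1: "(1 + y\<^sup>2) powr (q / 2) \<le> C1 * (1 + \<bar>y\<bar> powr q)"
      using powr_add_le[of 1 "y\<^sup>2" "q / 2"] q1 by (simp add: amplitude_invariants C1_def)
    have "x\<^sup>2 * Z x y powr s \<le> Z x y powr (q - 1) * Z x y powr s"
      by (intro mult_right_mono x2_le) simp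
    also have "\<dots> = Z x y powr (q / 2)" by (simp add: powr_add[symmetric] s_bounds)
    also have "\<dots> \<le> C1 * ((y\<^sup>2) powr (q / 2) + ((1 + x\<^sup>2) powr (p - 1)) powr (q / 2))"
      unfolding Z_def C1_def using q1 by (intro powr_add_le) auto
    also have "((1 + x\<^sup>2) powr (p - 1)) powr (q / 2) = (1 + x\<^sup>2) powr (p / 2)"
    proof -
      have "(p - 1) * (q / 2) = p / 2" using pq by (simp add: field_simps)
      then show ?thesis by (simp add: powr_powr)
    qed
    also have "(1 + x\<^sup>2) powr (p / 2) \<le> C2 * (1 + \<bar>x\<bar> powr p)"
      using powr_add_le[of 1 "x\<^sup>2" "p / 2"] p2 by (simp add: amplitude_invariants C2_def)
    finally have 2: "x\<^sup>2 * Z x y powr s \<le> C1 * (\<bar>y\<bar> powr q + C2 * (1 + \<bar>x\<bar> powr p))"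
      using c by (simp add: amplitude_invariants)
    define X Y where "X = \<bar>x\<bar> powr p" and "Y = \<bar>y\<bar> powr q"
    have "0 \<le> X" "0 \<le> Y" by (simp_all add: X_def Y_def)
    have "B x y \<le> K * (C1 * (1 + Y)) + C1 * (Y + C2 * (1 + X))"
      unfolding B_def using 1 2 K_pos by (intro add_mono mult_left_mono) (auto simp: X_def Y_def)
    also have "\<dots> \<le> (K * C1 + C1 + C1 * C2) * (1 + X + Y)"
      using c K_pos \<open>0 \<le> X\<close> \<open>0 \<le> Y\<close> by (simp add: algebra_simps)
    finally show ?thesis by (simp add: X_def Y_def)
  qed
  moreover have "0 < K * C1 + C1 + C1 * C2" using c K_pos by (intro add_pos_pos mult_pos_pos) auto
  ultimately show ?thesis by blast
qed

lemma continuous_B: "continuous_on UNIV (\<lambda>v. B (fst v) (snd v))"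
  unfolding B_def Z_def using Z_ge[unfolded Z_def]
  by (intro continuous_intros) (auto simp: add_nonneg_eq_0_iff less_imp_neq[symmetric] intro!: less_imp_neq[symmetric] simp: add_pos_nonneg)

text \<open>The second derivative along a line splits into three parts, quadratic in \<open>d\<close>, mixed, and
  quadratic in \<open>e\<close>; the mixed part and the negative part of the last are absorbed by choice of
  the constant \<open>K\<close>.\<close>
lemma hessian_lower:
  fixes a b d e u w :: real
  defines "u \<equiv> Z a b powr s" and "w \<equiv> (1 + a\<^sup>2) powr (p - 1)"
  defines "W1 \<equiv> 2 * (p - 1) * d * a * (w / (1 + a\<^sup>2))"
    and "W2 \<equiv> 2 * (p - 1) * d\<^sup>2 * (w / (1 + a\<^sup>2) + 2 * (p - 2) * a\<^sup>2 * (w / (1 + a\<^sup>2)\<^sup>2))"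
  shows "2 * \<bar>d * e\<bar> \<le>
     K * q * e\<^sup>2 * ((1 + b\<^sup>2) powr (- s) - (2 - q) * b\<^sup>2 * ((1 + b\<^sup>2) powr (- s) / (1 + b\<^sup>2)))
     + 2 * d\<^sup>2 * u + 4 * a * d * s * (u / Z a b) * (2 * b * e + W1)
     + a\<^sup>2 * s * (u / Z a b) * (2 * e\<^sup>2 + W2) - a\<^sup>2 * s * (1 - s) * (u / (Z a b)\<^sup>2) * (2 * b * e + W1)\<^sup>2"
proof -
  define z where "z = Z a b"
  define R where "R = 1 + a\<^sup>2"
  \<comment> \<open>Scale-free variables: \<open>rho\<close> and \<open>om\<close> lie between 0 and
    1 and \<open>\<bar>m\<bar> \<le> 1\<close>. In these terms \<open>Q\<close>, \<open>X\<close>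
    and \<open>Y\<close> have the sizes \<open>d\<^sup>2 * u\<close>, \<open>d * e\<close> and
    \<open>e\<^sup>2 / u\<close>.\<close>
  define rho where "rho = a\<^sup>2 / R"
  define om where "om = w / z"
  define m where "m = u * (a * b) / z"
  have z: "1 \<le> z" "0 < z" "w \<le> z" "1 + b\<^sup>2 \<le> z" using Z_ge[where x=a and y=b] by (auto simp: z_def w_def)
  have R: "0 < R" "1 \<le> R" by (auto simp: R_def add_pos_nonneg)
  have rho: "0 \<le> rho" "rho \<le> 1" using R by (auto simp: rho_def R_def field_simps)
  have om: "0 \<le> om" "om \<le> 1" using z by (auto simp: om_def w_def field_simps)
  have u: "0 < u" using z by (simp add: u_def z_def)
  have m2: "m\<^sup>2 \<le> 1" using xy_le[of a b] by (simp add: m_def u_def z_def)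
  then have m1: "\<bar>m\<bar> \<le> 1" by (simp add: abs_square_le_1)
  define Q where "Q = 2 * s * (p - 1) * u * d\<^sup>2 * rho * om * (5 + 2 * (p - 2) * rho - 2 * (1 - s) * (p - 1) * rho * om)"
  define X where "X = 8 * s * m * (d * e) * (1 - (1 - s) * (p - 1) * rho * om)"
  define Y where "Y = a\<^sup>2 * s * (u / z) * 2 * e\<^sup>2 - 4 * s * (1 - s) * (m\<^sup>2 / u) * e\<^sup>2"
  have eq: "4 * a * d * s * (u / z) * (2 * b * e + W1)
     + a\<^sup>2 * s * (u / z) * (2 * e\<^sup>2 + W2) - a\<^sup>2 * s * (1 - s) * (u / z\<^sup>2) * (2 * b * e + W1)\<^sup>2 = Q + X + Y"
  proof -
    have aW1: "a * W1 = 2 * (p - 1) * d * rho * w" 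
      unfolding W1_def rho_def R_def by (simp add: power2_eq_square)
    have aW2: "a\<^sup>2 * W2 = 2 * (p - 1) * d\<^sup>2 * w * (rho + 2 * (p - 2) * rho\<^sup>2)"
      unfolding W2_def rho_def R_def by (simp add: power2_eq_square algebra_simps)
    have wz: "w = om * z" using z by (simp add: om_def)
    have mu: "m\<^sup>2 / u = u * (a\<^sup>2 * b\<^sup>2) / z\<^sup>2" using u by (simp add: m_def power2_eq_square)
    have "4 * a * d * s * (u / z) * (2 * b * e + W1)
     + a\<^sup>2 * s * (u / z) * (2 * e\<^sup>2 + W2) - a\<^sup>2 * s * (1 - s) * (u / z\<^sup>2) * (2 * b * e + W1)\<^sup>2
     = 8 * s * (u * (a * b) / z) * (d * e) + 4 * d * s * (u / z) * (a * W1) + a\<^sup>2 * s * (u / z) * 2 * e\<^sup>2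
      + s * (u / z) * (a\<^sup>2 * W2) - s * (1 - s) * (u / z\<^sup>2) * (a * W1)\<^sup>2
      - 4 * s * (1 - s) * (u * (a * b) / z\<^sup>2) * e * (a * W1) - 4 * s * (1 - s) * (u * (a\<^sup>2 * b\<^sup>2) / z\<^sup>2) * e\<^sup>2"
      by (simp add: power2_eq_square algebra_simps add_divide_distrib diff_divide_distrib)
    also have "\<dots> = Q + X + Y"
      unfolding aW1 aW2 wz Q_def X_def Y_def mu m_def using z
      by (simp add: field_simps power2_eq_square)
    finally show ?thesis .
  qed
  have Q0: "0 \<le> Q"
  proof -
    \<comment> \<open>Estimating \<open>1 - s\<close> and \<open>om\<close> by 1 leaves at least
      \<open>5 - 2 * rho\<close> in the last factor of \<open>Q\<close>.\<close>
    have "(1 - s) * (rho * om) \<le> 1 * (rho * 1)"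
      using s_bounds rho om by (intro mult_mono) auto
    then have "2 * (p - 1) * ((1 - s) * (rho * om)) \<le> 2 * (p - 1) * rho"
      using p2 by (intro mult_left_mono) auto
    also have "\<dots> = 2 * (p - 2) * rho + 2 * rho" by (simp add: algebra_simps)
    finally have "2 * (p - 1) * ((1 - s) * (rho * om)) \<le> 2 * (p - 2) * rho + 2 * rho" .
    moreover have "2 * (1 - s) * (p - 1) * rho * om = 2 * (p - 1) * ((1 - s) * (rho * om))" by (simp add: algebra_simps)
    ultimately have "0 \<le> 5 + 2 * (p - 2) * rho - 2 * (1 - s) * (p - 1) * rho * om"
      using rho by linarith
    then show ?thesis unfolding Q_def using s_bounds p2 u rho om by (intro mult_nonneg_nonneg) auto
  qed
  have X0: "- (4 * p * \<bar>d * e\<bar>) \<le> X"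
  proof -
    have aux: "\<bar>1 - v\<bar> \<le> p" if "0 \<le> v" "v \<le> 1 * (p - 1) * 1 * 1" for v
      using that p2 by auto
    have "0 \<le> (1 - s) * (p - 1) * rho * om" using s_bounds p2 rho om by (intro mult_nonneg_nonneg) auto
    moreover have "(1 - s) * (p - 1) * rho * om \<le> 1 * (p - 1) * 1 * 1"
      using s_bounds p2 rho om by (intro mult_mono mult_nonneg_nonneg) auto
    ultimately have "\<bar>1 - (1 - s) * (p - 1) * rho * om\<bar> \<le> p"
      by (rule aux)
    moreover have "\<bar>X\<bar> = 8 * s * \<bar>m\<bar> * \<bar>d * e\<bar> * \<bar>1 - (1 - s) * (p - 1) * rho * om\<bar>"
      using s_bounds by (simp add: X_def abs_mult)
    ultimately have "\<bar>X\<bar> \<le> 8 * (1/2) * 1 * \<bar>d * e\<bar> * p"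
      using s_bounds m1 by (simp only:) (intro mult_mono mult_nonneg_nonneg, auto)
    then show ?thesis by (simp add: mult_ac)
  qed
  have Y0: "- (2 * (e\<^sup>2 / u)) \<le> Y"
  proof -
    have "s * (1 - s) * m\<^sup>2 \<le> (1/2) * 1 * 1"
      using s_bounds m2 by (intro mult_mono mult_nonneg_nonneg) auto
    then have "4 * (s * (1 - s) * m\<^sup>2) * (e\<^sup>2 / u) \<le> 2 * (e\<^sup>2 / u)"
      using u by (intro mult_right_mono) auto
    moreover have "0 \<le> a\<^sup>2 * s * (u / z) * 2 * e\<^sup>2" using s_bounds u z by (intro mult_nonneg_nonneg) auto
    ultimately show ?thesis by (simp add: Y_def field_simps)
  qed
  \<comment> \<open>Since \<open>1 + b\<^sup>2 \<le> z\<close>, the power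
    \<open>(1 + b\<^sup>2) powr (- s)\<close> is at least \<open>1 / u\<close>, and the bracket
    costs a factor \<open>q - 1\<close> at worst. The budget \<open>2 + 8 * p\<^sup>2\<close> in
    \<open>K\<close> is spent as 2 on the negative part of \<open>Y\<close> and as
    \<open>8 * p\<^sup>2\<close> on the mixed term through \<open>amgm\<close>.\<close>
  have K0: "(2 + 8 * p\<^sup>2) * (e\<^sup>2 / u) \<le>
    K * q * e\<^sup>2 * ((1 + b\<^sup>2) powr (- s) - (2 - q) * b\<^sup>2 * ((1 + b\<^sup>2) powr (- s) / (1 + b\<^sup>2)))"
  proof -
    have b: "0 < 1 + b\<^sup>2" by (simp add: add_pos_nonneg)
    have "(1 + b\<^sup>2) powr s \<le> u" unfolding u_def using z s_bounds b by (intro powr_mono2) (auto simp: z_def)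
    then have 1: "1 / u \<le> (1 + b\<^sup>2) powr (- s)" using b u
      by (simp add: powr_minus field_simps)
    have "(q - 1) * (1 / u) \<le> (q - 1) * (1 + b\<^sup>2) powr (- s)"
      using 1 q1 by (intro mult_left_mono) auto
    also have "\<dots> \<le> (1 - (2 - q) * (b\<^sup>2 / (1 + b\<^sup>2))) * (1 + b\<^sup>2) powr (- s)"
    proof (rule mult_right_mono)
      have "(2 - q) * (b\<^sup>2 / (1 + b\<^sup>2)) \<le> (2 - q) * 1"
        using q2 b by (intro mult_left_mono) (auto simp: field_simps)
      then show "q - 1 \<le> 1 - (2 - q) * (b\<^sup>2 / (1 + b\<^sup>2))" by simp
    qed simp
    finally have "K * q * e\<^sup>2 * ((q - 1) * (1 / u)) \<le> K * q * e\<^sup>2 * ((1 - (2 - q) * (b\<^sup>2 / (1 + b\<^sup>2))) * (1 + b\<^sup>2) powr (- s))"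
      using K_pos q1 by (intro mult_left_mono) auto
    moreover have "K * q * e\<^sup>2 * ((q - 1) * (1 / u)) = (K * q * (q - 1)) * (e\<^sup>2 / u)" by simp
    ultimately show ?thesis unfolding K_pos(2) by (simp add: algebra_simps)
  qed
  have amgm: "8 * p * \<bar>d * e\<bar> \<le> 2 * d\<^sup>2 * u + 8 * p\<^sup>2 * (e\<^sup>2 / u)"
  proof -
    have "0 \<le> 2 * (\<bar>d\<bar> * sqrt u - 2 * p * (\<bar>e\<bar> / sqrt u))\<^sup>2" by simp
    also have "\<dots> = 2 * d\<^sup>2 * u + 8 * p\<^sup>2 * (e\<^sup>2 / u) - 8 * p * \<bar>d * e\<bar>"
      using u by (simp add: power2_diff power_mult_distrib power_divide abs_mult)
    finally show ?thesis by simp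
  qed
  have "2 * \<bar>d * e\<bar> \<le> 4 * p * \<bar>d * e\<bar>" using p2 by (intro mult_right_mono) auto
  then show ?thesis
    using eq Q0 X0 Y0 K0 amgm unfolding z_def by (simp add: algebra_simps)
qed

text \<open>\<open>g\<close> and \<open>h\<close> are the partial derivatives of \<open>B\<close> at
  \<open>(x, y)\<close>; the inequality is Taylor's formula on the segment with the Hessian bound.
  It is convexity with the surplus \<open>\<bar>d * e\<bar>\<close>.\<close>

lemma B_support:
  "\<exists>g h. \<forall>d e. B x y + g * d + h * e + \<bar>d * e\<bar> \<le> B (x + d) (y + e)"
proof -
  define g where "g = 2 * x * Z x y powr s + x\<^sup>2 * (s * Z x y powr (s - 1) * (2 * (p - 1) * x * (1 + x\<^sup>2) powr (p - 2)))"
  define h where "h = K * (q * y * (1 + y\<^sup>2) powr (- s)) + x\<^sup>2 * (s * Z x y powr (s - 1) * (2 * y))"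
  have "B x y + g * d + h * e + \<bar>d * e\<bar> \<le> B (x + d) (y + e)" for d e
  proof -
    define a b where "a t = x + t * d" and "b t = y + t * e" for t :: real
    \<comment> \<open>The suffixes 1 and 2 mark first and second derivatives in \<open>t\<close>
      along the segment from \<open>(x, y)\<close> to \<open>(x + d, y + e)\<close>.\<close>
    define W W1 W2 where "W t = (1 + (a t)\<^sup>2) powr (p - 1)"
      and "W1 t = 2 * (p - 1) * d * a t * (1 + (a t)\<^sup>2) powr (p - 2)"
      and "W2 t = 2 * (p - 1) * d\<^sup>2 * ((1 + (a t)\<^sup>2) powr (p - 2) + 2 * (p - 2) * (a t)\<^sup>2 * (1 + (a t)\<^sup>2) powr (p - 3))" for t
    define z z1 z2 where "z t = Z (a t) (b t)" and "z1 t = 2 * b t * e + W1 t" and "z2 t = 2 * e\<^sup>2 + W2 t" for t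
    define f where "f t = K * (1 + (b t)\<^sup>2) powr (q / 2) + (a t)\<^sup>2 * z t powr s" for t
    define f1 where "f1 t = K * (q * e * b t * (1 + (b t)\<^sup>2) powr (- s)) + (2 * a t * d * z t powr s + (a t)\<^sup>2 * (s * z t powr (s - 1) * z1 t))" for t
    define f2 where "f2 t = K * (q * e\<^sup>2 * ((1 + (b t)\<^sup>2) powr (- s) - (2 - q) * (b t)\<^sup>2 * (1 + (b t)\<^sup>2) powr (- s - 1)))
      + (2 * d\<^sup>2 * z t powr s + 4 * a t * d * (s * z t powr (s - 1) * z1 t) + (a t)\<^sup>2 * (s * z t powr (s - 1) * z2 t)
        + (a t)\<^sup>2 * (s * ((s - 1) * z t powr (s - 2) * z1 t) * z1 t))" for t
    have pos: "0 < 1 + v\<^sup>2" for v :: real by (simp add: add_pos_nonneg)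
    have zpos: "0 < z t" for t using Z_ge by (simp add: z_def)
    have da [derivative_intros]: "(a has_real_derivative d) (at t)" "(b has_real_derivative e) (at t)" for t
      unfolding a_def b_def by (auto intro!: derivative_eq_intros)
    have dR: "((\<lambda>t. 1 + (a t)\<^sup>2) has_real_derivative 2 * a t * d) (at t)"
      "((\<lambda>t. 1 + (b t)\<^sup>2) has_real_derivative 2 * b t * e) (at t)" for t
      by (auto intro!: derivative_eq_intros)
    have dRp: "((\<lambda>t. (1 + (a t)\<^sup>2) powr r) has_real_derivative r * (1 + (a t)\<^sup>2) powr (r - 1) * (2 * a t * d)) (at t)"
      "((\<lambda>t. (1 + (b t)\<^sup>2) powr r) has_real_derivative r * (1 + (b t)\<^sup>2) powr (r - 1) * (2 * b t * e)) (at t)" for t r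
      using DERIV_fun_powr[OF dR(1) pos, of r] DERIV_fun_powr[OF dR(2) pos, of r] by simp_all
    have dW: "(W has_real_derivative W1 t) (at t)" for t
      unfolding W_def W1_def by (rule DERIV_cong[OF dRp(1)]) (simp add: algebra_simps)
    have dW1: "(W1 has_real_derivative W2 t) (at t)" for t
      unfolding W1_def W2_def
      by (rule dRp da derivative_eq_intros refl)+ (simp add: algebra_simps power2_eq_square)
    have dz: "(z has_real_derivative z1 t) (at t)" for t
      unfolding z_def Z_def z1_def W_def[symmetric]
      by (rule derivative_eq_intros dW da refl)+ simp
    have dz1: "(z1 has_real_derivative z2 t) (at t)" for t
      unfolding z1_def z2_def by (rule derivative_eq_intros dW1 da refl)+ (simp add: power2_eq_square)
    have dzp: "((\<lambda>t. z t powr r) has_real_derivative r * z t powr (r - 1) * z1 t) (at t)" for t r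
      using DERIV_fun_powr[OF dz zpos, of r] by simp
    have q_eq: "2 - q = 2 * s" by (simp add: s_def)
    have df: "(f has_real_derivative f1 t) (at t)" for t
      unfolding f_def f1_def
      by (rule dzp dRp da derivative_eq_intros refl)+ (simp add: s_bounds algebra_simps)
    have df1: "(f1 has_real_derivative f2 t) (at t)" for t
      unfolding f1_def f2_def
      by (rule dzp dRp da derivative_eq_intros dz1 refl)+ (simp add: q_eq algebra_simps power2_eq_square)
    have "2 * \<bar>d * e\<bar> \<le> f2 t" for t
    proof -
      have r: "v powr (r - 1) = v powr r / v" "v powr (r - 2) = v powr r / v\<^sup>2" if "0 < v" for v r :: real
        using that by (simp_all add: powr_diff)
      have id: "K * (q * e\<^sup>2 * (A0 - (2 - q) * v * A1)) + (2 * d\<^sup>2 * u0 + 4 * a' * d * (s * u1 * y1) + v' * (s * u1 * y2) + v' * (s * ((s - 1) * u2 * y1) * y1))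
        = K * q * e\<^sup>2 * (A0 - (2 - q) * v * A1) + 2 * d\<^sup>2 * u0 + 4 * a' * d * s * u1 * y1 + v' * s * u1 * y2 - v' * s * (1 - s) * u2 * y1\<^sup>2"
        for A0 A1 v v' a' u0 u1 u2 y1 y2 :: real
        by (simp add: algebra_simps power2_eq_square)
      have r3: "v powr (p - 2) = v powr (p - 1) / v" "v powr (p - 3) = v powr (p - 1) / v\<^sup>2" if "0 < v" for v :: real
        using r[OF that, of "p - 1"] by simp_all
      show ?thesis
        using hessian_lower[where d=d and e=e and a="a t" and b="b t"]
        unfolding f2_def z1_def z2_def W1_def W2_def z_def r[OF Z_ge(3), of _ _ s] r(1)[OF pos, of _ "- s"] r3[OF pos]
        by (simp only: id)
    qed
    then have "f 0 + f1 0 + \<bar>d * e\<bar> \<le> f 1"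
      using taylor_lower[OF df df1, of "\<bar>d * e\<bar>"] by simp
    moreover have "f 0 = B x y" "f 1 = B (x + d) (y + e)"
      by (simp_all add: f_def a_def b_def z_def B_def)
    moreover have "f1 0 = g * d + h * e"
      by (simp add: f1_def g_def h_def a_def b_def z_def z1_def W1_def algebra_simps)
    ultimately show ?thesis by simp
  qed
  then show ?thesis by blast
qed

end

section \<open>Riesz transforms\<close>

text \<open>The three lattice-symmetric directions \<open>dir\<close> are used because the Laplacian is \<open>2 / 3\<close>
  times the sum of the second derivatives along them; \<open>avg\<close> is the symbol of the random walk with
  steps \<open>h\<close> in these directions.\<close>
definition freq :: "nat \<Rightarrow> int \<times> int \<Rightarrow> real" where
  "freq j k = (if j = 0 then of_int (fst k) else if j = 1 then of_int (snd k) else of_int (fst k - snd k))"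

definition dir :: "nat \<Rightarrow> real^2" where
  "dir j = (if j = 0 then pt 1 0 else if j = 1 then pt 0 1 else pt 1 (- 1))"

definition freq_sum :: "int \<times> int \<Rightarrow> real" where
  "freq_sum k = (\<Sum>j<3. (freq j k)\<^sup>2)"

definition avg :: "real \<Rightarrow> int \<times> int \<Rightarrow> real" where
  "avg h k = (\<Sum>j<3. cos (h * freq j k)) / 3"

lemma ph_dir: "ph k (dir j) = freq j k"
  by (simp add: dir_def freq_def)

lemma freq_minus [simp]: "freq j (- k) = - freq j k"
  by (simp add: freq_def)

lemma freq_zero [simp]: "freq j 0 = 0"
  by (simp add: freq_def)

lemma avg_minus [simp]: "avg h (- k) = avg h k"
  by (simp add: avg_def)

lemma freq_sum_minus [simp]: "freq_sum (- k) = freq_sum k"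
  by (simp add: freq_sum_def)

lemma freq_sum_eq: "freq_sum k = (freq 0 k)\<^sup>2 + (freq 1 k)\<^sup>2 + (freq 2 k)\<^sup>2"
  by (simp add: freq_sum_def eval_nat_numeral)

lemma freq_sum_pos: "k \<noteq> 0 \<Longrightarrow> 0 < freq_sum k"
proof -
  assume "k \<noteq> 0"
  then consider "freq 0 k \<noteq> 0" | "freq 1 k \<noteq> 0" by (auto simp: freq_def prod_eq_iff)
  then show ?thesis
  proof cases
    case 1
    then have "0 < (freq 0 k)\<^sup>2" by simp
    then show ?thesis unfolding freq_sum_eq by (intro add_pos_nonneg) auto
  next
    case 2
    then have "0 < (freq 1 k)\<^sup>2" by simp
    then show ?thesis unfolding freq_sum_eq by (intro add_pos_nonneg add_nonneg_pos) auto
  qed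
qed

lemma mode_sum_shift: "(mode k c (x + a) + mode k c (x - a)) / 2 = mode k (of_real (cos (ph k a)) * c) x"
proof -
  have "mode k c (x - a) = mode k (cis (ph k (- a)) * c) x"
    using mode_shift[of k c x "- a"] by simp
  then have "(mode k c (x + a) + mode k c (x - a)) / 2 = mode k (of_real (1/2) * (cis (ph k a) * c + cis (ph k (- a)) * c)) x"
    unfolding mode_scale mode_add mode_shift by simp
  also have "of_real (1/2) * (cis (ph k a) * c + cis (ph k (- a)) * c) = of_real (cos (ph k a)) * c"
    by (simp add: complex_eq_iff field_simps)
  finally show ?thesis .
qed

lemma mode_diff_shift: "(mode k c (x + a) - mode k c (x - a)) / 2 = mode k (\<i> * of_real (sin (ph k a)) * c) x"
proof -
  have "mode k c (x - a) = mode k (cis (ph k (- a)) * c) x"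
    using mode_shift[of k c x "- a"] by simp
  then have "(mode k c (x + a) - mode k c (x - a)) / 2 = mode k (of_real (1/2) * (cis (ph k a) * c + of_real (- 1) * (cis (ph k (- a)) * c))) x"
    unfolding mode_scale mode_add mode_shift by simp
  also have "of_real (1/2) * (cis (ph k a) * c + of_real (- 1) * (cis (ph k (- a)) * c)) = \<i> * of_real (sin (ph k a)) * c"
    by (simp add: complex_eq_iff field_simps)
  finally show ?thesis .
qed

lemma T_mult: "fin c \<Longrightarrow> T (\<lambda>k. m k * c k) x = (\<Sum>k | c k \<noteq> 0. mode k (m k * c k) x)"
  by (rule T_on) (auto simp: fin_def)

lemma T_sum_shift:
  assumes "fin c" shows "(T c (x + a) + T c (x - a)) / 2 = T (\<lambda>k. of_real (cos (ph k a)) * c k) x"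
  unfolding T_mult[OF assms] mode_sum_shift[symmetric]
  by (simp add: T_def sum.distrib sum_divide_distrib add_divide_distrib)

lemma T_diff_shift:
  assumes "fin c" shows "(T c (x + a) - T c (x - a)) / 2 = T (\<lambda>k. \<i> * of_real (sin (ph k a)) * c k) x"
  unfolding T_mult[OF assms] mode_diff_shift[symmetric]
  by (simp add: T_def sum_subtractf sum_divide_distrib diff_divide_distrib)

lemma T_avg:
  assumes "fin c"
  shows "T (\<lambda>k. of_real (avg h k) * c k) x = (\<Sum>j<3. (T c (x + h *\<^sub>R dir j) + T c (x - h *\<^sub>R dir j)) / 2) / 3"
proof -
  have "of_real (avg h k) * c k = of_real (1/3) * (of_real (cos (h * freq 0 k)) * c k + of_real (cos (h * freq 1 k)) * c k + of_real (cos (h * freq 2 k)) * c k)" for k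
    by (simp add: avg_def eval_nat_numeral algebra_simps)
  then have "T (\<lambda>k. of_real (avg h k) * c k) x = (1/3) * (T (\<lambda>k. of_real (cos (h * freq 0 k)) * c k) x + T (\<lambda>k. of_real (cos (h * freq 1 k)) * c k) x + T (\<lambda>k. of_real (cos (h * freq 2 k)) * c k) x)"
    using assms by (simp only:) ((subst T_scale T_add; (intro fin_add fin_mult assms)?)+, rule refl)
  then show ?thesis
    unfolding T_sum_shift[OF assms] by (simp add: eval_nat_numeral ph_dir)
qed

text \<open>The multiplier enters through finitely many numbers \<open>m k\<close>, so limits of
  multipliers reduce to termwise limits in a finite sum.\<close>

lemma integral_T_linear:
  assumes "fin c" and that: "cper g"
  shows "(\<integral>x. T (\<lambda>k. of_real (m k) * c k) x * g x \<partial>torus) = (\<Sum>k | c k \<noteq> 0. m k * (\<integral>x. mode k (c k) x * g x \<partial>torus))"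
proof -
  have "(\<lambda>x. T (\<lambda>k. of_real (m k) * c k) x * g x) = (\<lambda>x. \<Sum>k | c k \<noteq> 0. m k * (mode k (c k) x * g x))"
    by (rule ext) (simp add: T_mult[OF assms(1)] mode_scale sum_distrib_right mult.assoc)
  then show ?thesis
    using that by (simp add: Bochner_Integration.integral_sum cper_mult)
qed

context bellman_exponents
begin

text \<open>The linear terms of the supporting plane cancel between the increments
  \<open>(d, e)\<close> and \<open>(- d, - e)\<close>.\<close>

lemma bellman_pair: "2 * B a b + 2 * \<bar>d * e\<bar> \<le> B (a + d) (b + e) + B (a - d) (b - e)"
proof -
  obtain g h where gh: "\<And>d e. B a b + g * d + h * e + \<bar>d * e\<bar> \<le> B (a + d) (b + e)"
    using B_support by blast
  show ?thesis using gh[of d e] gh[of "- d" "- e"] by simp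
qed

lemma bellman_jensen: "B ((\<Sum>j<3. a j) / 3) ((\<Sum>j<3. b j) / 3) \<le> (\<Sum>j<3. B (a j) (b j)) / 3" for a b :: "nat \<Rightarrow> real"
proof -
  let ?a = "(\<Sum>j<3. a j) / 3" and ?b = "(\<Sum>j<3. b j) / 3"
  obtain g h where gh: "\<And>d e. B ?a ?b + g * d + h * e + \<bar>d * e\<bar> \<le> B (?a + d) (?b + e)"
    using B_support by blast
  have "B ?a ?b + g * (a j - ?a) + h * (b j - ?b) \<le> B (a j) (b j)" for j
    using gh[of "a j - ?a" "b j - ?b"] by simp
  then have "(\<Sum>j<3. B ?a ?b + g * (a j - ?a) + h * (b j - ?b)) \<le> (\<Sum>j<3. B (a j) (b j))"
    by (intro sum_mono)
  moreover have "(\<Sum>j<3. B ?a ?b + g * (a j - ?a) + h * (b j - ?b)) = 3 * B ?a ?b"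
    by (simp add: eval_nat_numeral field_simps)
  ultimately show ?thesis by simp
qed

lemma cper_B [intro]: "cper f \<Longrightarrow> cper g \<Longrightarrow> cper (\<lambda>x. B (f x) (g x))"
  by (rule cper_compose2[OF _ _ continuous_B])

text \<open>The integral of \<open>B\<close> decreases along the random walk, and the decrease pays for the product
  of the increments.\<close>
lemma bellman_step:
  assumes c: "fin c" and d: "fin d"
  shows "(\<integral>x. B (T (\<lambda>k. of_real (avg h k) * c k) x) (T (\<lambda>k. of_real (avg h k) * d k) x) \<partial>torus)
    + (\<Sum>j<3. \<integral>x. \<bar>T (\<lambda>k. \<i> * of_real (sin (h * freq j k)) * c k) x * T (\<lambda>k. \<i> * of_real (sin (h * freq j k)) * d k) x\<bar> \<partial>torus) / 3
    \<le> (\<integral>x. B (T c x) (T d x) \<partial>torus)"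
proof -
  define u where "u j x = T (\<lambda>k. of_real (cos (h * freq j k)) * c k) x" for j x
  define v where "v j x = T (\<lambda>k. of_real (cos (h * freq j k)) * d k) x" for j x
  define U where "U j x = T (\<lambda>k. \<i> * of_real (sin (h * freq j k)) * c k) x" for j x
  define V where "V j x = T (\<lambda>k. \<i> * of_real (sin (h * freq j k)) * d k) x" for j x
  have uU: "T c (x + h *\<^sub>R dir j) = u j x + U j x" "T c (x - h *\<^sub>R dir j) = u j x - U j x"
    and vV: "T d (x + h *\<^sub>R dir j) = v j x + V j x" "T d (x - h *\<^sub>R dir j) = v j x - V j x" for j x
    using T_sum_shift[OF c, of x "h *\<^sub>R dir j"] T_diff_shift[OF c, of x "h *\<^sub>R dir j"]
      T_sum_shift[OF d, of x "h *\<^sub>R dir j"] T_diff_shift[OF d, of x "h *\<^sub>R dir j"]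
    by (simp_all add: u_def U_def v_def V_def ph_dir)
  let ?F = "\<lambda>x. B (T c x) (T d x)"
  have F: "cper ?F" by auto
  have cp: "cper (u j)" "cper (v j)" "cper (U j)" "cper (V j)" for j
    unfolding u_def v_def U_def V_def by auto
  have pt: "B (T (\<lambda>k. of_real (avg h k) * c k) x) (T (\<lambda>k. of_real (avg h k) * d k) x)
     \<le> (\<Sum>j<3. (?F (x + h *\<^sub>R dir j) + ?F (x + - (h *\<^sub>R dir j))) / 2 - \<bar>U j x * V j x\<bar>) / 3" for x
  proof -
    have "B (T (\<lambda>k. of_real (avg h k) * c k) x) (T (\<lambda>k. of_real (avg h k) * d k) x) = B ((\<Sum>j<3. u j x) / 3) ((\<Sum>j<3. v j x) / 3)"
      unfolding T_avg[OF c] T_avg[OF d] uU vV by simp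
    also have "\<dots> \<le> (\<Sum>j<3. B (u j x) (v j x)) / 3" by (rule bellman_jensen)
    also have "\<dots> \<le> (\<Sum>j<3. (?F (x + h *\<^sub>R dir j) + ?F (x + - (h *\<^sub>R dir j))) / 2 - \<bar>U j x * V j x\<bar>) / 3"
    proof (intro divide_right_mono sum_mono)
      fix j
      show "B (u j x) (v j x) \<le> (?F (x + h *\<^sub>R dir j) + ?F (x + - (h *\<^sub>R dir j))) / 2 - \<bar>U j x * V j x\<bar>"
      proof -
        have "?F (x + h *\<^sub>R dir j) = B (u j x + U j x) (v j x + V j x)"
          "?F (x + - (h *\<^sub>R dir j)) = B (u j x - U j x) (v j x - V j x)"
          using uU vV by simp_all
        moreover have "b \<le> (X + Y) / 2 - m" if "2 * b + 2 * m \<le> X + Y" for b m X Y :: real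
          using that by (simp add: field_simps)
        ultimately show ?thesis using bellman_pair[of "u j x" "v j x" "U j x" "V j x"] by presburger
      qed
    qed simp
    finally show ?thesis .
  qed
  have "(\<integral>x. B (T (\<lambda>k. of_real (avg h k) * c k) x) (T (\<lambda>k. of_real (avg h k) * d k) x) \<partial>torus)
     \<le> (\<integral>x. (\<Sum>j<3. (?F (x + h *\<^sub>R dir j) + ?F (x + - (h *\<^sub>R dir j))) / 2 - \<bar>U j x * V j x\<bar>) / 3 \<partial>torus)"
    by (rule integral_mono[OF _ _ pt])
      (intro cper_integrable cper_B cper_T cper_divide cper_sum cper_diff cper_add cper_shift[OF F] cper_abs cper_mult cp)+
  also have "\<dots> = (\<Sum>j<3. (\<integral>x. ?F x \<partial>torus) - (\<integral>x. \<bar>U j x * V j x\<bar> \<partial>torus)) / 3"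
  proof -
    have "(\<integral>x. (?F (x + h *\<^sub>R dir j) + ?F (x + - (h *\<^sub>R dir j))) / 2 - \<bar>U j x * V j x\<bar> \<partial>torus)
        = (\<integral>x. ?F x \<partial>torus) - (\<integral>x. \<bar>U j x * V j x\<bar> \<partial>torus)" for j
    proof -
      have 1: "integrable torus (\<lambda>x. ?F (x + a))" for a by (intro cper_integrable cper_shift[OF F])
      have 2: "integrable torus (\<lambda>x. \<bar>U j x * V j x\<bar>)" by (intro cper_integrable cper_abs cper_mult cp)
      have "(\<integral>x. (?F (x + h *\<^sub>R dir j) + ?F (x + - (h *\<^sub>R dir j))) / 2 - \<bar>U j x * V j x\<bar> \<partial>torus)
        = ((\<integral>x. ?F (x + h *\<^sub>R dir j) \<partial>torus) + (\<integral>x. ?F (x + - (h *\<^sub>R dir j)) \<partial>torus)) / 2 - (\<integral>x. \<bar>U j x * V j x\<bar> \<partial>torus)"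
        using 1 2 by (subst Bochner_Integration.integral_diff) (auto simp del: add_uminus_conv_diff)
      also have "\<dots> = (\<integral>x. ?F x \<partial>torus) - (\<integral>x. \<bar>U j x * V j x\<bar> \<partial>torus)"
        unfolding integral_translation[OF F] by simp
      finally show ?thesis .
    qed
    moreover have "integrable torus (\<lambda>x. (?F (x + h *\<^sub>R dir j) + ?F (x + - (h *\<^sub>R dir j))) / 2 - \<bar>U j x * V j x\<bar>)" for j
      by (intro cper_integrable cper_divide cper_diff cper_add cper_shift[OF F] cper_abs cper_mult cp)
    ultimately show ?thesis
      unfolding integral_divide_zero by (subst Bochner_Integration.integral_sum) auto
  qed
  also have "\<dots> = (\<integral>x. ?F x \<partial>torus) - (\<Sum>j<3. \<integral>x. \<bar>U j x * V j x\<bar> \<partial>torus) / 3"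
    by (simp add: sum_subtractf diff_divide_distrib)
  finally show ?thesis unfolding U_def V_def by simp
qed

text \<open>\<open>bellman_step\<close> is applied to the \<open>n\<close>-fold averages of both
  functions. The integrals \<open>E n\<close> telescope, and they are nonnegative because
  \<open>B\<close> is. In \<open>D n j\<close> each function contributes \<open>avg h k ^ n\<close>,
  whence the terms of a geometric series in \<open>(avg h k)\<^sup>2\<close>.\<close>

lemma bellman_sum:
  assumes c: "fin c" and d: "fin d" and j: "j < 3"
  shows "\<bar>\<Sum>k | c k \<noteq> 0. (\<Sum>n<N. (sin (h * freq j k))\<^sup>2 * ((avg h k)\<^sup>2) ^ n) * (\<integral>x. mode k (c k) x * T d x \<partial>torus)\<bar>
    \<le> 3 * (\<integral>x. B (T c x) (T d x) \<partial>torus)"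
proof -
  define cn where "cn n k = of_real (avg h k ^ n) * c k" for n k
  define dn where "dn n k = of_real (avg h k ^ n) * d k" for n k
  have fin: "fin (cn n)" "fin (dn n)" for n unfolding cn_def dn_def using c d by auto
  define E where "E n = (\<integral>x. B (T (cn n) x) (T (dn n) x) \<partial>torus)" for n
  define D where "D n i = (\<integral>x. T (\<lambda>k. \<i> * of_real (sin (h * freq i k)) * cn n k) x * T (\<lambda>k. \<i> * of_real (sin (h * freq i k)) * dn n k) x \<partial>torus)" for n i
  have step: "\<bar>D n j\<bar> \<le> 3 * (E n - E (Suc n))" for n
  proof -
    have s: "(\<lambda>k. of_real (avg h k) * cn n k) = cn (Suc n)" "(\<lambda>k. of_real (avg h k) * dn n k) = dn (Suc n)"
      by (auto simp: cn_def dn_def)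
    let ?A = "\<lambda>i. \<integral>x. \<bar>T (\<lambda>k. \<i> * of_real (sin (h * freq i k)) * cn n k) x * T (\<lambda>k. \<i> * of_real (sin (h * freq i k)) * dn n k) x\<bar> \<partial>torus"
    have "E (Suc n) + (\<Sum>i<3. ?A i) / 3 \<le> E n"
      using bellman_step[OF fin(1)[of n] fin(2)[of n], of h] unfolding s E_def .
    moreover have "?A j \<le> (\<Sum>i<3. ?A i)"
      using j by (intro member_le_sum) auto
    moreover have "\<bar>D n j\<bar> \<le> ?A j" unfolding D_def by (rule integral_abs_bound)
    ultimately show ?thesis by simp
  qed
  have D: "D n j = (\<integral>x. T (\<lambda>k. of_real ((sin (h * freq j k))\<^sup>2 * ((avg h k)\<^sup>2) ^ n) * c k) x * T d x \<partial>torus)" for n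
  proof -
    have "D n j = (\<integral>x. T (\<lambda>k. of_real ((sin (h * freq j k))\<^sup>2) * cn n k) x * T (dn n) x \<partial>torus)"
      unfolding D_def by (rule integral_T_odd[OF fin]) simp
    also have "\<dots> = (\<integral>x. T (\<lambda>k. of_real (avg h k ^ n) * (of_real ((sin (h * freq j k))\<^sup>2) * cn n k)) x * T d x \<partial>torus)"
      unfolding dn_def by (rule integral_T_even[symmetric]) (use fin d in auto)
    also have "(\<lambda>k. of_real (avg h k ^ n) * (of_real ((sin (h * freq j k))\<^sup>2) * cn n k)) = (\<lambda>k. of_real ((sin (h * freq j k))\<^sup>2 * ((avg h k)\<^sup>2) ^ n) * c k)"
      by (rule ext) (simp add: cn_def power2_eq_square power_mult_distrib)
    finally show ?thesis .
  qed
  have "(\<Sum>k | c k \<noteq> 0. (\<Sum>n<N. (sin (h * freq j k))\<^sup>2 * ((avg h k)\<^sup>2) ^ n) * (\<integral>x. mode k (c k) x * T d x \<partial>torus)) = (\<Sum>n<N. D n j)"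
    unfolding D integral_T_linear[OF c cper_T] sum_distrib_right by (rule sum.swap)
  also have "\<bar>\<dots>\<bar> \<le> (\<Sum>n<N. \<bar>D n j\<bar>)" by (rule sum_abs)
  also have "\<dots> \<le> (\<Sum>n<N. 3 * (E n - E (Suc n)))" by (intro sum_mono step)
  also have "\<dots> = 3 * (E 0 - E N)" by (induction N) (simp_all add: algebra_simps)
  also have "\<dots> \<le> 3 * E 0" unfolding E_def by (simp add: integral_nonneg_AE B_nonneg)
  also have "E 0 = (\<integral>x. B (T c x) (T d x) \<partial>torus)" 
  proof -
    have "cn 0 = c" "dn 0 = d" by (auto simp: cn_def dn_def)
    then show ?thesis by (simp add: E_def)
  qed
  finally show ?thesis .
qed

end

lemma sin_div_limit: "((\<lambda>h. sin (h * a) / h) \<longlongrightarrow> a) (at (0::real))"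
proof -
  have "((\<lambda>h. sin (h * a)) has_real_derivative a) (at 0)"
    by (auto intro!: derivative_eq_intros)
  then show ?thesis by (simp add: DERIV_def)
qed

text \<open>The factor \<open>1 + avg h k\<close> tends to 2, and \<open>1 - avg h k\<close> is a
  mean of \<open>2 * sin\<^sup>2\<close> of half angles. In the limit the walk generates a multiple
  of the Laplacian.\<close>

lemma avg_limit: "((\<lambda>h. (1 - (avg h k)\<^sup>2) / h\<^sup>2) \<longlongrightarrow> freq_sum k / 3) (at 0)"
proof -
  have c: "1 - cos (h * a) = 2 * (sin (h * (a / 2)))\<^sup>2" for h a :: real
    using cos_double_sin[of "h * a / 2"] by simp
  have e: "(1 - (avg h k)\<^sup>2) / h\<^sup>2 = (1 + avg h k) * ((\<Sum>j<3. 2 * (sin (h * (freq j k / 2)) / h)\<^sup>2) / 3)" for h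
  proof -
    have "(1 - (avg h k)\<^sup>2) / h\<^sup>2 = (1 + avg h k) * ((1 - avg h k) / h\<^sup>2)"
      by (simp add: power2_eq_square algebra_simps)
    also have "(1 - avg h k) / h\<^sup>2 = (\<Sum>j<3. 2 * (sin (h * (freq j k / 2)) / h)\<^sup>2) / 3"
    proof -
      have "1 - avg h k = (\<Sum>j<3. 1 - cos (h * freq j k)) / 3"
        by (simp add: avg_def eval_nat_numeral field_simps)
      then show ?thesis
        unfolding c by (simp add: sum_divide_distrib power_divide mult.commute)
    qed
    finally show ?thesis .
  qed
  have "(\<lambda>h. avg h k) \<midarrow>0\<rightarrow> (\<Sum>j<3. cos (0 * freq j k)) / 3"
    unfolding avg_def by (intro tendsto_intros) simp
  then have "(\<lambda>h. avg h k) \<midarrow>0\<rightarrow> 1" by simp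
  then have "((\<lambda>h. (1 - (avg h k)\<^sup>2) / h\<^sup>2) \<longlongrightarrow> (1 + 1) * ((\<Sum>j<3. 2 * (freq j k / 2)\<^sup>2) / 3)) (at 0)"
    unfolding e by (intro tendsto_intros sin_div_limit) auto
  moreover have "(1 + 1) * ((\<Sum>j<3. 2 * (freq j k / 2)\<^sup>2) / 3) = freq_sum k / 3"
    by (simp add: freq_sum_def sum_distrib_left power_divide field_simps sum_divide_distrib)
  ultimately show ?thesis by simp
qed

context bellman_exponents
begin

text \<open>Summing over all steps of the walk gives the multiplier \<open>(sin (h * freq j k))\<^sup>2 / (1 - (avg h k)\<^sup>2)\<close>,
  which tends to \<open>3 * (freq j k)\<^sup>2 / freq_sum k\<close> as \<open>h\<close> tends to \<open>0\<close>.\<close>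
lemma riesz_bellman:
  assumes c: "fin c" and d: "fin d" and j: "j < 3"
  shows "\<bar>\<integral>x. T (\<lambda>k. of_real ((freq j k)\<^sup>2 / freq_sum k) * c k) x * T d x \<partial>torus\<bar> \<le> (\<integral>x. B (T c x) (T d x) \<partial>torus)"
proof -
  define b where "b k = (\<integral>x. mode k (c k) x * T d x \<partial>torus)" for k
  let ?S = "{k. c k \<noteq> 0}"
  have S: "finite ?S" using c by (simp add: fin_def)
  have lim0: "((\<lambda>h. (sin (h * freq j k))\<^sup>2 / (1 - (avg h k)\<^sup>2)) \<longlongrightarrow> 3 * ((freq j k)\<^sup>2 / freq_sum k)) (at 0)" for k
  \<comment> \<open>At \<open>k = 0\<close> both quotients are \<open>0 / 0\<close>, which is 0 by
    convention.\<close>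
  proof (cases "k = 0")
    case False
    have "((\<lambda>h. (sin (h * freq j k) / h)\<^sup>2 / ((1 - (avg h k)\<^sup>2) / h\<^sup>2)) \<longlongrightarrow> (freq j k)\<^sup>2 / (freq_sum k / 3)) (at 0)"
      using freq_sum_pos[OF False] by (intro tendsto_intros sin_div_limit avg_limit) auto
    moreover have "\<forall>\<^sub>F h in at 0. (sin (h * freq j k) / h)\<^sup>2 / ((1 - (avg h k)\<^sup>2) / h\<^sup>2) = (sin (h * freq j k))\<^sup>2 / (1 - (avg h k)\<^sup>2)"
      by (rule eventually_mono[OF eventually_neq_at_within[of 0]]) (simp add: power_divide)
    ultimately show ?thesis by (simp add: filterlim_cong mult.commute Lim_transform_eventually)
  qed simp
  \<comment> \<open>For small \<open>h\<close> the geometric series converges at each of the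
    finitely many nonzero frequencies of \<open>c\<close>.\<close>
  have ev: "\<forall>\<^sub>F h in at 0. \<forall>k\<in>?S. k \<noteq> 0 \<longrightarrow> (avg h k)\<^sup>2 < 1"
  proof (intro eventually_ball_finite S ballI)
    fix k
    show "\<forall>\<^sub>F h in at 0. k \<noteq> 0 \<longrightarrow> (avg h k)\<^sup>2 < 1"
    proof (cases "k = 0")
      case False
      have "\<forall>\<^sub>F h in at 0. 0 < (1 - (avg h k)\<^sup>2) / h\<^sup>2"
        using freq_sum_pos[OF False] by (intro order_tendstoD[OF avg_limit]) simp
      then show ?thesis by (rule eventually_mono) (auto simp: zero_less_divide_iff)
    qed simp
  qed
  have "\<forall>\<^sub>F h in at 0. \<bar>\<Sum>k\<in>?S. (sin (h * freq j k))\<^sup>2 / (1 - (avg h k)\<^sup>2) * b k\<bar> \<le> 3 * (\<integral>x. B (T c x) (T d x) \<partial>torus)"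
    using ev
  proof (rule eventually_mono)
    fix h assume h: "\<forall>k\<in>?S. k \<noteq> 0 \<longrightarrow> (avg h k)\<^sup>2 < 1"
    have l: "(\<lambda>N. \<Sum>n<N. (sin (h * freq j k))\<^sup>2 * ((avg h k)\<^sup>2) ^ n) \<longlonglongrightarrow> (sin (h * freq j k))\<^sup>2 / (1 - (avg h k)\<^sup>2)" if "k \<in> ?S" for k
    proof (cases "k = 0")
      case False
      then have "(\<lambda>n. ((avg h k)\<^sup>2) ^ n) sums (1 / (1 - (avg h k)\<^sup>2))"
      proof (intro geometric_sums)
        have "(avg h k)\<^sup>2 < 1" using h that False by blast
        then show "norm ((avg h k)\<^sup>2) < 1" by simp
      qed
      from sums_mult[OF this, of "(sin (h * freq j k))\<^sup>2"] show ?thesis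
        by (simp add: sums_def)
    qed simp
    have "(\<lambda>N. \<bar>\<Sum>k\<in>?S. (\<Sum>n<N. (sin (h * freq j k))\<^sup>2 * ((avg h k)\<^sup>2) ^ n) * b k\<bar>) \<longlonglongrightarrow> \<bar>\<Sum>k\<in>?S. (sin (h * freq j k))\<^sup>2 / (1 - (avg h k)\<^sup>2) * b k\<bar>"
      by (intro tendsto_intros l)
    then show "\<bar>\<Sum>k\<in>?S. (sin (h * freq j k))\<^sup>2 / (1 - (avg h k)\<^sup>2) * b k\<bar> \<le> 3 * (\<integral>x. B (T c x) (T d x) \<partial>torus)"
      by (rule LIMSEQ_le_const2) (use bellman_sum[OF c d j] in \<open>auto simp: b_def\<close>)
  qed
  moreover have "((\<lambda>h. \<bar>\<Sum>k\<in>?S. (sin (h * freq j k))\<^sup>2 / (1 - (avg h k)\<^sup>2) * b k\<bar>) \<longlongrightarrow> \<bar>\<Sum>k\<in>?S. 3 * ((freq j k)\<^sup>2 / freq_sum k) * b k\<bar>) (at 0)"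
    by (intro tendsto_intros lim0)
  ultimately have "\<bar>\<Sum>k\<in>?S. 3 * ((freq j k)\<^sup>2 / freq_sum k) * b k\<bar> \<le> 3 * (\<integral>x. B (T c x) (T d x) \<partial>torus)"
    by (intro tendsto_upperbound[rotated]) auto
  moreover have "(\<Sum>k\<in>?S. 3 * ((freq j k)\<^sup>2 / freq_sum k) * b k) = 3 * (\<integral>x. T (\<lambda>k. of_real ((freq j k)\<^sup>2 / freq_sum k) * c k) x * T d x \<partial>torus)"
    unfolding integral_T_linear[OF c cper_T] b_def by (simp add: sum_distrib_left mult_ac)
  ultimately show ?thesis by (simp add: abs_mult)
qed

end

definition Ip :: "real \<Rightarrow> (real^2 \<Rightarrow> real) \<Rightarrow> real" where
  "Ip p f = (\<integral>x. \<bar>f x\<bar> powr p \<partial>torus)"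

lemma Ip_nonneg [simp]: "0 \<le> Ip p f"
  by (simp add: Ip_def)

text \<open>The Bellman function is built for \<open>2 \<le> p\<close>. One of two conjugate
  exponents is at least 2; in the other case self-adjointness moves the multiplier to the second
  function. The term \<open>vol\<close> stems from the 1 in \<open>B_upper\<close> and is absorbed
  later by scaling.\<close>

lemma riesz_bilinear:
  fixes p q :: real
  assumes "1 < p" "1 < q" and pq: "(p - 1) * (q - 1) = 1" and j: "j < 3"
  shows "\<exists>C>0. \<forall>c d. fin c \<longrightarrow> fin d \<longrightarrow>
    \<bar>\<integral>x. T (\<lambda>k. of_real ((freq j k)\<^sup>2 / freq_sum k) * c k) x * T d x \<partial>torus\<bar> \<le> C * (vol + Ip p (T c) + Ip q (T d))"
proof -
  have main: "\<exists>C>0. \<forall>c d. fin c \<longrightarrow> fin d \<longrightarrow>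
    \<bar>\<integral>x. T (\<lambda>k. of_real ((freq j k)\<^sup>2 / freq_sum k) * c k) x * T d x \<partial>torus\<bar> \<le> C * (vol + Ip p (T c) + Ip q (T d))"
    if "2 \<le> p" "1 < q" "(p - 1) * (q - 1) = 1" for p q :: real
  proof -
    interpret bellman_exponents p q "(2 - q) / 2" "(2 + 8 * p\<^sup>2) / (q * (q - 1))"
      by unfold_locales (use that in auto)
    obtain C where C: "0 < C" "\<And>x y. B x y \<le> C * (1 + \<bar>x\<bar> powr p + \<bar>y\<bar> powr q)"
      using B_upper by blast
    have "\<bar>\<integral>x. T (\<lambda>k. of_real ((freq j k)\<^sup>2 / freq_sum k) * c k) x * T d x \<partial>torus\<bar> \<le> C * (vol + Ip p (T c) + Ip q (T d))"
      if cd: "fin c" "fin d" for c d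
    proof -
      have i: "integrable torus (\<lambda>x. \<bar>T c x\<bar> powr p)" "integrable torus (\<lambda>x. \<bar>T d x\<bar> powr q)"
        using p2 q1 by (auto intro!: cper_integrable cper_abs_powr)
      have "(\<integral>x. B (T c x) (T d x) \<partial>torus) \<le> (\<integral>x. C * (1 + \<bar>T c x\<bar> powr p + \<bar>T d x\<bar> powr q) \<partial>torus)"
        by (rule integral_mono) (use i C in auto)
      also have "\<dots> = C * (vol + Ip p (T c) + Ip q (T d))"
        using i by (simp add: Ip_def)
      finally show ?thesis using riesz_bellman[OF cd j] by simp
    qed
    then show ?thesis using C by blast
  qed
  show ?thesis
  proof (cases "2 \<le> p")
    case True
    then show ?thesis using main[OF True assms(2,3)] by blast
  next
    case False
    have "2 \<le> q"
    proof (rule ccontr)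
      assume "\<not> 2 \<le> q"
      then have "(p - 1) * (q - 1) < 1 * 1" using False assms by (intro mult_strict_mono) auto
      then show False using pq by simp
    qed
    from main[OF this assms(1)] pq obtain C where C: "0 < C" "\<And>c d. fin c \<Longrightarrow> fin d \<Longrightarrow>
       \<bar>\<integral>x. T (\<lambda>k. of_real ((freq j k)\<^sup>2 / freq_sum k) * c k) x * T d x \<partial>torus\<bar> \<le> C * (vol + Ip q (T c) + Ip p (T d))"
      by (auto simp: mult.commute)
    have "\<bar>\<integral>x. T (\<lambda>k. of_real ((freq j k)\<^sup>2 / freq_sum k) * c k) x * T d x \<partial>torus\<bar> \<le> C * (vol + Ip p (T c) + Ip q (T d))"
      if "fin c" "fin d" for c d
    proof -
      have "(\<integral>x. T (\<lambda>k. of_real ((freq j k)\<^sup>2 / freq_sum k) * c k) x * T d x \<partial>torus) = (\<integral>x. T (\<lambda>k. of_real ((freq j k)\<^sup>2 / freq_sum k) * d k) x * T c x \<partial>torus)"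
        using integral_T_even[OF that, of "\<lambda>k. (freq j k)\<^sup>2 / freq_sum k"] by (simp add: mult.commute)
      then show ?thesis using C(2)[OF that(2,1)] by (simp add: algebra_simps)
    qed
    then show ?thesis using C(1) by blast
  qed
qed

section \<open>Convexity inequalities for \<open>p\<close>-th powers\<close>

lemma powr_tangent:
  fixes a r p :: real
  assumes "1 \<le> p" "0 < a" "0 \<le> r"
  shows "a powr p + p * a powr (p - 1) * (r - a) \<le> r powr p"
\<comment> \<open>Convexity is invoked on the open half-line, so the endpoint is computed
  directly.\<close>
proof (cases "r = 0")
  case True
  have "a * a powr (p - 1) = a powr p" using powr_mult_base[of a "p - 1"] assms by simp
  then have "p * a powr (p - 1) * (r - a) = - (p * a powr p)" using True by (simp add: algebra_simps)
  moreover have "1 * a powr p \<le> p * a powr p" using assms by (intro mult_right_mono) auto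
  moreover have "r powr p = 0" using True by simp
  ultimately show ?thesis by linarith
next
  case False
  have "r powr p - a powr p \<ge> (p * a powr (p - 1)) * (r - a)"
  proof (rule convex_on_imp_above_tangent[OF powr_convex[OF assms(1)]])
    show "((\<lambda>x. x powr p) has_field_derivative p * a powr (p - 1)) (at a within {0<..})"
      using assms by (intro DERIV_subset[OF has_real_derivative_powr]) auto
  qed (use assms False in \<open>auto simp: interior_open\<close>)
  then show ?thesis by simp
qed

text \<open>Jensen's inequality: the tangent of \<open>r powr p\<close> at the mean is summed, and
  its linear part cancels.\<close>

lemma power_mean:
  fixes a :: "'i \<Rightarrow> real"
  assumes "1 \<le> p" "finite I" "I \<noteq> {}"
  shows "\<bar>(\<Sum>i\<in>I. a i) / card I\<bar> powr p \<le> (\<Sum>i\<in>I. \<bar>a i\<bar> powr p) / card I"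
proof -
  have n: "0 < real (card I)" using assms by (simp add: card_gt_0_iff)
  define m where "m = (\<Sum>i\<in>I. \<bar>a i\<bar>) / card I"
  have m0: "0 \<le> m" by (simp add: m_def sum_nonneg)
  have "\<bar>(\<Sum>i\<in>I. a i) / card I\<bar> \<le> m"
    unfolding m_def by (simp add: abs_divide divide_right_mono)
  then have "\<bar>(\<Sum>i\<in>I. a i) / card I\<bar> powr p \<le> m powr p"
    using assms by (intro powr_mono2) auto
  also have "\<dots> \<le> (\<Sum>i\<in>I. \<bar>a i\<bar> powr p) / card I"
  proof (cases "m = 0")
    case False
    have "(\<Sum>i\<in>I. m powr p + p * m powr (p - 1) * (\<bar>a i\<bar> - m)) \<le> (\<Sum>i\<in>I. \<bar>a i\<bar> powr p)"
      using assms False m0 by (intro sum_mono powr_tangent) auto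
    moreover have "(\<Sum>i\<in>I. m powr p + p * m powr (p - 1) * (\<bar>a i\<bar> - m)) = card I * m powr p"
    proof -
      have "(\<Sum>i\<in>I. \<bar>a i\<bar> - m) = 0" using n by (simp add: sum_subtractf m_def)
      then show ?thesis by (simp add: sum.distrib sum_distrib_left[symmetric])
    qed
    ultimately show ?thesis using n by (simp add: field_simps)
  qed (simp add: sum_nonneg)
  finally show ?thesis .
qed

lemma torus_dct:
  fixes f :: "nat \<Rightarrow> real^2 \<Rightarrow> real"
  assumes "\<And>n. f n \<in> borel_measurable torus" "g \<in> borel_measurable torus"
    and "AE x in torus. (\<lambda>n. f n x) \<longlonglongrightarrow> g x" "\<And>n x. x \<in> cell \<Longrightarrow> \<bar>f n x\<bar> \<le> R"
  shows "(\<lambda>n. \<integral>x. f n x \<partial>torus) \<longlonglongrightarrow> (\<integral>x. g x \<partial>torus)"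
  by (rule integral_dominated_convergence[where w = "\<lambda>_. R"]) (use assms in \<open>auto intro!: AE_I2\<close>)

text \<open>The same tangent argument for the normalised integral. The power of \<open>vol\<close>
  is the price of working with an unnormalised measure.\<close>

lemma jensen_Ip:
  assumes p: "1 \<le> p" and f: "f \<in> borel_measurable torus" and i: "integrable torus (\<lambda>x. \<bar>f x\<bar> powr p)"
  shows "integrable torus f" "(\<integral>x. \<bar>f x\<bar> \<partial>torus) powr p \<le> vol powr (p - 1) * Ip p f"
proof -
  show fi: "integrable torus f"
  proof (rule Bochner_Integration.integrable_bound)
    show "integrable torus (\<lambda>x. 1 + \<bar>f x\<bar> powr p)" using i by simp
    show "AE x in torus. norm (f x) \<le> norm (1 + \<bar>f x\<bar> powr p)"
    proof (rule AE_I2)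
      fix x
      have "\<bar>f x\<bar> \<le> 1 + \<bar>f x\<bar> powr p"
      proof (cases "\<bar>f x\<bar> \<le> 1")
        case False
        then have "\<bar>f x\<bar> powr 1 \<le> \<bar>f x\<bar> powr p" using p by (intro powr_mono) auto
        then show ?thesis using False by simp
      qed (simp add: add_increasing2)
      then show "norm (f x) \<le> norm (1 + \<bar>f x\<bar> powr p)" by simp
    qed
  qed (rule f)
  define m where "m = (\<integral>x. \<bar>f x\<bar> \<partial>torus) / vol"
  have m0: "0 \<le> m" using vol_pos by (simp add: m_def)
  have im: "(\<integral>x. \<bar>f x\<bar> \<partial>torus) = m * vol" using vol_pos by (simp add: m_def)
  show "(\<integral>x. \<bar>f x\<bar> \<partial>torus) powr p \<le> vol powr (p - 1) * Ip p f"
  proof (cases "m = 0")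
    case True then show ?thesis by (simp add: im)
  next
    case False
    then have m: "0 < m" using m0 by simp
    have "(\<integral>x. m powr p + p * m powr (p - 1) * (\<bar>f x\<bar> - m) \<partial>torus) \<le> Ip p f"
      unfolding Ip_def by (rule integral_mono) (use fi i p m in \<open>auto intro!: powr_tangent\<close>)
    then have "m powr p * vol \<le> Ip p f" using fi im by (simp add: mult.commute)
    then have "vol powr (p - 1) * (m powr p * vol) \<le> vol powr (p - 1) * Ip p f"
      by (intro mult_left_mono) auto
    moreover have "vol powr (p - 1) * (m powr p * vol) = (m * vol) powr p"
      using vol_pos m by (simp add: powr_mult powr_diff)
    ultimately show ?thesis by (simp add: im)
  qed
qed

lemma Ip_add:
  assumes "0 < p" "cper f" "cper g"
  shows "Ip p (\<lambda>x. f x + g x) \<le> 2 powr p * (Ip p f + Ip p g)"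
proof -
  have "Ip p (\<lambda>x. f x + g x) \<le> (\<integral>x. 2 powr p * (\<bar>f x\<bar> powr p + \<bar>g x\<bar> powr p) \<partial>torus)"
    unfolding Ip_def
  proof (rule integral_mono)
    fix x
    have "\<bar>f x + g x\<bar> powr p \<le> (\<bar>f x\<bar> + \<bar>g x\<bar>) powr p" using assms by (intro powr_mono2) auto
    also have "\<dots> \<le> 2 powr p * (\<bar>f x\<bar> powr p + \<bar>g x\<bar> powr p)" using assms by (intro powr_add_le) auto
    finally show "\<bar>f x + g x\<bar> powr p \<le> 2 powr p * (\<bar>f x\<bar> powr p + \<bar>g x\<bar> powr p)" .
  qed (use assms in \<open>auto intro!: cper_integrable cper_abs_powr\<close>)
  also have "\<dots> = 2 powr p * (Ip p f + Ip p g)"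
    using assms by (simp add: Ip_def cper_abs_powr)
  finally show ?thesis .
qed

lemma Ip_scale: "Ip p (\<lambda>x. r * f x) = \<bar>r\<bar> powr p * Ip p f"
  by (simp add: Ip_def abs_mult powr_mult)

section \<open>Boundedness of the Riesz transforms\<close>

text \<open>This is \<open>sgn r * \<bar>r\<bar> powr (p - 1)\<close>, the extremal function in
  Hoelder's inequality, written with \<open>max\<close> so that continuity at 0 follows from that of
  powers.\<close>

definition dual :: "real \<Rightarrow> real \<Rightarrow> real" where
  "dual p r = max r 0 powr (p - 1) - max (- r) 0 powr (p - 1)"

lemma dual_props:
  assumes "1 < p"
  shows "r * dual p r = \<bar>r\<bar> powr p" "\<bar>dual p r\<bar> = \<bar>r\<bar> powr (p - 1)" "continuous_on UNIV (dual p)"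
proof -
  have m: "v * v powr (p - 1) = v powr p" if "0 \<le> v" for v :: real
    using powr_mult_base[OF that, of "p - 1"] by simp
  show "r * dual p r = \<bar>r\<bar> powr p" using m[of r] m[of "- r"]
    by (cases r "0 :: real" rule: linorder_cases) (auto simp: dual_def max_def)
  show "\<bar>dual p r\<bar> = \<bar>r\<bar> powr (p - 1)"
    by (cases r "0 :: real" rule: linorder_cases) (auto simp: dual_def max_def)
  show "continuous_on UNIV (dual p)"
    unfolding dual_def using assms by (intro continuous_intros continuous_on_powr') auto
qed

text \<open>The extremal test function for a trigonometric polynomial is in general only continuous.
  Uniform approximation extends the second argument to such functions.\<close>

lemma riesz_cper:
  fixes p q :: real
  assumes "1 < p" "1 < q" and pq: "(p - 1) * (q - 1) = 1" and j: "j < 3"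
  shows "\<exists>C>0. \<forall>c g. fin c \<longrightarrow> cper g \<longrightarrow>
    \<bar>\<integral>x. T (\<lambda>k. of_real ((freq j k)\<^sup>2 / freq_sum k) * c k) x * g x \<partial>torus\<bar> \<le> C * (vol + Ip p (T c) + Ip q g)"
proof -
  obtain C where C: "0 < C" "\<And>c d. fin c \<Longrightarrow> fin d \<Longrightarrow>
    \<bar>\<integral>x. T (\<lambda>k. of_real ((freq j k)\<^sup>2 / freq_sum k) * c k) x * T d x \<partial>torus\<bar> \<le> C * (vol + Ip p (T c) + Ip q (T d))"
    using riesz_bilinear[OF assms] by blast
  have "\<bar>\<integral>x. T (\<lambda>k. of_real ((freq j k)\<^sup>2 / freq_sum k) * c k) x * g x \<partial>torus\<bar> \<le> C * (vol + Ip p (T c) + Ip q g)"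
    if c: "fin c" and g: "cper g" for c g
  proof -
    let ?h = "T (\<lambda>k. of_real ((freq j k)\<^sup>2 / freq_sum k) * c k)"
    have "\<exists>d. fin d \<and> (\<forall>x. \<bar>g x - T d x\<bar> < inverse (Suc n))" for n
      using trig_approx_cper[OF g, of "inverse (Suc n)"] by (auto simp: trig_def)
    then obtain d where d: "\<And>n. fin (d n)" "\<And>n x. \<bar>g x - T (d n) x\<bar> < inverse (Suc n)" by metis
    have lim: "(\<lambda>n. T (d n) x) \<longlonglongrightarrow> g x" for x
    proof (rule LIMSEQ_I)
      fix r :: real assume "0 < r"
      then obtain N where N: "inverse (Suc N) < r" using reals_Archimedean by blast
      have "norm (T (d n) x - g x) < r" if "N \<le> n" for n
      proof -
        have "inverse (real (Suc n)) \<le> inverse (Suc N)" using that by (simp add: le_imp_inverse_le)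
        then have "\<bar>g x - T (d n) x\<bar> < r" using d(2)[of x n] N by linarith
        then show ?thesis by (simp add: abs_minus_commute)
      qed
      then show "\<exists>no. \<forall>n\<ge>no. norm (T (d n) x - g x) < r" by blast
    qed
    obtain Rg where Rg: "0 < Rg" "\<And>x. \<bar>g x\<bar> \<le> Rg" using cper_bounded[OF g] by blast
    have bd: "\<bar>T (d n) x\<bar> \<le> Rg + 1" for n x
    proof -
      have "inverse (real (Suc n)) \<le> 1" by (simp add: inverse_le_1_iff)
      then show ?thesis using d(2)[of x n] Rg(2)[of x] by linarith
    qed
    obtain Rh where Rh: "0 < Rh" "\<And>x. \<bar>?h x\<bar> \<le> Rh" using cper_bounded[OF cper_T] by blast
    have 1: "(\<lambda>n. \<integral>x. ?h x * T (d n) x \<partial>torus) \<longlonglongrightarrow> (\<integral>x. ?h x * g x \<partial>torus)"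
    proof (rule torus_dct[where R = "Rh * (Rg + 1)"])
      show "AE x in torus. (\<lambda>n. ?h x * T (d n) x) \<longlonglongrightarrow> ?h x * g x"
        by (intro AE_I2 tendsto_intros lim)
      show "\<bar>?h x * T (d n) x\<bar> \<le> Rh * (Rg + 1)" for n x
        unfolding abs_mult using Rh Rg bd by (intro mult_mono) auto
    qed (auto intro!: cper_measurable g)
    have 2: "(\<lambda>n. Ip q (T (d n))) \<longlonglongrightarrow> Ip q g"
      unfolding Ip_def
    proof (rule torus_dct[where R = "(Rg + 1) powr q"])
      show "AE x in torus. (\<lambda>n. \<bar>T (d n) x\<bar> powr q) \<longlonglongrightarrow> \<bar>g x\<bar> powr q"
        using assms by (intro AE_I2 tendsto_powr' tendsto_intros lim) auto
      show "\<bar>\<bar>T (d n) x\<bar> powr q\<bar> \<le> (Rg + 1) powr q" for n x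
        using bd assms by (auto intro!: powr_mono2)
    qed (use assms g in \<open>auto intro!: cper_measurable cper_abs_powr\<close>)
    have "(\<lambda>n. \<bar>\<integral>x. ?h x * T (d n) x \<partial>torus\<bar>) \<longlonglongrightarrow> \<bar>\<integral>x. ?h x * g x \<partial>torus\<bar>"
      by (intro tendsto_intros 1)
    moreover have "(\<lambda>n. C * (vol + Ip p (T c) + Ip q (T (d n)))) \<longlonglongrightarrow> C * (vol + Ip p (T c) + Ip q g)"
      by (intro tendsto_intros 2)
    ultimately show ?thesis
      by (rule LIMSEQ_le) (use C c d in blast)
  qed
  then show ?thesis using C(1) by blast
qed

text \<open>Testing with \<open>dual p\<close> gives an inhomogeneous inequality. Free factors
  \<open>a\<close> and \<open>b\<close> on the two arguments, chosen to normalise both integrals to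
  1, turn it into a homogeneous bound.\<close>

lemma riesz_Lp:
  fixes p :: real
  assumes p: "1 < p" and j: "j < 3"
  shows "\<exists>C>0. \<forall>c. fin c \<longrightarrow> Ip p (T (\<lambda>k. of_real ((freq j k)\<^sup>2 / freq_sum k) * c k)) \<le> C * Ip p (T c)"
proof -
  define q where "q = p / (p - 1)"
  have q: "1 < q" "(p - 1) * (q - 1) = 1" "(p - 1) * q = p" using p by (auto simp: q_def field_simps)
  obtain C where C: "0 < C" "\<And>c g. fin c \<Longrightarrow> cper g \<Longrightarrow>
    \<bar>\<integral>x. T (\<lambda>k. of_real ((freq j k)\<^sup>2 / freq_sum k) * c k) x * g x \<partial>torus\<bar> \<le> C * (vol + Ip p (T c) + Ip q g)"
    using riesz_cper[OF p q(1,2) j] by blast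
  have "Ip p (T (\<lambda>k. of_real ((freq j k)\<^sup>2 / freq_sum k) * c k)) \<le> (C * (vol + 2)) powr p * Ip p (T c)" if c: "fin c" for c
  proof -
    let ?h = "T (\<lambda>k. of_real ((freq j k)\<^sup>2 / freq_sum k) * c k)"
    define X Y where "X = Ip p ?h" and "Y = Ip p (T c)"
    have XY0: "0 \<le> X" "0 \<le> Y" by (simp_all add: X_def Y_def)
    have key: "a * b * X \<le> C * (vol + a powr p * Y + b powr q * X)" if "0 < a" "0 < b" for a b
    proof -
      let ?g = "\<lambda>x. b * dual p (?h x)"
      have g: "cper ?g" by (intro cper_mult cper_const cper_compose[OF cper_T dual_props(3)[OF p]])
      have "(\<integral>x. T (\<lambda>k. of_real ((freq j k)\<^sup>2 / freq_sum k) * (of_real a * c k)) x * ?g x \<partial>torus) = (\<integral>x. a * b * (\<bar>?h x\<bar> powr p) \<partial>torus)"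
      proof (rule Bochner_Integration.integral_cong[OF refl])
        fix x
        have "T (\<lambda>k. of_real ((freq j k)\<^sup>2 / freq_sum k) * (of_real a * c k)) x = a * ?h x"
          using T_scale[OF fin_mult[OF c], of a "\<lambda>k. of_real ((freq j k)\<^sup>2 / freq_sum k)" x]
          by (simp only: mult.left_commute[of "of_real ((freq j k)\<^sup>2 / freq_sum k)" "of_real a" for k])
        then have "T (\<lambda>k. of_real ((freq j k)\<^sup>2 / freq_sum k) * (of_real a * c k)) x * ?g x = a * b * (?h x * dual p (?h x))"
          by (simp only: mult_ac)
        then show "T (\<lambda>k. of_real ((freq j k)\<^sup>2 / freq_sum k) * (of_real a * c k)) x * ?g x = a * b * (\<bar>?h x\<bar> powr p)"
          by (simp only: dual_props(1)[OF p])
      qed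
      also have "\<dots> = a * b * X" by (simp add: X_def Ip_def)
      finally have "a * b * X \<le> C * (vol + Ip p (T (\<lambda>k. of_real a * c k)) + Ip q ?g)"
        using C(2)[OF fin_mult[OF c, of "\<lambda>_. of_real a"] g] by simp
      moreover have "Ip p (T (\<lambda>k. of_real a * c k)) = a powr p * Y"
      proof -
        have "T (\<lambda>k. of_real a * c k) = (\<lambda>x. a * T c x)" by (rule ext) (rule T_scale[OF c])
        then show ?thesis using that by (simp add: Ip_scale Y_def)
      qed
      moreover have "Ip q ?g = b powr q * X"
      proof -
        have "Ip q (\<lambda>x. dual p (?h x)) = X"
          unfolding Ip_def X_def by (simp add: dual_props(2)[OF p] powr_powr q(3))
        then show ?thesis using that unfolding Ip_scale by simp
      qed
      ultimately show ?thesis by simp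
    qed
    have "X \<le> (C * (vol + 2)) powr p * Y"
    proof (cases "X = 0")
      case False
      then have X: "0 < X" using XY0 by simp
      define r where "r = X powr (1 / p)"
      have r: "0 < r" using X by (simp add: r_def)
      \<comment> \<open>The factor \<open>b = X powr (- 1 / q)\<close> normalises the dual test
        function.\<close>
      have b: "X powr (- 1 / q) * X = r" "(X powr (- 1 / q)) powr q * X = 1"
      proof -
        have "- 1 / q + 1 = 1 / p" using p by (simp add: q_def field_simps)
        then show "X powr (- 1 / q) * X = r"
          unfolding r_def using X powr_add[of X "- 1 / q" 1] by simp
        have "- 1 / q * q = - 1" using q by simp
        then show "(X powr (- 1 / q)) powr q * X = 1" unfolding powr_powr using X by (simp only: powr_minus) simp
      qed
      have key2: "a * r \<le> C * (vol + a powr p * Y + 1)" if "0 < a" for a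
        using key[OF that, of "X powr (- 1 / q)"] X b by (simp add: mult.assoc)
      \<comment> \<open>Were \<open>Y = 0\<close>, the right side of \<open>key2\<close> would not
        depend on \<open>a\<close> while the left side grows with it; the value of \<open>a\<close>
        is chosen so that the left side exceeds the right by 1.\<close>
      have Y: "Y \<noteq> 0"
      proof
        assume Y0: "Y = 0"
        have "(C * (vol + 1) + 1) / r * r \<le> C * (vol + 1)"
          using key2[of "(C * (vol + 1) + 1) / r"] C r vol_pos Y0 by (simp add: add_pos_pos)
        then show False using r by simp
      qed
      then have Y: "0 < Y" using XY0 by simp
      define a where "a = Y powr (- 1 / p)"
      have a: "0 < a" "a powr p * Y = 1"
      proof -
        show "0 < a" using Y by (simp add: a_def)
        have "- 1 / p * p = - 1" using p by simp
        then show "a powr p * Y = 1" unfolding a_def powr_powr using Y by (simp only: powr_minus) simp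
      qed
      have "a * r \<le> C * (vol + 2)" using key2[OF a(1)] a(2) by (simp add: add.commute)
      then have "(a * r) powr p \<le> (C * (vol + 2)) powr p" using a r p by (intro powr_mono2) auto
      moreover have "(a * r) powr p * Y = X"
        using a r p X by (simp add: powr_mult r_def powr_powr)
      ultimately show ?thesis using mult_right_mono[of "(a * r) powr p" "(C * (vol + 2)) powr p" Y] Y by simp
    qed (use XY0 in simp)
    then show ?thesis by (simp add: X_def Y_def)
  qed
  moreover have "0 < (C * (vol + 2)) powr p" using C vol_pos by simp
  ultimately show ?thesis by blast
qed

text \<open>Since \<open>freq 2 = freq 0 - freq 1\<close>, the mixed product of the first two
  frequencies is half of \<open>(freq 0)\<^sup>2 + (freq 1)\<^sup>2 - (freq 2)\<^sup>2\<close>. So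
  every quadratic form in the frequency has this shape, and the three Riesz multipliers cover all
  second derivatives.\<close>

definition quad :: "real \<Rightarrow> real \<Rightarrow> real \<Rightarrow> int \<times> int \<Rightarrow> real" where
  "quad a b d k = a * (freq 0 k)\<^sup>2 + b * (freq 1 k)\<^sup>2 + d * (freq 2 k)\<^sup>2"

lemma quad_Lp:
  assumes p: "1 < p"
  shows "\<exists>C>0. \<forall>c. fin c \<longrightarrow> Ip p (T (\<lambda>k. of_real (quad a b d k / freq_sum k) * c k)) \<le> C * Ip p (T c)"
proof -
  obtain C0 C1 C2 where C: "0 < C0" "0 < C1" "0 < C2"
    "\<And>c. fin c \<Longrightarrow> Ip p (T (\<lambda>k. of_real ((freq 0 k)\<^sup>2 / freq_sum k) * c k)) \<le> C0 * Ip p (T c)"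
    "\<And>c. fin c \<Longrightarrow> Ip p (T (\<lambda>k. of_real ((freq 1 k)\<^sup>2 / freq_sum k) * c k)) \<le> C1 * Ip p (T c)"
    "\<And>c. fin c \<Longrightarrow> Ip p (T (\<lambda>k. of_real ((freq 2 k)\<^sup>2 / freq_sum k) * c k)) \<le> C2 * Ip p (T c)"
    using riesz_Lp[OF p, of 0] riesz_Lp[OF p, of 1] riesz_Lp[OF p, of 2] by auto
  define K where "K = 2 powr p * (2 powr p * (\<bar>a\<bar> powr p * C0 + \<bar>b\<bar> powr p * C1) + \<bar>d\<bar> powr p * C2)"
  have "Ip p (T (\<lambda>k. of_real (quad a b d k / freq_sum k) * c k)) \<le> (K + 1) * Ip p (T c)" if c: "fin c" for c
  proof -
    let ?u = "\<lambda>j. T (\<lambda>k. of_real ((freq j k)\<^sup>2 / freq_sum k) * c k)"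
    have e: "T (\<lambda>k. of_real (quad a b d k / freq_sum k) * c k) = (\<lambda>x. (a * ?u 0 x + b * ?u 1 x) + d * ?u 2 x)"
    proof
      fix x
      have "of_real (quad a b d k / freq_sum k) * c k = (of_real a * (of_real ((freq 0 k)\<^sup>2 / freq_sum k) * c k)
         + of_real b * (of_real ((freq 1 k)\<^sup>2 / freq_sum k) * c k)) + of_real d * (of_real ((freq 2 k)\<^sup>2 / freq_sum k) * c k)" for k
        by (simp add: quad_def add_divide_distrib algebra_simps)
      then show "T (\<lambda>k. of_real (quad a b d k / freq_sum k) * c k) x = (a * ?u 0 x + b * ?u 1 x) + d * ?u 2 x"
        by (simp only:) ((subst T_add T_scale; (intro fin_add fin_mult c)?)+, rule refl)
    qed
    have "Ip p (\<lambda>x. (a * ?u 0 x + b * ?u 1 x) + d * ?u 2 x) \<le> 2 powr p * (Ip p (\<lambda>x. a * ?u 0 x + b * ?u 1 x) + Ip p (\<lambda>x. d * ?u 2 x))"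
      using p by (intro Ip_add cper_add cper_mult cper_const cper_T) simp
    also have "\<dots> \<le> 2 powr p * (2 powr p * (Ip p (\<lambda>x. a * ?u 0 x) + Ip p (\<lambda>x. b * ?u 1 x)) + Ip p (\<lambda>x. d * ?u 2 x))"
      using p by (intro mult_left_mono add_right_mono Ip_add cper_mult cper_const cper_T) auto
    also have "\<dots> \<le> 2 powr p * (2 powr p * (\<bar>a\<bar> powr p * (C0 * Ip p (T c)) + \<bar>b\<bar> powr p * (C1 * Ip p (T c))) + \<bar>d\<bar> powr p * (C2 * Ip p (T c)))"
      unfolding Ip_scale by (intro mult_left_mono add_mono C c) auto
    also have "\<dots> = K * Ip p (T c)" by (simp add: K_def algebra_simps)
    also have "\<dots> \<le> (K + 1) * Ip p (T c)" by (intro mult_right_mono) auto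
    finally show ?thesis unfolding e .
  qed
  moreover have "0 < K + 1" unfolding K_def using C by (intro add_nonneg_pos mult_nonneg_nonneg add_nonneg_nonneg) auto
  ultimately show ?thesis by blast
qed

section \<open>Poincare and Sobolev inequalities\<close>

definition dir_deriv :: "real^2 \<Rightarrow> (int \<times> int \<Rightarrow> complex) \<Rightarrow> int \<times> int \<Rightarrow> complex" where
  "dir_deriv y c = (\<lambda>k. \<i> * of_real (ph k y) * c k)"

lemma fin_dir_deriv [intro]: "fin c \<Longrightarrow> fin (dir_deriv y c)"
  unfolding dir_deriv_def by (rule fin_mult)

lemma dir_deriv_zero [simp]: "dir_deriv y c 0 = 0"
  by (simp add: dir_deriv_def)

lemma mode_eq: "mode k c x = Re c * cos (ph k x) - Im c * sin (ph k x)"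
  by (simp add: mode_def)

lemma T_line_deriv:
  assumes c: "fin c"
  shows "((\<lambda>t. T c (x + t *\<^sub>R y)) has_real_derivative T (dir_deriv y c) (x + t *\<^sub>R y)) (at t)"
proof -
  have "((\<lambda>t. mode k (c k) (x + t *\<^sub>R y)) has_real_derivative mode k (\<i> * of_real (ph k y) * c k) (x + t *\<^sub>R y)) (at t)" for k
    unfolding mode_eq by (auto intro!: derivative_eq_intros simp: algebra_simps)
  then show ?thesis
    unfolding dir_deriv_def T_mult[OF c] T_def by (intro derivative_intros)
qed

text \<open>The translation is split into \<open>Suc n\<close> equal steps. The power mean
  inequality and translation invariance bound the total by one difference quotient, which dominated
  convergence replaces by the derivative.\<close>

lemma shift_diff_Ip:
  assumes p: "1 \<le> p" and c: "fin c"
  shows "Ip p (\<lambda>x. T c (x + y) - T c x) \<le> Ip p (T (dir_deriv y c))"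
proof -
  define F where "F n x = real (Suc n) * (T c (x + (1 / Suc n) *\<^sub>R y) - T c x)" for n x
  have cF: "cper (F n)" for n unfolding F_def by (intro cper_mult cper_diff cper_const cper_shift cper_T)
  have le: "Ip p (\<lambda>x. T c (x + y) - T c x) \<le> Ip p (F n)" for n
  proof -
    let ?N = "Suc n"
    let ?z = "\<lambda>i. (real i / ?N) *\<^sub>R y"
    have pt: "\<bar>T c (x + y) - T c x\<bar> powr p \<le> (\<Sum>i<?N. \<bar>F n (x + ?z i)\<bar> powr p) / ?N" for x
    proof -
      have "(\<Sum>i<?N. T c (x + ?z (Suc i)) - T c (x + ?z i)) = T c (x + ?z ?N) - T c (x + ?z 0)"
        by (rule sum_lessThan_telescope)
      also have "\<dots> = T c (x + y) - T c x" by simp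
      finally have "T c (x + y) - T c x = (\<Sum>i<?N. F n (x + ?z i)) / ?N"
      proof -
        assume a: "(\<Sum>i<?N. T c (x + ?z (Suc i)) - T c (x + ?z i)) = T c (x + y) - T c x"
        have "F n (x + ?z i) = real ?N * (T c (x + ?z (Suc i)) - T c (x + ?z i))" for i
        proof -
          have "x + ?z i + (1 / ?N) *\<^sub>R y = x + ?z (Suc i)"
            by (simp add: add_divide_distrib scaleR_add_left algebra_simps)
          then show ?thesis by (simp only: F_def)
        qed
        then have "(\<Sum>i<?N. F n (x + ?z i)) = real ?N * (T c (x + y) - T c x)"
          unfolding a[symmetric] sum_distrib_left by simp
        then show ?thesis by simp
      qed
      then show ?thesis using power_mean[OF p, of "{..<?N}" "\<lambda>i. F n (x + ?z i)"]
        by (simp del: sum.lessThan_Suc add: lessThan_empty_iff)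
    qed
    have "Ip p (\<lambda>x. T c (x + y) - T c x) \<le> (\<integral>x. (\<Sum>i<?N. \<bar>F n (x + ?z i)\<bar> powr p) / ?N \<partial>torus)"
      unfolding Ip_def using p
      by (intro integral_mono pt cper_integrable cper_abs_powr cper_diff cper_shift cper_T cper_divide cper_sum cF) auto
    also have "\<dots> = (\<Sum>i<?N. \<integral>x. \<bar>F n (x + ?z i)\<bar> powr p \<partial>torus) / ?N"
    proof -
      have "integrable torus (\<lambda>x. \<bar>F n (x + ?z i)\<bar> powr p)" for i
        using p by (intro cper_integrable cper_abs_powr cper_shift cF) auto
      then show ?thesis by (subst integral_divide_zero) (subst Bochner_Integration.integral_sum, auto)
    qed
    also have "\<dots> = (\<Sum>i<?N. Ip p (F n)) / ?N"
    proof -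
      have "(\<integral>x. \<bar>F n (x + ?z i)\<bar> powr p \<partial>torus) = Ip p (F n)" for i
        unfolding Ip_def using p by (intro integral_translation cper_abs_powr cF) auto
      then show ?thesis by simp
    qed
    finally show ?thesis by simp
  qed
  obtain R where R: "0 < R" "\<And>x. \<bar>T (dir_deriv y c) x\<bar> \<le> R" using cper_bounded[OF cper_T] by blast
  have bd: "\<bar>F n x\<bar> \<le> R" for n x
  proof -
    have "\<exists>z. 0 < z \<and> z < 1 / Suc n \<and> T c (x + (1 / Suc n) *\<^sub>R y) - T c (x + 0 *\<^sub>R y) = (1 / Suc n - 0) * T (dir_deriv y c) (x + z *\<^sub>R y)"
      by (rule MVT2) (use T_line_deriv[OF c] in auto)
    then obtain z where "T c (x + (1 / Suc n) *\<^sub>R y) - T c x = (1 / Suc n) * T (dir_deriv y c) (x + z *\<^sub>R y)" by auto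
    then have "F n x = T (dir_deriv y c) (x + z *\<^sub>R y)" by (simp add: F_def)
    then show ?thesis using R by simp
  qed
  have "(\<lambda>n. Ip p (F n)) \<longlonglongrightarrow> Ip p (T (dir_deriv y c))"
    unfolding Ip_def
  proof (rule torus_dct[where R = "R powr p"])
    show "AE x in torus. (\<lambda>n. \<bar>F n x\<bar> powr p) \<longlonglongrightarrow> \<bar>T (dir_deriv y c) x\<bar> powr p"
    proof (intro AE_I2 tendsto_powr' tendsto_intros)
      fix x
      have "((\<lambda>h. (T c (x + h *\<^sub>R y) - T c x) / h) \<longlongrightarrow> T (dir_deriv y c) x) (at 0)"
        using T_line_deriv[OF c, of x y 0] by (simp add: DERIV_def)
      moreover have "filterlim (\<lambda>n. 1 / real (Suc n)) (at 0) sequentially"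
        unfolding filterlim_at using LIMSEQ_inverse_real_of_nat by (auto simp: inverse_eq_divide)
      ultimately have "(\<lambda>n. (T c (x + (1 / real (Suc n)) *\<^sub>R y) - T c x) / (1 / real (Suc n))) \<longlonglongrightarrow> T (dir_deriv y c) x"
        by (rule filterlim_compose)
      then show "(\<lambda>n. F n x) \<longlonglongrightarrow> T (dir_deriv y c) x"
        by (simp add: F_def mult.commute)
    qed (use p in auto)
    show "\<bar>\<bar>F n x\<bar> powr p\<bar> \<le> R powr p" for n x using bd p by (auto intro!: powr_mono2)
  qed (use p cF in \<open>auto intro!: cper_measurable cper_abs_powr\<close>)
  then show ?thesis by (rule LIMSEQ_le_const) (use le in auto)
qed

lemma root_of_unity_sum:
  assumes "m \<noteq> 0" "\<bar>m\<bar> < int N"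
  shows "(\<Sum>i<N. cis (of_int m * (2 * pi * real i / real N))) = 0"
proof -
  let ?z = "cis (of_int m * (2 * pi / real N))"
  have N: "0 < real N" using assms by linarith
  have z: "cis (of_int m * (2 * pi * real i / real N)) = ?z ^ i" for i
    unfolding Complex.DeMoivre by (rule arg_cong[where f = cis]) simp
  have "?z ^ N = cis (2 * pi * of_int m)" using N by (simp add: Complex.DeMoivre mult_ac)
  then have zN: "?z ^ N = 1" by (simp add: cis_multiple_2pi)
  have nz: "?z \<noteq> 1"
  proof
    assume "?z = 1"
    then have "cis (of_int m * (2 * pi / real N)) = cis 0" by simp
    from cis_eq_imp[OF this] obtain l :: int where "of_int m * (2 * pi / real N) = 0 + 2 * pi * of_int l" by blast
    then have "of_int m = real N * of_int l" using N by (simp add: field_simps)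
    then have e: "m = int N * l" by (metis of_int_eq_iff of_int_mult of_int_of_nat_eq)
    then have "l \<noteq> 0" using assms by auto
    then have "int N * 1 \<le> int N * \<bar>l\<bar>" by (intro mult_left_mono) auto
    then show False using assms e by (simp add: abs_mult)
  qed
  show ?thesis unfolding z geometric_sum[OF nz] zN by simp
qed

text \<open>On a grid of \<open>N\<close> points per period a nonzero frequency smaller than
  \<open>N\<close> sums to 0, as a sum over roots of unity. A finite grid in place of the mean
  integral lets \<open>power_mean\<close> do the work of Jensen's inequality.\<close>

lemma T_average:
  assumes c: "fin c" and c0: "c 0 = 0"
  obtains N where "0 < N" "\<And>x. (\<Sum>v\<in>{..<N} \<times> {..<N}. T c (x + pt (2 * pi * real (fst v) / real N) (2 * pi * real (snd v) / real N))) = 0"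
proof -
  have fS: "finite {k. c k \<noteq> 0}" using c by (simp add: fin_def)
  obtain M where M: "\<And>k. c k \<noteq> 0 \<Longrightarrow> \<bar>fst k\<bar> + \<bar>snd k\<bar> \<le> M"
  proof -
    have "bdd_above ((\<lambda>k. \<bar>fst k\<bar> + \<bar>snd k\<bar>) ` {k. c k \<noteq> 0})" using fS by (intro bdd_above_finite) auto
    then show thesis using that unfolding bdd_above_def by blast
  qed
  define N where "N = nat (\<bar>M\<bar> + 1)"
  have N: "0 < N" "\<And>k. c k \<noteq> 0 \<Longrightarrow> \<bar>fst k\<bar> < int N \<and> \<bar>snd k\<bar> < int N"
    using M by (auto simp: N_def) (smt (verit))+
  define w where "w v = pt (2 * pi * real (fst v) / real N) (2 * pi * real (snd v) / real N)" for v :: "nat \<times> nat"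
  have z: "(\<Sum>v\<in>{..<N} \<times> {..<N}. cis (ph k (w v))) = 0" if "c k \<noteq> 0" for k
  proof -
    let ?a = "\<lambda>m i. cis (of_int m * (2 * pi * real i / real N))"
    have "cis (ph k (w v)) = ?a (fst k) (fst v) * ?a (snd k) (snd v)" for v
      by (simp add: w_def cis_mult)
    then have "(\<Sum>v\<in>{..<N} \<times> {..<N}. cis (ph k (w v))) = (\<Sum>i<N. ?a (fst k) i) * (\<Sum>i<N. ?a (snd k) i)"
      by (simp add: sum_product sum.cartesian_product case_prod_unfold)
    moreover have "k \<noteq> 0" using that c0 by auto
    then have "fst k \<noteq> 0 \<or> snd k \<noteq> 0" by (simp add: prod_eq_iff)
    ultimately show ?thesis using root_of_unity_sum N(2)[OF that] by auto
  qed
  have "(\<Sum>v\<in>{..<N} \<times> {..<N}. T c (x + w v)) = 0" for x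
  proof -
    have "(\<Sum>v\<in>{..<N} \<times> {..<N}. T c (x + w v)) = (\<Sum>k | c k \<noteq> 0. \<Sum>v\<in>{..<N} \<times> {..<N}. mode k (c k) (x + w v))"
      unfolding T_def by (rule sum.swap)
    also have "\<dots> = (\<Sum>k | c k \<noteq> 0. 0)"
    proof (rule sum.cong[OF refl])
      fix k assume "k \<in> {k. c k \<noteq> 0}"
      have "mode k (c k) (x + w v) = Re (c k * cis (ph k x) * cis (ph k (w v)))" for v
        by (simp only: mode_def ph_simps cis_mult[symmetric] mult.assoc)
      then have e: "(\<Sum>v\<in>{..<N} \<times> {..<N}. mode k (c k) (x + w v)) = Re (c k * cis (ph k x) * (\<Sum>v\<in>{..<N} \<times> {..<N}. cis (ph k (w v))))"
        by (simp only: sum_distrib_left Re_sum)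
      have zk: "(\<Sum>v\<in>{..<N} \<times> {..<N}. cis (ph k (w v))) = 0" using z \<open>k \<in> _\<close> by blast
      show "(\<Sum>v\<in>{..<N} \<times> {..<N}. mode k (c k) (x + w v)) = 0"
        unfolding e zk by simp
    qed
    finally show ?thesis by simp
  qed
  then show thesis using that N(1) unfolding w_def by blast
qed

lemma dir_deriv_split: "dir_deriv y c = (\<lambda>k. of_real (ph1 y) * dir_deriv (dir 0) c k + of_real (ph2 y) * dir_deriv (dir 1) c k)"
  by (rule ext) (simp add: dir_deriv_def dir_def ph_def algebra_simps)

lemma Ip_dir_deriv_le:
  assumes p: "1 \<le> p" and c: "fin c" and y: "\<bar>ph1 y\<bar> \<le> 2 * pi" "\<bar>ph2 y\<bar> \<le> 2 * pi"
  shows "Ip p (T (dir_deriv y c)) \<le> 2 powr p * (2 * pi) powr p * (Ip p (T (dir_deriv (dir 0) c)) + Ip p (T (dir_deriv (dir 1) c)))"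
proof -
  let ?u = "T (dir_deriv (dir 0) c)" and ?v = "T (dir_deriv (dir 1) c)"
  have "T (dir_deriv y c) = (\<lambda>x. ph1 y * ?u x + ph2 y * ?v x)"
  proof
    fix x
    show "T (dir_deriv y c) x = ph1 y * ?u x + ph2 y * ?v x"
      unfolding dir_deriv_split[of y] by ((subst T_add T_scale; (intro fin_add fin_mult fin_dir_deriv c)?)+, rule refl)
  qed
  then have "Ip p (T (dir_deriv y c)) \<le> 2 powr p * (Ip p (\<lambda>x. ph1 y * ?u x) + Ip p (\<lambda>x. ph2 y * ?v x))"
    using p by (simp only:) (intro Ip_add cper_mult cper_const cper_T, auto)
  also have "\<dots> \<le> 2 powr p * ((2 * pi) powr p * Ip p ?u + (2 * pi) powr p * Ip p ?v)"
    unfolding Ip_scale using y p by (intro mult_left_mono add_mono mult_right_mono powr_mono2) auto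
  finally show ?thesis by (simp add: algebra_simps)
qed

text \<open>As the grid average vanishes, \<open>- T c x\<close> is the average of the differences
  \<open>T c (x + w v) - T c x\<close>, and each difference is controlled by a directional
  derivative.\<close>

lemma poincare:
  assumes p: "1 \<le> p" and c: "fin c" and c0: "c 0 = 0"
  shows "Ip p (T c) \<le> 2 powr p * (2 * pi) powr p * (Ip p (T (dir_deriv (dir 0) c)) + Ip p (T (dir_deriv (dir 1) c)))"
proof -
  obtain N where N: "0 < N" "\<And>x. (\<Sum>v\<in>{..<N} \<times> {..<N}. T c (x + pt (2 * pi * real (fst v) / real N) (2 * pi * real (snd v) / real N))) = 0"
    using T_average[OF c c0] by blast
  define w where "w v = pt (2 * pi * real (fst v) / real N) (2 * pi * real (snd v) / real N)" for v :: "nat \<times> nat"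
  let ?I = "{..<N} \<times> {..<N}"
  let ?K = "2 powr p * (2 * pi) powr p * (Ip p (T (dir_deriv (dir 0) c)) + Ip p (T (dir_deriv (dir 1) c)))"
  have I: "finite ?I" "?I \<noteq> {}" "0 < real (card ?I)" using N by auto
  have pt: "\<bar>T c x\<bar> powr p \<le> (\<Sum>v\<in>?I. \<bar>T c (x + w v) - T c x\<bar> powr p) / card ?I" for x
  proof -
    define n where "n = real (card ?I)"
    have e: "(\<Sum>v\<in>?I. T c (x + w v) - T c x) = - (n * T c x)"
      using N(2)[of x] by (simp add: w_def sum_subtractf n_def)
    have "(\<Sum>v\<in>?I. T c (x + w v) - T c x) / n = - T c x"
      using I(3) unfolding e n_def[symmetric] by simp
    then show ?thesis using power_mean[OF p I(1,2), of "\<lambda>v. T c (x + w v) - T c x"]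
      unfolding n_def[symmetric] by simp
  qed
  have i: "integrable torus (\<lambda>x. \<bar>T c (x + w v) - T c x\<bar> powr p)" for v
    using p by (intro cper_integrable cper_abs_powr cper_diff cper_shift cper_T) auto
  have "Ip p (T c) \<le> (\<integral>x. (\<Sum>v\<in>?I. \<bar>T c (x + w v) - T c x\<bar> powr p) / card ?I \<partial>torus)"
    unfolding Ip_def using p by (intro integral_mono pt integrable_divide Bochner_Integration.integrable_sum i) (intro cper_integrable cper_abs_powr cper_T, auto)
  also have "\<dots> = (\<Sum>v\<in>?I. Ip p (\<lambda>x. T c (x + w v) - T c x)) / card ?I"
    unfolding Ip_def by (subst integral_divide_zero) (subst Bochner_Integration.integral_sum, auto intro: i)
  also have "\<dots> \<le> (\<Sum>v\<in>?I. ?K) / card ?I"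
  proof (intro divide_right_mono sum_mono)
    fix v assume v: "v \<in> ?I"
    have "\<bar>ph1 (w v)\<bar> \<le> 2 * pi" "\<bar>ph2 (w v)\<bar> \<le> 2 * pi"
      using v N(1) by (auto simp: w_def abs_mult field_simps)
    then show "Ip p (\<lambda>x. T c (x + w v) - T c x) \<le> ?K"
      by (intro order_trans[OF shift_diff_Ip[OF p c] Ip_dir_deriv_le[OF p c]])
  qed simp
  also have "\<dots> = ?K" using N(1) by simp
  finally show ?thesis .
qed

text \<open>For every \<open>s\<close> between 0 and 1, \<open>\<bar>f 0\<bar>\<close> is at most
  \<open>\<bar>f s\<bar>\<close> plus the integral of \<open>\<bar>f'\<bar>\<close>; this is
  averaged over \<open>s\<close>.\<close>

lemma line_average:
  fixes f f' :: "real \<Rightarrow> real"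
  assumes d: "\<And>t. (f has_real_derivative f' t) (at t)" and c: "continuous_on UNIV f'"
  shows "\<bar>f 0\<bar> \<le> integral {0..1} (\<lambda>s. \<bar>f s\<bar> + \<bar>f' s\<bar>)"
proof -
  have cf: "continuous_on S f" for S
    by (rule DERIV_continuous_on) (use d in \<open>auto intro: DERIV_subset\<close>)
  have cf': "continuous_on S f'" for S using c by (rule continuous_on_subset) simp
  have i: "(\<lambda>s. \<bar>f s\<bar>) integrable_on {0..1}" "\<And>a b. (\<lambda>s. \<bar>f' s\<bar>) integrable_on {a..b}" "\<And>a b. f' integrable_on {a..b}"
    by (intro integrable_continuous_real continuous_intros cf cf')+
  define M where "M = integral {0..1} (\<lambda>s. \<bar>f' s\<bar>)"
  have le: "\<bar>f 0\<bar> \<le> \<bar>f s\<bar> + M" if "s \<in> {0..1}" for s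
  proof -
    have "(f' has_integral (f s - f 0)) {0..s}"
      using that d by (intro fundamental_theorem_of_calculus)
        (auto simp: has_real_derivative_iff_has_vector_derivative[symmetric] intro: DERIV_subset)
    then have e: "f s - f 0 = integral {0..s} f'" by (simp add: integral_unique)
    have "norm (integral {0..s} f') \<le> integral {0..s} (\<lambda>s. \<bar>f' s\<bar>)"
      by (rule integral_norm_bound_integral) (use i in auto)
    also have "\<dots> \<le> M" unfolding M_def
      by (rule integral_subset_le) (use i that in auto)
    finally show ?thesis using e by simp
  qed
  have "\<bar>f 0\<bar> = integral {0..1::real} (\<lambda>s. \<bar>f 0\<bar>)" by simp
  also have "\<dots> \<le> integral {0..1} (\<lambda>s. \<bar>f s\<bar> + M)"
    by (rule integral_le) (use i le in \<open>auto intro!: integrable_add\<close>)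
  also have "\<dots> = integral {0..1} (\<lambda>s. \<bar>f s\<bar> + \<bar>f' s\<bar>)"
  proof -
    have "integral {0..1} (\<lambda>s. \<bar>f s\<bar> + M) = integral {0..1} (\<lambda>s. \<bar>f s\<bar>) + integral {0..1::real} (\<lambda>s. M)"
      by (rule Henstock_Kurzweil_Integration.integral_add) (use i in auto)
    moreover have "integral {0..1} (\<lambda>s. \<bar>f s\<bar> + \<bar>f' s\<bar>) = integral {0..1} (\<lambda>s. \<bar>f s\<bar>) + integral {0..1} (\<lambda>s. \<bar>f' s\<bar>)"
      by (rule Henstock_Kurzweil_Integration.integral_add) (use i in auto)
    ultimately show ?thesis by (simp add: M_def)
  qed
  finally show ?thesis .
qed

lemma integral_mode_line:
  "integral {0..1} (\<lambda>t. mode k c (x + t *\<^sub>R lat v)) = (if ph k (lat v) = 0 then mode k c x else 0)"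
proof (cases "ph k (lat v) = 0")
  case True
  then have "mode k c (x + t *\<^sub>R lat v) = mode k c x" for t by (simp add: mode_def)
  then show ?thesis using True by simp
next
  case False
  let ?d = "c / (\<i> * of_real (ph k (lat v)))"
  have "((\<lambda>t. mode k d (x + t *\<^sub>R lat v)) has_real_derivative mode k (\<i> * of_real (ph k (lat v)) * d) (x + t *\<^sub>R lat v)) (at t within S)" for d t S
    unfolding mode_eq by (auto intro!: derivative_eq_intros simp: algebra_simps)
  from this[of ?d] have "((\<lambda>t. mode k ?d (x + t *\<^sub>R lat v)) has_real_derivative mode k (\<i> * of_real (ph k (lat v)) * ?d) (x + t *\<^sub>R lat v)) (at t within S)" for t S .
  moreover have "\<i> * of_real (ph k (lat v)) * ?d = c" using False by simp
  ultimately have "((\<lambda>t. mode k c (x + t *\<^sub>R lat v)) has_integral (mode k ?d (x + 1 *\<^sub>R lat v) - mode k ?d (x + 0 *\<^sub>R lat v))) {0..1}"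
    by (intro fundamental_theorem_of_calculus) (simp_all only: has_real_derivative_iff_has_vector_derivative[symmetric] zero_le_one)
  moreover have "mode k ?d (x + 1 *\<^sub>R lat v) - mode k ?d (x + 0 *\<^sub>R lat v) = 0"
    using cper_lat[OF cper_mode] by simp
  ultimately show ?thesis using False by (simp add: integral_unique)
qed

text \<open>The mean over a period parallelogram based at \<open>x\<close>, as an iterated gauge
  integral, the form in which the fundamental theorem of calculus can be used line by line.\<close>

definition box_avg :: "(real^2 \<Rightarrow> real) \<Rightarrow> real^2 \<Rightarrow> real" where
  "box_avg F x = integral {0..1} (\<lambda>s. integral {0..1} (\<lambda>t. F (x + s *\<^sub>R lat (1, 0) + t *\<^sub>R lat (0, 1))))"

lemma cper_continuous: "cper F \<Longrightarrow> continuous_on S g \<Longrightarrow> continuous_on S (\<lambda>x. F (g x))"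
  by (rule continuous_on_compose2[of UNIV F]) (auto simp: cper_def)

lemma inner_continuous:
  assumes "cper F"
  shows "continuous_on U (\<lambda>s. integral {0..1::real} (\<lambda>t. F (x + s *\<^sub>R y + t *\<^sub>R z)))"
proof -
  have "continuous_on U (\<lambda>s. integral (cbox 0 (1::real)) (\<lambda>t. F (x + s *\<^sub>R y + t *\<^sub>R z)))"
    by (rule integral_continuous_on_param)
      (auto simp: case_prod_unfold intro!: cper_continuous[OF assms] continuous_intros)
  then show ?thesis by simp
qed

lemma box_integrable:
  assumes "cper F"
  shows "(\<lambda>t. F (x + t *\<^sub>R y)) integrable_on {0..1::real}"
    "(\<lambda>s. integral {0..1::real} (\<lambda>t. F (x + s *\<^sub>R y + t *\<^sub>R z))) integrable_on {0..1::real}"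
  by (intro integrable_continuous_real cper_continuous[OF assms] inner_continuous[OF assms] continuous_intros)+

lemma box_avg_mono:
  assumes "cper F" "cper H" "\<And>x. F x \<le> H x"
  shows "box_avg F x \<le> box_avg H x"
  unfolding box_avg_def using assms by (intro integral_le box_integrable) auto

lemma box_avg_T:
  assumes c: "fin c" shows "box_avg (T c) x = Re (c 0)"
proof -
  have f: "finite {k. c k \<noteq> 0}" using c by (simp add: fin_def)
  have "box_avg (T c) x = (\<Sum>k | c k \<noteq> 0. box_avg (mode k (c k)) x)"
  proof -
    have "integral {0..1} (\<lambda>t. T c (x + s *\<^sub>R lat (1, 0) + t *\<^sub>R lat (0, 1)))
       = (\<Sum>k | c k \<noteq> 0. integral {0..1} (\<lambda>t. mode k (c k) (x + s *\<^sub>R lat (1, 0) + t *\<^sub>R lat (0, 1))))" for s :: real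
      unfolding T_def by (rule Henstock_Kurzweil_Integration.integral_sum[OF f]) (rule box_integrable[OF cper_mode])
    then show ?thesis unfolding box_avg_def
      by (simp only:) (rule Henstock_Kurzweil_Integration.integral_sum[OF f box_integrable(2)[OF cper_mode]])
  qed
  also have "\<dots> = (\<Sum>k | c k \<noteq> 0. if k = 0 then Re (c k) else 0)"
  proof (rule sum.cong[OF refl])
    fix k
    have p: "ph k (lat (1, 0)) = 2 * pi * of_int (fst k)" "ph k (lat (0, 1)) = 2 * pi * of_int (snd k)"
      by (simp_all add: ph_def)
    have "box_avg (mode k (c k)) x = (if snd k = 0 then if fst k = 0 then mode k (c k) x else 0 else 0)"
      unfolding box_avg_def integral_mode_line p by (simp add: integral_mode_line p)
    then show "box_avg (mode k (c k)) x = (if k = 0 then Re (c k) else 0)"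
      by (auto simp: prod_eq_iff mode_def ph_def)
  qed
  also have "\<dots> = Re (c 0)" using f by (simp add: sum.delta' if_distrib)
  finally show ?thesis .
qed

lemma integral_T: assumes c: "fin c" shows "(\<integral>x. T c x \<partial>torus) = vol * Re (c 0)"
proof -
  have f: "finite {k. c k \<noteq> 0}" using c by (simp add: fin_def)
  have "(\<integral>x. T c x \<partial>torus) = (\<Sum>k | c k \<noteq> 0. \<integral>x. mode k (c k) x \<partial>torus)"
    unfolding T_def by (rule Bochner_Integration.integral_sum) auto
  also have "\<dots> = (\<Sum>k | c k \<noteq> 0. if k = 0 then Re (c k) * vol else 0)"
    by (rule sum.cong) (auto simp: integral_mode)
  also have "\<dots> = vol * Re (c 0)" using f by (simp add: sum.delta' mult.commute)
  finally show ?thesis .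
qed

text \<open>Both means are monotone and both give the constant coefficient of a trigonometric
  polynomial; a uniform sandwich between two such polynomials extends the equality, without a change
  of variables.\<close>

lemma box_avg_eq:
  assumes F: "cper F" shows "box_avg F x = (\<integral>x. F x \<partial>torus) / vol"
proof -
  have "\<bar>box_avg F x - (\<integral>x. F x \<partial>torus) / vol\<bar> \<le> 0 + e" if e: "0 < e" for e
  proof -
    obtain t where "trig t" "\<And>x. \<bar>F x - t x\<bar> < e / 2" using trig_approx_cper[OF F, of "e / 2"] e by auto
    then obtain c where c: "fin c" "\<And>x. \<bar>F x - T c x\<bar> < e / 2" by (auto simp: trig_def)
    define cl where "cl r k = c k + (if k = 0 then of_real r else 0)" for r k
    have fcl: "fin (cl r)" for r unfolding cl_def by (intro fin_add c) (simp add: fin_def)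
    have Tcl: "T (cl r) x = T c x + r" for r x
    proof -
      have f0: "fin (\<lambda>k. if k = 0 then of_real r else 0)" by (simp add: fin_def)
      have "T (\<lambda>k. if k = 0 then of_real r else 0) x = r"
        by (subst T_on[of "{0}"]) (auto split: if_splits)
      then show ?thesis using T_add[OF c(1) f0, of x] by (simp add: cl_def[abs_def])
    qed
    have b: "T (cl (- (e / 2))) x \<le> F x" "F x \<le> T (cl (e / 2)) x" for x
      using c(2)[of x] unfolding Tcl abs_less_iff by linarith+
    have "Re (c 0) - e / 2 \<le> box_avg F x" "box_avg F x \<le> Re (c 0) + e / 2"
      using box_avg_mono[OF cper_T F b(1), of x] box_avg_mono[OF F cper_T b(2), of x]
      unfolding box_avg_T[OF fcl] by (simp_all add: cl_def)
    moreover have "vol * (Re (c 0) - e / 2) \<le> (\<integral>x. F x \<partial>torus)" "(\<integral>x. F x \<partial>torus) \<le> vol * (Re (c 0) + e / 2)"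
    proof -
      have "(\<integral>x. T (cl (- (e / 2))) x \<partial>torus) \<le> (\<integral>x. F x \<partial>torus)" "(\<integral>x. F x \<partial>torus) \<le> (\<integral>x. T (cl (e / 2)) x \<partial>torus)"
        by (intro integral_mono b cper_integrable cper_T F)+
      then show "vol * (Re (c 0) - e / 2) \<le> (\<integral>x. F x \<partial>torus)" "(\<integral>x. F x \<partial>torus) \<le> vol * (Re (c 0) + e / 2)"
        unfolding integral_T[OF fcl] by (simp_all add: cl_def)
    qed
    then have "Re (c 0) - e / 2 \<le> (\<integral>x. F x \<partial>torus) / vol" "(\<integral>x. F x \<partial>torus) / vol \<le> Re (c 0) + e / 2"
      using vol_pos by (simp_all add: field_simps)
    ultimately show ?thesis by (simp add: abs_le_iff)
  qed
  then have "\<bar>box_avg F x - (\<integral>x. F x \<partial>torus) / vol\<bar> \<le> 0" by (rule field_le_epsilon)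
  then show ?thesis by simp
qed

text \<open>\<open>line_average\<close> is used along one lattice vector and, under the integral,
  along the other. The factors \<open>2 * pi\<close> arise because the lattice vectors are
  \<open>2 * pi\<close> times \<open>dir 0\<close> and \<open>dir 1\<close>.\<close>

lemma sup_le_integral:
  assumes c: "fin c"
  shows "vol * \<bar>T c x\<bar> \<le> Ip 1 (T c) + 2 * pi * Ip 1 (T (dir_deriv (dir 1) c)) + 2 * pi * Ip 1 (T (dir_deriv (dir 0) c))
     + (2 * pi)\<^sup>2 * Ip 1 (T (dir_deriv (dir 1) (dir_deriv (dir 0) c)))"
proof -
  let ?y = "lat (1, 0)" and ?z = "lat (0, 1)"
  define F where "F x = (\<bar>T c x\<bar> + \<bar>T (dir_deriv ?z c) x\<bar>) + (\<bar>T (dir_deriv ?y c) x\<bar> + \<bar>T (dir_deriv ?z (dir_deriv ?y c)) x\<bar>)" for x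
  have cF: "cper F" unfolding F_def by (intro cper_add cper_abs cper_T)
  have line: "\<bar>T b w\<bar> \<le> integral {0..1} (\<lambda>s. \<bar>T b (w + s *\<^sub>R y)\<bar> + \<bar>T (dir_deriv y b) (w + s *\<^sub>R y)\<bar>)" if "fin b" for b w y
  proof -
    have "continuous_on UNIV (\<lambda>t. T (dir_deriv y b) (w + t *\<^sub>R y))"
      by (intro cper_continuous[OF cper_T] continuous_intros)
    from line_average[OF T_line_deriv[OF that, of w y] this] show ?thesis by simp
  qed
  have ab: "cper (\<lambda>x. \<bar>T b x\<bar> + \<bar>T b' x\<bar>)" for b b' by (intro cper_add cper_abs cper_T)
  have "\<bar>T c x\<bar> \<le> integral {0..1} (\<lambda>s. \<bar>T c (x + s *\<^sub>R ?y)\<bar> + \<bar>T (dir_deriv ?y c) (x + s *\<^sub>R ?y)\<bar>)"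
    by (rule line[OF c])
  also have "\<dots> \<le> box_avg F x"
    unfolding box_avg_def
  proof (rule integral_le)
    show "(\<lambda>s. \<bar>T c (x + s *\<^sub>R ?y)\<bar> + \<bar>T (dir_deriv ?y c) (x + s *\<^sub>R ?y)\<bar>) integrable_on {0..1}"
      by (rule box_integrable(1)[OF ab])
    show "(\<lambda>s. integral {0..1} (\<lambda>t. F (x + s *\<^sub>R ?y + t *\<^sub>R ?z))) integrable_on {0..1}"
      by (rule box_integrable(2)[OF cF])
    fix s :: real
    have "integral {0..1} (\<lambda>t. F (x + s *\<^sub>R ?y + t *\<^sub>R ?z)) =
      integral {0..1} (\<lambda>t. \<bar>T c (x + s *\<^sub>R ?y + t *\<^sub>R ?z)\<bar> + \<bar>T (dir_deriv ?z c) (x + s *\<^sub>R ?y + t *\<^sub>R ?z)\<bar>)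
      + integral {0..1} (\<lambda>t. \<bar>T (dir_deriv ?y c) (x + s *\<^sub>R ?y + t *\<^sub>R ?z)\<bar> + \<bar>T (dir_deriv ?z (dir_deriv ?y c)) (x + s *\<^sub>R ?y + t *\<^sub>R ?z)\<bar>)"
      unfolding F_def by (rule Henstock_Kurzweil_Integration.integral_add) (rule box_integrable(1)[OF ab])+
    then show "\<bar>T c (x + s *\<^sub>R ?y)\<bar> + \<bar>T (dir_deriv ?y c) (x + s *\<^sub>R ?y)\<bar> \<le> integral {0..1} (\<lambda>t. F (x + s *\<^sub>R ?y + t *\<^sub>R ?z))"
      using line[OF c, of "x + s *\<^sub>R ?y" ?z] line[OF fin_dir_deriv[OF c], of ?y "x + s *\<^sub>R ?y" ?z] by simp
  qed
  also have "\<dots> = (\<integral>x. F x \<partial>torus) / vol" by (rule box_avg_eq[OF cF])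
  finally have "vol * \<bar>T c x\<bar> \<le> (\<integral>x. F x \<partial>torus)" using vol_pos by (simp add: field_simps)
  also have "\<dots> = Ip 1 (T c) + Ip 1 (T (dir_deriv ?z c)) + (Ip 1 (T (dir_deriv ?y c)) + Ip 1 (T (dir_deriv ?z (dir_deriv ?y c))))"
    unfolding F_def Ip_def by (simp add: cper_abs)
  finally have le: "vol * \<bar>T c x\<bar> \<le> Ip 1 (T c) + Ip 1 (T (dir_deriv ?z c)) + (Ip 1 (T (dir_deriv ?y c)) + Ip 1 (T (dir_deriv ?z (dir_deriv ?y c))))" .
  have z: "T (dir_deriv ?z c) = (\<lambda>x. 2 * pi * T (dir_deriv (dir 1) c) x)"
  proof
    fix x
    have "dir_deriv ?z c = (\<lambda>k. of_real (2 * pi) * dir_deriv (dir 1) c k)" by (rule ext) (simp add: dir_deriv_def ph_def dir_def)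
    then show "T (dir_deriv ?z c) x = 2 * pi * T (dir_deriv (dir 1) c) x" by (simp only:) (rule T_scale[OF fin_dir_deriv[OF c]])
  qed
  have y: "T (dir_deriv ?y c) = (\<lambda>x. 2 * pi * T (dir_deriv (dir 0) c) x)"
  proof
    fix x
    have "dir_deriv ?y c = (\<lambda>k. of_real (2 * pi) * dir_deriv (dir 0) c k)" by (rule ext) (simp add: dir_deriv_def ph_def dir_def)
    then show "T (dir_deriv ?y c) x = 2 * pi * T (dir_deriv (dir 0) c) x" by (simp only:) (rule T_scale[OF fin_dir_deriv[OF c]])
  qed
  have zy: "T (dir_deriv ?z (dir_deriv ?y c)) = (\<lambda>x. (2 * pi)\<^sup>2 * T (dir_deriv (dir 1) (dir_deriv (dir 0) c)) x)"
  proof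
    fix x
    have "dir_deriv ?z (dir_deriv ?y c) = (\<lambda>k. of_real ((2 * pi)\<^sup>2) * dir_deriv (dir 1) (dir_deriv (dir 0) c) k)"
      by (rule ext) (simp add: dir_deriv_def ph_def dir_def power2_eq_square)
    then show "T (dir_deriv ?z (dir_deriv ?y c)) x = (2 * pi)\<^sup>2 * T (dir_deriv (dir 1) (dir_deriv (dir 0) c)) x"
      by (simp only:) (rule T_scale[OF fin_dir_deriv[OF fin_dir_deriv[OF c]]])
  qed
  have sc: "Ip 1 (\<lambda>x. r * f x) = r * Ip 1 f" if "0 < r" for r f
    using that by (simp add: Ip_scale)
  have p: "0 < 2 * pi" "0 < (2 * pi)\<^sup>2" by simp_all
  from le show ?thesis unfolding z y zy sc[OF p(1)] sc[OF p(2)] by (simp only: add.assoc)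
qed

section \<open>Estimates for the inverse Laplacian\<close>

text \<open>The frequency \<open>k\<close> has eigenvalue \<open>2 / 3 * freq_sum k\<close>; at \<open>k = 0\<close> the convention
  \<open>3 / (2 * 0) = 0\<close> makes \<open>inv_laplace\<close> discard the mean.\<close>
definition inv_laplace :: "(int \<times> int \<Rightarrow> complex) \<Rightarrow> int \<times> int \<Rightarrow> complex" where
  "inv_laplace c = (\<lambda>k. of_real (3 / (2 * freq_sum k)) * c k)"

lemma fin_inv_laplace [intro]: "fin c \<Longrightarrow> fin (inv_laplace c)"
  unfolding inv_laplace_def by (rule fin_mult)

lemma inv_laplace_zero [simp]: "inv_laplace c 0 = 0"
  by (simp add: inv_laplace_def freq_sum_def)

lemma ph_freq: "ph k y = ph1 y * freq 0 k + ph2 y * freq 1 k"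
  by (simp add: ph_def freq_def)

lemma hess_Lp:
  assumes p: "1 < p"
  shows "\<exists>C>0. \<forall>c. fin c \<longrightarrow> Ip p (T (dir_deriv y (dir_deriv z (inv_laplace c)))) \<le> C * Ip p (T c)"
proof -
  \<comment> \<open>The coefficients come from polarising the mixed product of frequencies. The
    factor \<open>- 3 / 2\<close> combines the square of \<open>\<i>\<close> with the constant of
    the inverse Laplacian.\<close>
  let ?m = "(ph1 y * ph2 z + ph2 y * ph1 z) / 2"
  let ?a = "- 3 / 2 * (ph1 y * ph1 z + ?m)" and ?b = "- 3 / 2 * (ph2 y * ph2 z + ?m)" and ?d = "3 / 2 * ?m"
  have "dir_deriv y (dir_deriv z (inv_laplace c)) = (\<lambda>k. of_real (quad ?a ?b ?d k / freq_sum k) * c k)" for c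
  proof
    fix k
    have k2: "freq 2 k = freq 0 k - freq 1 k" by (simp add: freq_def)
    have e: "- (3 / 2) * (ph k y * ph k z) = quad ?a ?b ?d k"
      unfolding ph_freq quad_def k2 by (simp add: power2_eq_square field_simps)
    have q: "quad ?a ?b ?d k / freq_sum k = - (ph k y * ph k z * (3 / (2 * freq_sum k)))"
      unfolding e[symmetric] by simp
    show "dir_deriv y (dir_deriv z (inv_laplace c)) k = of_real (quad ?a ?b ?d k / freq_sum k) * c k"
      unfolding q by (simp add: dir_deriv_def inv_laplace_def mult_ac)
  qed
  then show ?thesis using quad_Lp[OF p, of ?a ?b ?d] by simp
qed

text \<open>A derivative has no constant term, so \<open>poincare\<close> reduces the bound to
  second derivatives.\<close>

lemma Ip_dir_deriv_inv_laplace: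
  assumes p: "1 < p"
  shows "\<exists>C>0. \<forall>c. fin c \<longrightarrow> Ip p (T (dir_deriv y (inv_laplace c))) \<le> C * Ip p (T c)"
proof -
  obtain C0 C1 where C: "0 < C0" "0 < C1"
    "\<And>c. fin c \<Longrightarrow> Ip p (T (dir_deriv (dir 0) (dir_deriv y (inv_laplace c)))) \<le> C0 * Ip p (T c)"
    "\<And>c. fin c \<Longrightarrow> Ip p (T (dir_deriv (dir 1) (dir_deriv y (inv_laplace c)))) \<le> C1 * Ip p (T c)"
    using hess_Lp[OF p, of "dir 0" y] hess_Lp[OF p, of "dir 1" y] by blast
  let ?K = "2 powr p * (2 * pi) powr p"
  have "Ip p (T (dir_deriv y (inv_laplace c))) \<le> (?K * (C0 + C1)) * Ip p (T c)" if c: "fin c" for c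
  proof -
    have "Ip p (T (dir_deriv y (inv_laplace c))) \<le> ?K * (Ip p (T (dir_deriv (dir 0) (dir_deriv y (inv_laplace c)))) + Ip p (T (dir_deriv (dir 1) (dir_deriv y (inv_laplace c)))))"
      by (rule poincare) (use p c in auto)
    also have "\<dots> \<le> ?K * (C0 * Ip p (T c) + C1 * Ip p (T c))"
      by (intro mult_left_mono add_mono C c) simp
    finally show ?thesis by (simp add: algebra_simps)
  qed
  moreover have "0 < ?K * (C0 + C1)" using C by (intro mult_pos_pos) auto
  ultimately show ?thesis by blast
qed

lemma sup_le_hess:
  "\<exists>K>0. \<forall>c. fin c \<longrightarrow> c 0 = 0 \<longrightarrow> (\<forall>x. \<bar>T c x\<bar> \<le> K * (\<Sum>i<2. \<Sum>j<2. Ip 1 (T (dir_deriv (dir i) (dir_deriv (dir j) c)))))"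
proof -
  define k where "k = 2 powr 1 * (2 * pi) powr 1"
  have k: "0 < k" by (simp add: k_def)
  \<comment> \<open>Two Poincare steps for the function give \<open>2 * k\<^sup>2\<close>, one step
    for each of the two first derivatives gives \<open>4 * pi * k\<close>, and the mixed derivative
    gives the last term.\<close>
  define K where "K = (2 * k\<^sup>2 + 4 * pi * k + (2 * pi)\<^sup>2) / vol"
  have "\<bar>T c x\<bar> \<le> K * (\<Sum>i<2. \<Sum>j<2. Ip 1 (T (dir_deriv (dir i) (dir_deriv (dir j) c))))" if c: "fin c" "c 0 = 0" for c x
  proof -
    let ?S = "\<Sum>i<2. \<Sum>j<2. Ip 1 (T (dir_deriv (dir i) (dir_deriv (dir j) c)))"
    define a where "a i j = Ip 1 (T (dir_deriv (dir i) (dir_deriv (dir j) c)))" for i j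
    have S: "?S = a 0 0 + a 0 1 + (a 1 0 + a 1 1)" by (simp add: a_def eval_nat_numeral)
    have a0: "0 \<le> a i j" for i j by (simp add: a_def)
    have g: "Ip 1 (T (dir_deriv (dir j) c)) \<le> k * (a 0 j + a 1 j)" for j
      unfolding k_def a_def by (rule poincare) (use c in auto)
    have g0: "Ip 1 (T (dir_deriv (dir 0) c)) \<le> k * ?S" "Ip 1 (T (dir_deriv (dir 1) c)) \<le> k * ?S"
      using k a0 by (auto intro!: order_trans[OF g] mult_left_mono simp: S)
    have "Ip 1 (T c) \<le> k * (Ip 1 (T (dir_deriv (dir 0) c)) + Ip 1 (T (dir_deriv (dir 1) c)))"
      unfolding k_def by (rule poincare) (use c in auto)
    also have "\<dots> \<le> k * (k * ?S + k * ?S)" using g0 k by (intro mult_left_mono add_mono) auto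
    finally have "Ip 1 (T c) \<le> 2 * k\<^sup>2 * ?S" by (simp add: power2_eq_square algebra_simps)
    moreover have "Ip 1 (T (dir_deriv (dir 1) (dir_deriv (dir 0) c))) \<le> ?S"
      unfolding S using a0[of 0 0] a0[of 0 1] a0[of 1 1] unfolding a_def by linarith
    ultimately have "vol * \<bar>T c x\<bar> \<le> 2 * k\<^sup>2 * ?S + 2 * pi * (k * ?S) + 2 * pi * (k * ?S) + (2 * pi)\<^sup>2 * ?S"
      using g0 by (intro order_trans[OF sup_le_integral[OF c(1)]] add_mono mult_left_mono) auto
    also have "\<dots> = vol * (K * ?S)" using vol_pos by (simp add: K_def field_simps)
    finally show ?thesis using vol_pos by simp
  qed
  moreover have "0 < K" unfolding K_def using vol_pos k by (intro divide_pos_pos add_pos_pos) auto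
  ultimately show ?thesis by blast
qed

text \<open>The sup norm is controlled by \<open>L^1\<close> norms of second derivatives, and these
  by \<open>L^p\<close> norms through Jensen's inequality, so every \<open>p > 1\<close> is covered.
  The factor 4 counts the pairs of directions.\<close>

lemma inv_laplace_sup:
  assumes p: "1 < p"
  shows "\<exists>C>0. \<forall>c. fin c \<longrightarrow> (\<forall>x. \<bar>T (inv_laplace c) x\<bar> powr p \<le> C * Ip p (T c))"
proof -
  obtain K where K: "0 < K" "\<And>c x. fin c \<Longrightarrow> c 0 = 0 \<Longrightarrow> \<bar>T c x\<bar> \<le> K * (\<Sum>i<2. \<Sum>j<2. Ip 1 (T (dir_deriv (dir i) (dir_deriv (dir j) c))))"
    using sup_le_hess by blast
  have "\<forall>i j. \<exists>C>0. \<forall>c. fin c \<longrightarrow> Ip p (T (dir_deriv (dir i) (dir_deriv (dir j) (inv_laplace c)))) \<le> C * Ip p (T c)"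
    using hess_Lp[OF p] by blast
  then obtain C where C: "\<And>i j. 0 < C i j" "\<And>i j c. fin c \<Longrightarrow> Ip p (T (dir_deriv (dir i) (dir_deriv (dir j) (inv_laplace c)))) \<le> C i j * Ip p (T c)"
    by metis
  define M where "M = (4 * K) powr p * (vol powr (p - 1) * (\<Sum>i<2. \<Sum>j<2. C i j))"
  have "\<bar>T (inv_laplace c) x\<bar> powr p \<le> M * Ip p (T c)" if c: "fin c" for c x
  proof -
    define a where "a v = Ip 1 (T (dir_deriv (dir (fst v)) (dir_deriv (dir (snd v)) (inv_laplace c))))" for v
    let ?I = "{..<2::nat} \<times> {..<2::nat}"
    have aC: "a v powr p \<le> vol powr (p - 1) * (C (fst v) (snd v) * Ip p (T c))" for v
    proof -
      have "a v powr p \<le> vol powr (p - 1) * Ip p (T (dir_deriv (dir (fst v)) (dir_deriv (dir (snd v)) (inv_laplace c))))"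
        using jensen_Ip(2)[of p "T (dir_deriv (dir (fst v)) (dir_deriv (dir (snd v)) (inv_laplace c)))"] p
        by (simp add: a_def Ip_def cper_measurable cper_abs_powr)
      also have "\<dots> \<le> vol powr (p - 1) * (C (fst v) (snd v) * Ip p (T c))"
        by (intro mult_left_mono C c) simp
      finally show ?thesis .
    qed
    have "\<bar>T (inv_laplace c) x\<bar> \<le> K * (\<Sum>v\<in>?I. a v)"
      using K(2)[OF fin_inv_laplace[OF c] inv_laplace_zero] unfolding a_def by (simp add: sum.cartesian_product case_prod_unfold)
    also have "\<dots> = 4 * K * \<bar>(\<Sum>v\<in>?I. a v) / card ?I\<bar>" by (simp add: a_def sum_nonneg)
    finally have "\<bar>T (inv_laplace c) x\<bar> powr p \<le> (4 * K) powr p * \<bar>(\<Sum>v\<in>?I. a v) / card ?I\<bar> powr p"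
      using K(1) p by (subst powr_mult[symmetric]) (auto intro!: powr_mono2)
    also have "\<dots> \<le> (4 * K) powr p * ((\<Sum>v\<in>?I. \<bar>a v\<bar> powr p) / card ?I)"
      using p by (intro mult_left_mono power_mean) (auto simp: lessThan_empty_iff)
    also have "\<dots> \<le> (4 * K) powr p * (\<Sum>v\<in>?I. \<bar>a v\<bar> powr p)"
      by (intro mult_left_mono) (auto simp: sum_nonneg)
    also have "\<dots> \<le> (4 * K) powr p * (\<Sum>v\<in>?I. vol powr (p - 1) * (C (fst v) (snd v) * Ip p (T c)))"
      using aC by (intro mult_left_mono sum_mono) (auto simp: a_def)
    also have "\<dots> = M * Ip p (T c)"
      by (simp add: M_def sum.cartesian_product case_prod_unfold sum_distrib_left sum_distrib_right mult_ac)
    finally show ?thesis .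
  qed
  moreover have "0 < M" unfolding M_def using K(1) vol_pos C(1)
    by (intro mult_pos_pos sum_pos) (auto simp: lessThan_empty_iff)
  ultimately show ?thesis by blast
qed

section \<open>Density and completeness\<close>

text \<open>The distance to the sides of the cell in phase coordinates, 0 outside. A cutoff made
  from it vanishes at the boundary points, the only points of \<open>ccell\<close> that the torus
  identifies.\<close>

definition depth :: "real^2 \<Rightarrow> real" where
  "depth x = max 0 (min (min (ph1 x) (2 * pi - ph1 x)) (min (ph2 x) (2 * pi - ph2 x)))"

lemma continuous_depth [continuous_intros]: "continuous_on S f \<Longrightarrow> continuous_on S (\<lambda>x. depth (f x))"
  unfolding depth_def by (intro continuous_intros)

lemma AE_torus_negligible:
  assumes "negligible N" "\<And>x. x \<in> cell \<Longrightarrow> x \<notin> N \<Longrightarrow> P x"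
  shows "AE x in torus. P x"
proof -
  have "AE x in lebesgue. x \<notin> N" using assms(1) by (intro AE_not_in) (simp add: negligible_iff_null_sets)
  then have "AE x in lebesgue. x \<in> cell \<longrightarrow> P x" by (rule AE_mp) (use assms(2) in auto)
  then show ?thesis unfolding torus_def by (simp add: AE_restrict_space_iff)
qed

lemma negligible_edges: "negligible {x. ph1 x = 0 \<or> ph2 x = 0}"
proof -
  have "ph1 x = vector [1, - 1 / sqrt 3] \<bullet> x" "ph2 x = vector [0, 2 / sqrt 3] \<bullet> x" for x
    by (simp_all add: inner_vec_def sum_2 vector_2 ph1_def ph2_def)
  then have "{x. ph1 x = 0 \<or> ph2 x = 0} = {x. vector [1, - 1 / sqrt 3] \<bullet> x = 0} \<union> {x :: real^2. vector [0, 2 / sqrt 3] \<bullet> x = 0}"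
    by auto
  moreover have "vector [1, - 1 / sqrt 3] \<noteq> (0 :: real^2)" "vector [0, 2 / sqrt 3] \<noteq> (0 :: real^2)"
    by (simp_all add: vec_eq_iff forall_2 vector_2)
  ultimately show ?thesis by (auto intro!: negligible_Un negligible_hyperplane)
qed

lemma Psi_inj_interior:
  assumes "x \<in> ccell" "y \<in> ccell" "Psi x = Psi y" "0 < depth x"
  shows "x = y"
proof -
  have key: "a = b" if c: "cis a = cis b" "0 < a" "a < 2 * pi" "0 \<le> b" "b \<le> 2 * pi" for a b
  proof -
    obtain m :: int where m: "a = b + 2 * pi * of_int m" using cis_eq_imp[OF c(1)] by blast
    have "- 1 < (a - b) / (2 * pi)" "(a - b) / (2 * pi) < 1" using c by (auto simp: field_simps)
    moreover have "(a - b) / (2 * pi) = of_int m" using m by simp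
    ultimately have "m = 0" by linarith
    then show ?thesis using m by simp
  qed
  show ?thesis
    by (rule ph_eqI; rule key) (use assms in \<open>auto simp: Psi_def ccell_def depth_def max_def split: if_splits\<close>)
qed

text \<open>A Lebesgue measurable function is an almost everywhere limit of continuous ones.
  Clipping keeps them within \<open>R\<close>, and a cutoff by \<open>depth\<close> makes them
  compatible with the identification of sides; the cutoff equals 1 eventually at each interior
  point. The uniform error, at most 1, explains the bound \<open>R + 1\<close>.\<close>

lemma trig_bounded_approx:
  assumes g: "g \<in> borel_measurable torus" and R: "0 < R" "\<And>x. x \<in> cell \<Longrightarrow> \<bar>g x\<bar> \<le> R"
  obtains c where "\<And>n. fin (c n)" "\<And>n x. \<bar>T (c n) x\<bar> \<le> R + 1" "AE x in torus. (\<lambda>n. T (c n) x) \<longlonglongrightarrow> g x"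
proof -
  define g' where "g' x = indicator cell x *\<^sub>R g x" for x
  have "g' \<in> borel_measurable lebesgue"
    using g unfolding g'_def torus_def by (subst (asm) borel_measurable_restrict_space_iff) auto
  then have "g' measurable_on UNIV" by (intro lebesgue_measurable_imp_measurable_on_real) auto
  then obtain N H where N: "negligible N" and H: "\<And>n. continuous_on UNIV (H n)" "\<And>x. x \<notin> N \<Longrightarrow> (\<lambda>n. H n x) \<longlonglongrightarrow> g' x"
    unfolding measurable_on_def by auto
  define h where "h n x = max (- R) (min R (H n x)) * min 1 (real n * depth x)" for n x
  have hc: "continuous_on ccell (h n)" for n
    unfolding h_def by (intro continuous_intros continuous_on_subset[OF H(1)]) auto
  have d0: "0 \<le> depth x" for x by (simp add: depth_def)
  have hR: "\<bar>h n x\<bar> \<le> R" for n x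
  proof -
    have "\<bar>h n x\<bar> \<le> R * 1" unfolding h_def abs_mult using R(1) d0[of x] by (intro mult_mono) auto
    then show ?thesis by simp
  qed
  have hP: "h n x = h n y" if xy: "x \<in> ccell" "y \<in> ccell" "Psi x = Psi y" for n x y
  proof (cases "0 < depth x \<or> 0 < depth y")
    case True
    then have "x = y" using Psi_inj_interior xy by metis
    then show ?thesis by simp
  next
    case False
    then have "depth x = 0" "depth y = 0" using d0[of x] d0[of y] by auto
    then show ?thesis by (simp add: h_def)
  qed
  have "\<exists>c. fin c \<and> (\<forall>x\<in>ccell. \<bar>h n x - T c x\<bar> < inverse (Suc n))" for n
  proof -
    have "0 < inverse (real (Suc n))" by simp
    then obtain t where "trig t" "\<And>x. x \<in> ccell \<Longrightarrow> \<bar>h n x - t x\<bar> < inverse (real (Suc n))"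
      using trig_uniform_approx[OF hc[of n] hP[where n = n]] by metis
    then show ?thesis by (auto simp: trig_def)
  qed
  then obtain c where c: "\<And>n. fin (c n)" "\<And>n x. x \<in> ccell \<Longrightarrow> \<bar>h n x - T (c n) x\<bar> < inverse (Suc n)" by metis
  have b: "\<bar>T (c n) x\<bar> \<le> R + 1" for n x
  proof -
    have "x + lat (red x) \<in> ccell" using cell_red cell_subset by blast
    from c(2)[OF this, of n] have "\<bar>h n (x + lat (red x)) - T (c n) x\<bar> < inverse (Suc n)"
      by (simp add: cper_lat[OF cper_T])
    moreover have "inverse (real (Suc n)) \<le> 1" by (simp add: inverse_le_1_iff)
    ultimately show ?thesis using hR[of n "x + lat (red x)"] by linarith
  qed
  have lim: "(\<lambda>n. T (c n) x) \<longlonglongrightarrow> g x" if x: "x \<in> cell" "x \<notin> N \<union> {x. ph1 x = 0 \<or> ph2 x = 0}" for x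
  proof -
    have dx: "0 < depth x" using x by (auto simp: cell_iff depth_def max_def)
    have "(\<lambda>n. max (- R) (min R (H n x))) \<longlonglongrightarrow> max (- R) (min R (g' x))"
      using x by (intro tendsto_intros H) auto
    moreover have "max (- R) (min R (g' x)) = g x" using R(2)[OF x(1)] x(1) by (simp add: g'_def)
    moreover have "\<forall>\<^sub>F n in sequentially. h n x = max (- R) (min R (H n x))"
    proof -
      obtain M :: nat where M: "1 / depth x < M" using reals_Archimedean2 by blast
      show ?thesis
      proof (rule eventually_sequentiallyI[of M])
        fix n assume "M \<le> n"
        then have "1 / depth x \<le> real n" using M by linarith
        then have "1 \<le> real n * depth x" using dx by (simp add: field_simps)
        then show "h n x = max (- R) (min R (H n x))" by (simp add: h_def)
      qed
    qed
    ultimately have h: "(\<lambda>n. h n x) \<longlonglongrightarrow> g x" by (simp add: tendsto_cong)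
    have "x \<in> ccell" using x cell_subset by blast
    have "(\<lambda>n. h n x - T (c n) x) \<longlonglongrightarrow> 0"
      by (rule Lim_null_comparison[OF always_eventually LIMSEQ_inverse_real_of_nat])
        (use c(2)[OF \<open>x \<in> ccell\<close>] in \<open>auto intro: less_imp_le\<close>)
    from tendsto_diff[OF h this] show ?thesis by simp
  qed
  have "AE x in torus. (\<lambda>n. T (c n) x) \<longlonglongrightarrow> g x"
    by (rule AE_torus_negligible[OF negligible_Un[OF N negligible_edges] lim])
  then show thesis using that c(1) b by blast
qed

text \<open>Bounded trigonometric polynomials converge almost everywhere to \<open>sgn f\<close>.
  Dominated convergence turns the vanishing of all coefficients into a vanishing integral of
  \<open>\<bar>f\<bar>\<close>, for \<open>f\<close> merely integrable.\<close>

lemma fourier_unique: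
  assumes f: "integrable torus f" and z: "\<And>k c. (\<integral>x. f x * mode k c x \<partial>torus) = 0"
  shows "AE x in torus. f x = 0"
proof -
  have [measurable]: "f \<in> borel_measurable torus" using f by simp
  obtain c where c: "\<And>n. fin (c n)" "\<And>n x. \<bar>T (c n) x\<bar> \<le> 1 + 1" "AE x in torus. (\<lambda>n. T (c n) x) \<longlonglongrightarrow> sgn (f x)"
    by (rule trig_bounded_approx[of "\<lambda>x. sgn (f x)" 1]) (auto simp: abs_sgn_eq)
  have zn: "(\<integral>x. f x * T (c n) x \<partial>torus) = 0" for n
  proof -
    have "integrable torus (\<lambda>x. f x * mode k b x)" for k b
    proof (rule Bochner_Integration.integrable_bound[OF integrable_mult_right[OF integrable_abs[OF f], of "cmod b"]])
      show "AE x in torus. norm (f x * mode k b x) \<le> norm (cmod b * \<bar>f x\<bar>)"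
      proof (rule AE_I2)
        fix x
        show "norm (f x * mode k b x) \<le> norm (cmod b * \<bar>f x\<bar>)"
          using mult_right_mono[OF mode_bound[of k b x], of "\<bar>f x\<bar>"] by (simp add: abs_mult mult.commute)
      qed
    qed (use cper_measurable[OF cper_mode] in measurable)
    then show ?thesis unfolding T_def sum_distrib_left by (subst Bochner_Integration.integral_sum) (auto simp: z)
  qed
  have "(\<lambda>n. \<integral>x. f x * T (c n) x \<partial>torus) \<longlonglongrightarrow> (\<integral>x. f x * sgn (f x) \<partial>torus)"
  proof (rule integral_dominated_convergence[where w = "\<lambda>x. 2 * \<bar>f x\<bar>"])
    show "AE x in torus. (\<lambda>n. f x * T (c n) x) \<longlonglongrightarrow> f x * sgn (f x)"
      using c(3) by (rule AE_mp) (auto intro!: AE_I2 tendsto_intros)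
    show "AE x in torus. norm (f x * T (c n) x) \<le> 2 * \<bar>f x\<bar>" for n
      using mult_left_mono[OF c(2)[of n], of "\<bar>f x\<bar>" for x] by (intro AE_I2) (simp add: abs_mult mult.commute)
  qed (use f cper_measurable[OF cper_T] in \<open>auto intro!: borel_measurable_times\<close>)
  then have "(\<integral>x. f x * sgn (f x) \<partial>torus) = 0" unfolding zn by (simp add: LIMSEQ_const_iff)
  then have "(\<integral>x. \<bar>f x\<bar> \<partial>torus) = 0" by (simp add: abs_sgn)
  then have "AE x in torus. \<bar>f x\<bar> = 0" using f by (subst (asm) integral_nonneg_eq_0_iff_AE) auto
  then show ?thesis by simp
qed

text \<open>Norm estimates concern the cell only; periodicity is restored where membership in
  \<open>Lp\<close> is claimed.\<close>

definition Lm :: "real \<Rightarrow> (real^2 \<Rightarrow> real) set" where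
  "Lm p = {f. f \<in> borel_measurable torus \<and> integrable torus (\<lambda>x. \<bar>f x\<bar> powr p)}"

lemma Lm_cper: "cper f \<Longrightarrow> 0 < p \<Longrightarrow> f \<in> Lm p"
  by (auto simp: Lm_def cper_measurable cper_abs_powr)

lemma Lm_Lp: "f \<in> Lp p \<Longrightarrow> f \<in> Lm p"
  by (simp add: Lm_def Lp_def torus_measurable_def)

lemma Lm_bounded: "f \<in> borel_measurable torus \<Longrightarrow> (\<And>x. x \<in> cell \<Longrightarrow> \<bar>f x\<bar> \<le> R) \<Longrightarrow> 0 < p \<Longrightarrow> f \<in> Lm p"
  unfolding Lm_def
  by (auto intro!: integrable_torus_bounded[of _ "R powr p"] powr_mono2)

lemma Lm_add:
  assumes "0 < p" "f \<in> Lm p" "g \<in> Lm p"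
  shows "(\<lambda>x. f x + g x) \<in> Lm p" "Ip p (\<lambda>x. f x + g x) \<le> 2 powr p * (Ip p f + Ip p g)"
proof -
  have [measurable]: "f \<in> borel_measurable torus" "g \<in> borel_measurable torus" using assms by (auto simp: Lm_def)
  have i: "integrable torus (\<lambda>x. 2 powr p * (\<bar>f x\<bar> powr p + \<bar>g x\<bar> powr p))" using assms by (auto simp: Lm_def)
  have le: "\<bar>f x + g x\<bar> powr p \<le> 2 powr p * (\<bar>f x\<bar> powr p + \<bar>g x\<bar> powr p)" for x
  proof -
    have "\<bar>f x + g x\<bar> powr p \<le> (\<bar>f x\<bar> + \<bar>g x\<bar>) powr p" using assms by (intro powr_mono2) auto
    also have "\<dots> \<le> 2 powr p * (\<bar>f x\<bar> powr p + \<bar>g x\<bar> powr p)" using assms by (intro powr_add_le) auto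
    finally show ?thesis .
  qed
  have j: "integrable torus (\<lambda>x. \<bar>f x + g x\<bar> powr p)"
    by (rule Bochner_Integration.integrable_bound[OF i]) (auto intro!: AE_I2 le order_trans[OF le])
  then show "(\<lambda>x. f x + g x) \<in> Lm p" by (simp add: Lm_def)
  have "Ip p (\<lambda>x. f x + g x) \<le> (\<integral>x. 2 powr p * (\<bar>f x\<bar> powr p + \<bar>g x\<bar> powr p) \<partial>torus)"
    unfolding Ip_def by (rule integral_mono[OF j i le])
  also have "\<dots> = 2 powr p * (Ip p f + Ip p g)" using assms by (simp add: Ip_def Lm_def)
  finally show "Ip p (\<lambda>x. f x + g x) \<le> 2 powr p * (Ip p f + Ip p g)" .
qed

lemma Lm_minus: "f \<in> Lm p \<Longrightarrow> (\<lambda>x. - f x) \<in> Lm p"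
  by (simp add: Lm_def)

lemma Lm_diff:
  assumes "0 < p" "f \<in> Lm p" "g \<in> Lm p"
  shows "(\<lambda>x. f x - g x) \<in> Lm p" "Ip p (\<lambda>x. f x - g x) \<le> 2 powr p * (Ip p f + Ip p g)"
  using Lm_add[OF assms(1,2) Lm_minus[OF assms(3)]] by (simp_all add: Ip_def)

lemma Ip_commute: "Ip p (\<lambda>x. f x - g x) = Ip p (\<lambda>x. g x - f x)"
  by (simp add: Ip_def abs_minus_commute)

lemma Ip_triangle:
  assumes "0 < p" "f \<in> Lm p" "g \<in> Lm p" "h \<in> Lm p"
  shows "Ip p (\<lambda>x. f x - h x) \<le> 2 powr p * (Ip p (\<lambda>x. f x - g x) + Ip p (\<lambda>x. g x - h x))"
  using Lm_add(2)[OF assms(1) Lm_diff(1)[OF assms(1,2,3)] Lm_diff(1)[OF assms(1,3,4)]] by simp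

lemma Lm_integrable: "1 \<le> p \<Longrightarrow> f \<in> Lm p \<Longrightarrow> integrable torus f"
  by (rule jensen_Ip(1)) (auto simp: Lm_def)

lemma Lm_jensen: "1 \<le> p \<Longrightarrow> f \<in> Lm p \<Longrightarrow> (\<integral>x. \<bar>f x\<bar> \<partial>torus) powr p \<le> vol powr (p - 1) * Ip p f"
  by (rule jensen_Ip(2)) (auto simp: Lm_def)

lemma Ip_tendsto_L1:
  assumes p: "1 \<le> p" and f: "\<And>n. f n \<in> Lm p" and l: "(\<lambda>n. Ip p (f n)) \<longlonglongrightarrow> 0"
  shows "(\<lambda>n. \<integral>x. \<bar>f n x\<bar> \<partial>torus) \<longlonglongrightarrow> 0"
proof -
  have "(\<lambda>n. (\<integral>x. \<bar>f n x\<bar> \<partial>torus) powr p) \<longlonglongrightarrow> 0"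
    by (rule tendsto_sandwich[OF _ _ tendsto_const tendsto_mult_right_zero[OF l, of "vol powr (p - 1)"]])
      (use Lm_jensen[OF p f] in auto)
  then have "(\<lambda>n. ((\<integral>x. \<bar>f n x\<bar> \<partial>torus) powr p) powr (1 / p)) \<longlonglongrightarrow> 0 powr (1 / p)"
    using p by (intro tendsto_powr') auto
  then show ?thesis using p by (simp add: powr_powr)
qed

lemma trig_dense_Lm:
  assumes p: "1 \<le> p" and f: "f \<in> Lm p" and e: "0 < e"
  obtains c where "fin c" "Ip p (\<lambda>x. f x - T c x) < e"
proof -
  have [measurable]: "f \<in> borel_measurable torus" using f by (simp add: Lm_def)
  define t where "t n x = max (- real (Suc n)) (min (real (Suc n)) (f x))" for n x
  have tm [measurable]: "t n \<in> borel_measurable torus" for n unfolding t_def by measurable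
  have tb: "\<bar>t n x\<bar> \<le> Suc n" for n x by (auto simp: t_def)
  have tL: "t n \<in> Lm p" for n using tm tb p by (intro Lm_bounded) auto
  have "(\<lambda>n. Ip p (\<lambda>x. f x - t n x)) \<longlonglongrightarrow> (\<integral>x. 0 \<partial>torus)"
    unfolding Ip_def
  proof (rule integral_dominated_convergence[where w = "\<lambda>x. \<bar>f x\<bar> powr p"])
    show "AE x in torus. (\<lambda>n. \<bar>f x - t n x\<bar> powr p) \<longlonglongrightarrow> 0"
    proof (rule AE_I2)
      fix x
      obtain M :: nat where M: "\<bar>f x\<bar> < M" using reals_Archimedean2 by blast
      have "\<forall>\<^sub>F n in sequentially. \<bar>f x - t n x\<bar> powr p = 0"
        by (rule eventually_sequentiallyI[of M]) (use M in \<open>auto simp: t_def\<close>)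
      then show "(\<lambda>n. \<bar>f x - t n x\<bar> powr p) \<longlonglongrightarrow> 0" by (rule tendsto_eventually)
    qed
    show "AE x in torus. norm (\<bar>f x - t n x\<bar> powr p) \<le> \<bar>f x\<bar> powr p" for n
      using p by (intro AE_I2) (auto simp: t_def intro!: powr_mono2)
  qed (use f in \<open>auto simp: Lm_def\<close>)
  then have "\<forall>\<^sub>F n in sequentially. Ip p (\<lambda>x. f x - t n x) < e / (2 * 2 powr p)"
    using e by (intro order_tendstoD) auto
  then obtain n where n: "Ip p (\<lambda>x. f x - t n x) < e / (2 * 2 powr p)" by (auto dest: eventually_happens)
  obtain c where c: "\<And>m. fin (c m)" "\<And>m x. \<bar>T (c m) x\<bar> \<le> real (Suc n) + 1" "AE x in torus. (\<lambda>m. T (c m) x) \<longlonglongrightarrow> t n x"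
    using trig_bounded_approx[OF tm, of "real (Suc n)" n] tb by auto
  have "(\<lambda>m. Ip p (\<lambda>x. t n x - T (c m) x)) \<longlonglongrightarrow> (\<integral>x. 0 \<partial>torus)"
    unfolding Ip_def
  proof (rule torus_dct[where R = "(2 * real (Suc n) + 1) powr p"])
    show "AE x in torus. (\<lambda>m. \<bar>t n x - T (c m) x\<bar> powr p) \<longlonglongrightarrow> 0"
      using c(3)
    proof (rule AE_mp, intro AE_I2 impI)
      fix x assume "(\<lambda>m. T (c m) x) \<longlonglongrightarrow> t n x"
      then have "(\<lambda>m. \<bar>t n x - T (c m) x\<bar> powr p) \<longlonglongrightarrow> \<bar>t n x - t n x\<bar> powr p"
        using p by (intro tendsto_powr' tendsto_intros) auto
      then show "(\<lambda>m. \<bar>t n x - T (c m) x\<bar> powr p) \<longlonglongrightarrow> 0" by simp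
    qed
    show "\<bar>\<bar>t n x - T (c m) x\<bar> powr p\<bar> \<le> (2 * real (Suc n) + 1) powr p" for m x
    proof -
      have "\<bar>t n x - T (c m) x\<bar> \<le> 2 * real (Suc n) + 1" using order_trans[OF abs_triangle_ineq4 add_mono[OF tb[of n x] c(2)[of m x]]] by simp
      then show ?thesis using p by (auto intro!: powr_mono2)
    qed
  qed (use cper_measurable[OF cper_T] in auto)
  then have "\<forall>\<^sub>F m in sequentially. Ip p (\<lambda>x. t n x - T (c m) x) < e / (2 * 2 powr p)"
    using e by (intro order_tendstoD) auto
  then obtain m where m: "Ip p (\<lambda>x. t n x - T (c m) x) < e / (2 * 2 powr p)" by (auto dest: eventually_happens)
  have "Ip p (\<lambda>x. f x - T (c m) x) \<le> 2 powr p * (Ip p (\<lambda>x. f x - t n x) + Ip p (\<lambda>x. t n x - T (c m) x))"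
    using p by (intro Ip_triangle f tL Lm_cper) auto
  also have "\<dots> < 2 powr p * (e / (2 * 2 powr p) + e / (2 * 2 powr p))"
    by (intro mult_strict_left_mono add_strict_mono n m) simp
  also have "\<dots> = e" by (simp add: field_simps)
  finally show thesis using that c(1) by blast
qed

text \<open>Deleting the constant term costs no more than the approximation error: as
  \<open>f\<close> has mean zero, that term is minus the mean of the error, and Jensen's inequality
  applies.\<close>

lemma trig_dense_mean_zero:
  assumes p: "1 \<le> p" and f: "f \<in> Lm p" and e: "0 < e" and mz: "(\<integral>x. f x \<partial>torus) = 0"
  obtains c where "fin c" "c 0 = 0" "Ip p (\<lambda>x. f x - T c x) < e"
proof -
  define e' where "e' = e / (2 * 2 powr p)"
  have "0 < e'" using e by (simp add: e'_def)
  then obtain c where c: "fin c" "Ip p (\<lambda>x. f x - T c x) < e'" using trig_dense_Lm[OF p f] by blast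
  define d where "d k = (if k = 0 then 0 else c k)" for k
  have fd: "fin d" by (rule fin_subset[OF c(1)]) (auto simp: d_def split: if_splits)
  have Td: "T c x = T d x + Re (c 0)" for x
  proof -
    have f0: "fin (\<lambda>k. if k = 0 then c 0 else 0)" by (simp add: fin_def)
    have "T (\<lambda>k. if k = 0 then c 0 else 0) x = Re (c 0)"
      by (subst T_on[of "{0}"]) (auto split: if_splits)
    moreover have "(\<lambda>k. d k + (if k = 0 then c 0 else 0)) = c" by (auto simp: d_def)
    ultimately show ?thesis using T_add[OF fd f0, of x] by simp
  qed
  have L: "T c \<in> Lm p" "T d \<in> Lm p" "(\<lambda>x. f x - T c x) \<in> Lm p"
    using p f by (auto intro!: Lm_cper Lm_diff(1)[OF _ f Lm_cper[OF cper_T]])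
  have "Ip p (\<lambda>x. T c x - T d x) = \<bar>Re (c 0)\<bar> powr p * vol" by (simp add: Td Ip_def)
  also have "\<dots> \<le> Ip p (\<lambda>x. f x - T c x)"
  proof -
    have "vol * Re (c 0) = - (\<integral>x. f x - T c x \<partial>torus)"
      using Lm_integrable[OF p f] by (simp add: mz integral_T[OF c(1)])
    then have "vol * \<bar>Re (c 0)\<bar> \<le> (\<integral>x. \<bar>f x - T c x\<bar> \<partial>torus)"
    proof -
      have "vol * \<bar>Re (c 0)\<bar> = \<bar>vol * Re (c 0)\<bar>" using vol_pos by (simp add: abs_mult)
      also have "\<dots> = \<bar>\<integral>x. f x - T c x \<partial>torus\<bar>" unfolding \<open>vol * Re (c 0) = _\<close> by (rule abs_minus_cancel)
      finally show ?thesis using integral_abs_bound[of torus "\<lambda>x. f x - T c x"] by simp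
    qed
    then have "(vol * \<bar>Re (c 0)\<bar>) powr p \<le> (\<integral>x. \<bar>f x - T c x\<bar> \<partial>torus) powr p"
      using p vol_pos by (intro powr_mono2) auto
    also have "\<dots> \<le> vol powr (p - 1) * Ip p (\<lambda>x. f x - T c x)" by (rule Lm_jensen[OF p L(3)])
    finally have "vol powr (p - 1) * (vol * \<bar>Re (c 0)\<bar> powr p) \<le> vol powr (p - 1) * Ip p (\<lambda>x. f x - T c x)"
      using vol_pos by (simp add: powr_mult powr_diff)
    then show ?thesis using vol_pos by (simp add: mult.commute)
  qed
  finally have "Ip p (\<lambda>x. f x - T d x) \<le> 2 powr p * (Ip p (\<lambda>x. f x - T c x) + Ip p (\<lambda>x. f x - T c x))"
    using p by (intro order_trans[OF Ip_triangle[OF _ f L(1,2)]] mult_left_mono add_left_mono) auto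
  also have "\<dots> < 2 powr p * (e' + e')" using c(2) by (intro mult_strict_left_mono add_strict_mono) auto
  also have "\<dots> = e" by (simp add: e'_def field_simps)
  finally show thesis using that[OF fd] by (simp add: d_def)
qed

lemma Lp_complete:
  assumes p: "1 \<le> p" and cau: "\<And>e. 0 < e \<Longrightarrow> \<exists>N. \<forall>m\<ge>N. \<forall>n\<ge>N. Ip p (\<lambda>x. T (c m) x - T (c n) x) < e"
  obtains h where "h \<in> Lp p" "(\<lambda>n. Ip p (\<lambda>x. h x - T (c n) x)) \<longlonglongrightarrow> 0"
proof -
  have TL: "T b \<in> Lm p" for b using p by (auto intro!: Lm_cper)
  have "\<exists>N. \<forall>i\<ge>N. \<forall>j\<ge>N. (\<integral>x. norm (T (c i) x - T (c j) x) \<partial>torus) < e" if e: "0 < e" for e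
  proof -
    have "0 < e powr p / vol powr (p - 1)" using e vol_pos by simp
    then obtain N where N: "\<And>i j. N \<le> i \<Longrightarrow> N \<le> j \<Longrightarrow> Ip p (\<lambda>x. T (c i) x - T (c j) x) < e powr p / vol powr (p - 1)"
      using cau by blast
    have "(\<integral>x. norm (T (c i) x - T (c j) x) \<partial>torus) < e" if "N \<le> i" "N \<le> j" for i j
    proof -
      have "(\<lambda>x. T (c i) x - T (c j) x) \<in> Lm p" using p TL by (intro Lm_diff) auto
      then have "(\<integral>x. \<bar>T (c i) x - T (c j) x\<bar> \<partial>torus) powr p \<le> vol powr (p - 1) * Ip p (\<lambda>x. T (c i) x - T (c j) x)"
        by (rule Lm_jensen[OF p])
      also have "\<dots> < vol powr (p - 1) * (e powr p / vol powr (p - 1))"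
        using N[OF that] vol_pos by (intro mult_strict_left_mono) auto
      also have "\<dots> = e powr p" using vol_pos by simp
      finally have *: "(\<integral>x. \<bar>T (c i) x - T (c j) x\<bar> \<partial>torus) powr p < e powr p" .
      show ?thesis
      proof (rule ccontr)
        assume "\<not> ?thesis"
        then have "e powr p \<le> (\<integral>x. \<bar>T (c i) x - T (c j) x\<bar> \<partial>torus) powr p" using p e by (intro powr_mono2) auto
        then show False using * by simp
      qed
    qed
    then show ?thesis by blast
  qed
  from cauchy_L1_AE_cauchy_subseq[of torus "\<lambda>n. T (c n)", OF cper_integrable[OF cper_T] this]
  obtain r where r: "strict_mono r" "AE x in torus. Cauchy (\<lambda>i. T (c (r i)) x)" by blast
  \<comment> \<open>The pointwise \<open>lim\<close> is taken at every point, convergent or not, so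
    \<open>h\<close> is periodic everywhere and not just almost everywhere.\<close>
  define h where "h x = lim (\<lambda>i. T (c (r i)) x)" for x
  have hm [measurable]: "h \<in> borel_measurable torus"
    unfolding h_def by (rule borel_measurable_lim_metric) (use cper_measurable[OF cper_T] in auto)
  have conv: "AE x in torus. (\<lambda>i. T (c (r i)) x) \<longlonglongrightarrow> h x"
    using r(2) unfolding h_def by (rule AE_mp) (auto intro!: AE_I2 simp: Cauchy_convergent_iff convergent_LIMSEQ_iff)
  have key: "(\<lambda>x. h x - T (c n) x) \<in> Lm p \<and> Ip p (\<lambda>x. h x - T (c n) x) \<le> e"
    if N: "\<And>m n. N \<le> m \<Longrightarrow> N \<le> n \<Longrightarrow> Ip p (\<lambda>x. T (c m) x - T (c n) x) < e" and n: "N \<le> n" for e N n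
  proof -
    have m: "(\<lambda>x. \<bar>h x - T (c n) x\<bar> powr p) \<in> borel_measurable torus" using cper_measurable[OF cper_T] by measurable
    have "(\<integral>\<^sup>+x. ennreal (\<bar>h x - T (c n) x\<bar> powr p) \<partial>torus) = (\<integral>\<^sup>+x. liminf (\<lambda>i. ennreal (\<bar>T (c (r i)) x - T (c n) x\<bar> powr p)) \<partial>torus)"
    proof (rule nn_integral_cong_AE, rule AE_mp[OF conv], intro AE_I2 impI)
      fix x assume "(\<lambda>i. T (c (r i)) x) \<longlonglongrightarrow> h x"
      then have "(\<lambda>i. ennreal (\<bar>T (c (r i)) x - T (c n) x\<bar> powr p)) \<longlonglongrightarrow> ennreal (\<bar>h x - T (c n) x\<bar> powr p)"
        using p by (intro tendsto_ennrealI tendsto_powr' tendsto_intros) auto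
      then show "ennreal (\<bar>h x - T (c n) x\<bar> powr p) = liminf (\<lambda>i. ennreal (\<bar>T (c (r i)) x - T (c n) x\<bar> powr p))"
        by (rule lim_imp_Liminf[OF sequentially_bot, symmetric])
    qed
    also have "\<dots> \<le> liminf (\<lambda>i. \<integral>\<^sup>+x. ennreal (\<bar>T (c (r i)) x - T (c n) x\<bar> powr p) \<partial>torus)"
      by (rule nn_integral_liminf) (use cper_measurable[OF cper_T] in measurable)
    also have "\<dots> \<le> liminf (\<lambda>i. ennreal e)"
    proof (rule Liminf_mono, rule eventually_sequentiallyI[of N])
      fix i assume "N \<le> i"
      then have "N \<le> r i" using seq_suble[OF r(1), of i] by linarith
      have "integrable torus (\<lambda>x. \<bar>T (c (r i)) x - T (c n) x\<bar> powr p)"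
        using p by (intro cper_integrable cper_abs_powr cper_diff cper_T) auto
      then have "(\<integral>\<^sup>+x. ennreal (\<bar>T (c (r i)) x - T (c n) x\<bar> powr p) \<partial>torus) = ennreal (Ip p (\<lambda>x. T (c (r i)) x - T (c n) x))"
        unfolding Ip_def by (rule nn_integral_eq_integral) simp
      also have "\<dots> \<le> ennreal e" using N[OF \<open>N \<le> r i\<close> n] by (intro ennreal_leI) simp
      finally show "(\<integral>\<^sup>+x. ennreal (\<bar>T (c (r i)) x - T (c n) x\<bar> powr p) \<partial>torus) \<le> ennreal e" .
    qed
    also have "\<dots> = ennreal e" by (simp add: Liminf_const)
    finally have le: "(\<integral>\<^sup>+x. ennreal (\<bar>h x - T (c n) x\<bar> powr p) \<partial>torus) \<le> ennreal e" .
    have i: "integrable torus (\<lambda>x. \<bar>h x - T (c n) x\<bar> powr p)"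
      by (rule integrableI_bounded[OF m]) (use le in \<open>auto simp: less_top[symmetric] top_unique\<close>)
    have "ennreal (Ip p (\<lambda>x. h x - T (c n) x)) \<le> ennreal e"
      unfolding Ip_def using le nn_integral_eq_integral[OF i] by simp
    moreover have "0 < e" using N[OF n n] by (simp add: Ip_def)
    ultimately show ?thesis using i hm cper_measurable[OF cper_T] by (auto simp: Lm_def ennreal_le_iff)
  qed
  have lim: "(\<lambda>n. Ip p (\<lambda>x. h x - T (c n) x)) \<longlonglongrightarrow> 0"
  proof (rule LIMSEQ_I)
    fix e :: real assume "0 < e"
    then obtain N where N: "\<And>m n. N \<le> m \<Longrightarrow> N \<le> n \<Longrightarrow> Ip p (\<lambda>x. T (c m) x - T (c n) x) < e / 2" using cau[of "e / 2"] by auto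
    have "norm (Ip p (\<lambda>x. h x - T (c n) x) - 0) < e" if "N \<le> n" for n
      using key[of N "e / 2" n, OF N that] \<open>0 < e\<close> by simp
    then show "\<exists>N. \<forall>n\<ge>N. norm (Ip p (\<lambda>x. h x - T (c n) x) - 0) < e" by blast
  qed
  obtain N where N: "\<And>m n. N \<le> m \<Longrightarrow> N \<le> n \<Longrightarrow> Ip p (\<lambda>x. T (c m) x - T (c n) x) < 1" using cau[of 1] by auto
  from key[of N 1 N, OF N order_refl] have "(\<lambda>x. h x - T (c N) x) \<in> Lm p" by simp
  from Lm_add(1)[of p, OF _ this TL[of "c N"]] p have "h \<in> Lm p" by simp
  moreover have "periodic h" by (rule periodicI) (simp add: h_def cper_lat[OF cper_T])
  ultimately have "h \<in> Lp p" by (simp add: Lm_def Lp_def torus_measurable_def)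
  then show thesis using that lim by blast
qed

section \<open>Weak derivatives\<close>

lemma differentiable_line:
  fixes f :: "real^2 \<Rightarrow> real"
  assumes "\<And>x. f differentiable (at x)"
  shows "((\<lambda>t. f (x + t *\<^sub>R axis i 1)) has_real_derivative partial_deriv i f (x + t *\<^sub>R axis i 1)) (at t)"
proof -
  let ?z = "x + t *\<^sub>R axis i 1"
  let ?D = "frechet_derivative f (at ?z)"
  have D: "(f has_derivative ?D) (at ?z)" using assms frechet_derivative_works by blast
  have "((\<lambda>t. x + t *\<^sub>R axis i 1) has_derivative (\<lambda>h. h *\<^sub>R axis i 1)) (at t)"
    by (auto intro!: derivative_eq_intros)
  from has_derivative_compose[OF this D]
  have "((\<lambda>t. f (x + t *\<^sub>R axis i 1)) has_derivative (\<lambda>h. ?D (h *\<^sub>R axis i 1))) (at t)" .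
  moreover have "?D (h *\<^sub>R axis i 1) = partial_deriv i f ?z * h" for h
    using linear_scale[OF has_derivative_linear[OF D]] by (simp add: partial_deriv_def mult.commute)
  ultimately show ?thesis by (simp add: has_field_derivative_def)
qed

lemma ph_has_derivative: "(ph k has_derivative ph k) (at x within S)"
proof -
  have "linear (ph k)" by (rule linearI) simp_all
  then show ?thesis by (simp add: linear_imp_has_derivative)
qed

lemma mode_has_derivative: "(mode k c has_derivative (\<lambda>h. mode k (\<i> * of_real (ph k h) * c) x)) (at x)"
proof -
  have "mode k c = (\<lambda>x. Re c * cos (ph k x) - Im c * sin (ph k x))" by (rule ext) (rule mode_eq)
  then show ?thesis
    unfolding mode_eq[of k "\<i> * _ * c"] by (auto intro!: derivative_eq_intros ph_has_derivative simp: algebra_simps)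
qed

lemma partial_deriv_mode: "partial_deriv i (mode k c) = mode k (\<i> * of_real (ph k (axis i 1)) * c)"
  by (rule ext) (simp add: partial_deriv_def frechet_derivative_at[OF mode_has_derivative, symmetric])

lemma test_function_mode: "test_function (mode k c)"
proof -
  have "C_k n (mode k c)" for n
  proof (induction n arbitrary: c)
    case 0
    then show ?case using cper_mode by (simp add: cper_def)
  next
    case (Suc n)
    have "mode k c differentiable (at x)" for x
      using mode_has_derivative[of k c x] unfolding differentiable_def by blast
    then show ?case unfolding C_k.simps partial_deriv_mode using Suc by blast
  qed
  then show ?thesis using cper_mode by (simp add: test_function_def cper_def)
qed

lemma test_function_cper: "test_function f \<Longrightarrow> cper f"
  unfolding test_function_def cper_def by (metis C_k.simps(1))

lemma test_function_differentiable: "test_function f \<Longrightarrow> f differentiable (at x)"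
  unfolding test_function_def by (metis C_k.simps(2))

lemma test_function_partial: assumes "test_function f" shows "test_function (partial_deriv i f)"
proof -
  have per: "periodic f" using assms by (simp add: test_function_def)
  have "partial_deriv i f (x + lat v) = partial_deriv i f x" for x v
  proof -
    have "(f has_derivative frechet_derivative f (at (x + lat v))) (at (x + lat v))"
      using test_function_differentiable[OF assms] frechet_derivative_works by blast
    then have "((\<lambda>y. f (y + lat v)) has_derivative frechet_derivative f (at (x + lat v))) (at x)"
      by (rule has_derivative_compose[rotated]) (auto intro!: derivative_eq_intros)
    then have "(f has_derivative frechet_derivative f (at (x + lat v))) (at x)"
      by (simp add: periodicD[OF per])
    from frechet_derivative_at[OF this] show ?thesis by (simp add: partial_deriv_def)
  qed
  moreover have "C_k n (partial_deriv i f)" for n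
    using assms unfolding test_function_def by (metis C_k.simps(2))
  ultimately show ?thesis by (auto simp: test_function_def intro: periodicI)
qed

text \<open>Difference quotients integrate to 0 by translation invariance and are bounded by the
  mean value theorem, so dominated convergence applies.\<close>

lemma integral_line_deriv_zero:
  assumes h: "cper h" and h': "cper h'"
    and d: "\<And>x t. ((\<lambda>t. h (x + t *\<^sub>R y)) has_real_derivative h' (x + t *\<^sub>R y)) (at t)"
  shows "(\<integral>x. h' x \<partial>torus) = 0"
proof -
  define F where "F n x = real (Suc n) * (h (x + (1 / Suc n) *\<^sub>R y) - h x)" for n x
  obtain R where R: "0 < R" "\<And>x. \<bar>h' x\<bar> \<le> R" using cper_bounded[OF h'] by blast
  have bd: "\<bar>F n x\<bar> \<le> R" for n x
  proof -
    have "\<exists>z. 0 < z \<and> z < 1 / Suc n \<and> h (x + (1 / Suc n) *\<^sub>R y) - h (x + 0 *\<^sub>R y) = (1 / Suc n - 0) * h' (x + z *\<^sub>R y)"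
      by (rule MVT2) (use d in auto)
    then obtain z where "h (x + (1 / Suc n) *\<^sub>R y) - h x = (1 / Suc n) * h' (x + z *\<^sub>R y)" by auto
    then have "F n x = h' (x + z *\<^sub>R y)" by (simp add: F_def)
    then show ?thesis using R by simp
  qed
  have "(\<lambda>n. \<integral>x. F n x \<partial>torus) \<longlonglongrightarrow> (\<integral>x. h' x \<partial>torus)"
  proof (rule torus_dct[where R = R])
    show "AE x in torus. (\<lambda>n. F n x) \<longlonglongrightarrow> h' x"
    proof (intro AE_I2)
      fix x
      have "((\<lambda>t. (h (x + t *\<^sub>R y) - h x) / t) \<longlongrightarrow> h' x) (at 0)"
        using d[of x 0] by (simp add: DERIV_def)
      moreover have "filterlim (\<lambda>n. 1 / real (Suc n)) (at 0) sequentially"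
        unfolding filterlim_at using LIMSEQ_inverse_real_of_nat by (auto simp: inverse_eq_divide)
      ultimately have "(\<lambda>n. (h (x + (1 / real (Suc n)) *\<^sub>R y) - h x) / (1 / real (Suc n))) \<longlonglongrightarrow> h' x"
        by (rule filterlim_compose)
      then show "(\<lambda>n. F n x) \<longlonglongrightarrow> h' x" by (simp add: F_def mult.commute)
    qed
    show "F n \<in> borel_measurable torus" for n
      unfolding F_def by (intro cper_measurable cper_mult cper_const cper_diff cper_shift h)
  qed (use h' bd cper_measurable in auto)
  moreover have "(\<integral>x. F n x \<partial>torus) = 0" for n
    unfolding F_def using integral_translation[OF h] h by (simp add: cper_shift)
  ultimately show ?thesis by (simp add: LIMSEQ_const_iff)
qed

lemma ibp_T:
  assumes b: "fin b" and f: "test_function f"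
  shows "(\<integral>x. T b x * partial_deriv i f x \<partial>torus) = - (\<integral>x. T (dir_deriv (axis i 1) b) x * f x \<partial>torus)"
proof -
  have cp: "cper f" "cper (partial_deriv i f)"
    using f by (auto intro: test_function_cper test_function_partial)
  let ?h' = "\<lambda>x. T (dir_deriv (axis i 1) b) x * f x + T b x * partial_deriv i f x"
  have "(\<integral>x. ?h' x \<partial>torus) = 0"
  proof (rule integral_line_deriv_zero[of "\<lambda>x. T b x * f x" _ "axis i 1"])
    show "cper (\<lambda>x. T b x * f x)" "cper ?h'" by (intro cper_add cper_mult cper_T cp)+
    show "((\<lambda>t. T b (x + t *\<^sub>R axis i 1) * f (x + t *\<^sub>R axis i 1)) has_real_derivative ?h' (x + t *\<^sub>R axis i 1)) (at t)" for x t
      by (rule DERIV_mult'[OF T_line_deriv[OF b] differentiable_line[OF test_function_differentiable[OF f]], THEN DERIV_cong]) simp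
  qed
  then show ?thesis using cp by (subst (asm) Bochner_Integration.integral_add) auto
qed

lemma L1_test:
  assumes f: "\<And>n. integrable torus (f n)" and g: "integrable torus g"
    and l: "(\<lambda>n. \<integral>x. \<bar>g x - f n x\<bar> \<partial>torus) \<longlonglongrightarrow> 0" and h: "cper h"
  shows "(\<lambda>n. \<integral>x. f n x * h x \<partial>torus) \<longlonglongrightarrow> (\<integral>x. g x * h x \<partial>torus)"
proof -
  obtain R where R: "0 < R" "\<And>x. \<bar>h x\<bar> \<le> R" using cper_bounded[OF h] by blast
  have ih: "integrable torus (\<lambda>x. f x * h x)" if "integrable torus f" for f
  proof (rule Bochner_Integration.integrable_bound[OF integrable_mult_right[OF integrable_abs[OF that], of R]])
    show "AE x in torus. norm (f x * h x) \<le> norm (R * \<bar>f x\<bar>)"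
    proof (rule AE_I2)
      fix x show "norm (f x * h x) \<le> norm (R * \<bar>f x\<bar>)"
        using mult_left_mono[OF R(2)[of x], of "\<bar>f x\<bar>"] R(1) by (simp add: abs_mult mult.commute)
    qed
  qed (use that cper_measurable[OF h] in measurable)
  have "(\<lambda>n. (\<integral>x. f n x * h x \<partial>torus) - (\<integral>x. g x * h x \<partial>torus)) \<longlonglongrightarrow> 0"
  proof (rule Lim_null_comparison[OF always_eventually tendsto_mult_right_zero[OF l, of R]], intro allI)
    fix n
    have "norm ((\<integral>x. f n x * h x \<partial>torus) - (\<integral>x. g x * h x \<partial>torus)) = \<bar>\<integral>x. (f n x - g x) * h x \<partial>torus\<bar>"
      using ih f g by (simp add: left_diff_distrib)
    also have "\<dots> \<le> (\<integral>x. \<bar>(f n x - g x) * h x\<bar> \<partial>torus)" by (rule integral_abs_bound)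
    also have "\<dots> \<le> (\<integral>x. R * \<bar>g x - f n x\<bar> \<partial>torus)"
    proof (rule integral_mono)
      show "integrable torus (\<lambda>x. \<bar>(f n x - g x) * h x\<bar>)" using ih[of "\<lambda>x. f n x - g x"] f g by auto
      show "integrable torus (\<lambda>x. R * \<bar>g x - f n x\<bar>)" using f g by auto
      show "\<bar>(f n x - g x) * h x\<bar> \<le> R * \<bar>g x - f n x\<bar>" for x
        using mult_left_mono[OF R(2)[of x], of "\<bar>g x - f n x\<bar>"] by (simp add: abs_mult mult.commute abs_minus_commute)
    qed
    also have "\<dots> = R * (\<integral>x. \<bar>g x - f n x\<bar> \<partial>torus)" by simp
    finally show "norm ((\<integral>x. f n x * h x \<partial>torus) - (\<integral>x. g x * h x \<partial>torus)) \<le> R * (\<integral>x. \<bar>g x - f n x\<bar> \<partial>torus)" .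
  qed
  then show ?thesis by (rule LIM_zero_cancel)
qed

text \<open>Test functions and their derivatives are bounded, so both sides of the weak formulation
  pass to \<open>L^1\<close> limits.\<close>

lemma weak_deriv_limit:
  assumes b: "\<And>n. fin (b n)" and p: "1 \<le> p" and u: "u \<in> Lm p" "(\<lambda>n. Ip p (\<lambda>x. u x - T (b n) x)) \<longlonglongrightarrow> 0"
    and v: "v \<in> Lm p" "(\<lambda>n. Ip p (\<lambda>x. v x - T (dir_deriv (axis i 1) (b n)) x)) \<longlonglongrightarrow> 0"
  shows "weak_deriv i u v"
  unfolding weak_deriv_def
proof (intro allI impI)
  fix f assume f: "test_function f"
  have TL: "T c \<in> Lm p" for c using p by (auto intro!: Lm_cper)
  have "(\<lambda>n. \<integral>x. T (b n) x * partial_deriv i f x \<partial>torus) \<longlonglongrightarrow> (\<integral>x. u x * partial_deriv i f x \<partial>torus)"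
    by (rule L1_test[OF _ Lm_integrable[OF p u(1)] Ip_tendsto_L1[OF p _ u(2)]])
      (use p u(1) TL f in \<open>auto intro!: Lm_diff(1) test_function_cper test_function_partial\<close>)
  moreover have "(\<lambda>n. - (\<integral>x. T (dir_deriv (axis i 1) (b n)) x * f x \<partial>torus)) \<longlonglongrightarrow> - (\<integral>x. v x * f x \<partial>torus)"
    by (rule tendsto_minus, rule L1_test[OF _ Lm_integrable[OF p v(1)] Ip_tendsto_L1[OF p _ v(2)]])
      (use p v(1) TL f in \<open>auto intro!: Lm_diff(1) test_function_cper\<close>)
  ultimately show "(\<integral>x. u x * partial_deriv i f x \<partial>torus) = - (\<integral>x. v x * f x \<partial>torus)"
    unfolding ibp_T[OF b f] by (rule LIMSEQ_unique)
qed

section \<open>The Poisson equation\<close>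

text \<open>A multiplier bounded on trigonometric polynomials is extended along a prescribed
  approximating sequence, so that \<open>u\<close> and all its derivatives can be obtained from one
  and the same sequence.\<close>

lemma multiplier_limit:
  assumes p: "1 \<le> p" and f: "f \<in> Lm p" and c: "\<And>n. fin (c n)" and l: "(\<lambda>n. Ip p (\<lambda>x. f x - T (c n) x)) \<longlonglongrightarrow> 0"
    and m: "0 < C" "\<And>c. fin c \<Longrightarrow> Ip p (T (\<lambda>k. m k * c k)) \<le> C * Ip p (T c)"
  obtains h where "h \<in> Lp p" "(\<lambda>n. Ip p (\<lambda>x. h x - T (\<lambda>k. m k * c n k) x)) \<longlonglongrightarrow> 0"
proof (rule Lp_complete[OF p, of "\<lambda>n k. m k * c n k"])
  fix e :: real assume e: "0 < e"
  let ?e = "e / (2 * C * 2 powr p)"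
  have "0 < ?e" using e m(1) by simp
  then have "\<forall>\<^sub>F n in sequentially. Ip p (\<lambda>x. f x - T (c n) x) < ?e" by (rule order_tendstoD[OF l])
  then obtain N where N: "\<And>n. N \<le> n \<Longrightarrow> Ip p (\<lambda>x. f x - T (c n) x) < ?e" by (auto simp: eventually_sequentially)
  have "Ip p (\<lambda>x. T (\<lambda>k. m k * c i k) x - T (\<lambda>k. m k * c j k) x) < e" if "N \<le> i" "N \<le> j" for i j
  proof -
    have "(\<lambda>x. T (\<lambda>k. m k * c i k) x - T (\<lambda>k. m k * c j k) x) = T (\<lambda>k. m k * (c i k - c j k))"
      by (rule ext) (subst T_diff[symmetric]; auto intro!: fin_mult c simp: right_diff_distrib)
    then have "Ip p (\<lambda>x. T (\<lambda>k. m k * c i k) x - T (\<lambda>k. m k * c j k) x) \<le> C * Ip p (T (\<lambda>k. c i k - c j k))"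
      using m(2)[OF fin_diff[OF c c]] by simp
    also have "T (\<lambda>k. c i k - c j k) = (\<lambda>x. T (c i) x - T (c j) x)" by (rule ext) (rule T_diff[OF c c])
    also have "Ip p (\<lambda>x. T (c i) x - T (c j) x) \<le> 2 powr p * (Ip p (\<lambda>x. T (c i) x - f x) + Ip p (\<lambda>x. f x - T (c j) x))"
      using p f by (intro Ip_triangle) (auto intro!: Lm_cper)
    also have "\<dots> < 2 powr p * (?e + ?e)"
      using N[OF that(1)] N[OF that(2)] by (intro mult_strict_left_mono add_strict_mono) (auto simp: Ip_commute)
    finally show ?thesis using m(1) by (simp add: field_simps)
  qed
  then show "\<exists>N. \<forall>i\<ge>N. \<forall>j\<ge>N. Ip p (\<lambda>x. T (\<lambda>k. m k * c i k) x - T (\<lambda>k. m k * c j k) x) < e" by blast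
qed (use that in blast)

lemma ph_axis: "ph k (axis 1 1) = freq 0 k" "ph k (axis 2 1) = (2 * freq 1 k - freq 0 k) / sqrt 3"
  by (simp_all add: ph_def ph1_def ph2_def freq_def axis_def field_simps)

lemma laplace_inv_laplace:
  assumes c: "fin c" and c0: "c 0 = 0"
  shows "(\<Sum>i\<in>UNIV. T (dir_deriv (axis i 1) (dir_deriv (axis i 1) (inv_laplace c))) x) = - T c x"
proof -
  have UN: "(UNIV :: 2 set) = {1, 2}" using exhaust_2 by auto
  have s: "(\<Sum>i\<in>UNIV. dir_deriv (axis i 1) (dir_deriv (axis i 1) (inv_laplace c)) k) = of_real (- 1) * c k" for k
  proof (cases "k = 0")
    case True
    then show ?thesis by (simp add: dir_deriv_def c0)
  next
    case False
    have k2: "freq 2 k = freq 0 k - freq 1 k" by (simp add: freq_def)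
    have "(ph k (axis 1 1))\<^sup>2 + (ph k (axis 2 1))\<^sup>2 = 2 / 3 * freq_sum k"
      unfolding ph_axis freq_sum_eq k2 by (simp add: power_divide power2_eq_square field_simps)
    then have e: "((ph k (axis 1 1))\<^sup>2 + (ph k (axis 2 1))\<^sup>2) * (3 / (2 * freq_sum k)) = 1"
      using freq_sum_pos[OF False] by simp
    have "(\<Sum>i\<in>UNIV. dir_deriv (axis i 1) (dir_deriv (axis i 1) (inv_laplace c)) k) = of_real (- (((ph k (axis 1 1))\<^sup>2 + (ph k (axis 2 1))\<^sup>2) * (3 / (2 * freq_sum k)))) * c k"
      unfolding UN by (simp add: dir_deriv_def inv_laplace_def power2_eq_square algebra_simps add_divide_distrib)
    then show ?thesis unfolding e .
  qed
  have "(\<Sum>i\<in>UNIV. T (dir_deriv (axis i 1) (dir_deriv (axis i 1) (inv_laplace c))) x) = T (\<lambda>k. \<Sum>i\<in>UNIV. dir_deriv (axis i 1) (dir_deriv (axis i 1) (inv_laplace c)) k) x"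
    unfolding UN using c by (simp add: T_add fin_dir_deriv fin_inv_laplace)
  then show ?thesis unfolding s T_scale[OF c] by simp
qed

lemma inv_laplace_diff: "inv_laplace (\<lambda>k. c k - d k) = (\<lambda>k. inv_laplace c k - inv_laplace d k)"
  by (rule ext) (simp add: inv_laplace_def right_diff_distrib)

text \<open>The sup bound makes \<open>T (inv_laplace (c n))\<close> converge uniformly along
  mean-zero approximations of \<open>f\<close>; weak derivatives are \<open>L^p\<close> limits along
  the same sequence. The last clause is a stability estimate: for \<open>c = 0\<close> it bounds the
  sup norm of \<open>u\<close>, and for \<open>f = T c\<close> it identifies
  \<open>u\<close>.\<close>

lemma poisson_exists:
  assumes p: "1 < p"
  shows "\<exists>C>0. \<forall>f\<in>Lp0 p. \<exists>u. cper u \<and> poisson_solution p f u \<and>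
    (\<forall>c. fin c \<longrightarrow> c 0 = 0 \<longrightarrow> (\<forall>x. \<bar>u x - T (inv_laplace c) x\<bar> powr p \<le> C * Ip p (\<lambda>x. f x - T c x)))"
proof -
  have p1: "1 \<le> p" using p by simp
  obtain C where C: "0 < C" "\<And>c x. fin c \<Longrightarrow> \<bar>T (inv_laplace c) x\<bar> powr p \<le> C * Ip p (T c)" using inv_laplace_sup[OF p] by blast
  let ?M = "C * 2 powr p"
  have "\<exists>u. cper u \<and> poisson_solution p f u \<and>
    (\<forall>c. fin c \<longrightarrow> c 0 = 0 \<longrightarrow> (\<forall>x. \<bar>u x - T (inv_laplace c) x\<bar> powr p \<le> ?M * Ip p (\<lambda>x. f x - T c x)))"
    if f: "f \<in> Lp0 p" for f
  proof -
    have fL: "f \<in> Lm p" and fm: "(\<integral>x. f x \<partial>torus) = 0" using f by (auto simp: Lp0_def mean_zero_def Lm_Lp)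
    have TL: "T c \<in> Lm p" for c using p by (auto intro!: Lm_cper)
    have "\<exists>c. fin c \<and> c 0 = 0 \<and> Ip p (\<lambda>x. f x - T c x) < inverse (Suc n)" for n
      using trig_dense_mean_zero[OF p1 fL _ fm, of "inverse (Suc n)"] by auto
    then obtain c where c: "\<And>n. fin (c n)" "\<And>n. c n 0 = 0" "\<And>n. Ip p (\<lambda>x. f x - T (c n) x) < inverse (Suc n)" by metis
    have l: "(\<lambda>n. Ip p (\<lambda>x. f x - T (c n) x)) \<longlonglongrightarrow> 0"
      by (rule tendsto_sandwich[OF _ _ tendsto_const LIMSEQ_inverse_real_of_nat])
        (intro always_eventually allI Ip_nonneg less_imp_le[OF c(3)])+
    have diff: "\<bar>T (inv_laplace a) x - T (inv_laplace b) x\<bar> powr p \<le> ?M * (Ip p (\<lambda>x. f x - T a x) + Ip p (\<lambda>x. f x - T b x))" if "fin a" "fin b" for a b x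
    proof -
      have "\<bar>T (inv_laplace a) x - T (inv_laplace b) x\<bar> powr p = \<bar>T (inv_laplace (\<lambda>k. a k - b k)) x\<bar> powr p"
        unfolding inv_laplace_diff using that by (simp add: T_diff fin_inv_laplace)
      also have "\<dots> \<le> C * Ip p (T (\<lambda>k. a k - b k))" using that by (intro C fin_diff)
      also have "T (\<lambda>k. a k - b k) = (\<lambda>x. T a x - T b x)" by (rule ext) (rule T_diff[OF that])
      also have "C * Ip p (\<lambda>x. T a x - T b x) \<le> C * (2 powr p * (Ip p (\<lambda>x. T a x - f x) + Ip p (\<lambda>x. f x - T b x)))"
        using p C(1) by (intro mult_left_mono Ip_triangle fL TL) auto
      finally show ?thesis by (simp add: Ip_commute[of p "T a" f])
    qed
    have "uniformly_Cauchy_on UNIV (\<lambda>n. T (inv_laplace (c n)))"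
    proof (rule uniformly_Cauchy_onI)
      fix e :: real assume e: "0 < e"
      have "0 < e powr p / (2 * ?M)" using e C(1) by simp
      then have "\<forall>\<^sub>F n in sequentially. Ip p (\<lambda>x. f x - T (c n) x) < e powr p / (2 * ?M)" by (rule order_tendstoD[OF l])
      then obtain N where N: "\<And>n. N \<le> n \<Longrightarrow> Ip p (\<lambda>x. f x - T (c n) x) < e powr p / (2 * ?M)" by (auto simp: eventually_sequentially)
      have "dist (T (inv_laplace (c m)) x) (T (inv_laplace (c n)) x) < e" if "N \<le> m" "N \<le> n" for m n x
      proof (rule ccontr)
        assume "\<not> ?thesis"
        then have "e powr p \<le> \<bar>T (inv_laplace (c m)) x - T (inv_laplace (c n)) x\<bar> powr p" using e p by (intro powr_mono2) (auto simp: dist_real_def)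
        also have "\<dots> \<le> ?M * (Ip p (\<lambda>x. f x - T (c m) x) + Ip p (\<lambda>x. f x - T (c n) x))" by (rule diff[OF c(1) c(1)])
        also have "\<dots> < ?M * (e powr p / (2 * ?M) + e powr p / (2 * ?M))"
          using N that C(1) by (intro mult_strict_left_mono add_strict_mono) auto
        also have "\<dots> = e powr p" using C(1) by (simp add: field_simps)
        finally show False by simp
      qed
      then show "\<exists>N. \<forall>x\<in>UNIV. \<forall>m\<ge>N. \<forall>n\<ge>N. dist (T (inv_laplace (c m)) x) (T (inv_laplace (c n)) x) < e" by blast
    qed
    then obtain u where u: "uniform_limit UNIV (\<lambda>n. T (inv_laplace (c n))) u sequentially"
      using Cauchy_uniformly_convergent uniformly_convergent_uniform_limit_iff by blast
    have pw: "(\<lambda>n. T (inv_laplace (c n)) x) \<longlonglongrightarrow> u x" for x using tendsto_uniform_limitI[OF u] by simp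
    have cu: "cper u"
    proof (rule cperI)
      show "continuous_on UNIV u"
        by (rule uniform_limit_theorem[OF _ u]) (use cper_T in \<open>auto simp: cper_def intro!: always_eventually\<close>)
      show "u (x + lat v) = u x" for x v
        using LIMSEQ_unique[OF pw[of "x + lat v"]] pw[of x] by (simp add: cper_lat[OF cper_T])
    qed
    have est: "\<bar>u x - T (inv_laplace b) x\<bar> powr p \<le> ?M * Ip p (\<lambda>x. f x - T b x)" if b: "fin b" for b x
    proof -
      have "(\<lambda>n. \<bar>T (inv_laplace (c n)) x - T (inv_laplace b) x\<bar> powr p) \<longlonglongrightarrow> \<bar>u x - T (inv_laplace b) x\<bar> powr p"
        using p by (intro tendsto_powr' tendsto_intros pw) auto
      moreover have "(\<lambda>n. ?M * (Ip p (\<lambda>x. f x - T (c n) x) + Ip p (\<lambda>x. f x - T b x))) \<longlonglongrightarrow> ?M * (0 + Ip p (\<lambda>x. f x - T b x))"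
        by (intro tendsto_intros l)
      ultimately show ?thesis using LIMSEQ_le diff[OF c(1) b] by fastforce
    qed
    have lu: "(\<lambda>n. Ip p (\<lambda>x. u x - T (inv_laplace (c n)) x)) \<longlonglongrightarrow> 0"
    proof (rule tendsto_sandwich[OF _ _ tendsto_const])
      show "\<forall>\<^sub>F n in sequentially. Ip p (\<lambda>x. u x - T (inv_laplace (c n)) x) \<le> ?M * Ip p (\<lambda>x. f x - T (c n) x) * vol"
      proof (intro always_eventually allI)
        fix n
        have "Ip p (\<lambda>x. u x - T (inv_laplace (c n)) x) \<le> (\<integral>x. ?M * Ip p (\<lambda>x. f x - T (c n) x) \<partial>torus)"
          unfolding Ip_def[of p "\<lambda>x. u x - T (inv_laplace (c n)) x"]
          by (rule integral_mono[OF _ _ est[OF c(1)]]) (use p cu in \<open>auto intro!: cper_integrable cper_abs_powr\<close>)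
        then show "Ip p (\<lambda>x. u x - T (inv_laplace (c n)) x) \<le> ?M * Ip p (\<lambda>x. f x - T (c n) x) * vol" by (simp add: mult_ac)
      qed
      show "(\<lambda>n. ?M * Ip p (\<lambda>x. f x - T (c n) x) * vol) \<longlonglongrightarrow> 0"
        using tendsto_mult[OF tendsto_mult[OF tendsto_const l] tendsto_const, of ?M vol] by simp
    qed auto
    have "\<exists>v\<in>Lp p. (\<lambda>n. Ip p (\<lambda>x. v x - T (dir_deriv (axis i 1) (inv_laplace (c n))) x)) \<longlonglongrightarrow> 0" for i
    proof -
      obtain K where K: "0 < K" "\<And>c. fin c \<Longrightarrow> Ip p (T (dir_deriv (axis i 1) (inv_laplace c))) \<le> K * Ip p (T c)"
        using Ip_dir_deriv_inv_laplace[OF p] by blast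
      define m where "m k = \<i> * of_real (ph k (axis i 1)) * (of_real (3 / (2 * freq_sum k)) :: complex)" for k
      have e: "dir_deriv (axis i 1) (inv_laplace a) = (\<lambda>k. m k * a k)" for a
        by (rule ext) (simp add: dir_deriv_def inv_laplace_def m_def)
      show ?thesis
        using multiplier_limit[OF p1 fL c(1) l K(1) K(2)[unfolded e]] unfolding e by blast
    qed
    then obtain v where v: "\<And>i. v i \<in> Lp p" "\<And>i. (\<lambda>n. Ip p (\<lambda>x. v i x - T (dir_deriv (axis i 1) (inv_laplace (c n))) x)) \<longlonglongrightarrow> 0" by metis
    have "\<exists>w\<in>Lp p. (\<lambda>n. Ip p (\<lambda>x. w x - T (dir_deriv (axis j 1) (dir_deriv (axis i 1) (inv_laplace (c n)))) x)) \<longlonglongrightarrow> 0" for i j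
    proof -
      obtain K where K: "0 < K" "\<And>c. fin c \<Longrightarrow> Ip p (T (dir_deriv (axis j 1) (dir_deriv (axis i 1) (inv_laplace c)))) \<le> K * Ip p (T c)"
        using hess_Lp[OF p] by blast
      define m where "m k = \<i> * of_real (ph k (axis j 1)) * (\<i> * of_real (ph k (axis i 1)) * (of_real (3 / (2 * freq_sum k)) :: complex))" for k
      have e: "dir_deriv (axis j 1) (dir_deriv (axis i 1) (inv_laplace a)) = (\<lambda>k. m k * a k)" for a
        by (rule ext) (simp add: dir_deriv_def inv_laplace_def m_def)
      show ?thesis
        using multiplier_limit[OF p1 fL c(1) l K(1) K(2)[unfolded e]] unfolding e by blast
    qed
    then have "\<exists>w. w \<in> Lp p \<and> (\<lambda>n. Ip p (\<lambda>x. w x - T (dir_deriv (axis j 1) (dir_deriv (axis i 1) (inv_laplace (c n)))) x)) \<longlonglongrightarrow> 0" for i j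
      by blast
    note ex = someI_ex[OF this]
    define w where "w i j = (SOME w. w \<in> Lp p \<and> (\<lambda>n. Ip p (\<lambda>x. w x - T (dir_deriv (axis j 1) (dir_deriv (axis i 1) (inv_laplace (c n)))) x)) \<longlonglongrightarrow> 0)" for i j
    have w: "w i j \<in> Lp p" "(\<lambda>n. Ip p (\<lambda>x. w i j x - T (dir_deriv (axis j 1) (dir_deriv (axis i 1) (inv_laplace (c n)))) x)) \<longlonglongrightarrow> 0" for i j
      using ex[of j i] unfolding w_def by blast+
    have uL: "u \<in> Lp p" using cu p by (simp add: Lp_def torus_measurable_def cper_measurable cper_abs_powr) (simp add: cper_def)
    have wu: "weak_deriv i u (v i)" for i
      by (rule weak_deriv_limit[OF _ p1 Lm_Lp[OF uL] lu Lm_Lp[OF v(1)] v(2)]) (auto intro: c)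
    \<comment> \<open>The label is local and unrelated to the waves of the first eigenspace; these
      are the second weak derivatives.\<close>
    have low_wave: "weak_deriv j (v i) (w i j)" for i j
      by (rule weak_deriv_limit[OF _ p1 Lm_Lp[OF v(1)] v(2) Lm_Lp[OF w(1)] w(2)]) (auto intro: c)
    have "mean_zero u"
    proof -
      have "(\<lambda>n. \<integral>x. T (inv_laplace (c n)) x * 1 \<partial>torus) \<longlonglongrightarrow> (\<integral>x. u x * 1 \<partial>torus)"
        by (rule L1_test[OF _ _ Ip_tendsto_L1[OF p1 _ lu]]) (use p cu in \<open>auto intro!: Lm_cper\<close>)
      then show ?thesis using integral_T[OF fin_inv_laplace[OF c(1)]] by (simp add: LIMSEQ_const_iff mean_zero_def)
    qed
    moreover have "u \<in> W2p p" using uL v(1) w(1) wu low_wave unfolding W2p_def by blast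
    moreover have "AE x in torus. - (\<Sum>i\<in>UNIV. w i i x) = f x"
    proof -
      define s where "s x = f x + (\<Sum>i\<in>UNIV. w i i x)" for x
      \<comment> \<open>The residual of the equation, written in approximation errors only. It does
        not depend on \<open>n\<close> because the approximants solve their equations exactly, while
        every error tends to 0 in \<open>L^1\<close>.\<close>
      define r where "r n x = (f x - T (c n) x) + (\<Sum>i\<in>UNIV. w i i x - T (dir_deriv (axis i 1) (dir_deriv (axis i 1) (inv_laplace (c n)))) x)" for n x
      have rs: "r n x = s x" for n x
        unfolding r_def s_def sum_subtractf laplace_inv_laplace[OF c(1,2)] by simp
      have UN: "(UNIV :: 2 set) = {1, 2}" using exhaust_2 by auto
      have L0: "(\<lambda>x. f x - T (c n) x) \<in> Lm p" for n using p by (intro Lm_diff(1) fL TL) auto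
      have Lw: "(\<lambda>x. w i i x - T (dir_deriv (axis i 1) (dir_deriv (axis i 1) (inv_laplace (c n)))) x) \<in> Lm p" for i n
        using p by (intro Lm_diff(1) Lm_Lp[OF w(1)] TL) auto
      have i0: "integrable torus (\<lambda>x. \<bar>f x - T (c n) x\<bar>)" for n using Lm_integrable[OF p1 L0] by auto
      have iw: "integrable torus (\<lambda>x. \<bar>w i i x - T (dir_deriv (axis i 1) (dir_deriv (axis i 1) (inv_laplace (c n)))) x\<bar>)" for i n using Lm_integrable[OF p1 Lw] by auto
      have si: "integrable torus s"
        unfolding s_def by (intro Bochner_Integration.integrable_add Bochner_Integration.integrable_sum Lm_integrable[OF p1] fL Lm_Lp[OF w(1)])
      have "(\<integral>x. \<bar>s x\<bar> \<partial>torus) \<le> (\<integral>x. \<bar>f x - T (c n) x\<bar> \<partial>torus) + (\<Sum>i\<in>UNIV. \<integral>x. \<bar>w i i x - T (dir_deriv (axis i 1) (dir_deriv (axis i 1) (inv_laplace (c n)))) x\<bar> \<partial>torus)" for n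
      proof -
        have "(\<integral>x. \<bar>s x\<bar> \<partial>torus) \<le> (\<integral>x. \<bar>f x - T (c n) x\<bar> + (\<Sum>i\<in>UNIV. \<bar>w i i x - T (dir_deriv (axis i 1) (dir_deriv (axis i 1) (inv_laplace (c n)))) x\<bar>) \<partial>torus)"
        proof (rule integral_mono)
          show "\<bar>s x\<bar> \<le> \<bar>f x - T (c n) x\<bar> + (\<Sum>i\<in>UNIV. \<bar>w i i x - T (dir_deriv (axis i 1) (dir_deriv (axis i 1) (inv_laplace (c n)))) x\<bar>)" for x
            unfolding rs[of n, symmetric] r_def by (intro order_trans[OF abs_triangle_ineq] add_left_mono sum_abs)
        qed (use si i0 iw in auto)
        then show ?thesis using i0 iw by simp
      qed
      moreover have "(\<lambda>n. (\<integral>x. \<bar>f x - T (c n) x\<bar> \<partial>torus) + (\<Sum>i\<in>UNIV. \<integral>x. \<bar>w i i x - T (dir_deriv (axis i 1) (dir_deriv (axis i 1) (inv_laplace (c n)))) x\<bar> \<partial>torus)) \<longlonglongrightarrow> 0 + (\<Sum>i\<in>(UNIV :: 2 set). 0)"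
        by (intro tendsto_add tendsto_sum Ip_tendsto_L1[OF p1 L0 l] Ip_tendsto_L1[OF p1 Lw w(2)])
      ultimately have "(\<integral>x. \<bar>s x\<bar> \<partial>torus) \<le> 0" by (intro LIMSEQ_le_const[where X = "\<lambda>n. (\<integral>x. \<bar>f x - T (c n) x\<bar> \<partial>torus) + (\<Sum>i\<in>UNIV. \<integral>x. \<bar>w i i x - T (dir_deriv (axis i 1) (dir_deriv (axis i 1) (inv_laplace (c n)))) x\<bar> \<partial>torus)"]) auto
      moreover have "0 \<le> (\<integral>x. \<bar>s x\<bar> \<partial>torus)" by simp
      ultimately have "(\<integral>x. \<bar>s x\<bar> \<partial>torus) = 0" by linarith
      then have "AE x in torus. \<bar>s x\<bar> = 0" using si by (subst (asm) integral_nonneg_eq_0_iff_AE) auto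
      then show ?thesis by (rule AE_mp) (auto intro!: AE_I2 simp: s_def)
    qed
    moreover from this have "\<exists>v w. (\<forall>i. v i \<in> Lp p \<and> w i \<in> Lp p \<and> weak_deriv i u (v i) \<and> weak_deriv i (v i) (w i)) \<and>
        (AE x in torus. - (\<Sum>i\<in>UNIV. w i x) = f x)"
      by (rule_tac exI[of _ v], rule_tac exI[of _ "\<lambda>i. w i i"]) (use v(1) w(1) wu low_wave in blast)
    ultimately have "poisson_solution p f u"
      unfolding poisson_solution_def W2p0_def by blast
    then show ?thesis using cu est by blast
  qed
  moreover have "0 < ?M" using C(1) by simp
  ultimately show ?thesis by blast
qed

section \<open>Fourier coefficients of solutions, uniqueness and continuity of the energy\<close>

lemma Lm_mult_cper:
  assumes f: "integrable torus f" and h: "cper h"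
  shows "integrable torus (\<lambda>x. f x * h x)"
proof -
  obtain R where R: "0 < R" "\<And>x. \<bar>h x\<bar> \<le> R" using cper_bounded[OF h] by blast
  show ?thesis
  proof (rule Bochner_Integration.integrable_bound[OF integrable_mult_right[OF integrable_abs[OF f], of R]])
    show "AE x in torus. norm (f x * h x) \<le> norm (R * \<bar>f x\<bar>)"
    proof (rule AE_I2)
      fix x show "norm (f x * h x) \<le> norm (R * \<bar>f x\<bar>)"
        using mult_left_mono[OF R(2)[of x], of "\<bar>f x\<bar>"] R(1) by (simp add: abs_mult mult.commute)
    qed
  qed (use f cper_measurable[OF h] in measurable)
qed

text \<open>Testing the two weak derivatives with modes diagonalises the equation, whatever solution
  is given.\<close>

lemma poisson_modes:
  assumes p: "1 \<le> p" and f: "f \<in> borel_measurable torus" and s: "poisson_solution p f u"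
  shows "(\<integral>x. f x * mode k c x \<partial>torus) = 2 / 3 * freq_sum k * (\<integral>x. u x * mode k c x \<partial>torus)"
proof -
  obtain v w where vw: "\<And>i. v i \<in> Lp p" "\<And>i. w i \<in> Lp p" "\<And>i. weak_deriv i u (v i)" "\<And>i. weak_deriv i (v i) (w i)"
    and ae: "AE x in torus. - (\<Sum>i\<in>UNIV. w i x) = f x"
    using s unfolding poisson_solution_def by blast
  have UN: "(UNIV :: 2 set) = {1, 2}" using exhaust_2 by auto
  have iw: "integrable torus (w i)" for i using Lm_integrable[OF p Lm_Lp[OF vw(2)]] .
  have step: "(\<integral>x. w i x * mode k c x \<partial>torus) = - (ph k (axis i 1))\<^sup>2 * (\<integral>x. u x * mode k c x \<partial>torus)" for i
  proof -
    let ?r = "ph k (axis i 1)"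
    have "(\<integral>x. u x * partial_deriv i (partial_deriv i (mode k c)) x \<partial>torus) = - (\<integral>x. v i x * partial_deriv i (mode k c) x \<partial>torus)"
      using vw(3) test_function_partial[OF test_function_mode] unfolding weak_deriv_def by blast
    also have "\<dots> = (\<integral>x. w i x * mode k c x \<partial>torus)"
      using vw(4)[of i] test_function_mode[of k c] unfolding weak_deriv_def by auto
    also have "partial_deriv i (partial_deriv i (mode k c)) = (\<lambda>x. - ?r\<^sup>2 * mode k c x)"
    proof
      fix x
      have "\<i> * of_real ?r * (\<i> * of_real ?r * c) = of_real (- ?r\<^sup>2) * c"
        by (simp add: power2_eq_square algebra_simps)
      then show "partial_deriv i (partial_deriv i (mode k c)) x = - ?r\<^sup>2 * mode k c x"
        unfolding partial_deriv_mode by (simp only: mode_scale)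
    qed
    finally have e: "(\<integral>x. u x * (- ?r\<^sup>2 * mode k c x) \<partial>torus) = (\<integral>x. w i x * mode k c x \<partial>torus)" .
    have "(\<lambda>x. u x * (- ?r\<^sup>2 * mode k c x)) = (\<lambda>x. - ?r\<^sup>2 * (u x * mode k c x))" by auto
    then show ?thesis unfolding e[symmetric] by (simp only: integral_mult_right_zero)
  qed
  have "(\<integral>x. f x * mode k c x \<partial>torus) = (\<integral>x. - (\<Sum>i\<in>UNIV. w i x) * mode k c x \<partial>torus)"
  proof (rule integral_cong_AE)
    show "AE x in torus. f x * mode k c x = - (\<Sum>i\<in>UNIV. w i x) * mode k c x"
      using ae by (rule AE_mp) (auto intro!: AE_I2)
    show "(\<lambda>x. f x * mode k c x) \<in> borel_measurable torus"
      using f cper_measurable[OF cper_mode] by measurable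
    show "(\<lambda>x. - (\<Sum>i\<in>UNIV. w i x) * mode k c x) \<in> borel_measurable torus"
      using iw cper_measurable[OF cper_mode[of k c]] by (auto intro!: borel_measurable_times borel_measurable_sum borel_measurable_uminus)
  qed
  also have "(\<lambda>x. - (\<Sum>i\<in>UNIV. w i x) * mode k c x) = (\<lambda>x. - (\<Sum>i\<in>UNIV. w i x * mode k c x))"
    by (simp add: sum_distrib_right)
  also have "(\<integral>x. - (\<Sum>i\<in>UNIV. w i x * mode k c x) \<partial>torus) = - (\<Sum>i\<in>UNIV. \<integral>x. w i x * mode k c x \<partial>torus)"
    by (subst Bochner_Integration.integral_minus, subst Bochner_Integration.integral_sum) (auto intro: Lm_mult_cper iw)
  also have "\<dots> = ((ph k (axis 1 1))\<^sup>2 + (ph k (axis 2 1))\<^sup>2) * (\<integral>x. u x * mode k c x \<partial>torus)"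
    unfolding step UN by (simp add: algebra_simps)
  also have "(ph k (axis 1 1))\<^sup>2 + (ph k (axis 2 1))\<^sup>2 = 2 / 3 * freq_sum k"
  proof -
    have k2: "freq 2 k = freq 0 k - freq 1 k" by (simp add: freq_def)
    show ?thesis unfolding ph_axis freq_sum_eq k2 by (simp add: power_divide power2_eq_square field_simps)
  qed
  finally show ?thesis .
qed

lemma poisson_integrable: "1 \<le> p \<Longrightarrow> poisson_solution p f u \<Longrightarrow> integrable torus u \<and> (\<integral>x. u x \<partial>torus) = 0"
  using Lm_integrable[OF _ Lm_Lp] unfolding poisson_solution_def W2p0_def W2p_def mean_zero_def by blast

lemma poisson_unique:
  assumes p: "1 \<le> p" and f: "f \<in> borel_measurable torus" and s: "poisson_solution p f u" "poisson_solution p f v"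
  shows "AE x in torus. u x = v x"
proof -
  have i: "integrable torus u" "integrable torus v" "(\<integral>x. u x \<partial>torus) = 0" "(\<integral>x. v x \<partial>torus) = 0"
    using poisson_integrable[OF p] s by blast+
  have "AE x in torus. u x - v x = 0"
  proof (rule fourier_unique)
    show "integrable torus (\<lambda>x. u x - v x)" using i by auto
    fix k c
    have d: "(\<integral>x. (u x - v x) * mode k c x \<partial>torus) = (\<integral>x. u x * mode k c x \<partial>torus) - (\<integral>x. v x * mode k c x \<partial>torus)"
      using i by (simp add: left_diff_distrib Lm_mult_cper)
    show "(\<integral>x. (u x - v x) * mode k c x \<partial>torus) = 0"
    proof (cases "k = 0")
      case True then show ?thesis unfolding d using i by simp
    next
      case False
      then show ?thesis unfolding d using poisson_modes[OF p f s(1), of k c] poisson_modes[OF p f s(2), of k c] freq_sum_pos[OF False] by simp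
    qed
  qed
  then show ?thesis by simp
qed

text \<open>Frees the energy from the representative chosen in \<open>G\<close>: any solution may be
  inserted.\<close>

lemma energy_eq:
  assumes p: "1 \<le> p" and f: "f \<in> borel_measurable torus" and s: "poisson_solution p f u"
  shows "energy p f = 1 / 2 * (\<integral>x. f x * u x \<partial>torus)"
proof -
  have "\<exists>u. poisson_solution p f u" using s by blast
  then have "poisson_solution p f (G p f)" unfolding G_def by (rule someI_ex)
  from poisson_unique[OF p f this s] have "AE x in torus. f x * G p f x = f x * u x"
    by (rule AE_mp) (auto intro!: AE_I2)
  moreover have "G p f \<in> borel_measurable torus" "u \<in> borel_measurable torus"
    using poisson_integrable[OF p] \<open>poisson_solution p f (G p f)\<close> s by blast+
  ultimately show ?thesis unfolding energy_def using f by (subst integral_cong_AE[of _ _ "\<lambda>x. f x * u x"]) auto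
qed

lemma T_Lp0: assumes "fin c" "c 0 = 0" "0 < p" shows "T c \<in> Lp0 p"
  using assms integral_T[OF assms(1)] cper_T[of c] unfolding Lp0_def Lp_def mean_zero_def torus_measurable_def
  by (auto simp: cper_measurable cper_abs_powr cper_def)

text \<open>The stability estimate of \<open>poisson_exists\<close>, with \<open>c\<close> itself as
  the approximation, has right side 0.\<close>

lemma poisson_T:
  assumes p: "1 < p" and c: "fin c" "c 0 = 0"
  shows "poisson_solution p (T c) (T (inv_laplace c))"
proof -
  obtain C where C: "\<And>f. f \<in> Lp0 p \<Longrightarrow> \<exists>u. cper u \<and> poisson_solution p f u \<and>
    (\<forall>c. fin c \<longrightarrow> c 0 = 0 \<longrightarrow> (\<forall>x. \<bar>u x - T (inv_laplace c) x\<bar> powr p \<le> C * Ip p (\<lambda>x. f x - T c x)))"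
    using poisson_exists[OF p] by blast
  obtain u where u: "poisson_solution p (T c) u" "\<And>x. \<bar>u x - T (inv_laplace c) x\<bar> powr p \<le> C * Ip p (\<lambda>x. T c x - T c x)"
    using C[OF T_Lp0[OF c]] p c by force
  have "\<bar>u x - T (inv_laplace c) x\<bar> powr p \<le> 0" for x using u(2)[of x] by (simp add: Ip_def)
  then have "\<bar>u x - T (inv_laplace c) x\<bar> powr p = 0" for x by (intro antisym) auto
  then have "u = T (inv_laplace c)" by (intro ext) simp
  then show ?thesis using u(1) by simp
qed

lemma energy_T:
  assumes "1 < p" "fin c" "c 0 = 0"
  shows "energy p (T c) = 1 / 2 * (\<integral>x. T c x * T (inv_laplace c) x \<partial>torus)"
  by (rule energy_eq[OF _ _ poisson_T]) (use assms in \<open>auto intro: cper_measurable\<close>)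

text \<open>With \<open>h = f - g\<close>, twice the difference of energies is the integral of
  \<open>h * S f\<close> plus that of \<open>g * S h\<close>. Each pairs an integrable function with
  a bounded one, and either the former is small in \<open>L^1\<close> or the latter in the sup norm;
  so all \<open>p > 1\<close> are treated alike.\<close>

lemma energy_continuous:
  assumes p: "1 < p" and f: "\<And>n. f n \<in> Lp0 p" and g: "\<And>n. g n \<in> Lp0 p"
    and R: "\<And>n. Ip p (f n) \<le> R" "\<And>n. Ip p (g n) \<le> R"
    and l: "(\<lambda>n::nat. Ip p (\<lambda>x. f n x - g n x)) \<longlonglongrightarrow> 0"
  shows "(\<lambda>n. energy p (f n) - energy p (g n)) \<longlonglongrightarrow> 0"
proof -
  have p1: "1 \<le> p" using p by simp
  obtain C where C: "0 < C" "\<And>f. f \<in> Lp0 p \<Longrightarrow> \<exists>u. cper u \<and> poisson_solution p f u \<and>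
    (\<forall>c. fin c \<longrightarrow> c 0 = 0 \<longrightarrow> (\<forall>x. \<bar>u x - T (inv_laplace c) x\<bar> powr p \<le> C * Ip p (\<lambda>x. f x - T c x)))"
    using poisson_exists[OF p] by blast
  have Lm0: "f \<in> Lm p" "(\<integral>x. f x \<partial>torus) = 0" if "f \<in> Lp0 p" for f
    using that by (auto simp: Lp0_def mean_zero_def Lm_Lp)
  define S where "S f = (SOME u. cper u \<and> poisson_solution p f u \<and>
    (\<forall>c. fin c \<longrightarrow> c 0 = 0 \<longrightarrow> (\<forall>x. \<bar>u x - T (inv_laplace c) x\<bar> powr p \<le> C * Ip p (\<lambda>x. f x - T c x))))" for f
  have S: "cper (S f)" "poisson_solution p f (S f)"
    "\<And>c x. fin c \<Longrightarrow> c 0 = 0 \<Longrightarrow> \<bar>S f x - T (inv_laplace c) x\<bar> powr p \<le> C * Ip p (\<lambda>x. f x - T c x)" if "f \<in> Lp0 p" for f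
    using someI_ex[OF C(2)[OF that]] unfolding S_def by blast+
  define r where "r a = (C * a) powr (1 / p)" for a
  have sup: "\<bar>S h x\<bar> \<le> r (Ip p h)" if h: "h \<in> Lp0 p" for h x
  proof -
    have z: "fin (\<lambda>k. 0)" "T (inv_laplace (\<lambda>k. 0)) x = 0" "T (\<lambda>k. 0) = (\<lambda>x. 0)" by (simp_all add: fin_def T_def inv_laplace_def fun_eq_iff)
    have "\<bar>S h x\<bar> powr p \<le> C * Ip p h" using S(3)[OF h z(1), of x] unfolding z(2,3) by simp
    then have "(\<bar>S h x\<bar> powr p) powr (1 / p) \<le> r (Ip p h)" unfolding r_def using p by (intro powr_mono2) auto
    then show ?thesis using p by (simp add: powr_powr)
  qed
  have r_mono: "0 \<le> a \<Longrightarrow> a \<le> b \<Longrightarrow> r a \<le> r b" for a b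
    unfolding r_def using C(1) p by (intro powr_mono2 mult_left_mono) auto
  have r0: "0 \<le> r a" for a by (simp add: r_def)
  define h where "h n x = f n x - g n x" for n x
  have h: "h n \<in> Lp0 p" for n
  proof -
    have "h n \<in> Lm p" unfolding h_def using p by (intro Lm_diff Lm0(1) f g) auto
    moreover have "periodic (h n)" using f[of n] g[of n] by (simp add: h_def Lp0_def Lp_def torus_measurable_def periodic_def)
    moreover have "(\<integral>x. h n x \<partial>torus) = 0" unfolding h_def using Lm_integrable[OF p1 Lm0(1)] Lm0(2) f g by simp
    ultimately show ?thesis by (simp add: Lm_def Lp0_def Lp_def torus_measurable_def mean_zero_def)
  qed
  have int: "integrable torus u" if "u \<in> Lp0 p" for u using Lm_integrable[OF p1 Lm0(1)[OF that]] .
  \<comment> \<open>\<open>S\<close> is obtained by choice, so its linearity has to come from the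
    Fourier coefficients.\<close>
  have lin: "AE x in torus. S (f n) x - S (g n) x = S (h n) x" for n
  proof -
    have "AE x in torus. S (f n) x - S (g n) x - S (h n) x = 0"
    proof (rule fourier_unique)
      show "integrable torus (\<lambda>x. S (f n) x - S (g n) x - S (h n) x)"
        by (intro cper_integrable cper_diff S(1) f g h)
      fix k c
      have d: "(\<integral>x. (S (f n) x - S (g n) x - S (h n) x) * mode k c x \<partial>torus)
        = (\<integral>x. S (f n) x * mode k c x \<partial>torus) - (\<integral>x. S (g n) x * mode k c x \<partial>torus) - (\<integral>x. S (h n) x * mode k c x \<partial>torus)"
        using S(1)[OF f] S(1)[OF g] S(1)[OF h] by (simp add: left_diff_distrib cper_mult)
      show "(\<integral>x. (S (f n) x - S (g n) x - S (h n) x) * mode k c x \<partial>torus) = 0"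
      proof (cases "k = 0")
        case True
        then show ?thesis unfolding d using poisson_integrable[OF p1 S(2)] f g h by simp
      next
        case False
        have m: "(\<integral>x. S u x * mode k c x \<partial>torus) = (\<integral>x. u x * mode k c x \<partial>torus) / (2 / 3 * freq_sum k)" if "u \<in> Lp0 p" for u
          using poisson_modes[OF p1 _ S(2)[OF that], of k c] freq_sum_pos[OF False] int[OF that] by simp
        have "(\<integral>x. h n x * mode k c x \<partial>torus) = (\<integral>x. f n x * mode k c x \<partial>torus) - (\<integral>x. g n x * mode k c x \<partial>torus)"
          using int[OF f] int[OF g] by (simp add: h_def left_diff_distrib Lm_mult_cper)
        then show ?thesis unfolding d m[OF f] m[OF g] m[OF h] by (simp add: diff_divide_distrib)
      qed
    qed
    then show ?thesis by simp
  qed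
  have e: "energy p u = 1 / 2 * (\<integral>x. u x * S u x \<partial>torus)" if "u \<in> Lp0 p" for u
    using energy_eq[OF p1 _ S(2)[OF that]] int[OF that] by simp
  have l1: "(\<lambda>n. \<integral>x. \<bar>h n x\<bar> \<partial>torus) \<longlonglongrightarrow> 0"
  proof -
    have "(\<lambda>n. Ip p (h n)) \<longlonglongrightarrow> 0" using l by (simp add: h_def[abs_def])
    from Ip_tendsto_L1[OF p1 Lm0(1)[OF h] this] show ?thesis .
  qed
  have g1: "(\<integral>x. \<bar>g n x\<bar> \<partial>torus) \<le> (vol powr (p - 1) * R) powr (1 / p)" for n
  proof -
    have "(\<integral>x. \<bar>g n x\<bar> \<partial>torus) powr p \<le> vol powr (p - 1) * Ip p (g n)" by (rule Lm_jensen[OF p1 Lm0(1)[OF g]])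
    also have "\<dots> \<le> vol powr (p - 1) * R" using R by (intro mult_left_mono) auto
    finally have "((\<integral>x. \<bar>g n x\<bar> \<partial>torus) powr p) powr (1 / p) \<le> (vol powr (p - 1) * R) powr (1 / p)"
      using p by (intro powr_mono2) auto
    then show ?thesis using p by (simp add: powr_powr)
  qed
  have hold: "\<bar>\<integral>x. u x * w x \<partial>torus\<bar> \<le> M * (\<integral>x. \<bar>u x\<bar> \<partial>torus)"
    if "integrable torus u" "cper w" "\<And>x. \<bar>w x\<bar> \<le> M" for u w M
  proof -
    have "\<bar>\<integral>x. u x * w x \<partial>torus\<bar> \<le> (\<integral>x. \<bar>u x * w x\<bar> \<partial>torus)" by (rule integral_abs_bound)
    also have "\<dots> \<le> (\<integral>x. M * \<bar>u x\<bar> \<partial>torus)"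
    proof (rule integral_mono)
      show "\<bar>u x * w x\<bar> \<le> M * \<bar>u x\<bar>" for x
        using mult_left_mono[OF that(3)[of x], of "\<bar>u x\<bar>"] by (simp add: abs_mult mult.commute)
    qed (use that Lm_mult_cper in auto)
    finally show ?thesis by simp
  qed
  have b: "\<bar>energy p (f n) - energy p (g n)\<bar> \<le> r R * (\<integral>x. \<bar>h n x\<bar> \<partial>torus) + r (Ip p (h n)) * (vol powr (p - 1) * R) powr (1 / p)" for n
  proof -
    have "(\<integral>x. g n x * (S (f n) x - S (g n) x) \<partial>torus) = (\<integral>x. g n x * S (h n) x \<partial>torus)"
    proof (rule integral_cong_AE)
      show "AE x in torus. g n x * (S (f n) x - S (g n) x) = g n x * S (h n) x"
        using lin[of n] by (rule AE_mp) (auto intro!: AE_I2)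
    qed (use int[OF g] S(1)[OF f] S(1)[OF g] S(1)[OF h] in \<open>auto intro!: borel_measurable_times borel_measurable_diff cper_measurable\<close>)
    moreover have "(\<integral>x. f n x * S (f n) x \<partial>torus) - (\<integral>x. g n x * S (g n) x \<partial>torus)
      = (\<integral>x. h n x * S (f n) x \<partial>torus) + (\<integral>x. g n x * (S (f n) x - S (g n) x) \<partial>torus)"
      using Lm_mult_cper[OF int[OF f] S(1)[OF f]] Lm_mult_cper[OF int[OF g] S(1)[OF f]] Lm_mult_cper[OF int[OF g] S(1)[OF g]]
      by (simp add: h_def left_diff_distrib right_diff_distrib)
    ultimately have "2 * (energy p (f n) - energy p (g n)) = (\<integral>x. h n x * S (f n) x \<partial>torus) + (\<integral>x. g n x * S (h n) x \<partial>torus)"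
      using e[OF f, of n] e[OF g, of n] by simp
    moreover have "\<bar>\<integral>x. h n x * S (f n) x \<partial>torus\<bar> \<le> r R * (\<integral>x. \<bar>h n x\<bar> \<partial>torus)"
      by (rule hold[OF int[OF h] S(1)[OF f]]) (rule order_trans[OF sup[OF f] r_mono[OF Ip_nonneg R(1)]])
    moreover have "\<bar>\<integral>x. g n x * S (h n) x \<partial>torus\<bar> \<le> r (Ip p (h n)) * (\<integral>x. \<bar>g n x\<bar> \<partial>torus)"
      by (rule hold[OF int[OF g] S(1)[OF h] sup[OF h]])
    moreover have "r (Ip p (h n)) * (\<integral>x. \<bar>g n x\<bar> \<partial>torus) \<le> r (Ip p (h n)) * (vol powr (p - 1) * R) powr (1 / p)"
      by (intro mult_left_mono g1 r0)
    moreover have "2 * (a - b) = s + t \<Longrightarrow> \<bar>s\<bar> \<le> u \<Longrightarrow> \<bar>t\<bar> \<le> v \<Longrightarrow> v \<le> w \<Longrightarrow> \<bar>a - b\<bar> \<le> u + w" for a b s t u v w :: real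
    proof -
      assume a: "2 * (a - b) = s + t" "\<bar>s\<bar> \<le> u" "\<bar>t\<bar> \<le> v" "v \<le> w"
      have "\<bar>a - b\<bar> \<le> \<bar>2 * (a - b)\<bar>" by (simp add: abs_mult)
      also have "\<dots> \<le> \<bar>s\<bar> + \<bar>t\<bar>" unfolding a(1) by (rule abs_triangle_ineq)
      also have "\<dots> \<le> u + w" using a by (intro add_mono) auto
      finally show ?thesis .
    qed
    ultimately show ?thesis by blast
  qed
  have "(\<lambda>n. r R * (\<integral>x. \<bar>h n x\<bar> \<partial>torus) + r (Ip p (h n)) * (vol powr (p - 1) * R) powr (1 / p))
     \<longlonglongrightarrow> r R * 0 + (C * 0) powr (1 / p) * (vol powr (p - 1) * R) powr (1 / p)"
    unfolding r_def using p C(1) l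
    by (intro tendsto_add tendsto_mult tendsto_const l1 tendsto_powr') (auto simp: h_def[abs_def] intro!: always_eventually)
  then have z: "(\<lambda>n. r R * (\<integral>x. \<bar>h n x\<bar> \<partial>torus) + r (Ip p (h n)) * (vol powr (p - 1) * R) powr (1 / p)) \<longlonglongrightarrow> 0" by simp
  show ?thesis by (rule Lim_null_comparison[OF always_eventually z]) (use b in simp)
qed

section \<open>The spectral gap\<close>

text \<open>Twice the norm form of the Eisenstein integers. Its smallest positive values are 1,
  taken at the six units that make up \<open>low\<close>, and 3; hence the ratio 3 between the first
  two eigenvalues.\<close>

lemma freq_sum_nat: "freq_sum k = 2 * of_int ((fst k)\<^sup>2 - fst k * snd k + (snd k)\<^sup>2)"
  by (simp add: freq_sum_eq freq_def power2_eq_square algebra_simps)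

definition low :: "(int \<times> int) set" where
  "low = {(1, 0), (-1, 0), (0, 1), (0, -1), (1, 1), (-1, -1)}"

text \<open>Four times the form is \<open>(2 * m - n)\<^sup>2 + 3 * n\<^sup>2\<close>, and
  symmetrically in \<open>m\<close>, so both variables are at most 1 in absolute value.\<close>

lemma form_cases:
  fixes m n :: int
  assumes "m\<^sup>2 - m * n + n\<^sup>2 \<le> 2" "(m, n) \<noteq> 0"
  shows "(m, n) \<in> low"
proof -
  have aux: "4 * a = b + 3 * d \<Longrightarrow> a \<le> 2 \<Longrightarrow> 0 \<le> b \<Longrightarrow> 3 * d \<le> 8" for a b d :: int by linarith
  have "3 * n\<^sup>2 \<le> 8"
  proof -
    have "4 * (m\<^sup>2 - m * n + n\<^sup>2) = (2 * m - n)\<^sup>2 + 3 * n\<^sup>2" by (simp add: power2_eq_square algebra_simps)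
    from aux[OF this assms(1) zero_le_power2] show ?thesis .
  qed
  then have "\<bar>n\<bar> < 2" by (intro power2_less_imp_less[of "\<bar>n\<bar>" 2]) auto
  have "3 * m\<^sup>2 \<le> 8"
  proof -
    have "4 * (m\<^sup>2 - m * n + n\<^sup>2) = (2 * n - m)\<^sup>2 + 3 * m\<^sup>2" by (simp add: power2_eq_square algebra_simps)
    from aux[OF this assms(1) zero_le_power2] show ?thesis .
  qed
  then have "\<bar>m\<bar> < 2" by (intro power2_less_imp_less[of "\<bar>m\<bar>" 2]) auto
  then have "m \<in> {-1, 0, 1}" "n \<in> {-1, 0, 1}" using \<open>\<bar>n\<bar> < 2\<close> by auto
  then show ?thesis using assms by (auto simp: low_def zero_prod_def)
qed

lemma freq_sum_low: "k \<in> low \<Longrightarrow> freq_sum k = 2"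
  by (auto simp: low_def freq_sum_nat)

lemma freq_sum_high: assumes "k \<noteq> 0" "k \<notin> low" shows "6 \<le> freq_sum k"
proof -
  have "\<not> (fst k)\<^sup>2 - fst k * snd k + (snd k)\<^sup>2 \<le> 2" using form_cases[of "fst k" "snd k"] assms by auto
  then have "3 \<le> (fst k)\<^sup>2 - fst k * snd k + (snd k)\<^sup>2" by linarith
  then have "of_int 3 \<le> (of_int ((fst k)\<^sup>2 - fst k * snd k + (snd k)\<^sup>2) :: real)" by (rule of_int_le_iff[THEN iffD2])
  then show ?thesis unfolding freq_sum_nat by simp
qed

lemma freq_sum_ge_2: "k \<noteq> 0 \<Longrightarrow> 2 \<le> freq_sum k"
  using freq_sum_low[of k] freq_sum_high[of k] by fastforce

definition proj :: "(int \<times> int \<Rightarrow> complex) \<Rightarrow> int \<times> int \<Rightarrow> complex" where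
  "proj c k = (if k \<in> low then c k else 0)"

text \<open>Frequency by frequency: \<open>3 / 4 - 3 / (2 * freq_sum k)\<close> is 0 on
  \<open>low\<close>, where \<open>freq_sum\<close> is 2, and at least 1/2 elsewhere, where it is at
  least 6.\<close>

lemma gap_T:
  assumes c: "fin c" "c 0 = 0" "herm c"
  shows "1 / 2 * (\<integral>x. (T c x - T (proj c) x)\<^sup>2 \<partial>torus) \<le> 3 / 4 * (\<integral>x. (T c x)\<^sup>2 \<partial>torus) - (\<integral>x. T c x * T (inv_laplace c) x \<partial>torus)"
proof -
  define S where "S = {k. c k \<noteq> 0}"
  have S: "finite S" using c by (simp add: S_def fin_def)
  have fp: "fin (proj c)" by (rule fin_subset[OF c(1)]) (auto simp: proj_def split: if_splits)
  define d where "d k = c k - proj c k" for k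
  have dk: "d k = (if k \<in> low then 0 else c k)" for k by (simp add: d_def proj_def)
  have lowm: "- k \<in> low \<longleftrightarrow> k \<in> low" for k by (cases k) (auto simp: low_def)
  have hd: "herm d" using c(3) by (simp only: herm_def dk lowm) simp
  have hg: "herm (inv_laplace c)" using c(3) by (simp only: herm_def inv_laplace_def freq_sum_minus) simp
  have sub: "\<And>k. c k \<noteq> 0 \<Longrightarrow> k \<in> S" "\<And>k. d k \<noteq> 0 \<Longrightarrow> k \<in> S" "\<And>k. inv_laplace c k \<noteq> 0 \<Longrightarrow> k \<in> S"
    by (auto simp: S_def dk inv_laplace_def split: if_splits)
  have e: "T c x - T (proj c) x = T d x" for x unfolding d_def using T_diff[OF c(1) fp] by simp
  have P1: "(\<integral>x. (T d x)\<^sup>2 \<partial>torus) = vol * (\<Sum>k\<in>S. Re (d k * cnj (d k)))"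
    unfolding power2_eq_square by (rule parseval[OF S sub(2) sub(2) hd hd])
  have P2: "(\<integral>x. (T c x)\<^sup>2 \<partial>torus) = vol * (\<Sum>k\<in>S. Re (c k * cnj (c k)))"
    unfolding power2_eq_square by (rule parseval[OF S sub(1) sub(1) c(3) c(3)])
  have P3: "(\<integral>x. T c x * T (inv_laplace c) x \<partial>torus) = vol * (\<Sum>k\<in>S. Re (c k * cnj (inv_laplace c k)))"
    by (rule parseval[OF S sub(1) sub(3) c(3) hg])
  have pt: "1 / 2 * Re (d k * cnj (d k)) \<le> 3 / 4 * Re (c k * cnj (c k)) - Re (c k * cnj (inv_laplace c k))" if "k \<in> S" for k
  proof -
    have k0: "k \<noteq> 0" using that c(2) by (auto simp: S_def)
    define X where "X = Re (c k * cnj (c k))"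
    have X: "0 \<le> X" by (simp add: X_def)
    have g: "Re (c k * cnj (inv_laplace c k)) = 3 / (2 * freq_sum k) * X" by (simp add: inv_laplace_def X_def field_simps)
    show ?thesis
    proof (cases "k \<in> low")
      case True
      then show ?thesis unfolding g by (simp add: dk freq_sum_low X_def)
    next
      case False
      have "3 / (2 * freq_sum k) \<le> 1 / 4" using freq_sum_high[OF k0 False] by (simp add: field_simps)
      then have "3 / (2 * freq_sum k) * X \<le> 1 / 4 * X" using X by (intro mult_right_mono) auto
      moreover have "d k = c k" using False by (simp add: dk)
      moreover have "t \<le> 1 / 4 * X \<Longrightarrow> 1 / 2 * X \<le> 3 / 4 * X - t" for t by linarith
      ultimately show ?thesis unfolding g X_def[symmetric] by (simp only: X_def[symmetric])
    qed
  qed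
  have "(\<Sum>k\<in>S. 1 / 2 * Re (d k * cnj (d k))) \<le> (\<Sum>k\<in>S. 3 / 4 * Re (c k * cnj (c k)) - Re (c k * cnj (inv_laplace c k)))"
    by (intro sum_mono pt)
  then have "vol * (1 / 2 * (\<Sum>k\<in>S. Re (d k * cnj (d k)))) \<le> vol * (3 / 4 * (\<Sum>k\<in>S. Re (c k * cnj (c k))) - (\<Sum>k\<in>S. Re (c k * cnj (inv_laplace c k))))"
    using vol_pos by (intro mult_left_mono) (simp_all only: sum_distrib_left sum_subtractf less_imp_le)
  then show ?thesis unfolding e P1 P2 P3 by (simp add: algebra_simps)
qed

section \<open>The first eigenspace in complex coordinates, and the gap for bounded
  functions\<close>

definition low_wave :: "complex \<times> complex \<times> complex \<Rightarrow> real^2 \<Rightarrow> real" where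
  "low_wave v x = mode (1, 0) (fst v) x + mode (0, 1) (fst (snd v)) x + mode (1, 1) (snd (snd v)) x"

text \<open>Normalised to return \<open>c\<close> from \<open>mode k c\<close> for
  \<open>k \<noteq> 0\<close>; here \<open>mode k \<i>\<close> is minus a sine. On Hermitian
  coefficients it returns \<open>2 * c k\<close>, as \<open>k\<close> and \<open>- k\<close>
  describe one wave.\<close>

definition fourier_coeff :: "int \<times> int \<Rightarrow> (real^2 \<Rightarrow> real) \<Rightarrow> complex" where
  "fourier_coeff k f = Complex (2 / vol * (\<integral>x. f x * mode k 1 x \<partial>torus)) (2 / vol * (\<integral>x. f x * mode k \<i> x \<partial>torus))"

text \<open>Coordinates of the orthogonal projection onto the first eigenspace, meaningful for every
  integrable function.\<close>

definition low_coeffs :: "(real^2 \<Rightarrow> real) \<Rightarrow> complex \<times> complex \<times> complex" where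
  "low_coeffs f = (fourier_coeff (1, 0) f, fourier_coeff (0, 1) f, fourier_coeff (1, 1) f)"

lemma cper_low_wave [simp, intro]: "cper (low_wave v)"
  unfolding low_wave_def by (intro cper_add cper_mode)

lemma wave_eq_low_wave:
  "wave A B C \<alpha> \<beta> \<gamma> = low_wave (of_real A * cis \<alpha>, of_real B * cis \<beta>, of_real C * cis \<gamma>)"
proof
  fix x
  have m: "mode k (of_real a * cis b) x = a * cos (ph k x + b)" for k a b
    by (simp add: mode_def mult.assoc cis_mult add.commute[of b])
  have "ph (1, 0) x = x $ 1 - x $ 2 / sqrt 3" "ph (0, 1) x = 2 * x $ 2 / sqrt 3" "ph (1, 1) x = x $ 1 + x $ 2 / sqrt 3"
    by (simp_all add: ph_def ph1_def ph2_def)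
  then show "wave A B C \<alpha> \<beta> \<gamma> x = low_wave (of_real A * cis \<alpha>, of_real B * cis \<beta>, of_real C * cis \<gamma>) x"
    by (simp only: wave_def low_wave_def fst_conv snd_conv m)
qed

lemma low_wave_coeffs:
  obtains c where "fin c" "T c = low_wave v" "\<And>k. c k \<noteq> 0 \<Longrightarrow> k \<in> low"
proof -
  define c where "c k = (if k = (1, 0) then fst v else if k = (0, 1) then fst (snd v) else if k = (1, 1) then snd (snd v) else 0)" for k :: "int \<times> int"
  have s: "k \<in> {(1, 0), (0, 1), (1, 1)}" if "c k \<noteq> 0" for k
    using that by (auto simp: c_def split: if_splits)
  have "T c x = (\<Sum>k\<in>{(1, 0), (0, 1), (1, 1)}. mode k (c k) x)" for x
    by (rule T_on) (use s in auto)
  then have "T c = low_wave v" by (intro ext) (simp add: c_def low_wave_def)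
  moreover have "fin c" unfolding fin_def by (rule finite_subset[of _ "{(1, 0), (0, 1), (1, 1)}"]) (use s in auto)
  moreover have "k \<in> low" if "c k \<noteq> 0" for k using s[OF that] by (auto simp: low_def)
  ultimately show thesis using that by blast
qed

lemma low_nonzero: "k \<in> low \<Longrightarrow> k \<noteq> 0"
  by (auto simp: low_def zero_prod_def)

lemma inv_laplace_low: "(\<And>k. c k \<noteq> 0 \<Longrightarrow> k \<in> low) \<Longrightarrow> inv_laplace c = (\<lambda>k. of_real (3 / 4) * c k)"
proof
  assume a: "\<And>k. c k \<noteq> 0 \<Longrightarrow> k \<in> low"
  fix k
  show "inv_laplace c k = of_real (3 / 4) * c k"
    using a[of k] by (cases "c k = 0") (simp_all add: inv_laplace_def freq_sum_low)
qed

lemma low_wave_poisson: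
  assumes p: "1 < p" shows "poisson_solution p (\<lambda>x. 4 / 3 * low_wave v x) (low_wave v)"
proof -
  obtain c where c: "fin c" "T c = low_wave v" "\<And>k. c k \<noteq> 0 \<Longrightarrow> k \<in> low" using low_wave_coeffs[of v] by blast
  define d where "d = (\<lambda>k. of_real (4 / 3) * c k)"
  have "c 0 = 0" using c(3) low_nonzero by blast
  moreover have "fin d" unfolding d_def by (rule fin_mult[OF c(1)])
  ultimately have d: "fin d" "d 0 = 0" by (simp_all add: d_def)
  have "poisson_solution p (T d) (T (inv_laplace d))" by (rule poisson_T[OF p d])
  moreover have "inv_laplace d = c"
  proof -
    have "inv_laplace d = (\<lambda>k. of_real (3 / 4) * d k)" by (rule inv_laplace_low) (use c(3) in \<open>auto simp: d_def\<close>)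
    then show ?thesis by (auto simp: d_def)
  qed
  moreover have "T d = (\<lambda>x. 4 / 3 * T c x)" unfolding d_def by (rule ext) (rule T_scale[OF c(1)])
  ultimately show ?thesis using c(2) by simp
qed

text \<open>At \<open>k \<noteq> 0\<close> the coefficient of an eigenfunction is annihilated by
  \<open>2 / 3 * freq_sum k - l\<close>, which is positive if \<open>l < 4 / 3\<close>; at
  \<open>k = 0\<close> it vanishes by zero mean.\<close>

lemma first_eigenvalue_eq: "first_eigenvalue = 4 / 3"
  unfolding first_eigenvalue_def
proof (rule Least_equality)
  show "is_eigenvalue (4 / 3)"
    unfolding is_eigenvalue_def eigenspace_def
  proof (rule bexI[of _ "low_wave (1, 0, 0)"])
    show "low_wave (1, 0, 0) \<in> {u. poisson_solution 2 (\<lambda>x. 4 / 3 * u x) u}" using low_wave_poisson by simp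
    show "\<not> (AE x in torus. low_wave (1, 0, 0) x = 0)"
    proof
      assume ae: "AE x in torus. low_wave (1, 0, 0) x = 0"
      have "(\<integral>x. mode (1, 0) 1 x * mode (1, 0) 1 x \<partial>torus) = (\<integral>x. 0 \<partial>torus)"
      proof (rule integral_cong_AE)
        show "AE x in torus. mode (1, 0) 1 x * mode (1, 0) 1 x = 0"
          using ae by (rule AE_mp) (auto intro!: AE_I2 simp: low_wave_def)
        show "(\<lambda>x. mode (1, 0) 1 x * mode (1, 0) 1 x) \<in> borel_measurable torus"
          by (intro cper_measurable cper_mult cper_mode)
      qed simp
      then show False unfolding integral_mode_mult using vol_pos by simp
    qed
  qed
next
  fix l assume "is_eigenvalue l"
  then obtain u where u: "poisson_solution 2 (\<lambda>x. l * u x) u" "\<not> (AE x in torus. u x = 0)"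
    unfolding is_eigenvalue_def eigenspace_def by blast
  have i: "integrable torus u" "(\<integral>x. u x \<partial>torus) = 0" using poisson_integrable[OF _ u(1)] by auto
  show "4 / 3 \<le> l"
  proof (rule ccontr)
    assume l: "\<not> 4 / 3 \<le> l"
    have "AE x in torus. u x = 0"
    proof (rule fourier_unique[OF i(1)])
      fix k c
      show "(\<integral>x. u x * mode k c x \<partial>torus) = 0"
      proof (cases "k = 0")
        case True then show ?thesis using i by simp
      next
        case False
        have "(\<integral>x. l * u x * mode k c x \<partial>torus) = 2 / 3 * freq_sum k * (\<integral>x. u x * mode k c x \<partial>torus)"
          by (rule poisson_modes[OF _ _ u(1)]) (use i in auto)
        moreover have "(\<integral>x. l * u x * mode k c x \<partial>torus) = l * (\<integral>x. u x * mode k c x \<partial>torus)"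
          by (simp add: mult.assoc)
        ultimately have "(2 / 3 * freq_sum k - l) * (\<integral>x. u x * mode k c x \<partial>torus) = 0"
          unfolding left_diff_distrib by linarith
        moreover have "2 / 3 * freq_sum k - l \<noteq> 0" using freq_sum_ge_2[OF False] l by linarith
        ultimately show ?thesis by simp
      qed
    qed
    then show False using u(2) by simp
  qed
qed

lemma low_wave_E1: "low_wave v \<in> E1"
  unfolding E1_def eigenspace_def first_eigenvalue_eq using low_wave_poisson[of 2 v] by simp

lemma low_wave_Lp0: "1 < p \<Longrightarrow> low_wave v \<in> Lp0 p"
proof -
  assume p: "1 < p"
  obtain c where c: "fin c" "T c = low_wave v" "\<And>k. c k \<noteq> 0 \<Longrightarrow> k \<in> low" using low_wave_coeffs[of v] by blast
  have "c 0 = 0" using c(3) low_nonzero by blast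
  then show ?thesis using T_Lp0[OF c(1), of p] c(2) p by simp
qed

text \<open>The equality case of the gap inequality: the functional vanishes on the
  eigenspace.\<close>

lemma energy_low_wave: assumes p: "1 < p" shows "energy p (low_wave v) = 3 / 8 * (\<integral>x. (low_wave v x)\<^sup>2 \<partial>torus)"
proof -
  obtain c where c: "fin c" "T c = low_wave v" "\<And>k. c k \<noteq> 0 \<Longrightarrow> k \<in> low" using low_wave_coeffs[of v] by blast
  have "c 0 = 0" using c(3) low_nonzero by blast
  from energy_T[OF p c(1) this] have "energy p (low_wave v) = 1 / 2 * (\<integral>x. low_wave v x * T (inv_laplace c) x \<partial>torus)" by (simp add: c(2))
  also have "T (inv_laplace c) = (\<lambda>x. 3 / 4 * low_wave v x)"
  proof -
    have "inv_laplace c = (\<lambda>k. of_real (3 / 4) * c k)" by (rule inv_laplace_low) (rule c(3))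
    then show ?thesis unfolding c(2)[symmetric] by (simp only:) (rule ext, rule T_scale[OF c(1)])
  qed
  also have "(\<lambda>x. low_wave v x * (3 / 4 * low_wave v x)) = (\<lambda>x. 3 / 4 * (low_wave v x)\<^sup>2)" by (auto simp: power2_eq_square)
  finally show ?thesis by simp
qed

lemma fourier_coeff_T:
  assumes c: "fin c" "herm c" and k: "k \<noteq> 0"
  shows "fourier_coeff k (T c) = 2 * c k"
proof -
  have S: "finite {l. c l \<noteq> 0}" using c by (simp add: fin_def)
  have "(\<integral>x. T c x * mode k b x \<partial>torus) = vol * Re (c k * cnj b)" for b
  proof -
    have "(\<integral>x. T c x * mode k b x \<partial>torus) = (\<Sum>l | c l \<noteq> 0. \<integral>x. mode l (c l) x * mode k b x \<partial>torus)"
      unfolding T_def sum_distrib_right by (rule Bochner_Integration.integral_sum) (auto intro: cper_mult)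
    also have "\<dots> = (\<Sum>l | c l \<noteq> 0. (if l = - k then vol / 2 * Re (c l * b) else 0) + (if l = k then vol / 2 * Re (c l * cnj b) else 0))"
      by (rule sum.cong[OF refl], subst integral_mode_mult) (auto simp: field_simps)
    also have "\<dots> = vol / 2 * Re (c (- k) * b) + vol / 2 * Re (c k * cnj b)"
      using S by (simp add: sum.distrib sum.delta')
    also have "Re (c (- k) * b) = Re (c k * cnj b)" unfolding hermD[OF c(2)] by simp
    finally show ?thesis by simp
  qed
  from this[of 1] this[of \<i>] show ?thesis using vol_pos by (simp add: fourier_coeff_def complex_eq_iff)
qed

lemma T_proj:
  assumes c: "fin c" "herm c"
  shows "T (proj c) = low_wave (low_coeffs (T c))"
proof
  fix x
  have n: "mode (- k) (c (- k)) x = mode k (c k) x" for k unfolding hermD[OF c(2)] by (rule mode_cnj)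
  have d: "mode k (2 * b) x = 2 * mode k b x" for k b using mode_scale[of k 2 b x] by simp
  have "T (proj c) x = (\<Sum>k\<in>low. mode k (proj c k) x)"
    by (rule T_on) (auto simp: low_def proj_def split: if_splits)
  also have "\<dots> = (\<Sum>k\<in>low. mode k (c k) x)" by (rule sum.cong) (auto simp: proj_def)
  also have "\<dots> = 2 * mode (1, 0) (c (1, 0)) x + 2 * mode (0, 1) (c (0, 1)) x + 2 * mode (1, 1) (c (1, 1)) x"
    using n[of "(1, 0)"] n[of "(0, 1)"] n[of "(1, 1)"] by (simp add: low_def)
  also have "\<dots> = low_wave (low_coeffs (T c)) x"
    by (simp add: low_wave_def low_coeffs_def fourier_coeff_T[OF c] zero_prod_def d)
  finally show "T (proj c) x = low_wave (low_coeffs (T c)) x" .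
qed

lemma fourier_coeff_tendsto:
  assumes "\<And>n. f n \<in> borel_measurable torus" "g \<in> borel_measurable torus"
    and "AE x in torus. (\<lambda>n. f n x) \<longlonglongrightarrow> g x" "\<And>n x. x \<in> cell \<Longrightarrow> \<bar>f n x\<bar> \<le> R"
  shows "(\<lambda>n. fourier_coeff k (f n)) \<longlonglongrightarrow> fourier_coeff k g"
proof -
  have "(\<lambda>n. \<integral>x. f n x * mode k b x \<partial>torus) \<longlonglongrightarrow> (\<integral>x. g x * mode k b x \<partial>torus)" for b
  proof (rule torus_dct[where R = "R * cmod b"])
    show "AE x in torus. (\<lambda>n. f n x * mode k b x) \<longlonglongrightarrow> g x * mode k b x"
      using assms(3) by (rule AE_mp) (auto intro!: AE_I2 tendsto_intros)
    show "\<bar>f n x * mode k b x\<bar> \<le> R * cmod b" if "x \<in> cell" for n x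
      unfolding abs_mult using assms(4)[OF that] mode_bound[of k b x] by (intro mult_mono) (auto intro: order_trans[OF abs_ge_zero])
  qed (use assms cper_measurable[OF cper_mode] in \<open>auto intro!: borel_measurable_times\<close>)
  then show ?thesis unfolding fourier_coeff_def tendsto_complex_iff using vol_pos by (auto intro!: tendsto_intros)
qed

lemma low_wave_tendsto:
  assumes "v \<longlonglongrightarrow> w" shows "(\<lambda>n. low_wave (v n) x) \<longlonglongrightarrow> low_wave w x"
  unfolding low_wave_def mode_def
  by (intro tendsto_add tendsto_Re tendsto_mult tendsto_const tendsto_fst tendsto_snd assms)

lemma low_wave_bound: "\<bar>low_wave v x\<bar> \<le> cmod (fst v) + cmod (fst (snd v)) + cmod (snd (snd v))"
  unfolding low_wave_def by (intro order_trans[OF abs_triangle_ineq] add_mono mode_bound)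

lemma fourier_coeff_bound:
  assumes f: "f \<in> borel_measurable torus" "\<And>x. x \<in> cell \<Longrightarrow> \<bar>f x\<bar> \<le> R"
  shows "cmod (fourier_coeff k f) \<le> 4 * R"
proof -
  have "\<bar>\<integral>x. f x * mode k b x \<partial>torus\<bar> \<le> R * vol" if "cmod b = 1" for b
  proof -
    have b: "\<bar>f x * mode k b x\<bar> \<le> R" if "x \<in> cell" for x
    proof -
      have "\<bar>f x * mode k b x\<bar> \<le> R * 1"
        unfolding abs_mult using f(2)[OF that] mode_bound[of k b x] \<open>cmod b = 1\<close> by (intro mult_mono) (auto intro: order_trans[OF abs_ge_zero])
      then show ?thesis by simp
    qed
    have i: "integrable torus (\<lambda>x. f x * mode k b x)"
      by (rule integrable_torus_bounded[OF _ b]) (use f cper_measurable[OF cper_mode] in auto)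
    have "\<bar>\<integral>x. f x * mode k b x \<partial>torus\<bar> \<le> (\<integral>x. \<bar>f x * mode k b x\<bar> \<partial>torus)" by (rule integral_abs_bound)
    also have "\<dots> \<le> (\<integral>x. R \<partial>torus)" by (rule integral_mono) (use i b in auto)
    finally show ?thesis by (simp add: mult.commute)
  qed
  from this[of 1] this[of \<i>] have "\<bar>Re (fourier_coeff k f)\<bar> \<le> 2 * R" "\<bar>Im (fourier_coeff k f)\<bar> \<le> 2 * R"
    using vol_pos by (auto simp: fourier_coeff_def abs_mult field_simps)
  then show ?thesis using cmod_le[of "fourier_coeff k f"] by linarith
qed

text \<open>\<open>gap_T\<close> passes to the limit along bounded, almost everywhere convergent
  polynomials, made Hermitian and freed of their constant term. Uniform boundedness gives
  convergence of the squares and, in \<open>L^p\<close>, of the energies.\<close>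

lemma gap_bounded:
  assumes p: "1 < p" and f: "f \<in> Lp0 p" and R: "0 < R" "\<And>x. x \<in> cell \<Longrightarrow> \<bar>f x\<bar> \<le> R"
  shows "1 / 2 * (\<integral>x. (f x - low_wave (low_coeffs f) x)\<^sup>2 \<partial>torus) \<le> 3 / 4 * (\<integral>x. (f x)\<^sup>2 \<partial>torus) - 2 * energy p f"
proof -
  have fm: "f \<in> borel_measurable torus" "(\<integral>x. f x \<partial>torus) = 0"
    using f by (auto simp: Lp0_def Lp_def torus_measurable_def mean_zero_def)
  have fL: "f \<in> Lm p" using f by (simp add: Lp0_def Lm_Lp)
  obtain c where c: "\<And>n. fin (c n)" "\<And>n x. \<bar>T (c n) x\<bar> \<le> R + 1" "AE x in torus. (\<lambda>n. T (c n) x) \<longlonglongrightarrow> f x"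
    using trig_bounded_approx[OF fm(1) R] by blast
  have "\<exists>d. fin d \<and> herm d \<and> T d = T (c n)" for n using herm_exists[OF c(1)] by metis
  then obtain d where d: "\<And>n. fin (d n)" "\<And>n. herm (d n)" "\<And>n. T (d n) = T (c n)" by metis
  define e where "e n k = (if k = 0 then 0 else d n k)" for n k
  have fe: "fin (e n)" for n by (rule fin_subset[OF d(1)]) (auto simp: e_def split: if_splits)
  have he: "herm (e n)" for n using hermD[OF d(2)] by (simp only: herm_def e_def neg_equal_0_iff_equal) simp
  have e0: "e n 0 = 0" for n by (simp add: e_def)
  have Te: "T (e n) x = T (c n) x - (\<integral>x. T (c n) x \<partial>torus) / vol" for n x
  proof -
    have f0: "fin (\<lambda>k. if k = 0 then d n 0 else 0)" by (simp add: fin_def)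
    have "T (\<lambda>k. if k = 0 then d n 0 else 0) x = Re (d n 0)"
      by (subst T_on[of "{0}"]) (auto split: if_splits)
    moreover have "(\<lambda>k. e n k + (if k = 0 then d n 0 else 0)) = d n" by (auto simp: e_def)
    moreover have "(\<integral>x. T (c n) x \<partial>torus) / vol = Re (d n 0)" using integral_T[OF d(1), of n] d(3)[of n] vol_pos by simp
    ultimately show ?thesis using T_add[OF fe f0, of n x] d(3)[of n] by simp
  qed
  have "(\<lambda>n. \<integral>x. T (c n) x \<partial>torus) \<longlonglongrightarrow> (\<integral>x. f x \<partial>torus)"
    by (rule torus_dct[OF cper_measurable[OF cper_T] fm(1) c(3) c(2)])
  then have m0: "(\<lambda>n. (\<integral>x. T (c n) x \<partial>torus) / vol) \<longlonglongrightarrow> 0"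
    using tendsto_divide[OF _ tendsto_const, of _ 0 sequentially vol] vol_pos fm(2) by fastforce
  have ae: "AE x in torus. (\<lambda>n. T (e n) x) \<longlonglongrightarrow> f x"
    using c(3)
  proof (rule AE_mp, intro AE_I2 impI)
    fix x assume "(\<lambda>n. T (c n) x) \<longlonglongrightarrow> f x"
    from tendsto_diff[OF this m0] show "(\<lambda>n. T (e n) x) \<longlonglongrightarrow> f x" unfolding Te by simp
  qed
  define Q where "Q = 2 * (R + 1)"
  have bd: "\<bar>T (e n) x\<bar> \<le> Q" for n x
  proof -
    have "\<bar>\<integral>x. T (c n) x \<partial>torus\<bar> \<le> (\<integral>x. \<bar>T (c n) x\<bar> \<partial>torus)" by (rule integral_abs_bound)
    also have "\<dots> \<le> (\<integral>x. R + 1 \<partial>torus)" by (rule integral_mono) (use c(2) in \<open>auto intro!: cper_integrable\<close>)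
    finally have "\<bar>(\<integral>x. T (c n) x \<partial>torus) / vol\<bar> \<le> R + 1" using vol_pos by (simp add: field_simps)
    from order_trans[OF abs_triangle_ineq4 add_mono[OF c(2)[of n x] this]] show ?thesis unfolding Te Q_def by simp
  qed
  have Q: "0 < Q" "R \<le> Q" using R(1) by (auto simp: Q_def)
  have em: "T (e n) \<in> borel_measurable torus" for n by (rule cper_measurable[OF cper_T])
  have zl: "(\<lambda>n. low_coeffs (T (e n))) \<longlonglongrightarrow> low_coeffs f"
    unfolding low_coeffs_def by (intro tendsto_Pair fourier_coeff_tendsto[OF em fm(1) ae bd])
  have wave_bd: "\<bar>low_wave (low_coeffs g) x\<bar> \<le> 12 * Q" if "g \<in> borel_measurable torus" "\<And>x. x \<in> cell \<Longrightarrow> \<bar>g x\<bar> \<le> Q" for g x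
    using low_wave_bound[of "low_coeffs g" x] fourier_coeff_bound[OF that, of "(1, 0)"] fourier_coeff_bound[OF that, of "(0, 1)"] fourier_coeff_bound[OF that, of "(1, 1)"]
    by (simp add: low_coeffs_def)
  have 1: "(\<lambda>n. \<integral>x. (T (e n) x - low_wave (low_coeffs (T (e n))) x)\<^sup>2 \<partial>torus) \<longlonglongrightarrow> (\<integral>x. (f x - low_wave (low_coeffs f) x)\<^sup>2 \<partial>torus)"
  proof (rule torus_dct[where R = "(13 * Q)\<^sup>2"])
    show "AE x in torus. (\<lambda>n. (T (e n) x - low_wave (low_coeffs (T (e n))) x)\<^sup>2) \<longlonglongrightarrow> (f x - low_wave (low_coeffs f) x)\<^sup>2"
      using ae by (rule AE_mp) (auto intro!: AE_I2 tendsto_intros low_wave_tendsto zl)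
    show "\<bar>(T (e n) x - low_wave (low_coeffs (T (e n))) x)\<^sup>2\<bar> \<le> (13 * Q)\<^sup>2" if "x \<in> cell" for n x
    proof -
      have "\<bar>T (e n) x - low_wave (low_coeffs (T (e n))) x\<bar> \<le> Q + 12 * Q"
        using bd[of n x] wave_bd[OF em bd, of n x] by (intro order_trans[OF abs_triangle_ineq4] add_mono)
      from power_mono[OF this abs_ge_zero, of 2] show ?thesis by simp
    qed
    show "(\<lambda>x. (T (e n) x - low_wave (low_coeffs (T (e n))) x)\<^sup>2) \<in> borel_measurable torus" for n
      by (intro cper_measurable cper_power cper_diff cper_T cper_low_wave)
    show "(\<lambda>x. (f x - low_wave (low_coeffs f) x)\<^sup>2) \<in> borel_measurable torus"
      using fm(1) cper_measurable[OF cper_low_wave] by auto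
  qed
  have 2: "(\<lambda>n. \<integral>x. (T (e n) x)\<^sup>2 \<partial>torus) \<longlonglongrightarrow> (\<integral>x. (f x)\<^sup>2 \<partial>torus)"
  proof (rule torus_dct[where R = "Q\<^sup>2"])
    show "AE x in torus. (\<lambda>n. (T (e n) x)\<^sup>2) \<longlonglongrightarrow> (f x)\<^sup>2"
      using ae by (rule AE_mp) (auto intro!: AE_I2 tendsto_intros)
    show "\<bar>(T (e n) x)\<^sup>2\<bar> \<le> Q\<^sup>2" for n x using power_mono[OF bd[of n x] abs_ge_zero, of 2] by simp
  qed (use fm em in auto)
  have IpQ: "Ip p g \<le> Q powr p * vol" if "g \<in> borel_measurable torus" "\<And>x. x \<in> cell \<Longrightarrow> \<bar>g x\<bar> \<le> Q" for g
  proof -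
    have "Ip p g \<le> (\<integral>x. Q powr p \<partial>torus)"
      unfolding Ip_def
    proof (rule integral_mono)
      show "integrable torus (\<lambda>x. \<bar>g x\<bar> powr p)" using Lm_bounded[OF that, of p] p by (simp add: Lm_def)
      show "\<bar>g x\<bar> powr p \<le> Q powr p" if "x \<in> space torus" for x using that \<open>\<And>x. x \<in> cell \<Longrightarrow> \<bar>g x\<bar> \<le> Q\<close> p by (intro powr_mono2) auto
    qed simp
    then show ?thesis by (simp add: mult.commute)
  qed
  have l: "(\<lambda>n. Ip p (\<lambda>x. T (e n) x - f x)) \<longlonglongrightarrow> (\<integral>x. 0 \<partial>torus)"
    unfolding Ip_def
  proof (rule torus_dct[where R = "(2 * Q) powr p"])
    show "AE x in torus. (\<lambda>n. \<bar>T (e n) x - f x\<bar> powr p) \<longlonglongrightarrow> 0"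
      using ae
    proof (rule AE_mp, intro AE_I2 impI)
      fix x assume "(\<lambda>n. T (e n) x) \<longlonglongrightarrow> f x"
      then have "(\<lambda>n. \<bar>T (e n) x - f x\<bar> powr p) \<longlonglongrightarrow> \<bar>f x - f x\<bar> powr p"
        using p by (intro tendsto_powr' tendsto_intros) auto
      then show "(\<lambda>n. \<bar>T (e n) x - f x\<bar> powr p) \<longlonglongrightarrow> 0" by simp
    qed
    show "\<bar>\<bar>T (e n) x - f x\<bar> powr p\<bar> \<le> (2 * Q) powr p" if "x \<in> cell" for n x
    proof -
      have "\<bar>T (e n) x - f x\<bar> \<le> Q + Q"
        using bd[of n x] order_trans[OF R(2)[OF that] Q(2)] by (intro order_trans[OF abs_triangle_ineq4] add_mono)
      then show ?thesis using p by (auto intro!: powr_mono2)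
    qed
  qed (use fm em in auto)
  have "(\<lambda>n. energy p (T (e n)) - energy p f) \<longlonglongrightarrow> 0"
  proof (rule energy_continuous[OF p])
    show "T (e n) \<in> Lp0 p" for n using T_Lp0[OF fe e0] p by simp
    show "Ip p (T (e n)) \<le> Q powr p * vol" for n by (rule IpQ[OF em bd])
    show "Ip p f \<le> Q powr p * vol" by (rule IpQ[OF fm(1) order_trans[OF R(2) Q(2)]])
  qed (use f l in auto)
  then have 3: "(\<lambda>n. energy p (T (e n))) \<longlonglongrightarrow> energy p f" by (rule LIM_zero_cancel)
  have g: "1 / 2 * (\<integral>x. (T (e n) x - low_wave (low_coeffs (T (e n))) x)\<^sup>2 \<partial>torus) \<le> 3 / 4 * (\<integral>x. (T (e n) x)\<^sup>2 \<partial>torus) - 2 * energy p (T (e n))" for n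
    using gap_T[OF fe e0 he, of n] energy_T[OF p fe e0, of n] unfolding T_proj[OF fe he] by simp
  show ?thesis
    by (rule LIMSEQ_le[OF tendsto_mult[OF tendsto_const 1] tendsto_diff[OF tendsto_mult[OF tendsto_const 2] tendsto_mult[OF tendsto_const 3]]])
      (use g in blast)
qed

section \<open>Moments of a wave\<close>

text \<open>The half-angle formula, the source of all even moments: a squared mode is a constant
  plus a mode of doubled frequency.\<close>

lemma mode_amplitude_invariants: "(mode k c x)\<^sup>2 = ((cmod c)\<^sup>2 + mode (k + k) (c\<^sup>2) x) / 2"
proof -
  have "Re (c * cnj c) = (cmod c)\<^sup>2" by (simp add: complex_mult_cnj cmod_power2)
  then show ?thesis using mode_mult[of k c x k c] by (simp add: power2_eq_square)
qed

lemma integral_mode_nonzero: "k \<noteq> 0 \<Longrightarrow> (\<integral>x. mode k c x \<partial>torus) = 0"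
  by (simp add: integral_mode)

lemma integral_mode_orth: "l \<noteq> k \<Longrightarrow> l \<noteq> - k \<Longrightarrow> (\<integral>x. mode k c x * mode l d x \<partial>torus) = 0"
  by (simp add: integral_mode_mult)

lemma integral_mode_self:
  assumes "k \<noteq> 0" shows "(\<integral>x. mode k c x * mode k d x \<partial>torus) = vol / 2 * Re (c * cnj d)"
proof -
  have "k \<noteq> - k" using assms by (cases k) (auto simp: zero_prod_def)
  then show ?thesis by (simp add: integral_mode_mult)
qed

lemma double_nonzero: "k \<noteq> 0 \<Longrightarrow> k + k \<noteq> (0 :: int \<times> int)"
  by (cases k) (auto simp: zero_prod_def)

lemma double_eq_iff: "k + k = l + l \<longleftrightarrow> k = (l :: int \<times> int)"
  by (cases k, cases l) auto

lemma integral_mode_pow2: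
  assumes k: "k \<noteq> 0" shows "(\<integral>x. (mode k c x)\<^sup>2 \<partial>torus) = vol * ((cmod c)\<^sup>2 / 2)"
  unfolding mode_amplitude_invariants using integral_mode_nonzero[OF double_nonzero[OF k]] by simp

lemma integral_mode_pow4:
  assumes k: "k \<noteq> 0" shows "(\<integral>x. (mode k c x) ^ 4 \<partial>torus) = vol * (3 / 8 * ((cmod c)\<^sup>2)\<^sup>2)"
proof -
  let ?a = "(cmod c)\<^sup>2" and ?X = "mode (k + k) (c\<^sup>2)"
  have "(mode k c x) ^ 4 = ?a\<^sup>2 / 4 + ?a / 2 * ?X x + 1 / 4 * (?X x)\<^sup>2" for x
  proof -
    have "(mode k c x) ^ 4 = ((mode k c x)\<^sup>2)\<^sup>2" by simp
    then show ?thesis unfolding mode_amplitude_invariants[of k c x] by (simp add: power2_eq_square field_simps)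
  qed
  then have "(\<integral>x. (mode k c x) ^ 4 \<partial>torus) = ?a\<^sup>2 / 4 * vol + ?a / 2 * (\<integral>x. ?X x \<partial>torus) + 1 / 4 * (\<integral>x. (?X x)\<^sup>2 \<partial>torus)"
    by (simp add: cper_power)
  then show ?thesis
    unfolding integral_mode_pow2[OF double_nonzero[OF k]] integral_mode_nonzero[OF double_nonzero[OF k]]
    by (simp add: norm_power norm_mult power2_eq_square field_simps)
qed

lemma integral_mode_pow22:
  assumes k: "k \<noteq> 0" "l \<noteq> 0" "l \<noteq> k" "l \<noteq> - k"
  shows "(\<integral>x. (mode k c x)\<^sup>2 * (mode l d x)\<^sup>2 \<partial>torus) = vol * ((cmod c)\<^sup>2 * (cmod d)\<^sup>2 / 4)"
proof -
  let ?a = "(cmod c)\<^sup>2" and ?b = "(cmod d)\<^sup>2" and ?X = "mode (k + k) (c\<^sup>2)" and ?Y = "mode (l + l) (d\<^sup>2)"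
  have "(mode k c x)\<^sup>2 * (mode l d x)\<^sup>2 = ?a * ?b / 4 + ?b / 4 * ?X x + ?a / 4 * ?Y x + 1 / 4 * (?X x * ?Y x)" for x
    unfolding mode_amplitude_invariants by (simp add: field_simps)
  then have "(\<integral>x. (mode k c x)\<^sup>2 * (mode l d x)\<^sup>2 \<partial>torus) = ?a * ?b / 4 * vol + ?b / 4 * (\<integral>x. ?X x \<partial>torus) + ?a / 4 * (\<integral>x. ?Y x \<partial>torus) + 1 / 4 * (\<integral>x. ?X x * ?Y x \<partial>torus)"
    by (simp add: cper_mult)
  moreover have "l + l \<noteq> - (k + k)" "l + l \<noteq> k + k" using k double_eq_iff[of l k] double_eq_iff[of l "- k"] by auto
  ultimately show ?thesis
    using integral_mode_orth[of "l + l" "k + k"] integral_mode_nonzero double_nonzero k by simp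
qed

lemma integral_mode_pow6:
  assumes k: "k \<noteq> 0" shows "(\<integral>x. (mode k c x) ^ 6 \<partial>torus) = vol * (5 / 16 * ((cmod c)\<^sup>2) ^ 3)"
proof -
  let ?a = "(cmod c)\<^sup>2" and ?X = "mode (k + k) (c\<^sup>2)" and ?Y = "mode ((k + k) + (k + k)) ((c\<^sup>2)\<^sup>2)"
  have k2: "k + k \<noteq> 0" by (rule double_nonzero[OF k])
  have s: "(mode k c x) ^ 6 = ?a ^ 3 / 8 + 3 * ?a\<^sup>2 / 8 * ?X x + 3 * ?a / 8 * (?X x)\<^sup>2 + ?a\<^sup>2 / 16 * ?X x + 1 / 16 * (?X x * ?Y x)" for x
  proof -
    have "(mode k c x) ^ 6 = ((mode k c x)\<^sup>2) ^ 3" by simp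
    also have "\<dots> = ?a ^ 3 / 8 + 3 * ?a\<^sup>2 / 8 * ?X x + 3 * ?a / 8 * (?X x)\<^sup>2 + 1 / 8 * (?X x * (?X x)\<^sup>2)"
      unfolding mode_amplitude_invariants[of k c x] by (simp add: power2_eq_square power3_eq_cube field_simps)
    also have "?X x * (?X x)\<^sup>2 = ?a\<^sup>2 / 2 * ?X x + 1 / 2 * (?X x * ?Y x)"
      unfolding mode_amplitude_invariants[of "k + k" "c\<^sup>2" x] by (simp add: norm_power field_simps)
    finally show ?thesis by (simp add: field_simps)
  qed
  have "(\<integral>x. (mode k c x) ^ 6 \<partial>torus) = ?a ^ 3 / 8 * vol + 3 * ?a\<^sup>2 / 8 * (\<integral>x. ?X x \<partial>torus) + 3 * ?a / 8 * (\<integral>x. (?X x)\<^sup>2 \<partial>torus)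
     + ?a\<^sup>2 / 16 * (\<integral>x. ?X x \<partial>torus) + 1 / 16 * (\<integral>x. ?X x * ?Y x \<partial>torus)"
    unfolding s by (simp add: cper_mult cper_power)
  moreover have "(k + k) + (k + k) \<noteq> k + k" "(k + k) + (k + k) \<noteq> - (k + k)"
    using k by (cases k; auto simp: zero_prod_def)+
  then have "(\<integral>x. ?X x * ?Y x \<partial>torus) = 0" by (intro integral_mode_orth)
  ultimately show ?thesis
    unfolding integral_mode_pow2[OF k2] integral_mode_nonzero[OF k2]
    by (simp add: norm_power norm_mult power2_eq_square power3_eq_cube field_simps)
qed

text \<open>The fourth power contains the frequencies \<open>2 * k\<close> and \<open>4 * k\<close>,
  the square contains \<open>2 * l\<close>; the hypotheses on \<open>l\<close> keep these from
  coinciding up to sign.\<close>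

lemma integral_mode_pow42:
  assumes k: "k \<noteq> 0" "l \<noteq> 0" "l \<noteq> k" "l \<noteq> - k" "l \<noteq> k + k" "l \<noteq> - (k + k)"
  shows "(\<integral>x. (mode k c x) ^ 4 * (mode l d x)\<^sup>2 \<partial>torus) = vol * (3 / 16 * ((cmod c)\<^sup>2)\<^sup>2 * (cmod d)\<^sup>2)"
proof -
  let ?a = "(cmod c)\<^sup>2" and ?b = "(cmod d)\<^sup>2"
    and ?X = "mode (k + k) (c\<^sup>2)" and ?W = "mode ((k + k) + (k + k)) ((c\<^sup>2)\<^sup>2)" and ?Y = "mode (l + l) (d\<^sup>2)"
  have s: "(mode k c x) ^ 4 * (mode l d x)\<^sup>2 = 3 * ?a\<^sup>2 * ?b / 16 + ?a * ?b / 4 * ?X x + ?b / 16 * ?W x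
      + 3 * ?a\<^sup>2 / 16 * ?Y x + ?a / 4 * (?X x * ?Y x) + 1 / 16 * (?W x * ?Y x)" for x
  proof -
    have "(mode k c x) ^ 4 = ((mode k c x)\<^sup>2)\<^sup>2" by simp
    also have "\<dots> = ?a\<^sup>2 / 4 + ?a / 2 * ?X x + 1 / 4 * (?X x)\<^sup>2"
      unfolding mode_amplitude_invariants[of k c x] by (simp add: power2_eq_square field_simps)
    also have "(?X x)\<^sup>2 = ?a\<^sup>2 / 2 + ?W x / 2" unfolding mode_amplitude_invariants[of "k + k" "c\<^sup>2" x] by (simp add: norm_power add_divide_distrib)
    finally have e: "(mode k c x) ^ 4 = 3 * ?a\<^sup>2 / 8 + ?a / 2 * ?X x + ?W x / 8" by (simp add: field_simps)
    show ?thesis unfolding e mode_amplitude_invariants[of l d x] by (simp add: field_simps)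
  qed
  have "(\<integral>x. (mode k c x) ^ 4 * (mode l d x)\<^sup>2 \<partial>torus) = 3 * ?a\<^sup>2 * ?b / 16 * vol + ?a * ?b / 4 * (\<integral>x. ?X x \<partial>torus) + ?b / 16 * (\<integral>x. ?W x \<partial>torus)
      + 3 * ?a\<^sup>2 / 16 * (\<integral>x. ?Y x \<partial>torus) + ?a / 4 * (\<integral>x. ?X x * ?Y x \<partial>torus) + 1 / 16 * (\<integral>x. ?W x * ?Y x \<partial>torus)"
    unfolding s by (simp add: cper_mult)
  moreover have "l + l \<noteq> - (k + k)" "l + l \<noteq> k + k" using k double_eq_iff[of l k] double_eq_iff[of l "- k"] by auto
  moreover have "l + l \<noteq> (k + k) + (k + k)" "l + l \<noteq> - ((k + k) + (k + k))"
    using k double_eq_iff[of l "k + k"] double_eq_iff[of l "- (k + k)"] by auto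
  ultimately show ?thesis
    using integral_mode_orth[of "l + l" "k + k" "c\<^sup>2" "d\<^sup>2"] integral_mode_orth[of "l + l" "(k + k) + (k + k)" "(c\<^sup>2)\<^sup>2" "d\<^sup>2"] integral_mode_nonzero double_nonzero k
    by simp
qed

text \<open>The resonance that couples the phases: the product of the first two modes contains the
  third frequency.\<close>

lemma integral_mode_triple:
  assumes "k \<noteq> 0" "l \<noteq> 0" "k + l \<noteq> 0"
  shows "(\<integral>x. mode k a x * mode l b x * mode (k + l) d x \<partial>torus) = vol / 4 * Re (a * b * cnj d)"
proof -
  have "(\<integral>x. mode k a x * mode l b x * mode (k + l) d x \<partial>torus)
    = (\<integral>x. 1 / 2 * (mode (k + l) (a * b) x * mode (k + l) d x) + 1 / 2 * (mode (k - l) (a * cnj b) x * mode (k + l) d x) \<partial>torus)"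
    unfolding mode_mult[of k a _ l b] by (simp add: field_simps)
  also have "\<dots> = 1 / 2 * (\<integral>x. mode (k + l) (a * b) x * mode (k + l) d x \<partial>torus) + 1 / 2 * (\<integral>x. mode (k - l) (a * cnj b) x * mode (k + l) d x \<partial>torus)"
    by (simp add: cper_mult)
  also have "(\<integral>x. mode (k - l) (a * cnj b) x * mode (k + l) d x \<partial>torus) = 0"
  proof (rule integral_mode_orth)
    show "k + l \<noteq> k - l" "k + l \<noteq> - (k - l)" using assms by (cases k; cases l; auto simp: zero_prod_def)+
  qed
  finally show ?thesis unfolding integral_mode_self[OF assms(3)] by simp
qed

text \<open>The doubled frequencies \<open>(2, 0)\<close>, \<open>(0, 2)\<close> and
  \<open>(2, 2)\<close> resonate again, which produces the square of the phase product.\<close>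

lemma integral_low_wave_pow222:
  "(\<integral>x. (mode (1, 0) a x)\<^sup>2 * (mode (0, 1) b x)\<^sup>2 * (mode (1, 1) d x)\<^sup>2 \<partial>torus)
    = vol / 8 * ((cmod a)\<^sup>2 * (cmod b)\<^sup>2 * (cmod d)\<^sup>2 + 1 / 4 * Re ((a * b * cnj d)\<^sup>2))"
proof -
  let ?a = "(cmod a)\<^sup>2" and ?b = "(cmod b)\<^sup>2" and ?d = "(cmod d)\<^sup>2"
    and ?X = "mode (2, 0) (a\<^sup>2)" and ?Y = "mode (0, 2) (b\<^sup>2)" and ?Z = "mode (2, 2) (d\<^sup>2)"
  have s: "(mode (1, 0) a x)\<^sup>2 * (mode (0, 1) b x)\<^sup>2 * (mode (1, 1) d x)\<^sup>2 = ?a * ?b * ?d / 8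
     + ?b * ?d / 8 * ?X x + ?a * ?d / 8 * ?Y x + ?a * ?b / 8 * ?Z x
     + ?d / 8 * (?X x * ?Y x) + ?b / 8 * (?X x * ?Z x) + ?a / 8 * (?Y x * ?Z x) + 1 / 8 * (?X x * ?Y x * ?Z x)" for x
    unfolding mode_amplitude_invariants by (simp add: field_simps)
  have "(\<integral>x. (mode (1, 0) a x)\<^sup>2 * (mode (0, 1) b x)\<^sup>2 * (mode (1, 1) d x)\<^sup>2 \<partial>torus) = ?a * ?b * ?d / 8 * vol
     + ?b * ?d / 8 * (\<integral>x. ?X x \<partial>torus) + ?a * ?d / 8 * (\<integral>x. ?Y x \<partial>torus) + ?a * ?b / 8 * (\<integral>x. ?Z x \<partial>torus)
     + ?d / 8 * (\<integral>x. ?X x * ?Y x \<partial>torus) + ?b / 8 * (\<integral>x. ?X x * ?Z x \<partial>torus) + ?a / 8 * (\<integral>x. ?Y x * ?Z x \<partial>torus) + 1 / 8 * (\<integral>x. ?X x * ?Y x * ?Z x \<partial>torus)"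
    unfolding s by (simp add: cper_mult)
  moreover have "(\<integral>x. ?X x * ?Y x * ?Z x \<partial>torus) = vol / 4 * Re (a\<^sup>2 * b\<^sup>2 * cnj (d\<^sup>2))"
    using integral_mode_triple[of "(2, 0)" "(0, 2)" "a\<^sup>2" "b\<^sup>2" "d\<^sup>2"] by (simp add: zero_prod_def)
  moreover have "a\<^sup>2 * b\<^sup>2 * cnj (d\<^sup>2) = (a * b * cnj d)\<^sup>2" by (simp add: power_mult_distrib)
  ultimately show ?thesis
    by (simp add: integral_mode_nonzero integral_mode_orth zero_prod_def del: times_complex.sel) (simp add: field_simps)
qed

text \<open>Translation by a half period reverses the sign of two of the three modes. Averaging over
  the four translations leaves only monomials whose three exponents have the same parity.\<close>

lemma low_wave_parity:
  assumes F: "\<And>f. cper f \<Longrightarrow> cper (\<lambda>x. F (f x))"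
    and E: "\<And>X Y Z. F (X + Y + Z) + F (- X + Y - Z) + F (X - Y - Z) + F (- X - Y + Z) = 4 * E X Y Z"
  shows "(\<integral>x. F (low_wave v x) \<partial>torus) = (\<integral>x. E (mode (1, 0) (fst v) x) (mode (0, 1) (fst (snd v)) x) (mode (1, 1) (snd (snd v)) x) \<partial>torus)"
proof -
  let ?X = "mode (1, 0) (fst v)" and ?Y = "mode (0, 1) (fst (snd v))" and ?Z = "mode (1, 1) (snd (snd v))"
  have p: "cis (pi + pi) = 1" using cis_2pi by simp
  have s: "low_wave v (x + pt pi 0) = - ?X x + ?Y x - ?Z x" "low_wave v (x + pt 0 pi) = ?X x - ?Y x - ?Z x" "low_wave v (x + pt pi pi) = - ?X x - ?Y x + ?Z x" for x
    unfolding low_wave_def mode_shift by (simp_all add: p) (simp_all add: mode_def)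
  have c: "cper (\<lambda>x. F (low_wave v x))" by (rule F[OF cper_low_wave])
  have i: "(\<integral>x. F (low_wave v x) \<partial>torus) = (\<integral>x. F (low_wave v (x + y)) \<partial>torus)" "integrable torus (\<lambda>x. F (low_wave v (x + y)))" for y
    using integral_translation[OF c, of y] cper_shift[OF c, of y] by auto
  have "4 * (\<integral>x. F (low_wave v x) \<partial>torus) = (\<integral>x. F (low_wave v x) \<partial>torus) + (\<integral>x. F (low_wave v (x + pt pi 0)) \<partial>torus)
     + (\<integral>x. F (low_wave v (x + pt 0 pi)) \<partial>torus) + (\<integral>x. F (low_wave v (x + pt pi pi)) \<partial>torus)"
    unfolding i(1)[symmetric] by simp
  also have "\<dots> = (\<integral>x. F (low_wave v x) + F (low_wave v (x + pt pi 0)) + F (low_wave v (x + pt 0 pi)) + F (low_wave v (x + pt pi pi)) \<partial>torus)"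
    using i(2) cper_integrable[OF c] by simp
  also have "(\<lambda>x. F (low_wave v x) + F (low_wave v (x + pt pi 0)) + F (low_wave v (x + pt 0 pi)) + F (low_wave v (x + pt pi pi))) = (\<lambda>x. 4 * E (?X x) (?Y x) (?Z x))"
    unfolding s E[symmetric] by (simp only: low_wave_def)
  finally show ?thesis by simp
qed

lemma moment_formulas:
  fixes v :: "complex \<times> complex \<times> complex"
  defines "a \<equiv> (cmod (fst v))\<^sup>2" and "b \<equiv> (cmod (fst (snd v)))\<^sup>2" and "d \<equiv> (cmod (snd (snd v)))\<^sup>2"
    and "W \<equiv> fst v * fst (snd v) * cnj (snd (snd v))"
  shows "(\<integral>x. (low_wave v x)\<^sup>2 \<partial>torus) = vol * ((a + b + d) / 2)"
    and "(\<integral>x. (low_wave v x) ^ 3 \<partial>torus) = vol * (3 / 2 * Re W)"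
    and "(\<integral>x. (low_wave v x) ^ 4 \<partial>torus) = vol * (3 / 8 * (a\<^sup>2 + b\<^sup>2 + d\<^sup>2) + 3 / 2 * (a * b + a * d + b * d))"
    and "(\<integral>x. (low_wave v x) ^ 6 \<partial>torus) = vol * (5 / 16 * (a ^ 3 + b ^ 3 + d ^ 3)
        + 45 / 16 * (a\<^sup>2 * b + b\<^sup>2 * a + a\<^sup>2 * d + d\<^sup>2 * a + b\<^sup>2 * d + d\<^sup>2 * b)
        + 90 / 8 * (a * b * d + 1 / 4 * Re (W\<^sup>2)))"
proof -
  let ?X = "mode (1, 0) (fst v)" and ?Y = "mode (0, 1) (fst (snd v))" and ?Z = "mode (1, 1) (snd (snd v))"
  have c: "cper ?X" "cper ?Y" "cper ?Z" by auto
  note ci = cper_integrable cper_add cper_mult cper_power cper_const c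
  have e2: "(X + Y + Z)\<^sup>2 + (- X + Y - Z)\<^sup>2 + (X - Y - Z)\<^sup>2 + (- X - Y + Z)\<^sup>2 = 4 * (X\<^sup>2 + Y\<^sup>2 + Z\<^sup>2)" for X Y Z :: real
    by algebra
  have e3: "(X + Y + Z) ^ 3 + (- X + Y - Z) ^ 3 + (X - Y - Z) ^ 3 + (- X - Y + Z) ^ 3 = 4 * (6 * (X * Y * Z))" for X Y Z :: real
    by algebra
  have e4: "(X + Y + Z) ^ 4 + (- X + Y - Z) ^ 4 + (X - Y - Z) ^ 4 + (- X - Y + Z) ^ 4
    = 4 * (X ^ 4 + Y ^ 4 + Z ^ 4 + 6 * (X\<^sup>2 * Y\<^sup>2 + X\<^sup>2 * Z\<^sup>2 + Y\<^sup>2 * Z\<^sup>2))" for X Y Z :: real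
    by algebra
  have e6: "(X + Y + Z) ^ 6 + (- X + Y - Z) ^ 6 + (X - Y - Z) ^ 6 + (- X - Y + Z) ^ 6
    = 4 * (X ^ 6 + Y ^ 6 + Z ^ 6 + 15 * (X ^ 4 * Y\<^sup>2 + Y ^ 4 * X\<^sup>2 + X ^ 4 * Z\<^sup>2 + Z ^ 4 * X\<^sup>2 + Y ^ 4 * Z\<^sup>2 + Z ^ 4 * Y\<^sup>2)
      + 90 * (X\<^sup>2 * Y\<^sup>2 * Z\<^sup>2))" for X Y Z :: real
    by algebra
  have nz: "((1, 0) :: int \<times> int) \<noteq> 0" "((0, 1) :: int \<times> int) \<noteq> 0" "((1, 1) :: int \<times> int) \<noteq> 0" by (auto simp: zero_prod_def)
  have "(\<integral>x. (low_wave v x)\<^sup>2 \<partial>torus) = (\<integral>x. (?X x)\<^sup>2 + (?Y x)\<^sup>2 + (?Z x)\<^sup>2 \<partial>torus)"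
    by (rule low_wave_parity[of "\<lambda>y. y\<^sup>2", OF cper_power e2])
  also have "\<dots> = vol * (a / 2) + vol * (b / 2) + vol * (d / 2)"
    by (simp add: cper_power integral_mode_pow2 nz a_def b_def d_def)
  finally show "(\<integral>x. (low_wave v x)\<^sup>2 \<partial>torus) = vol * ((a + b + d) / 2)" by (simp add: algebra_simps add_divide_distrib)
  have "(\<integral>x. (low_wave v x) ^ 3 \<partial>torus) = (\<integral>x. 6 * (?X x * ?Y x * ?Z x) \<partial>torus)"
    by (rule low_wave_parity[of "\<lambda>y. y ^ 3", OF cper_power e3])
  also have "\<dots> = 6 * (vol / 4 * Re W)"
    using integral_mode_triple[of "(1, 0)" "(0, 1)" "fst v" "fst (snd v)" "snd (snd v)"] by (simp add: zero_prod_def W_def del: times_complex.sel)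
  finally show "(\<integral>x. (low_wave v x) ^ 3 \<partial>torus) = vol * (3 / 2 * Re W)" by simp
  have "(\<integral>x. (low_wave v x) ^ 4 \<partial>torus) = (\<integral>x. (?X x) ^ 4 + (?Y x) ^ 4 + (?Z x) ^ 4 + 6 * ((?X x)\<^sup>2 * (?Y x)\<^sup>2 + (?X x)\<^sup>2 * (?Z x)\<^sup>2 + (?Y x)\<^sup>2 * (?Z x)\<^sup>2) \<partial>torus)"
    by (rule low_wave_parity[of "\<lambda>y. y ^ 4", OF cper_power e4])
  also have "\<dots> = vol * (3 / 8 * a\<^sup>2) + vol * (3 / 8 * b\<^sup>2) + vol * (3 / 8 * d\<^sup>2) + 6 * (vol * (a * b / 4) + vol * (a * d / 4) + vol * (b * d / 4))"
    unfolding a_def b_def d_def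
    by (subst integral_mode_pow4[symmetric, OF nz(1)], subst integral_mode_pow4[symmetric, OF nz(2)], subst integral_mode_pow4[symmetric, OF nz(3)],
        subst integral_mode_pow22[symmetric, of "(1, 0)" "(0, 1)"], (simp_all add: nz)[4],
        subst integral_mode_pow22[symmetric, of "(1, 0)" "(1, 1)"], (simp_all add: nz)[4],
        subst integral_mode_pow22[symmetric, of "(0, 1)" "(1, 1)"], (simp_all add: nz)[4])
      (simp add: cper_power cper_mult cper_add)
  finally show "(\<integral>x. (low_wave v x) ^ 4 \<partial>torus) = vol * (3 / 8 * (a\<^sup>2 + b\<^sup>2 + d\<^sup>2) + 3 / 2 * (a * b + a * d + b * d))"
    by (simp add: field_simps)
  have p42: "(\<integral>x. (?X x) ^ 4 * (?Y x)\<^sup>2 \<partial>torus) = vol * (3 / 16 * a\<^sup>2 * b)" "(\<integral>x. (?Y x) ^ 4 * (?X x)\<^sup>2 \<partial>torus) = vol * (3 / 16 * b\<^sup>2 * a)"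
    "(\<integral>x. (?X x) ^ 4 * (?Z x)\<^sup>2 \<partial>torus) = vol * (3 / 16 * a\<^sup>2 * d)" "(\<integral>x. (?Z x) ^ 4 * (?X x)\<^sup>2 \<partial>torus) = vol * (3 / 16 * d\<^sup>2 * a)"
    "(\<integral>x. (?Y x) ^ 4 * (?Z x)\<^sup>2 \<partial>torus) = vol * (3 / 16 * b\<^sup>2 * d)" "(\<integral>x. (?Z x) ^ 4 * (?Y x)\<^sup>2 \<partial>torus) = vol * (3 / 16 * d\<^sup>2 * b)"
    unfolding a_def b_def d_def by (rule integral_mode_pow42; simp add: nz)+
  have "(\<integral>x. (low_wave v x) ^ 6 \<partial>torus) = (\<integral>x. (?X x) ^ 6 + (?Y x) ^ 6 + (?Z x) ^ 6
      + 15 * ((?X x) ^ 4 * (?Y x)\<^sup>2 + (?Y x) ^ 4 * (?X x)\<^sup>2 + (?X x) ^ 4 * (?Z x)\<^sup>2 + (?Z x) ^ 4 * (?X x)\<^sup>2 + (?Y x) ^ 4 * (?Z x)\<^sup>2 + (?Z x) ^ 4 * (?Y x)\<^sup>2)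
      + 90 * ((?X x)\<^sup>2 * (?Y x)\<^sup>2 * (?Z x)\<^sup>2) \<partial>torus)"
    by (rule low_wave_parity[of "\<lambda>y. y ^ 6", OF cper_power e6])
  also have "\<dots> = vol * (5 / 16 * a ^ 3) + vol * (5 / 16 * b ^ 3) + vol * (5 / 16 * d ^ 3)
      + 15 * (vol * (3 / 16 * a\<^sup>2 * b) + vol * (3 / 16 * b\<^sup>2 * a) + vol * (3 / 16 * a\<^sup>2 * d) + vol * (3 / 16 * d\<^sup>2 * a) + vol * (3 / 16 * b\<^sup>2 * d) + vol * (3 / 16 * d\<^sup>2 * b))
      + 90 * (vol / 8 * (a * b * d + 1 / 4 * Re (W\<^sup>2)))"
    unfolding p42[symmetric]
    unfolding a_def b_def d_def W_def integral_low_wave_pow222[symmetric]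
    by (subst integral_mode_pow6[symmetric, OF nz(1)], subst integral_mode_pow6[symmetric, OF nz(2)], subst integral_mode_pow6[symmetric, OF nz(3)])
      (simp add: cper_power cper_mult cper_add)
  finally show "(\<integral>x. (low_wave v x) ^ 6 \<partial>torus) = vol * (5 / 16 * (a ^ 3 + b ^ 3 + d ^ 3)
        + 45 / 16 * (a\<^sup>2 * b + b\<^sup>2 * a + a\<^sup>2 * d + d\<^sup>2 * a + b\<^sup>2 * d + d\<^sup>2 * b)
        + 90 / 8 * (a * b * d + 1 / 4 * Re (W\<^sup>2)))"
    by (simp add: field_simps)
qed

section \<open>Invariants of the coefficient triple and trapping near a level set\<close>

definition phase_product :: "complex \<times> complex \<times> complex \<Rightarrow> complex" where
  "phase_product v = fst v * fst (snd v) * cnj (snd (snd v))"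

text \<open>In this order the entries yield the sum of the squared amplitudes, the real part of
  \<open>phase_product\<close>, the second symmetric function of the squared amplitudes, and their
  product.\<close>

definition moments :: "complex \<times> complex \<times> complex \<Rightarrow> real \<times> real \<times> real \<times> real" where
  "moments v = ((\<integral>x. (low_wave v x)\<^sup>2 \<partial>torus), (\<integral>x. (low_wave v x) ^ 3 \<partial>torus), (\<integral>x. (low_wave v x) ^ 4 \<partial>torus), (\<integral>x. (low_wave v x) ^ 6 \<partial>torus))"

text \<open>Squared amplitudes, because these are the roots of a cubic determined by the moments.
  The imaginary part carries the sign that the moments leave open.\<close>

definition amplitude_invariants :: "complex \<times> complex \<times> complex \<Rightarrow> real \<times> real \<times> real \<times> real" where
  "amplitude_invariants v = ((cmod (fst v))\<^sup>2, (cmod (fst (snd v)))\<^sup>2, (cmod (snd (snd v)))\<^sup>2, Im (phase_product v))"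

lemma continuous_amplitude_invariants: "continuous_on S amplitude_invariants"
proof -
  have "continuous_on S (\<lambda>v. ((cmod (fst v))\<^sup>2, (cmod (fst (snd v)))\<^sup>2, (cmod (snd (snd v)))\<^sup>2, Im (fst v * fst (snd v) * cnj (snd (snd v)))))"
    by (intro continuous_intros)
  then show ?thesis by (simp only: amplitude_invariants_def[abs_def] phase_product_def)
qed

lemma continuous_moments: "continuous_on S moments"
proof -
  note c = continuous_on_mult continuous_on_add continuous_on_const continuous_on_power continuous_on_Re
    continuous_on_norm continuous_on_fst continuous_on_snd continuous_on_cnj continuous_on_id
  have "continuous_on S (\<lambda>v. \<integral>x. (low_wave v x)\<^sup>2 \<partial>torus)"
    unfolding moment_formulas by (intro continuous_on_divide c) simp
  moreover have "continuous_on S (\<lambda>v. \<integral>x. (low_wave v x) ^ 3 \<partial>torus)"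
    unfolding moment_formulas by (intro c)
  moreover have "continuous_on S (\<lambda>v. \<integral>x. (low_wave v x) ^ 4 \<partial>torus)"
    unfolding moment_formulas by (intro c)
  moreover have "continuous_on S (\<lambda>v. \<integral>x. (low_wave v x) ^ 6 \<partial>torus)"
    unfolding moment_formulas by (intro c)
  ultimately show ?thesis unfolding moments_def[abs_def] by (intro continuous_on_Pair)
qed

text \<open>The moments determine the elementary symmetric functions of the squared amplitudes and the
  real part of \<open>phase_product\<close>, hence leave only finitely many values for \<open>amplitude_invariants\<close>.\<close>
lemma finite_amplitude_invariants_fibre: "finite (amplitude_invariants ` {v. moments v = moments v0})"
proof -
  define A B D where "A v = (cmod (fst v))\<^sup>2" and "B v = (cmod (fst (snd v)))\<^sup>2" and "D v = (cmod (snd (snd v)))\<^sup>2" for v :: "complex \<times> complex \<times> complex"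
  define e1 e2 e3 where "e1 v = A v + B v + D v" and "e2 v = A v * B v + A v * D v + B v * D v" and "e3 v = A v * B v * D v" for v
  have W: "Re ((phase_product v)\<^sup>2) = 2 * (Re (phase_product v))\<^sup>2 - e3 v" "(Re (phase_product v))\<^sup>2 + (Im (phase_product v))\<^sup>2 = e3 v" for v
  proof -
    have "(cmod (phase_product v))\<^sup>2 = e3 v" by (simp add: phase_product_def e3_def A_def B_def D_def norm_mult power_mult_distrib)
    then show n: "(Re (phase_product v))\<^sup>2 + (Im (phase_product v))\<^sup>2 = e3 v" by (simp add: cmod_power2)
    show "Re ((phase_product v)\<^sup>2) = 2 * (Re (phase_product v))\<^sup>2 - e3 v" unfolding n[symmetric] by (simp add: power2_eq_square)
  qed
  have m: "moments v = (vol * (e1 v / 2), vol * (3 / 2 * Re (phase_product v)), vol * (3 / 8 * (e1 v)\<^sup>2 + 3 / 4 * e2 v),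
      vol * (5 / 16 * (e1 v) ^ 3 + 15 / 8 * (e1 v * e2 v) + 15 / 16 * e3 v + 45 / 8 * (Re (phase_product v))\<^sup>2))" for v
  proof -
    have "3 / 8 * ((A v)\<^sup>2 + (B v)\<^sup>2 + (D v)\<^sup>2) + 3 / 2 * (A v * B v + A v * D v + B v * D v) = 3 / 8 * (e1 v)\<^sup>2 + 3 / 4 * e2 v"
      by (simp add: e1_def e2_def power2_eq_square algebra_simps)
    moreover have "5 / 16 * (A v ^ 3 + B v ^ 3 + D v ^ 3)
        + 45 / 16 * ((A v)\<^sup>2 * B v + (B v)\<^sup>2 * A v + (A v)\<^sup>2 * D v + (D v)\<^sup>2 * A v + (B v)\<^sup>2 * D v + (D v)\<^sup>2 * B v)
        + 90 / 8 * (A v * B v * D v + 1 / 4 * Re ((phase_product v)\<^sup>2))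
      = 5 / 16 * (e1 v) ^ 3 + 15 / 8 * (e1 v * e2 v) + 15 / 16 * e3 v + 45 / 8 * (Re (phase_product v))\<^sup>2"
      unfolding W(1) by (simp add: e1_def e2_def e3_def power2_eq_square power3_eq_cube algebra_simps)
    ultimately show ?thesis
      unfolding moments_def moment_formulas A_def[symmetric] B_def[symmetric] D_def[symmetric] phase_product_def[symmetric] e1_def[symmetric] by simp
  qed
  \<comment> \<open>On the fibre the cubic has the roots \<open>A v\<close>, \<open>B v\<close>,
    \<open>D v\<close>. The quadratic has the root \<open>Im (phase_product v)\<close>, since the
    squared modulus of the phase product is \<open>e3 v\<close>.\<close>
  define R where "R = {r. poly [:- e3 v0, e2 v0, - e1 v0, 1:] r = 0}"
  define I where "I = {r. poly [:(Re (phase_product v0))\<^sup>2 - e3 v0, 0, 1:] r = 0}"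
  have fin: "finite R" "finite I" unfolding R_def I_def by (intro poly_roots_finite; simp)+
  have "amplitude_invariants v \<in> R \<times> R \<times> R \<times> I" if v: "moments v = moments v0" for v
  proof -
    have 1: "e1 v = e1 v0" "Re (phase_product v) = Re (phase_product v0)" using v vol_pos unfolding m by auto
    then have 2: "e2 v = e2 v0" using v vol_pos unfolding m by auto
    then have 3: "e3 v = e3 v0" using v vol_pos 1 unfolding m by auto
    have "r \<in> R" if "r \<in> {A v, B v, D v}" for r
    proof -
      have "(r - A v) * (r - B v) * (r - D v) = 0" using that by auto
      then have "- e3 v + r * (e2 v + r * (- e1 v + r)) = 0" by (simp add: e1_def e2_def e3_def algebra_simps)
      then show ?thesis by (simp add: R_def 1 2 3)
    qed
    moreover have "Im (phase_product v) \<in> I" using W(2)[of v] by (simp add: I_def 1 3 power2_eq_square algebra_simps)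
    ultimately show ?thesis by (simp add: amplitude_invariants_def A_def B_def D_def)
  qed
  then have "amplitude_invariants ` {v. moments v = moments v0} \<subseteq> R \<times> R \<times> R \<times> I" by blast
  then show ?thesis using fin by (meson finite_SigmaI finite_subset)
qed

text \<open>A continuous path along which \<open>F\<close> stays close to its value at \<open>v0\<close> cannot leave the neighbourhood
  of the piece of the level set on which the discrete invariant \<open>y\<close> has the value \<open>y v0\<close>.\<close>
lemma level_set_trapping:
  fixes F :: "'a::euclidean_space \<Rightarrow> 'b::metric_space" and y :: "'a \<Rightarrow> 'c::t1_space"
  assumes X: "compact X" "v0 \<in> X" and F: "continuous_on X F" and y: "continuous_on X y"
    and fin: "finite (y ` {v \<in> X. F v = F v0})" and e: "0 < e"
  shows "\<exists>k>0. \<forall>v :: real \<Rightarrow> 'a. continuous_on UNIV v \<longrightarrow> (\<forall>t. v t \<in> X \<and> dist (F (v t)) (F v0) < k) \<longrightarrow> dist (v 0) v0 < k \<longrightarrow>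
    (\<forall>t. \<exists>p\<in>X. F p = F v0 \<and> y p = y v0 \<and> dist (v t) p < e)"
proof -
  define S where "S = {v \<in> X. F v = F v0}"
  define P where "P = {v \<in> S. y v = y v0}"
  define Q where "Q = {v \<in> S. y v \<noteq> y v0}"
  have cX: "closed X" using X(1) compact_imp_closed by blast
  have "closed (X \<inter> F -` {F v0})" by (rule continuous_closed_preimage[OF F cX]) simp
  moreover have S_eq: "S = X \<inter> F -` {F v0}" by (auto simp: S_def)
  ultimately have cS: "closed S" by simp
  have SX: "S \<subseteq> X" by (auto simp: S_def)
  have yS: "continuous_on S y" using y SX continuous_on_subset by blast
  have "closed (S \<inter> y -` {y v0})" by (rule continuous_closed_preimage[OF yS cS]) simp
  moreover have "P = S \<inter> y -` {y v0}" by (auto simp: P_def)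
  ultimately have cP: "closed P" by simp
  have "closed (S \<inter> y -` (y ` S - {y v0}))"
    by (rule continuous_closed_preimage[OF yS cS]) (use fin in \<open>simp add: S_def finite_imp_closed\<close>)
  moreover have "Q = S \<inter> y -` (y ` S - {y v0})" by (auto simp: Q_def)
  ultimately have cQ: "closed Q" by simp
  have "X \<inter> P = P" by (auto simp: P_def S_def)
  then have coP: "compact P" using compact_Int_closed[OF X(1) cP] by simp
  have "P \<inter> Q = {}" by (auto simp: P_def Q_def)
  from separate_compact_closed[OF coP cQ this] obtain d where d: "0 < d" "\<forall>a\<in>P. \<forall>b\<in>Q. d \<le> dist a b" by (elim exE conjE)
  \<comment> \<open>Half the distance of \<open>P\<close> from \<open>Q\<close> keeps their
    \<open>r\<close>-neighbourhoods disjoint.\<close>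
  define r where "r = min e (d / 2)"
  have r: "0 < r" "r \<le> e" "r \<le> d / 2" using e d by (auto simp: r_def)
  define U where "U = (\<Union>p\<in>P. ball p r)"
  define V where "V = (\<Union>p\<in>Q. ball p r)"
  have op: "open U" "open V" by (auto simp: U_def V_def)
  have UV: "U \<inter> V = {}"
  proof (rule ccontr)
    assume "U \<inter> V \<noteq> {}"
    then obtain z a b where z: "a \<in> P" "b \<in> Q" "dist a z < r" "dist b z < r" by (auto simp: U_def V_def)
    have "dist a b \<le> dist a z + dist b z" by (rule dist_triangle2)
    then show False using bspec[OF bspec[OF d(2) z(1)] z(2)] z(3,4) r(3) by linarith
  qed
  have SUV: "S \<subseteq> U \<union> V" using r(1) by (force simp: U_def V_def P_def Q_def)
  define K where "K = X - (U \<union> V)"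
  have cK: "compact K" unfolding K_def using X(1) op by (intro compact_diff) auto
  \<comment> \<open>On the compact rest \<open>K\<close> the distance of \<open>F\<close> from its
    level has a positive minimum, so a path with \<open>F\<close> closer than \<open>m\<close> stays
    in \<open>U \<union> V\<close> and, being connected, in \<open>U\<close>.\<close>
  obtain m where m: "0 < m" "\<And>v. v \<in> K \<Longrightarrow> m \<le> dist (F v) (F v0)"
  proof (cases "K = {}")
    case False
    have "continuous_on K (\<lambda>v. dist (F v) (F v0))"
      by (intro continuous_intros continuous_on_subset[OF F]) (auto simp: K_def)
    from continuous_attains_inf[OF cK False this] obtain w where w: "w \<in> K" "\<And>v. v \<in> K \<Longrightarrow> dist (F w) (F v0) \<le> dist (F v) (F v0)" by blast
    have "F w \<noteq> F v0" using w(1) SUV by (auto simp: K_def S_def)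
    then show thesis using that[of "dist (F w) (F v0)"] w(2) by simp
  qed (use that[of 1] in auto)
  have "\<exists>p\<in>X. F p = F v0 \<and> y p = y v0 \<and> dist (v t) p < e"
    if v: "continuous_on UNIV v" "\<And>t. v t \<in> X" "\<And>t. dist (F (v t)) (F v0) < min r m" "dist (v 0) v0 < min r m" for v :: "real \<Rightarrow> 'a" and t
  proof -
    have "range v \<subseteq> U \<union> V"
    proof (intro image_subsetI)
      fix t
      show "v t \<in> U \<union> V" using m(2)[of "v t"] v(2,3)[of t] by (auto simp: K_def)
    qed
    moreover have "connected (range v)" by (rule connected_continuous_image[OF v(1)]) simp
    ultimately have "U \<inter> range v = {} \<or> V \<inter> range v = {}" using connectedD[OF _ op] UV by blast
    moreover have "v0 \<in> P" using X by (simp add: P_def S_def)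
    then have "v 0 \<in> U" using v(4) by (auto simp: U_def dist_commute)
    ultimately have "v t \<in> U" using \<open>range v \<subseteq> U \<union> V\<close> by blast
    then obtain p where "p \<in> P" "dist p (v t) < r" by (auto simp: U_def)
    then show ?thesis using r(2) by (auto simp: P_def S_def dist_commute)
  qed
  moreover have "0 < min r m" using r m by simp
  ultimately show ?thesis by blast
qed

section \<open>Truncation, rearrangement and comparison of moments\<close>

lemma bounded_L1_Ip:
  fixes h :: "nat \<Rightarrow> real^2 \<Rightarrow> real"
  assumes p: "1 \<le> p" and h: "\<And>n. h n \<in> borel_measurable torus" "\<And>n x. x \<in> cell \<Longrightarrow> \<bar>h n x\<bar> \<le> R"
    and l: "(\<lambda>n. \<integral>x. \<bar>h n x\<bar> \<partial>torus) \<longlonglongrightarrow> 0"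
  shows "(\<lambda>n. Ip p (h n)) \<longlonglongrightarrow> 0"
proof (rule tendsto_sandwich[OF _ _ tendsto_const tendsto_mult_right_zero[OF l, of "R powr (p - 1)"]])
  show "\<forall>\<^sub>F n in sequentially. Ip p (h n) \<le> R powr (p - 1) * (\<integral>x. \<bar>h n x\<bar> \<partial>torus)"
  proof (intro always_eventually allI)
    fix n
    have i: "integrable torus (h n)" by (rule integrable_torus_bounded[OF h(1,2)])
    have "Ip p (h n) \<le> (\<integral>x. R powr (p - 1) * \<bar>h n x\<bar> \<partial>torus)"
      unfolding Ip_def
    proof (rule integral_mono)
      show "integrable torus (\<lambda>x. \<bar>h n x\<bar> powr p)" using Lm_bounded[OF h(1,2), of p n] p by (simp add: Lm_def)
      fix x assume "x \<in> space torus"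
      then have "\<bar>h n x\<bar> powr (p - 1) * \<bar>h n x\<bar> \<le> R powr (p - 1) * \<bar>h n x\<bar>"
        using h(2)[of x n] p by (intro mult_right_mono powr_mono2) auto
      moreover have "\<bar>h n x\<bar> powr (p - 1) * \<bar>h n x\<bar> = \<bar>h n x\<bar> powr p"
        using powr_mult_base[of "\<bar>h n x\<bar>" "p - 1"] by (simp add: mult.commute)
      ultimately show "\<bar>h n x\<bar> powr p \<le> R powr (p - 1) * \<bar>h n x\<bar>" by simp
    qed (use i in auto)
    then show "Ip p (h n) \<le> R powr (p - 1) * (\<integral>x. \<bar>h n x\<bar> \<partial>torus)" by simp
  qed
  show "\<forall>\<^sub>F n in sequentially. 0 \<le> Ip p (h n)" by (intro always_eventually allI Ip_nonneg)
qed

lemma abs_power_diff: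
  fixes a b Q :: real
  assumes "\<bar>a\<bar> \<le> Q" "\<bar>b\<bar> \<le> Q"
  shows "\<bar>a ^ r - b ^ r\<bar> \<le> real r * Q ^ (r - 1) * \<bar>a - b\<bar>"
proof (induction r)
  case (Suc r)
  have Q: "0 \<le> Q" using assms by auto
  have "a ^ Suc r - b ^ Suc r = a * (a ^ r - b ^ r) + b ^ r * (a - b)" by (simp add: algebra_simps)
  then have "\<bar>a ^ Suc r - b ^ Suc r\<bar> \<le> \<bar>a\<bar> * \<bar>a ^ r - b ^ r\<bar> + \<bar>b\<bar> ^ r * \<bar>a - b\<bar>"
    by (metis abs_mult abs_triangle_ineq power_abs)
  also have "\<dots> \<le> Q * (real r * Q ^ (r - 1) * \<bar>a - b\<bar>) + Q ^ r * \<bar>a - b\<bar>"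
    using assms Suc Q by (intro add_mono mult_mono power_mono mult_nonneg_nonneg) auto
  also have "\<dots> = real (Suc r) * Q ^ (Suc r - 1) * \<bar>a - b\<bar>"
    by (cases r) (simp_all add: algebra_simps)
  finally show ?case .
next
  case 0
  show ?case by simp
qed

lemma moment_diff:
  fixes f g :: "nat \<Rightarrow> real^2 \<Rightarrow> real"
  assumes f: "\<And>n. f n \<in> borel_measurable torus" "\<And>n x. x \<in> cell \<Longrightarrow> \<bar>f n x\<bar> \<le> Q"
    and g: "\<And>n. g n \<in> borel_measurable torus" "\<And>n x. x \<in> cell \<Longrightarrow> \<bar>g n x\<bar> \<le> Q"
    and l: "(\<lambda>n. \<integral>x. \<bar>f n x - g n x\<bar> \<partial>torus) \<longlonglongrightarrow> 0"
  shows "(\<lambda>n. (\<integral>x. f n x ^ r \<partial>torus) - (\<integral>x. g n x ^ r \<partial>torus)) \<longlonglongrightarrow> 0"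
proof (rule Lim_null_comparison[OF always_eventually tendsto_mult_right_zero[OF l, of "real r * Q ^ (r - 1)"]], intro allI)
  fix n
  have i: "integrable torus (\<lambda>x. f n x ^ r)" "integrable torus (\<lambda>x. g n x ^ r)"
    by (rule integrable_torus_bounded[where R = "Q ^ r"]; use f g in \<open>auto simp: power_abs intro!: power_mono\<close>)+
  have j: "integrable torus (\<lambda>x. f n x - g n x)"
    by (intro Bochner_Integration.integrable_diff integrable_torus_bounded[OF f(1,2)] integrable_torus_bounded[OF g(1,2)])
  have "norm ((\<integral>x. f n x ^ r \<partial>torus) - (\<integral>x. g n x ^ r \<partial>torus)) = \<bar>\<integral>x. f n x ^ r - g n x ^ r \<partial>torus\<bar>"
    using i by simp
  also have "\<dots> \<le> (\<integral>x. \<bar>f n x ^ r - g n x ^ r\<bar> \<partial>torus)" by (rule integral_abs_bound)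
  also have "\<dots> \<le> (\<integral>x. real r * Q ^ (r - 1) * \<bar>f n x - g n x\<bar> \<partial>torus)"
    by (rule integral_mono) (use i j abs_power_diff f(2) g(2) in auto)
  finally show "norm ((\<integral>x. f n x ^ r \<partial>torus) - (\<integral>x. g n x ^ r \<partial>torus)) \<le> real r * Q ^ (r - 1) * (\<integral>x. \<bar>f n x - g n x\<bar> \<partial>torus)"
    by simp
qed

text \<open>The image measures agree on the half-lines \<open>{s<..}\<close>, which generate the
  Borel sets; adding \<open>UNIV\<close> to the generator provides the cover by a set of finite
  measure. So all integrals of Borel functions of the values agree.\<close>

lemma rearrangement_integral:
  fixes H :: "real \<Rightarrow> real"
  assumes f: "f \<in> borel_measurable torus" and g: "g \<in> rearrangements f" and H: "H \<in> borel_measurable borel"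
  shows "(\<integral>x. H (g x) \<partial>torus) = (\<integral>x. H (f x) \<partial>torus)"
proof -
  have gm: "g \<in> borel_measurable torus" using g by (simp add: rearrangements_def torus_measurable_def)
  have tail: "emeasure (distr torus borel g) {s<..} = emeasure (distr torus borel f) {s<..}" for s
  proof -
    have "g -` {s<..} \<inter> space torus = {x \<in> space torus. g x > s}" "f -` {s<..} \<inter> space torus = {x \<in> space torus. f x > s}" by auto
    then show ?thesis
      using g f gm by (simp add: emeasure_distr torus.emeasure_eq_measure rearrangements_def)
  qed
  have total: "emeasure (distr torus borel g) UNIV = emeasure (distr torus borel f) UNIV"
    using f gm by (simp add: emeasure_distr)
  have "distr torus borel g = distr torus borel f"
  proof (rule measure_eqI_generator_eq[where E = "range (\<lambda>s. {s<..}) \<union> {UNIV}" and \<Omega> = UNIV and A = "\<lambda>_. UNIV"])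
    show "Int_stable (range (\<lambda>s. {s<..}) \<union> {UNIV :: real set})"
    proof (rule Int_stableI)
      fix a b :: "real set" assume "a \<in> range (\<lambda>s. {s<..}) \<union> {UNIV}" "b \<in> range (\<lambda>s. {s<..}) \<union> {UNIV}"
      moreover have "{s<..} \<inter> {t<..} = {max s t<..}" for s t :: real by auto
      ultimately show "a \<inter> b \<in> range (\<lambda>s. {s<..}) \<union> {UNIV}" by auto
    qed
    have s: "sigma_sets UNIV (range (\<lambda>s. {s<..}) \<union> {UNIV :: real set}) = sets borel"
    proof -
      have "sigma_sets UNIV (range (\<lambda>s. {s<..}) \<union> {UNIV :: real set}) = sigma_sets UNIV (range (\<lambda>s :: real. {s<..}))"
        by (rule sigma_sets_eqI) (auto intro: sigma_sets.Basic sigma_sets_top)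
      then show ?thesis unfolding borel_Ioi by simp
    qed
    show "sets (distr torus borel g) = sigma_sets UNIV (range (\<lambda>s. {s<..}) \<union> {UNIV})"
      "sets (distr torus borel f) = sigma_sets UNIV (range (\<lambda>s. {s<..}) \<union> {UNIV})" unfolding s by (simp_all only: sets_distr)
    show "emeasure (distr torus borel g) X = emeasure (distr torus borel f) X" if "X \<in> range (\<lambda>s. {s<..}) \<union> {UNIV}" for X
      using that tail total by auto
    show "emeasure (distr torus borel g) UNIV \<noteq> \<infinity>" using finite_measure.emeasure_finite[OF torus.finite_measure_distr[OF gm], of UNIV] by simp
  qed auto
  then show ?thesis using integral_distr[OF gm H] integral_distr[OF f H] by simp
qed

definition clip :: "real \<Rightarrow> real \<Rightarrow> real" where
  "clip M y = max (- M) (min M y)"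

lemma clip_bound: "0 \<le> M \<Longrightarrow> \<bar>clip M y\<bar> \<le> M"
  by (auto simp: clip_def)

text \<open>Clipping is the projection onto an interval that contains \<open>w\<close>, so both the
  tail and the distance of the clipped value to \<open>w\<close> are bounded by the original
  distance.\<close>

lemma clip_le: assumes "\<bar>w\<bar> \<le> M" shows "\<bar>y - clip M y\<bar> \<le> \<bar>y - w\<bar>" "\<bar>clip M y - w\<bar> \<le> \<bar>y - w\<bar>"
  using assms by (auto simp: clip_def)

lemma clip_lipschitz: "\<bar>clip M y - clip M z\<bar> \<le> \<bar>y - z\<bar>"
  by (auto simp: clip_def)

lemma clip_measurable [measurable]: "clip M \<in> borel_measurable borel"
  unfolding clip_def[abs_def] by measurable

lemma clip_comp_measurable: "f \<in> borel_measurable torus \<Longrightarrow> (\<lambda>x. clip M (f x)) \<in> borel_measurable torus"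
  by (rule measurable_compose[OF _ clip_measurable])

lemma mode_diff: "mode k (c - d) x = mode k c x - mode k d x"
  by (simp add: mode_def algebra_simps)

lemma low_wave_lipschitz: "\<bar>low_wave v x - low_wave w x\<bar> \<le> 3 * dist v w"
proof -
  have e: "low_wave v x - low_wave w x = low_wave (v - w) x" by (simp add: low_wave_def mode_diff)
  have n: "norm (fst u) \<le> norm u" "norm (snd u) \<le> norm u" for u :: "'x::real_normed_vector \<times> 'y::real_normed_vector"
    using norm_fst_le[of "fst u" "snd u"] norm_snd_le[of "snd u" "fst u"] by simp_all
  have "cmod (fst (v - w)) + cmod (fst (snd (v - w))) + cmod (snd (snd (v - w))) \<le> 3 * norm (v - w)"
    using n(1)[of "v - w"] n(2)[of "v - w"] n(1)[of "snd (v - w)"] n(2)[of "snd (v - w)"] by linarith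
  then show ?thesis unfolding e using low_wave_bound[of "v - w" x] by (simp only: dist_norm)
qed

lemma fourier_coeff_lipschitz:
  assumes f: "integrable torus f" and g: "integrable torus g"
  shows "cmod (fourier_coeff k f - fourier_coeff k g) \<le> 4 / vol * (\<integral>x. \<bar>f x - g x\<bar> \<partial>torus)"
proof -
  have "\<bar>(\<integral>x. f x * mode k b x \<partial>torus) - (\<integral>x. g x * mode k b x \<partial>torus)\<bar> \<le> (\<integral>x. \<bar>f x - g x\<bar> \<partial>torus)" if b: "cmod b = 1" for b
  proof -
    have i: "integrable torus (\<lambda>x. f x * mode k b x)" "integrable torus (\<lambda>x. g x * mode k b x)"
      by (rule Lm_mult_cper[OF f cper_mode], rule Lm_mult_cper[OF g cper_mode])
    have "\<bar>(\<integral>x. f x * mode k b x \<partial>torus) - (\<integral>x. g x * mode k b x \<partial>torus)\<bar> = \<bar>\<integral>x. f x * mode k b x - g x * mode k b x \<partial>torus\<bar>"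
      using i by simp
    also have "\<dots> \<le> (\<integral>x. \<bar>f x * mode k b x - g x * mode k b x\<bar> \<partial>torus)" by (rule integral_abs_bound)
    also have "\<dots> \<le> (\<integral>x. \<bar>f x - g x\<bar> \<partial>torus)"
    proof (rule integral_mono)
      fix x
      have "\<bar>f x * mode k b x - g x * mode k b x\<bar> = \<bar>f x - g x\<bar> * \<bar>mode k b x\<bar>" by (simp add: abs_mult[symmetric] left_diff_distrib)
      also have "\<dots> \<le> \<bar>f x - g x\<bar> * 1" using mode_bound[of k b x] b by (intro mult_left_mono) auto
      finally show "\<bar>f x * mode k b x - g x * mode k b x\<bar> \<le> \<bar>f x - g x\<bar>" by simp
    qed (use f g i in auto)
    finally show ?thesis .
  qed
  from this[of 1] this[of \<i>] have i: "\<bar>(\<integral>x. f x * mode k 1 x \<partial>torus) - (\<integral>x. g x * mode k 1 x \<partial>torus)\<bar> \<le> (\<integral>x. \<bar>f x - g x\<bar> \<partial>torus)"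
    "\<bar>(\<integral>x. f x * mode k \<i> x \<partial>torus) - (\<integral>x. g x * mode k \<i> x \<partial>torus)\<bar> \<le> (\<integral>x. \<bar>f x - g x\<bar> \<partial>torus)" by simp_all
  have s: "\<bar>2 / vol * a - 2 / vol * b\<bar> \<le> 2 / vol * r" if "\<bar>a - b\<bar> \<le> r" for a b r
  proof -
    have "\<bar>2 / vol * a - 2 / vol * b\<bar> = 2 / vol * \<bar>a - b\<bar>" using vol_pos by (simp only: right_diff_distrib[symmetric] abs_mult) simp
    also have "\<dots> \<le> 2 / vol * r" using that vol_pos by (intro mult_left_mono) auto
    finally show ?thesis .
  qed
  have "cmod (fourier_coeff k f - fourier_coeff k g) \<le> \<bar>Re (fourier_coeff k f - fourier_coeff k g)\<bar> + \<bar>Im (fourier_coeff k f - fourier_coeff k g)\<bar>" by (rule cmod_le)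
  also have "\<dots> \<le> 2 / vol * (\<integral>x. \<bar>f x - g x\<bar> \<partial>torus) + 2 / vol * (\<integral>x. \<bar>f x - g x\<bar> \<partial>torus)"
    unfolding fourier_coeff_def minus_complex.sel complex.sel by (intro add_mono s i)
  finally show ?thesis by simp
qed

text \<open>The filter is arbitrary because the lemma serves sequences as well as continuity in
  time.\<close>

lemma low_coeffs_tendsto_L1:
  assumes f: "\<And>n. integrable torus (f n)" and g: "integrable torus g"
    and l: "((\<lambda>n. \<integral>x. \<bar>f n x - g x\<bar> \<partial>torus) \<longlongrightarrow> 0) S"
  shows "((\<lambda>n. low_coeffs (f n)) \<longlongrightarrow> low_coeffs g) S"
proof -
  have "((\<lambda>n. fourier_coeff k (f n)) \<longlongrightarrow> fourier_coeff k g) S" for k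
  proof (rule Lim_transform[OF tendsto_const])
    show "((\<lambda>n. fourier_coeff k (f n) - fourier_coeff k g) \<longlongrightarrow> 0) S"
    proof (rule Lim_null_comparison[OF always_eventually tendsto_mult_right_zero[OF l, of "4 / vol"]], intro allI)
      fix n show "norm (fourier_coeff k (f n) - fourier_coeff k g) \<le> 4 / vol * (\<integral>x. \<bar>f n x - g x\<bar> \<partial>torus)"
        using fourier_coeff_lipschitz[OF f[of n] g, of k] by (simp add: norm_minus_commute)
    qed
  qed
  then show ?thesis unfolding low_coeffs_def by (intro tendsto_Pair)
qed

lemma fourier_coeff_diff_const:
  assumes f: "integrable torus f" and k: "k \<noteq> 0"
  shows "fourier_coeff k (\<lambda>x. f x - c) = fourier_coeff k f"
proof -
  have "(\<integral>x. (f x - c) * mode k b x \<partial>torus) = (\<integral>x. f x * mode k b x \<partial>torus)" for b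
  proof -
    have "(\<integral>x. (f x - c) * mode k b x \<partial>torus) = (\<integral>x. f x * mode k b x - c * mode k b x \<partial>torus)"
      by (simp add: left_diff_distrib)
    also have "\<dots> = (\<integral>x. f x * mode k b x \<partial>torus) - c * (\<integral>x. mode k b x \<partial>torus)"
      using Lm_mult_cper[OF f cper_mode[of k b]] by simp
    finally show ?thesis by (simp add: integral_mode k)
  qed
  then show ?thesis by (simp add: fourier_coeff_def)
qed

lemma low_coeffs_diff_const: "integrable torus f \<Longrightarrow> low_coeffs (\<lambda>x. f x - c) = low_coeffs f"
  by (simp add: low_coeffs_def fourier_coeff_diff_const zero_prod_def)

lemma low_coeffs_low_wave: "low_coeffs (low_wave v) = v"
proof -
  have i: "(\<integral>x. low_wave v x * mode k b x \<partial>torus) = (\<integral>x. mode (1, 0) (fst v) x * mode k b x \<partial>torus)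
      + (\<integral>x. mode (0, 1) (fst (snd v)) x * mode k b x \<partial>torus) + (\<integral>x. mode (1, 1) (snd (snd v)) x * mode k b x \<partial>torus)" for k b
  proof -
    have "(\<integral>x. low_wave v x * mode k b x \<partial>torus) = (\<integral>x. mode (1, 0) (fst v) x * mode k b x
      + mode (0, 1) (fst (snd v)) x * mode k b x + mode (1, 1) (snd (snd v)) x * mode k b x \<partial>torus)"
      by (simp add: low_wave_def distrib_right)
    also have "\<dots> = (\<integral>x. mode (1, 0) (fst v) x * mode k b x \<partial>torus)
      + (\<integral>x. mode (0, 1) (fst (snd v)) x * mode k b x \<partial>torus) + (\<integral>x. mode (1, 1) (snd (snd v)) x * mode k b x \<partial>torus)"
      by (simp add: cper_mult cper_integrable cper_mode cper_add)
    finally show ?thesis .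
  qed
  show ?thesis unfolding low_coeffs_def fourier_coeff_def i integral_mode_mult
    using vol_pos by (simp add: prod_eq_iff complex_eq_iff)
qed

lemma Ip_triangle_tendsto:
  assumes p: "0 < p" and m: "\<And>n. f n \<in> Lm p" "\<And>n. g n \<in> Lm p" "\<And>n. h n \<in> Lm p"
    and l: "(\<lambda>n::nat. Ip p (\<lambda>x. f n x - g n x)) \<longlonglongrightarrow> 0" "(\<lambda>n. Ip p (\<lambda>x. g n x - h n x)) \<longlonglongrightarrow> 0"
  shows "(\<lambda>n. Ip p (\<lambda>x. f n x - h n x)) \<longlonglongrightarrow> 0"
proof (rule tendsto_sandwich[OF _ _ tendsto_const tendsto_mult_right_zero[OF tendsto_add_zero[OF l], of "2 powr p"]])
  show "\<forall>\<^sub>F n in sequentially. 0 \<le> Ip p (\<lambda>x. f n x - h n x)" by (intro always_eventually allI Ip_nonneg)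
  show "\<forall>\<^sub>F n in sequentially. Ip p (\<lambda>x. f n x - h n x) \<le> 2 powr p * (Ip p (\<lambda>x. f n x - g n x) + Ip p (\<lambda>x. g n x - h n x))"
    by (intro always_eventually allI Ip_triangle[OF p m])
qed

lemma Ip_mono:
  assumes "f \<in> Lm p" "g \<in> Lm p" "\<And>x. x \<in> cell \<Longrightarrow> \<bar>f x\<bar> \<le> \<bar>g x\<bar>" "0 \<le> p"
  shows "Ip p f \<le> Ip p g"
  unfolding Ip_def by (rule integral_mono) (use assms in \<open>auto simp: Lm_def intro!: powr_mono2\<close>)

lemma Ip_const: "Ip p (\<lambda>x. c) = \<bar>c\<bar> powr p * vol"
  by (simp add: Ip_def)

text \<open>All quantities of \<open>f'\<close> that matter are transferred from \<open>f\<close>: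
  tail, mean and moments by rearrangement, energy by conservation. Thus the gap functional of the
  clipped and centred \<open>f'\<close> tends to its value 0 at the wave.\<close>

lemma rearrangements_near_wave:
  fixes f f' :: "nat \<Rightarrow> real^2 \<Rightarrow> real"
  assumes p: "1 < p" and M: "0 < M" "\<And>x. \<bar>low_wave v0 x\<bar> \<le> M"
    and f: "\<And>n. f n \<in> Lp0 p" and f': "\<And>n. f' n \<in> Lp0 p" "\<And>n. f' n \<in> rearrangements (f n)" "\<And>n. energy p (f' n) = energy p (f n)"
    and l: "(\<lambda>n. Ip p (\<lambda>x. f n x - low_wave v0 x)) \<longlonglongrightarrow> 0"
  shows "(\<lambda>n. Ip p (\<lambda>x. f' n x - low_wave (low_coeffs (\<lambda>x. clip M (f' n x))) x)) \<longlonglongrightarrow> 0" (is ?A)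
    and "(\<lambda>n. moments (low_coeffs (\<lambda>x. clip M (f' n x)))) \<longlonglongrightarrow> moments v0" (is ?B)
    and "(\<lambda>n. low_coeffs (\<lambda>x. clip M (f n x))) \<longlonglongrightarrow> v0" (is ?C)
proof -
  have p1: "1 \<le> p" and p0: "0 < p" using p by auto
  define w where "w = low_wave v0"
  define F F' where "F n x = clip M (f n x)" and "F' n x = clip M (f' n x)" for n x
  \<comment> \<open>One constant centres both clipped functions, as they have equal means;
    \<open>g' n\<close> therefore has mean zero and the same moments as \<open>g n\<close>.\<close>
  define \<mu> where "\<mu> n = (\<integral>x. F n x \<partial>torus) / vol" for n
  define g g' where "g n x = F n x - \<mu> n" and "g' n x = F' n x - \<mu> n" for n x
  define u where "u n = low_wave (low_coeffs (F' n))" for n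
  have w: "cper w" "w \<in> Lm p" "w \<in> Lp0 p" "(\<integral>x. w x \<partial>torus) = 0"
    using low_wave_Lp0[OF p, of v0] Lm_cper[OF cper_low_wave p0] by (auto simp: w_def Lp0_def mean_zero_def)
  have mf: "f n \<in> borel_measurable torus" "f' n \<in> borel_measurable torus" and per: "periodic (f n)" "periodic (f' n)" for n
    using f[of n] f'(1)[of n] by (auto simp: Lp0_def Lp_def torus_measurable_def)
  have L: "f n \<in> Lm p" "f' n \<in> Lm p" for n using f[of n] f'(1)[of n] by (auto simp: Lp0_def intro: Lm_Lp)
  have mF: "F n \<in> borel_measurable torus" "F' n \<in> borel_measurable torus" for n
    unfolding F_def F'_def using mf by (auto intro: clip_comp_measurable)
  have bF: "\<bar>F n x\<bar> \<le> M" "\<bar>F' n x\<bar> \<le> M" for n x using M(1) by (auto simp: F_def F'_def intro: clip_bound)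
  have iF: "integrable torus (F n)" "integrable torus (F' n)" for n
    using integrable_torus_bounded[OF mF(1) bF(1)] integrable_torus_bounded[OF mF(2) bF(2)] by auto
  have LF: "F n \<in> Lm p" "F' n \<in> Lm p" for n
    using Lm_bounded[OF mF(1) bF(1) p0] Lm_bounded[OF mF(2) bF(2) p0] by auto
  have b\<mu>: "\<bar>\<mu> n\<bar> \<le> M" for n
  proof -
    have "\<bar>\<integral>x. F n x \<partial>torus\<bar> \<le> (\<integral>x. \<bar>F n x\<bar> \<partial>torus)" by (rule integral_abs_bound)
    also have "\<dots> \<le> (\<integral>x. M \<partial>torus)" by (rule integral_mono) (use iF bF in auto)
    finally show ?thesis using vol_pos by (simp add: \<mu>_def divide_le_eq mult.commute)
  qed
  have mg: "g n \<in> borel_measurable torus" "g' n \<in> borel_measurable torus" for n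
    unfolding g_def g'_def using mF by auto
  have bg: "\<bar>g n x\<bar> \<le> 2 * M" "\<bar>g' n x\<bar> \<le> 2 * M" for n x
    unfolding g_def g'_def using bF[of n x] b\<mu>[of n] by linarith+
  have Lg: "g n \<in> Lm p" "g' n \<in> Lm p" for n
    using Lm_bounded[OF mg(1) bg(1) p0] Lm_bounded[OF mg(2) bg(2) p0] by auto
  note re = rearrangement_integral[OF mf(1) f'(2)]
  have mean: "(\<integral>x. F' n x \<partial>torus) = \<mu> n * vol" for n
    unfolding F'_def using re[OF clip_measurable[of M], of n] vol_pos by (simp add: \<mu>_def F_def)
  have powg: "(\<integral>x. g' n x ^ r \<partial>torus) = (\<integral>x. g n x ^ r \<partial>torus)" for n r
    unfolding g_def g'_def F_def F'_def by (rule re[of "\<lambda>y. (clip M y - \<mu> n) ^ r" n]) measurable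
  have g'0: "g' n \<in> Lp0 p" for n
  proof -
    have "periodic (g' n)" using per(2)[of n] by (simp add: periodic_def g'_def F'_def)
    moreover have "(\<integral>x. g' n x \<partial>torus) = 0" unfolding g'_def using iF(2)[of n] mean[of n] by simp
    ultimately show ?thesis using Lg(2)[of n] mg(2)[of n] by (simp add: Lp0_def Lp_def Lm_def torus_measurable_def mean_zero_def)
  qed
  have fF: "(\<lambda>n. Ip p (\<lambda>x. f n x - F n x)) \<longlonglongrightarrow> 0"
  proof (rule tendsto_sandwich[OF _ _ tendsto_const l])
    show "\<forall>\<^sub>F n in sequentially. Ip p (\<lambda>x. f n x - F n x) \<le> Ip p (\<lambda>x. f n x - low_wave v0 x)"
      by (intro always_eventually allI Ip_mono Lm_diff(1)[OF p0] L LF Lm_cper cper_low_wave p0 less_imp_le[OF p0])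
        (simp add: F_def clip_le(1)[OF M(2)])
  qed simp
  have Fw: "(\<lambda>n. Ip p (\<lambda>x. F n x - w x)) \<longlonglongrightarrow> 0"
  proof (rule tendsto_sandwich[OF _ _ tendsto_const l])
    show "\<forall>\<^sub>F n in sequentially. Ip p (\<lambda>x. F n x - w x) \<le> Ip p (\<lambda>x. f n x - low_wave v0 x)"
      by (intro always_eventually allI Ip_mono Lm_diff(1)[OF p0] L LF w Lm_cper cper_low_wave p0 less_imp_le[OF p0])
        (simp add: F_def w_def clip_le(2)[OF M(2)])
  qed simp
  \<comment> \<open>The \<open>p\<close>-th power of the tail is a Borel function of the value, so
    the tails of \<open>f' n\<close> and \<open>f n\<close> have the same norm.\<close>
  have fF': "(\<lambda>n. Ip p (\<lambda>x. f' n x - F' n x)) \<longlonglongrightarrow> 0"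
  proof -
    have "Ip p (\<lambda>x. f' n x - F' n x) = Ip p (\<lambda>x. f n x - F n x)" for n
      unfolding Ip_def F_def F'_def by (rule re[of "\<lambda>y. \<bar>y - clip M y\<bar> powr p" n]) measurable
    then show ?thesis using fF by simp
  qed
  have Fw1: "(\<lambda>n. \<integral>x. \<bar>F n x - w x\<bar> \<partial>torus) \<longlonglongrightarrow> 0"
    by (rule Ip_tendsto_L1[OF p1 Lm_diff(1)[OF p0 LF(1) w(2)] Fw])
  have \<mu>0: "\<mu> \<longlonglongrightarrow> 0"
  proof (rule Lim_null_comparison[OF always_eventually tendsto_divide_zero[OF Fw1, of vol]], intro allI)
    fix n
    have "\<bar>\<integral>x. F n x \<partial>torus\<bar> = \<bar>\<integral>x. F n x - w x \<partial>torus\<bar>" using iF(1)[of n] w(1,4) by simp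
    also have "\<dots> \<le> (\<integral>x. \<bar>F n x - w x\<bar> \<partial>torus)" by (rule integral_abs_bound)
    finally show "norm (\<mu> n) \<le> (\<integral>x. \<bar>F n x - w x\<bar> \<partial>torus) / vol"
      using vol_pos by (simp add: \<mu>_def divide_right_mono)
  qed
  have c\<mu>: "(\<lambda>n. Ip p (\<lambda>x. \<mu> n)) \<longlonglongrightarrow> 0"
  proof -
    have "(\<lambda>n. \<bar>\<mu> n\<bar> powr p * vol) \<longlonglongrightarrow> \<bar>0\<bar> powr p * vol"
      by (intro tendsto_mult tendsto_const tendsto_powr' tendsto_rabs \<mu>0) (use p0 in auto)
    then show ?thesis by (simp add: Ip_const)
  qed
  have Fg': "(\<lambda>n. Ip p (\<lambda>x. F' n x - g' n x)) \<longlonglongrightarrow> 0" using c\<mu> by (simp add: g'_def)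
  have gF: "(\<lambda>n. Ip p (\<lambda>x. g n x - F n x)) \<longlonglongrightarrow> 0"
    using c\<mu> unfolding Ip_commute[of p "g _"] by (simp add: g_def)
  have fg': "(\<lambda>n. Ip p (\<lambda>x. f' n x - g' n x)) \<longlonglongrightarrow> 0"
    by (rule Ip_triangle_tendsto[OF p0 L(2) LF(2) Lg(2) fF' Fg'])
  have gw: "(\<lambda>n. Ip p (\<lambda>x. g n x - w x)) \<longlonglongrightarrow> 0"
    by (rule Ip_triangle_tendsto[OF p0 Lg(1) LF(1) w(2) gF Fw])
  have gw1: "(\<lambda>n. \<integral>x. \<bar>g n x - w x\<bar> \<partial>torus) \<longlonglongrightarrow> 0"
    by (rule Ip_tendsto_L1[OF p1 Lm_diff(1)[OF p0 Lg(1) w(2)] gw])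
  obtain R0 where R0: "\<And>n. Ip p (\<lambda>x. f n x - w x) \<le> R0"
  proof -
    have "Bseq (\<lambda>n. Ip p (\<lambda>x. f n x - low_wave v0 x))" by (rule convergent_imp_Bseq) (use l in \<open>auto simp: convergent_def\<close>)
    then obtain K where K: "\<And>n. norm (Ip p (\<lambda>x. f n x - low_wave v0 x)) \<le> K" by (auto simp: Bseq_def)
    show thesis by (rule that[of K]) (use K in \<open>auto simp: w_def\<close>)
  qed
  define R where "R = 2 powr p * (R0 + Ip p w) + (2 * M) powr p * vol + Ip p w"
  have pos: "0 \<le> R0" "0 \<le> Ip p w" "0 \<le> (2 * M) powr p * vol"
    using order_trans[OF Ip_nonneg R0[of 0]] vol_pos by auto
  have Rf: "Ip p (f n) \<le> R" for n
  proof -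
    have "Ip p (\<lambda>x. (f n x - w x) + w x) \<le> 2 powr p * (Ip p (\<lambda>x. f n x - w x) + Ip p w)"
      by (rule Lm_add(2)[OF p0 Lm_diff(1)[OF p0 L(1) w(2)] w(2)])
    also have "\<dots> \<le> 2 powr p * (R0 + Ip p w)" by (intro mult_left_mono add_right_mono R0) simp
    also have "\<dots> \<le> R" using pos by (simp add: R_def)
    finally show ?thesis by simp
  qed
  have Rf': "Ip p (f' n) \<le> R" for n
  proof -
    have "Ip p (f' n) = Ip p (f n)" unfolding Ip_def by (rule re[of "\<lambda>y. \<bar>y\<bar> powr p" n]) measurable
    then show ?thesis using Rf[of n] by simp
  qed
  have Rg': "Ip p (g' n) \<le> R" for n
  proof -
    have "Ip p (g' n) \<le> Ip p (\<lambda>x. 2 * M)"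
      using bg(2)[of n] M(1) p0 by (intro Ip_mono Lg Lm_cper cper_const) auto
    also have "\<dots> \<le> R" using pos M(1) by (simp add: Ip_const R_def)
    finally show ?thesis .
  qed
  have Rw: "Ip p w \<le> R" using pos by (simp add: R_def)
  have e1: "(\<lambda>n. energy p (f' n) - energy p (g' n)) \<longlonglongrightarrow> 0"
    by (rule energy_continuous[OF p f'(1) g'0 Rf' Rg' fg'])
  have e2: "(\<lambda>n. energy p (f n) - energy p w) \<longlonglongrightarrow> 0"
    by (rule energy_continuous[OF p f w(3) Rf Rw]) (use l in \<open>simp add: w_def\<close>)
  \<comment> \<open>Conservation links the two approximations: the energy of \<open>g' n\<close> is
    close to that of \<open>f' n\<close>, which equals that of \<open>f n\<close> and is close to
    that of the wave.\<close>
  have e: "(\<lambda>n. energy p (g' n)) \<longlonglongrightarrow> energy p w"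
  proof -
    have "(\<lambda>n. (energy p (f n) - energy p w) - (energy p (f' n) - energy p (g' n)) + energy p w) \<longlonglongrightarrow> 0 - 0 + energy p w"
      by (intro tendsto_add tendsto_diff e1 e2 tendsto_const)
    then show ?thesis by (simp add: f'(3))
  qed
  have gpow: "(\<lambda>n. \<integral>x. g' n x ^ r \<partial>torus) \<longlonglongrightarrow> (\<integral>x. w x ^ r \<partial>torus)" for r
  proof -
    have "(\<lambda>n. (\<integral>x. g n x ^ r \<partial>torus) - (\<integral>x. w x ^ r \<partial>torus)) \<longlonglongrightarrow> 0"
    proof (rule moment_diff[OF mg(1) bg(1) _ _ gw1])
      show "w \<in> borel_measurable torus" by (rule cper_measurable[OF w(1)])
      show "\<bar>w x\<bar> \<le> 2 * M" for x using M(1) M(2)[of x] by (simp add: w_def)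
    qed
    then show ?thesis unfolding powg by (rule LIM_zero_cancel)
  qed
  have zg: "low_coeffs (g' n) = low_coeffs (F' n)" for n unfolding g'_def by (rule low_coeffs_diff_const[OF iF(2)])
  have bu: "\<bar>u n x\<bar> \<le> 12 * M" for n x
  proof -
    have "cmod (fourier_coeff k (F' n)) \<le> 4 * M" for k by (rule fourier_coeff_bound[OF mF(2) bF(2)])
    from this[of "(1, 0)"] this[of "(0, 1)"] this[of "(1, 1)"] show ?thesis
      unfolding u_def using low_wave_bound[of "low_coeffs (F' n)" x] by (simp add: low_coeffs_def)
  qed
  have mu: "u n \<in> borel_measurable torus" for n unfolding u_def by (rule cper_measurable[OF cper_low_wave])
  have bgu: "\<bar>g' n x - u n x\<bar> \<le> 14 * M" for n x using bg(2)[of n x] bu[of n x] by linarith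
  have mgu: "(\<lambda>x. g' n x - u n x) \<in> borel_measurable torus" for n using mg(2) mu by auto
  have gap: "(\<lambda>n. \<integral>x. (g' n x - u n x)\<^sup>2 \<partial>torus) \<longlonglongrightarrow> 0"
  proof (rule tendsto_sandwich[OF _ _ tendsto_const])
    show "\<forall>\<^sub>F n in sequentially. (\<integral>x. (g' n x - u n x)\<^sup>2 \<partial>torus) \<le> 2 * (3 / 4 * (\<integral>x. (g' n x)\<^sup>2 \<partial>torus) - 2 * energy p (g' n))"
    proof (intro always_eventually allI)
      fix n
      have "1 / 2 * (\<integral>x. (g' n x - low_wave (low_coeffs (g' n)) x)\<^sup>2 \<partial>torus) \<le> 3 / 4 * (\<integral>x. (g' n x)\<^sup>2 \<partial>torus) - 2 * energy p (g' n)"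
        by (rule gap_bounded[OF p g'0 _ bg(2)]) (use M in auto)
      then show "(\<integral>x. (g' n x - u n x)\<^sup>2 \<partial>torus) \<le> 2 * (3 / 4 * (\<integral>x. (g' n x)\<^sup>2 \<partial>torus) - 2 * energy p (g' n))"
        by (simp add: u_def zg)
    qed
    have "(\<lambda>n. 2 * (3 / 4 * (\<integral>x. (g' n x)\<^sup>2 \<partial>torus) - 2 * energy p (g' n))) \<longlonglongrightarrow> 2 * (3 / 4 * (\<integral>x. (w x)\<^sup>2 \<partial>torus) - 2 * energy p w)"
      by (intro tendsto_mult tendsto_diff tendsto_const gpow e)
    then show "(\<lambda>n. 2 * (3 / 4 * (\<integral>x. (g' n x)\<^sup>2 \<partial>torus) - 2 * energy p (g' n))) \<longlonglongrightarrow> 0"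
      by (simp add: w_def energy_low_wave[OF p])
  qed simp
  have gu1: "(\<lambda>n. \<integral>x. \<bar>g' n x - u n x\<bar> \<partial>torus) \<longlonglongrightarrow> 0"
  proof (rule Ip_tendsto_L1[where p = 2])
    show "(\<lambda>x. g' n x - u n x) \<in> Lm 2" for n by (rule Lm_bounded[OF mgu bgu]) simp
    have "Ip 2 (\<lambda>x. g' n x - u n x) = (\<integral>x. (g' n x - u n x)\<^sup>2 \<partial>torus)" for n by (simp add: Ip_def powr_numeral)
    then show "(\<lambda>n. Ip 2 (\<lambda>x. g' n x - u n x)) \<longlonglongrightarrow> 0" using gap by simp
  qed simp
  \<comment> \<open>For uniformly bounded functions the \<open>L^1\<close> convergence obtained from
    the gap implies \<open>L^p\<close> convergence.\<close>
  have gu: "(\<lambda>n. Ip p (\<lambda>x. g' n x - u n x)) \<longlonglongrightarrow> 0"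
    by (rule bounded_L1_Ip[OF p1 mgu bgu gu1])
  have Lu: "u n \<in> Lm p" for n unfolding u_def by (rule Lm_cper[OF cper_low_wave p0])
  have "(\<lambda>n. Ip p (\<lambda>x. f' n x - u n x)) \<longlonglongrightarrow> 0"
    by (rule Ip_triangle_tendsto[OF p0 L(2) Lg(2) Lu fg' gu])
  then show ?A by (simp add: u_def F'_def[abs_def])
  have upow: "(\<lambda>n. \<integral>x. u n x ^ r \<partial>torus) \<longlonglongrightarrow> (\<integral>x. w x ^ r \<partial>torus)" for r
  proof -
    have "(\<lambda>n. (\<integral>x. g' n x ^ r \<partial>torus) - (\<integral>x. u n x ^ r \<partial>torus)) \<longlonglongrightarrow> 0"
    proof (rule moment_diff[OF mg(2) _ mu bu gu1])
      show "\<bar>g' n x\<bar> \<le> 12 * M" for n x using bg(2)[of n x] M(1) by linarith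
    qed
    from tendsto_diff[OF gpow[of r] this] show ?thesis by simp
  qed
  have "(\<lambda>n. moments (low_coeffs (F' n))) \<longlonglongrightarrow> moments v0"
    unfolding moments_def u_def[symmetric] w_def[symmetric] by (intro tendsto_Pair upow)
  then show ?B by (simp add: F'_def[abs_def])
  have "(\<lambda>n. low_coeffs (F n)) \<longlonglongrightarrow> low_coeffs w" by (rule low_coeffs_tendsto_L1[OF iF(1) _ Fw1]) (use w in auto)
  then show ?C by (simp add: w_def low_coeffs_low_wave F_def[abs_def])
qed

text \<open>The sequential statement in uniform form: failing pairs for
  \<open>inverse (Suc n)\<close> would contradict it. The third estimate concerns \<open>f\<close>
  and later places the starting point of the coefficient path.\<close>

lemma rearrangement_near_wave:
  assumes p: "1 < p" and M: "0 < M" "\<And>x. \<bar>low_wave v0 x\<bar> \<le> M" and e: "0 < e"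
  shows "\<exists>d>0. \<forall>f f'. f \<in> Lp0 p \<longrightarrow> f' \<in> Lp0 p \<longrightarrow> f' \<in> rearrangements f \<longrightarrow> energy p f' = energy p f \<longrightarrow>
    Ip p (\<lambda>x. f x - low_wave v0 x) < d \<longrightarrow>
    Ip p (\<lambda>x. f' x - low_wave (low_coeffs (\<lambda>x. clip M (f' x))) x) < e \<and> dist (moments (low_coeffs (\<lambda>x. clip M (f' x)))) (moments v0) < e
      \<and> dist (low_coeffs (\<lambda>x. clip M (f x))) v0 < e"
proof (rule ccontr)
  define P where "P d q \<longleftrightarrow> fst q \<in> Lp0 p \<and> snd q \<in> Lp0 p \<and> snd q \<in> rearrangements (fst q) \<and> energy p (snd q) = energy p (fst q) \<and>
    Ip p (\<lambda>x. fst q x - low_wave v0 x) < d \<and>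
    \<not> (Ip p (\<lambda>x. snd q x - low_wave (low_coeffs (\<lambda>x. clip M (snd q x))) x) < e \<and> dist (moments (low_coeffs (\<lambda>x. clip M (snd q x)))) (moments v0) < e
      \<and> dist (low_coeffs (\<lambda>x. clip M (fst q x))) v0 < e)" for d :: real and q
  assume "\<not> ?thesis"
  then have "\<exists>q. P d q" if "0 < d" for d using that unfolding P_def by fastforce
  then have ex: "\<exists>q. P (inverse (real (Suc n))) q" for n by simp
  define q where "q n = (SOME q. P (inverse (real (Suc n))) q)" for n
  have q: "P (inverse (real (Suc n))) (q n)" for n unfolding q_def by (rule someI_ex[OF ex])
  have l: "(\<lambda>n. Ip p (\<lambda>x. fst (q n) x - low_wave v0 x)) \<longlonglongrightarrow> 0"
  proof (rule tendsto_sandwich[OF _ _ tendsto_const LIMSEQ_inverse_real_of_nat])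
    show "\<forall>\<^sub>F n in sequentially. 0 \<le> Ip p (\<lambda>x. fst (q n) x - low_wave v0 x)" by (intro always_eventually allI Ip_nonneg)
    show "\<forall>\<^sub>F n in sequentially. Ip p (\<lambda>x. fst (q n) x - low_wave v0 x) \<le> inverse (real (Suc n))"
      using q unfolding P_def by (intro always_eventually allI less_imp_le) blast
  qed
  have s: "fst (q n) \<in> Lp0 p" "snd (q n) \<in> Lp0 p" "snd (q n) \<in> rearrangements (fst (q n))" "energy p (snd (q n)) = energy p (fst (q n))" for n
    using q[of n] unfolding P_def by blast+
  note k = rearrangements_near_wave[where f = "\<lambda>n. fst (q n)" and f' = "\<lambda>n. snd (q n)", OF p M s l]
  have "\<forall>\<^sub>F n in sequentially. Ip p (\<lambda>x. snd (q n) x - low_wave (low_coeffs (\<lambda>x. clip M (snd (q n) x))) x) < e"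
    by (rule order_tendstoD(2)[OF k(1) e])
  moreover have "\<forall>\<^sub>F n in sequentially. dist (moments (low_coeffs (\<lambda>x. clip M (snd (q n) x)))) (moments v0) < e"
    by (rule tendstoD[OF k(2) e])
  moreover have "\<forall>\<^sub>F n in sequentially. dist (low_coeffs (\<lambda>x. clip M (fst (q n) x))) v0 < e"
    by (rule tendstoD[OF k(3) e])
  ultimately have "\<forall>\<^sub>F n in sequentially. False"
  proof eventually_elim
    case (elim n)
    then show False using q[of n] unfolding P_def by blast
  qed
  then show False by simp
qed

section \<open>Coefficient paths and the stability theorem\<close>

lemma L1_le_Lp_norm:
  assumes p: "1 \<le> p" and f: "f \<in> Lm p"
  shows "(\<integral>x. \<bar>f x\<bar> \<partial>torus) \<le> (vol powr (p - 1)) powr (1 / p) * Lp_norm p f"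
proof -
  have "((\<integral>x. \<bar>f x\<bar> \<partial>torus) powr p) powr (1 / p) \<le> (vol powr (p - 1) * Ip p f) powr (1 / p)"
    by (rule powr_mono2[OF _ _ Lm_jensen[OF p f]]) (use p in auto)
  moreover have "((\<integral>x. \<bar>f x\<bar> \<partial>torus) powr p) powr (1 / p) = (\<integral>x. \<bar>f x\<bar> \<partial>torus)"
    using p by (simp add: powr_powr)
  ultimately show ?thesis by (simp add: powr_mult Lp_norm_def Ip_def)
qed

lemma Lp_norm_less_iff: "0 < p \<Longrightarrow> 0 < e \<Longrightarrow> Lp_norm p f < e \<longleftrightarrow> Ip p f < e powr p"
proof -
  assume p: "0 < p" and e: "0 < e"
  have "Ip p f < e powr p \<longleftrightarrow> (Ip p f) powr (1 / p) < (e powr p) powr (1 / p)"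
    using p by (smt (verit) Ip_nonneg divide_pos_pos powr_ge_zero powr_less_mono2 powr_mono2)
  then show ?thesis using p e by (simp add: powr_powr Lp_norm_def Ip_def)
qed

text \<open>Clipping is 1-Lipschitz pointwise and the coefficients are Lipschitz in
  \<open>L^1\<close>, which the \<open>L^p\<close> norm controls on a finite measure space.\<close>

lemma admissible_path_continuous:
  assumes p: "1 < p" and M: "0 < M" and a: "admissible p \<zeta>"
  shows "continuous_on UNIV (\<lambda>t. low_coeffs (\<lambda>x. clip M (\<zeta> t x)))"
  unfolding continuous_on_eq_continuous_at[OF open_UNIV] continuous_at
proof
  fix t
  have L: "\<zeta> s \<in> Lm p" for s using a by (auto simp: admissible_def Lp0_def intro: Lm_Lp)
  have m: "(\<lambda>x. clip M (\<zeta> s x)) \<in> borel_measurable torus" for s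
    using L[of s] by (intro clip_comp_measurable) (simp add: Lm_def)
  have i: "integrable torus (\<lambda>x. clip M (\<zeta> s x))" for s
    by (rule integrable_torus_bounded[OF m clip_bound]) (use M in simp)
  have D: "(\<lambda>x. \<zeta> s x - \<zeta> t x) \<in> Lm p" for s by (rule Lm_diff(1)[OF _ L L]) (use p in simp)
  have "((\<lambda>s. (vol powr (p - 1)) powr (1 / p) * Lp_norm p (\<lambda>x. \<zeta> s x - \<zeta> t x)) \<longlongrightarrow> 0) (at t)"
    by (rule tendsto_mult_right_zero) (use a in \<open>simp add: admissible_def\<close>)
  then have "((\<lambda>s. \<integral>x. \<bar>clip M (\<zeta> s x) - clip M (\<zeta> t x)\<bar> \<partial>torus) \<longlongrightarrow> 0) (at t)"
  proof (rule Lim_null_comparison[OF always_eventually, rotated], intro allI)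
    fix s
    have "(\<integral>x. \<bar>clip M (\<zeta> s x) - clip M (\<zeta> t x)\<bar> \<partial>torus) \<le> (\<integral>x. \<bar>\<zeta> s x - \<zeta> t x\<bar> \<partial>torus)"
      by (rule integral_mono) (use i clip_lipschitz Lm_integrable[OF _ D[of s]] p in auto)
    also have "\<dots> \<le> (vol powr (p - 1)) powr (1 / p) * Lp_norm p (\<lambda>x. \<zeta> s x - \<zeta> t x)"
      by (rule L1_le_Lp_norm[OF _ D]) (use p in simp)
    finally show "norm (\<integral>x. \<bar>clip M (\<zeta> s x) - clip M (\<zeta> t x)\<bar> \<partial>torus) \<le> (vol powr (p - 1)) powr (1 / p) * Lp_norm p (\<lambda>x. \<zeta> s x - \<zeta> t x)"
      by simp
  qed
  then show "((\<lambda>t. low_coeffs (\<lambda>x. clip M (\<zeta> t x))) \<longlongrightarrow> low_coeffs (\<lambda>x. clip M (\<zeta> t x))) (at t)"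
    by (rule low_coeffs_tendsto_L1[OF i i])
qed

lemma phase_product_eqI:
  assumes "moments q = moments v" "amplitude_invariants q = amplitude_invariants v" shows "phase_product q = phase_product v"
proof -
  have "vol * (3 / 2 * Re (phase_product q)) = vol * (3 / 2 * Re (phase_product v))"
    using assms(1) by (simp only: moments_def moment_formulas phase_product_def prod.inject)
  then have "Re (phase_product q) = Re (phase_product v)" using vol_pos by simp
  moreover have "Im (phase_product q) = Im (phase_product v)" using assms(2) by (simp add: amplitude_invariants_def)
  ultimately show ?thesis by (simp add: complex_eq_iff)
qed

text \<open>The phases are the arguments of the coefficients; for a vanishing amplitude any argument
  will do, because it is multiplied by 0.\<close>

lemma wave_param:
  fixes A B C :: real
  assumes "0 \<le> A" "0 \<le> B" "0 \<le> C"
    and "moments q = moments (of_real A * cis \<alpha>, of_real B * cis \<beta>, of_real C * cis \<gamma>)"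
    and "amplitude_invariants q = amplitude_invariants (of_real A * cis \<alpha>, of_real B * cis \<beta>, of_real C * cis \<gamma>)"
  obtains \<alpha>' \<beta>' \<gamma>' where "low_wave q = wave A B C \<alpha>' \<beta>' \<gamma>'"
    "complex_of_real (A * B * C) * exp (\<i> * complex_of_real (\<alpha> + \<beta> - \<gamma>)) =
     complex_of_real (A * B * C) * exp (\<i> * complex_of_real (\<alpha>' + \<beta>' - \<gamma>'))"
proof -
  have W: "phase_product (of_real A * cis a, of_real B * cis b, of_real C * cis c) = of_real (A * B * C) * exp (\<i> * complex_of_real (a + b - c))" for a b c
    unfolding cis_conv_exp[symmetric] by (simp add: phase_product_def cis_cnj cis_mult add_diff_eq)
  have n: "cmod (fst q) = A" "cmod (fst (snd q)) = B" "cmod (snd (snd q)) = C"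
    using assms(1-3,5) by (simp_all add: amplitude_invariants_def norm_mult)
  have "z = of_real (cmod z) * cis (Arg z)" for z using rcis_cmod_Arg[of z] by (simp add: rcis_def)
  from this[of "fst q"] this[of "fst (snd q)"] this[of "snd (snd q)"]
  have q: "q = (of_real A * cis (Arg (fst q)), of_real B * cis (Arg (fst (snd q))), of_real C * cis (Arg (snd (snd q))))"
    unfolding n by (simp add: prod_eq_iff)
  show thesis
  proof (rule that)
    show "low_wave q = wave A B C (Arg (fst q)) (Arg (fst (snd q))) (Arg (snd (snd q)))" unfolding wave_eq_low_wave q[symmetric] ..
    show "complex_of_real (A * B * C) * exp (\<i> * complex_of_real (\<alpha> + \<beta> - \<gamma>)) =
      complex_of_real (A * B * C) * exp (\<i> * complex_of_real (Arg (fst q) + Arg (fst (snd q)) - Arg (snd (snd q))))"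
      using phase_product_eqI[OF assms(4,5)] unfolding W[symmetric] q[symmetric] by simp
  qed
qed

theorem corollary1p9:
  fixes p A B C \<alpha> \<beta> \<gamma> :: real
  assumes "1 < p" and "0 \<le> A" and "0 \<le> B" and "0 \<le> C"
  shows "\<forall>\<epsilon>>0. \<exists>\<delta>>0. \<forall>\<zeta>. admissible p \<zeta> \<longrightarrow>
           Lp_norm p (\<lambda>x. \<zeta> 0 x - wave A B C \<alpha> \<beta> \<gamma> x) < \<delta> \<longrightarrow>
           (\<forall>t. \<exists>\<omega>\<in>E1. \<exists>\<alpha>' \<beta>' \<gamma>' :: real.
              \<omega> = wave A B C \<alpha>' \<beta>' \<gamma>' \<and>
              complex_of_real (A * B * C) * exp (\<i> * complex_of_real (\<alpha> + \<beta> - \<gamma>)) =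
              complex_of_real (A * B * C) * exp (\<i> * complex_of_real (\<alpha>' + \<beta>' - \<gamma>')) \<and>
              Lp_norm p (\<lambda>x. \<zeta> t x - \<omega> x) < \<epsilon>)"
proof (intro allI impI)
  fix \<epsilon> :: real assume \<epsilon>: "0 < \<epsilon>"
  note p = assms(1)
  have p0: "0 < p" using p by simp
  define v0 where "v0 = (of_real A * cis \<alpha>, of_real B * cis \<beta>, of_real C * cis \<gamma>)"
  have w: "wave A B C \<alpha> \<beta> \<gamma> = low_wave v0" by (simp add: v0_def wave_eq_low_wave)
  define M where "M = A + B + C + 1"
  have n0: "cmod (fst v0) = A" "cmod (fst (snd v0)) = B" "cmod (snd (snd v0)) = C"
    using assms by (simp_all add: v0_def norm_mult)
  have M: "0 < M" "\<bar>low_wave v0 x\<bar> \<le> M" for x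
    using assms low_wave_bound[of v0 x] unfolding n0 M_def by linarith+
  \<comment> \<open>A compact box for the coefficients of every function clipped at
    \<open>M\<close>, by \<open>fourier_coeff_bound\<close>; it also contains
    \<open>v0\<close>.\<close>
  define X where "X = cball (0 :: complex) (4 * M) \<times> cball (0 :: complex) (4 * M) \<times> cball (0 :: complex) (4 * M)"
  have X: "compact X" unfolding X_def by (intro compact_Times compact_cball)
  have v0X: "v0 \<in> X" using n0 assms unfolding X_def M_def by (simp add: mem_Times_iff)
  \<comment> \<open>Half the target: the triangle inequality for \<open>Ip\<close> costs
    \<open>2 powr p\<close>, and two errors of size \<open>c\<close> add up to
    \<open>\<epsilon> powr p\<close>.\<close>
  define c where "c = \<epsilon> powr p / (2 * 2 powr p)"
  have c: "0 < c" using \<epsilon> by (simp add: c_def)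
  \<comment> \<open>By \<open>low_wave_lipschitz\<close>, coefficients within \<open>\<eta>\<close>
    give waves within \<open>3 * \<eta>\<close>, and the constant \<open>3 * \<eta>\<close> has
    \<open>Ip\<close> equal to \<open>c\<close>.\<close>
  define \<eta> where "\<eta> = (c / vol) powr (1 / p) / 3"
  have \<eta>: "0 < \<eta>" using c vol_pos by (simp add: \<eta>_def)
  have \<eta>p: "(3 * \<eta>) powr p * vol = c" using c vol_pos p0 by (simp add: \<eta>_def powr_powr)
  have "finite (amplitude_invariants ` {v \<in> X. moments v = moments v0})"
    by (rule finite_subset[OF _ finite_amplitude_invariants_fibre[of v0]]) auto
  from level_set_trapping[OF X v0X continuous_moments continuous_amplitude_invariants this \<eta>]
  obtain k where k: "0 < k" "\<forall>v :: real \<Rightarrow> complex \<times> complex \<times> complex. continuous_on UNIV v \<longrightarrow> (\<forall>t. v t \<in> X \<and> dist (moments (v t)) (moments v0) < k) \<longrightarrow> dist (v 0) v0 < k \<longrightarrow>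
    (\<forall>t. \<exists>q\<in>X. moments q = moments v0 \<and> amplitude_invariants q = amplitude_invariants v0 \<and> dist (v t) q < \<eta>)" by (elim exE conjE)
  have "0 < min k c" using k(1) c by simp
  from rearrangement_near_wave[OF p M this]
  obtain d where d: "0 < d" "\<forall>f f'. f \<in> Lp0 p \<longrightarrow> f' \<in> Lp0 p \<longrightarrow> f' \<in> rearrangements f \<longrightarrow> energy p f' = energy p f \<longrightarrow>
    Ip p (\<lambda>x. f x - low_wave v0 x) < d \<longrightarrow>
    Ip p (\<lambda>x. f' x - low_wave (low_coeffs (\<lambda>x. clip M (f' x))) x) < min k c \<and> dist (moments (low_coeffs (\<lambda>x. clip M (f' x)))) (moments v0) < min k c
      \<and> dist (low_coeffs (\<lambda>x. clip M (f x))) v0 < min k c" by (elim exE conjE)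
  show "\<exists>\<delta>>0. \<forall>\<zeta>. admissible p \<zeta> \<longrightarrow>
           Lp_norm p (\<lambda>x. \<zeta> 0 x - wave A B C \<alpha> \<beta> \<gamma> x) < \<delta> \<longrightarrow>
           (\<forall>t. \<exists>\<omega>\<in>E1. \<exists>\<alpha>' \<beta>' \<gamma>' :: real.
              \<omega> = wave A B C \<alpha>' \<beta>' \<gamma>' \<and>
              complex_of_real (A * B * C) * exp (\<i> * complex_of_real (\<alpha> + \<beta> - \<gamma>)) =
              complex_of_real (A * B * C) * exp (\<i> * complex_of_real (\<alpha>' + \<beta>' - \<gamma>')) \<and>
              Lp_norm p (\<lambda>x. \<zeta> t x - \<omega> x) < \<epsilon>)"
  proof (intro exI[of _ "d powr (1 / p)"] conjI allI impI)
    show "0 < d powr (1 / p)" using d(1) by simp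
    fix \<zeta> t assume a: "admissible p \<zeta>" and "Lp_norm p (\<lambda>x. \<zeta> 0 x - wave A B C \<alpha> \<beta> \<gamma> x) < d powr (1 / p)"
    then have l: "Ip p (\<lambda>x. \<zeta> 0 x - low_wave v0 x) < d"
      using d(1) p0 by (simp add: w Lp_norm_less_iff powr_powr)
    have \<zeta>: "\<zeta> s \<in> Lp0 p" "\<zeta> s \<in> rearrangements (\<zeta> 0)" "energy p (\<zeta> s) = energy p (\<zeta> 0)" for s
      using a by (auto simp: admissible_def)
    define v where "v s = low_coeffs (\<lambda>x. clip M (\<zeta> s x))" for s
    \<comment> \<open>The pair consists of \<open>\<zeta> 0\<close> and its rearrangement
      \<open>\<zeta> s\<close>.\<close>
    have e: "Ip p (\<lambda>x. \<zeta> s x - low_wave (v s) x) < c" "dist (moments (v s)) (moments v0) < k" "dist (v 0) v0 < k" for s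
      using d(2)[rule_format, OF \<zeta>(1) \<zeta>(1,2,3) l, of s] by (simp_all add: v_def)
    have L: "\<zeta> s \<in> Lm p" for s using \<zeta>(1)[of s] by (auto simp: Lp0_def intro: Lm_Lp)
    have cv: "continuous_on UNIV v"
      using admissible_path_continuous[OF p M(1) a] by (simp add: v_def[abs_def])
    have vX: "v s \<in> X" for s
    proof -
      have "(\<lambda>x. clip M (\<zeta> s x)) \<in> borel_measurable torus" using L[of s] by (intro clip_comp_measurable) (simp add: Lm_def)
      then have "cmod (fourier_coeff j (\<lambda>x. clip M (\<zeta> s x))) \<le> 4 * M" for j by (rule fourier_coeff_bound) (use M(1) in \<open>auto intro: clip_bound\<close>)
      then show ?thesis by (simp add: v_def low_coeffs_def X_def)
    qed
    have "\<forall>s. v s \<in> X \<and> dist (moments (v s)) (moments v0) < k" using vX e(2) by blast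
    \<comment> \<open>Trapping selects \<open>q\<close> with the individual amplitudes and the phase
      sign of \<open>v0\<close>, not just with its moments.\<close>
    from k(2)[rule_format, OF cv this[rule_format] e(3), of t] obtain q where q: "moments q = moments v0" "amplitude_invariants q = amplitude_invariants v0" "dist (v t) q < \<eta>" by blast
    obtain \<alpha>' \<beta>' \<gamma>' where r: "low_wave q = wave A B C \<alpha>' \<beta>' \<gamma>'"
      "complex_of_real (A * B * C) * exp (\<i> * complex_of_real (\<alpha> + \<beta> - \<gamma>)) =
       complex_of_real (A * B * C) * exp (\<i> * complex_of_real (\<alpha>' + \<beta>' - \<gamma>'))"
      using wave_param[OF assms(2-4) q(1,2)[unfolded v0_def]] by blast
    have "Ip p (\<lambda>x. low_wave (v t) x - low_wave q x) \<le> Ip p (\<lambda>x. 3 * \<eta>)"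
    proof (rule Ip_mono)
      show "\<bar>low_wave (v t) x - low_wave q x\<bar> \<le> \<bar>3 * \<eta>\<bar>" for x using low_wave_lipschitz[of "v t" x q] q(3) by linarith
    qed (use p0 in \<open>auto intro!: Lm_cper cper_diff\<close>)
    also have "\<dots> = c" using \<eta>p \<eta> by (simp add: Ip_const)
    finally have i: "Ip p (\<lambda>x. low_wave (v t) x - low_wave q x) \<le> c" .
    have "Ip p (\<lambda>x. \<zeta> t x - low_wave q x) \<le> 2 powr p * (Ip p (\<lambda>x. \<zeta> t x - low_wave (v t) x) + Ip p (\<lambda>x. low_wave (v t) x - low_wave q x))"
      by (rule Ip_triangle[OF p0 L]) (use p0 in \<open>auto intro: Lm_cper\<close>)
    also have "\<dots> < 2 powr p * (c + c)" using e(1)[of t] i by (intro mult_strict_left_mono) auto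
    also have "\<dots> = \<epsilon> powr p" by (simp add: c_def)
    finally have "Lp_norm p (\<lambda>x. \<zeta> t x - low_wave q x) < \<epsilon>" using Lp_norm_less_iff[OF p0 \<epsilon>] by blast
    then show "\<exists>\<omega>\<in>E1. \<exists>\<alpha>' \<beta>' \<gamma>' :: real.
              \<omega> = wave A B C \<alpha>' \<beta>' \<gamma>' \<and>
              complex_of_real (A * B * C) * exp (\<i> * complex_of_real (\<alpha> + \<beta> - \<gamma>)) =
              complex_of_real (A * B * C) * exp (\<i> * complex_of_real (\<alpha>' + \<beta>' - \<gamma>')) \<and>
              Lp_norm p (\<lambda>x. \<zeta> t x - \<omega> x) < \<epsilon>"
      using low_wave_E1[of q] r by blast
  qed
qed

end
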